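(* Let $\Omega_1\subset\mathbb{R}^{d_1}$ and $\Omega_2\subset\mathbb{R}^{d_2}$ be open sets, $A\subset U\subset\mathbb{R}^n$ with $A$ compact and $U$ open, and $\Gamma$ a closed cone in $\dot T^*\Omega_1$. For any smooth map $f:\Omega_1\times U\to\Omega_2$ and any closed subset $C$ of $\Omega_1$ such that $f:C\times A\to\Omega_2$ is proper and $\underline{\pi}(\Gamma)\subset C$, the push-forwards $f(\cdot,a)_*$, $a\in A$, are uniformly continuous in the normal topology from $\{u\in\mathcal{D}'_\Gamma(\Omega_1) : \operatorname{supp}u\subset C\}$ to $\mathcal{D}'_\Xi(\Omega_2)$, where $\Xi=\bigcup_{a\in A}f(\cdot,a)_*\Gamma$. Here uniformly continuous means: for every continuous seminorm $p$ of $\mathcal{D}'_\Xi(\Omega_2)$ the seminorm $u\mapsto\sup_{a\in A}p(f(\cdot,a)_*u)$ is (finite and) continuous on $\{u\in\mathcal{D}'_\Gamma(\Omega_1) : \operatorname{supp}u\subset C\}$.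
   Context: For an open set $\Omega\subset\mathbb{R}^n$ write $\mathcal{D}(\Omega)=C_c^\infty(\Omega)$, $T^*\Omega=\Omega\times\mathbb{R}^n$, $\dot T^*\Omega=\{(x;\xi)\in T^*\Omega : \xi\neq 0\}$, and $\underline{\pi}(x;\xi)=x$. A cone in $\dot T^*\Omega$ is a subset $\Gamma$ such that $(x;\xi)\in\Gamma$ and $\lambda>0$ imply $(x;\lambda\xi)\in\Gamma$; closed means closed in $\dot T^*\Omega$. For a closed cone $\Gamma$, $\mathcal{D}'_\Gamma(\Omega)=\{u\in\mathcal{D}'(\Omega) : \mathrm{WF}(u)\subset\Gamma\}$. The normal topology on $\mathcal{D}'_\Gamma(\Omega)$ is the locally convex topology defined by the seminorms $p_B(u)=\sup_{\phi\in B}|\langle u,\phi\rangle|$, $B$ running over the bounded subsets of $\mathcal{D}(\Omega)$, and $\|u\|_{N,V,\chi}=\sup_{k\in V}(1+|k|)^N|\widehat{u\chi}(k)|$, where $N\ge 0$, $\chi\in\mathcal{D}(\Omega)$ and $V\subset\mathbb{R}^n$ is a closed cone with $(\operatorname{supp}\chi\times V)\cap\Gamma=\emptyset$; here $\widehat{w}(k)=\langle w,e^{-ik\cdot x}\rangle$. The subspace of distributions supported in $C$ has the induced topology. For a smooth map $g:\Omega_1\to\Omega_2$ that is proper on $C$: $\langle g_*u,\varphi\rangle=\langle u,\varphi\circ g\rangle$ for $\varphi\in\mathcal{D}(\Omega_2)$ and $\operatorname{supp}u\subset C$, and $g_*\Gamma=\{(y;\eta)\in\dot T^*\Omega_2 :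 \exists x\in\Omega_1,\ y=g(x),\ (x;\eta\circ dg_x)\in\Gamma\cup(C\times\{0\})\}$, with $\eta\circ dg_x=\sum_{i,j}\eta_j\,\partial_ig^j(x)\,dx^i$. *)

theory Defs
  imports "HOL-Analysis.Analysis"
begin

section \<open>Smooth functions and test functions\<close>

text \<open>Iterated directional derivative along the vectors of a list; lists over
  \<^term>\<open>Basis\<close> of length \<open>m\<close> give the partial derivatives of order \<open>m\<close>.\<close>

fun iter_deriv :: "'a::euclidean_space list \<Rightarrow> ('a \<Rightarrow> 'b::real_normed_vector) \<Rightarrow> 'a \<Rightarrow> 'b" where
  "iter_deriv [] f = f"
| "iter_deriv (v # vs) f = (\<lambda>x. frechet_derivative (iter_deriv vs f) (at x) v)"

text \<open>Only meant for open \<open>S\<close>. Continuity of all derivatives follows from their differentiability.\<close>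

definition smooth_on :: "'a::euclidean_space set \<Rightarrow> ('a \<Rightarrow> 'b::real_normed_vector) \<Rightarrow> bool" where
  "smooth_on S f \<longleftrightarrow> (\<forall>vs. \<forall>x\<in>S. iter_deriv vs f differentiable (at x))"

definition supp :: "('a::euclidean_space \<Rightarrow> complex) \<Rightarrow> 'a set" where
  "supp \<phi> = closure {x. \<phi> x \<noteq> 0}"

text \<open>Elements of $C_c^\infty(\Omega)$ are represented by their extensions by zero to the whole space.\<close>

definition test_fun :: "'a::euclidean_space set \<Rightarrow> ('a \<Rightarrow> complex) set" where
  "test_fun \<Omega> = {\<phi>. smooth_on UNIV \<phi> \<and> compact (supp \<phi>) \<and> supp \<phi> \<subseteq> \<Omega>}"

definition Ck_norm :: "nat \<Rightarrow> ('a::euclidean_space \<Rightarrow> complex) \<Rightarrow> real" where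
  "Ck_norm m \<phi> = Sup {norm (iter_deriv vs \<phi> x) | vs x. set vs \<subseteq> Basis \<and> length vs \<le> m}"


section \<open>Seminorms and locally convex topologies on spaces of complex functions\<close>

definition seminorm_on :: "('x \<Rightarrow> complex) set \<Rightarrow> (('x \<Rightarrow> complex) \<Rightarrow> real) \<Rightarrow> bool" where
  "seminorm_on E p \<longleftrightarrow>
     (\<forall>u\<in>E. 0 \<le> p u) \<and>
     (\<forall>u\<in>E. \<forall>v\<in>E. p (\<lambda>x. u x + v x) \<le> p u + p v) \<and>
     (\<forall>u\<in>E. \<forall>c. p (\<lambda>x. c * u x) = norm c * p u)"

text \<open>The topology on the vector space \<open>E\<close> defined by a family \<open>P\<close> of seminorms;
  the open semiballs form a subbasis.\<close>

definition seminorm_topology ::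
    "('x \<Rightarrow> complex) set \<Rightarrow> (('x \<Rightarrow> complex) \<Rightarrow> real) set \<Rightarrow> ('x \<Rightarrow> complex) topology" where
  "seminorm_topology E P =
     topology_generated_by {{v \<in> E. p (\<lambda>x. v x - u x) < r} | p u r. p \<in> P \<and> u \<in> E \<and> 0 < r}"

text \<open>Supremum of a set of nonnegative reals, with value 0 on the empty set
  (on which \<^const>\<open>Sup\<close> is unspecified for reals).\<close>

definition sup0 :: "real set \<Rightarrow> real" where
  "sup0 X = Sup (insert 0 X)"

text \<open>The continuous seminorms of the inductive limit topology on \<^term>\<open>test_fun \<Omega>\<close>: a seminorm
  is continuous iff all its restrictions to the Frechet spaces of test functions supported in a
  fixed compact subset are.\<close>

definition test_seminorm :: "'a::euclidean_space set \<Rightarrow> (('a \<Rightarrow> complex) \<Rightarrow> real) \<Rightarrow> bool" where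
  "test_seminorm \<Omega> p \<longleftrightarrow> seminorm_on (test_fun \<Omega>) p \<and>
     (\<forall>K. compact K \<and> K \<subseteq> \<Omega> \<longrightarrow>
        (\<exists>c m. \<forall>\<phi>\<in>test_fun \<Omega>. supp \<phi> \<subseteq> K \<longrightarrow> p \<phi> \<le> c * Ck_norm m \<phi>))"

definition test_bounded :: "'a::euclidean_space set \<Rightarrow> ('a \<Rightarrow> complex) set \<Rightarrow> bool" where
  "test_bounded \<Omega> B \<longleftrightarrow> B \<subseteq> test_fun \<Omega> \<and> (\<forall>p. test_seminorm \<Omega> p \<longrightarrow> bdd_above (p ` B))"


section \<open>Distributions\<close>

type_synonym 'a distr = "('a \<Rightarrow> complex) \<Rightarrow> complex"

text \<open>Distributions are extended by 0 to arguments that are not test functions, so that equal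
  distributions are equal as HOL functions and the set of distributions is a vector space.\<close>

definition distributions :: "'a::euclidean_space set \<Rightarrow> 'a distr set" where
  "distributions \<Omega> = {u.
     (\<forall>\<phi>\<in>test_fun \<Omega>. \<forall>\<psi>\<in>test_fun \<Omega>. u (\<lambda>x. \<phi> x + \<psi> x) = u \<phi> + u \<psi>) \<and>
     (\<forall>\<phi>\<in>test_fun \<Omega>. \<forall>c. u (\<lambda>x. c * \<phi> x) = c * u \<phi>) \<and>
     (\<forall>K. compact K \<and> K \<subseteq> \<Omega> \<longrightarrow>
        (\<exists>c m. \<forall>\<phi>\<in>test_fun \<Omega>. supp \<phi> \<subseteq> K \<longrightarrow> norm (u \<phi>) \<le> c * Ck_norm m \<phi>)) \<and>
     (\<forall>\<phi>. \<phi> \<notin> test_fun \<Omega> \<longrightarrow> u \<phi> = 0)}"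

definition dsupp :: "'a::euclidean_space set \<Rightarrow> 'a distr \<Rightarrow> 'a set" where
  "dsupp \<Omega> u = {x \<in> \<Omega>. \<forall>W. open W \<and> x \<in> W \<and> W \<subseteq> \<Omega> \<longrightarrow> (\<exists>\<phi>\<in>test_fun W. u \<phi> \<noteq> 0)}"

text \<open>The pairing of \<open>u\<close> with a function \<open>\<psi>\<close> that is smooth on \<open>\<Omega>\<close> but need not have compact
  support, for the case that the supports of \<open>u\<close> and \<open>\<psi>\<close> have compact intersection: the common
  value of \<open>u\<close> on \<open>\<theta>\<psi>\<close> for all cutoff functions \<open>\<theta>\<close> that are 1 near that intersection. The
  values of \<open>\<psi>\<close> outside \<open>\<Omega>\<close> are irrelevant.\<close>

definition pairing :: "'a::euclidean_space set \<Rightarrow> 'a distr \<Rightarrow> ('a \<Rightarrow> complex) \<Rightarrow> complex" where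
  "pairing \<Omega> u \<psi> = (THE z. \<forall>\<theta>\<in>test_fun \<Omega>.
     (\<exists>W. open W \<and> dsupp \<Omega> u \<inter> closure {x \<in> \<Omega>. \<psi> x \<noteq> 0} \<subseteq> W \<and> (\<forall>x\<in>W. \<theta> x = 1)) \<longrightarrow>
     u (\<lambda>x. \<theta> x * \<psi> x) = z)"

text \<open>The Fourier transform of the compactly supported distribution \<open>u\<theta>\<close>, that is
  $\langle u\theta, e^{-ik\cdot x}\rangle = \langle u, \theta e^{-ik\cdot x}\rangle$.\<close>

definition fourier_loc ::
    "'a::euclidean_space distr \<Rightarrow> ('a \<Rightarrow> complex) \<Rightarrow> 'a \<Rightarrow> complex" where
  "fourier_loc u \<theta> k = u (\<lambda>x. \<theta> x * exp (- \<i> * of_real (k \<bullet> x)))"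


section \<open>Cones and wave front sets\<close>

text \<open>Covectors are identified with vectors by means of the inner product.\<close>

definition dotT :: "'a::euclidean_space set \<Rightarrow> ('a \<times> 'a) set" where
  "dotT \<Omega> = \<Omega> \<times> (- {0})"

definition conic_set :: "'a::real_vector set \<Rightarrow> bool" where
  "conic_set V \<longleftrightarrow> (\<forall>k\<in>V. \<forall>t::real. 0 < t \<longrightarrow> t *\<^sub>R k \<in> V)"

definition closed_cone :: "'a::euclidean_space set \<Rightarrow> ('a \<times> 'a) set \<Rightarrow> bool" where
  "closed_cone \<Omega> \<Gamma> \<longleftrightarrow> closedin (top_of_set (dotT \<Omega>)) \<Gamma> \<and>
     (\<forall>x \<xi>. \<forall>t::real. (x, \<xi>) \<in> \<Gamma> \<and> 0 < t \<longrightarrow> (x, t *\<^sub>R \<xi>) \<in> \<Gamma>)"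

definition WF :: "'a::euclidean_space set \<Rightarrow> 'a distr \<Rightarrow> ('a \<times> 'a) set" where
  "WF \<Omega> u = {(x, \<xi>) \<in> dotT \<Omega>. \<not> (\<exists>\<theta> V. \<theta> \<in> test_fun \<Omega> \<and> \<theta> x \<noteq> 0 \<and>
     open V \<and> conic_set V \<and> \<xi> \<in> V \<and>
     (\<forall>N::nat. bdd_above ((\<lambda>k. (1 + norm k) ^ N * norm (fourier_loc u \<theta> k)) ` V)))}"

definition distributions_WF :: "'a::euclidean_space set \<Rightarrow> ('a \<times> 'a) set \<Rightarrow> 'a distr set" where
  "distributions_WF \<Omega> \<Gamma> = {u \<in> distributions \<Omega>. WF \<Omega> u \<subseteq> \<Gamma>}"


section \<open>The normal topology\<close>

definition bounded_seminorm :: "('a \<Rightarrow> complex) set \<Rightarrow> 'a distr \<Rightarrow> real" where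
  "bounded_seminorm B u = sup0 ((\<lambda>\<phi>. norm (u \<phi>)) ` B)"

definition conic_seminorm ::
    "nat \<Rightarrow> 'a::euclidean_space set \<Rightarrow> ('a \<Rightarrow> complex) \<Rightarrow> 'a distr \<Rightarrow> real" where
  "conic_seminorm N V \<theta> u = sup0 ((\<lambda>k. (1 + norm k) ^ N * norm (fourier_loc u \<theta> k)) ` V)"

definition normal_seminorms ::
    "'a::euclidean_space set \<Rightarrow> ('a \<times> 'a) set \<Rightarrow> ('a distr \<Rightarrow> real) set" where
  "normal_seminorms \<Omega> \<Gamma> =
     {bounded_seminorm B | B. test_bounded \<Omega> B} \<union>
     {conic_seminorm N V \<theta> | N V \<theta>.
        \<theta> \<in> test_fun \<Omega> \<and> closed V \<and> conic_set V \<and> (supp \<theta> \<times> V) \<inter> \<Gamma> = {}}"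

definition normal_topology ::
    "'a::euclidean_space set \<Rightarrow> ('a \<times> 'a) set \<Rightarrow> 'a distr topology" where
  "normal_topology \<Omega> \<Gamma> = seminorm_topology (distributions_WF \<Omega> \<Gamma>) (normal_seminorms \<Omega> \<Gamma>)"

lemma topspace_normal_topology: "topspace (normal_topology \<Omega> \<Gamma>) = distributions_WF \<Omega> \<Gamma>"
proof -
  let ?S = "{{v \<in> distributions_WF \<Omega> \<Gamma>. p (\<lambda>x. v x - u x) < r} | p u r.
    p \<in> normal_seminorms \<Omega> \<Gamma> \<and> u \<in> distributions_WF \<Omega> \<Gamma> \<and> 0 < r}"
  have B: "bounded_seminorm {} \<in> normal_seminorms \<Omega> \<Gamma>"
    by (auto simp: normal_seminorms_def test_bounded_def)
  have "u \<in> \<Union>?S" if u: "u \<in> distributions_WF \<Omega> \<Gamma>" for u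
  proof (rule UnionI)
    show "{v \<in> distributions_WF \<Omega> \<Gamma>. bounded_seminorm {} (\<lambda>x. v x - u x) < 1} \<in> ?S"
      using B u by (intro CollectI exI[of _ "bounded_seminorm {}"] exI[of _ u] exI[of _ 1]) simp
    show "u \<in> {v \<in> distributions_WF \<Omega> \<Gamma>. bounded_seminorm {} (\<lambda>x. v x - u x) < 1}"
      using u by (simp add: bounded_seminorm_def sup0_def)
  qed
  then have "\<Union>?S = distributions_WF \<Omega> \<Gamma>" by auto
  then show ?thesis
    unfolding normal_topology_def seminorm_topology_def topology_generated_by_topspace .
qed


section \<open>Push-forward\<close>

definition push_distr :: "'a::euclidean_space set \<Rightarrow> 'b::euclidean_space set \<Rightarrow>
    ('a \<Rightarrow> 'b) \<Rightarrow> 'a distr \<Rightarrow> 'b distr" where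
  "push_distr \<Omega>1 \<Omega>2 g u = (\<lambda>\<phi>. if \<phi> \<in> test_fun \<Omega>2 then pairing \<Omega>1 u (\<phi> \<circ> g) else 0)"

definition pull_covector :: "('a::euclidean_space \<Rightarrow> 'b::euclidean_space) \<Rightarrow> 'a \<Rightarrow> 'b \<Rightarrow> 'a" where
  "pull_covector g x \<eta> =
     (\<Sum>i\<in>Basis. (\<Sum>j\<in>Basis. (\<eta> \<bullet> j) * (frechet_derivative g (at x) i \<bullet> j)) *\<^sub>R i)"

definition push_cone :: "'a::euclidean_space set \<Rightarrow> 'b::euclidean_space set \<Rightarrow> 'a set \<Rightarrow>
    ('a \<Rightarrow> 'b) \<Rightarrow> ('a \<times> 'a) set \<Rightarrow> ('b \<times> 'b) set" where
  "push_cone \<Omega>1 \<Omega>2 C g \<Gamma> = {(y, \<eta>) \<in> dotT \<Omega>2.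
     \<exists>x\<in>\<Omega>1. y = g x \<and> (x, pull_covector g x \<eta>) \<in> \<Gamma> \<union> C \<times> {0}}"

definition uniformly_continuous_family ::
    "'i set \<Rightarrow> ('x \<Rightarrow> complex) topology \<Rightarrow> ('y \<Rightarrow> complex) topology \<Rightarrow>
     ('i \<Rightarrow> ('x \<Rightarrow> complex) \<Rightarrow> ('y \<Rightarrow> complex)) \<Rightarrow> bool" where
  "uniformly_continuous_family A X Y T \<longleftrightarrow>
     (\<forall>a\<in>A. \<forall>u\<in>topspace X. T a u \<in> topspace Y) \<and>
     (\<forall>p. seminorm_on (topspace Y) p \<and> continuous_map Y euclideanreal p \<longrightarrow>
        (\<forall>u\<in>topspace X. bdd_above ((\<lambda>a. p (T a u)) ` A)) \<and>
        seminorm_on (topspace X) (\<lambda>u. sup0 ((\<lambda>a. p (T a u)) ` A)) \<and>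
        continuous_map X euclideanreal (\<lambda>u. sup0 ((\<lambda>a. p (T a u)) ` A)))"

end

theory Submission
  imports Defs
begin

text \<open>The pairing of \<open>f(\<cdot>, a)\<^sub>* u\<close> with \<open>\<kappa> e\<^sup>-\<^sup>i\<^sup>k\<^sup>y\<close> is \<open>u\<close> applied to
  \<open>(\<kappa> \<circ> f\<^sub>a) exp (- i k \<bullet> f\<^sub>a)\<close>. After localising in \<open>x\<close>, \<open>a\<close> and the direction of \<open>k\<close>, this function
  is expanded into a Fourier series on a large cube, so that the pairing becomes a sum of
  coefficients \<open>c l\<close> times values of the Fourier transform of \<open>\<theta> u\<close> at lattice points \<open>l\<close>. Covectors
  \<open>l\<close> close to the direction of the pulled back covector \<open>k \<circ> df\<close> lie in a cone avoiding \<open>\<Gamma>\<close>, where the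
  transform is controlled by a conic seminorm of \<open>u\<close>. For all other \<open>l\<close> the phase \<open>l \<bullet> x - k \<bullet> f\<close> is
  nonstationary and \<open>c l\<close> decreases rapidly in \<open>k\<close> and \<open>l\<close> together; the functions \<open>\<theta> e\<^sup>-\<^sup>i\<^sup>l\<^sup>x\<close>, weighted by
  these coefficients, then form a bounded set of test functions, so that this part is controlled
  by a single seminorm \<open>p\<^sub>B\<close> whatever the order of \<open>u\<close>. Properness and compactness of \<open>A\<close> reduce
  everything to finitely many localisations. The same estimate for the identity map shows that
  the seminorms are finite exactly on the distributions with wave front set in the cone.\<close>

text \<open>The constant in the estimate must be the same for all distributions, whereas the order
  of a single one on a compact set is finite but not bounded over the space. So the bounded set, the
  exponents and the constant are fixed from \<open>f\<close>, the cutoffs and the cones before any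
  distribution is chosen; its order only makes the series converge. Expanding over a lattice reduces
  the pairing to an absolutely convergent sum, compared with the fixed summable
  \<open>weight\<close>. Frequencies with norm l <= \<epsilon> * norm k have to count as
  nonstationary even inside the good cone, since decay in l gives nothing in k there. Both
  conditions are invariant under scaling of (k, l) and the phase is linear in (k, l); so norm k +
  norm l is the large parameter, and the normalised pairs form a compact set. The term
  \<open>C \<times> {0}\<close> in \<open>push_cone\<close> acts twice: off \<Xi> it forces pulled
  back covectors to be nonzero, and it makes \<Xi> closed, because covectors in \<Gamma> may
  converge to 0.\<close>

subsection \<open>Smooth functions\<close>

text \<open>Derivatives up to order \<open>k\<close> are required to be differentiable, not only continuous.\<close>

definition Ck_on :: "nat \<Rightarrow> 'a::euclidean_space set \<Rightarrow> ('a \<Rightarrow> 'b::real_normed_vector) \<Rightarrow> bool" where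
  "Ck_on k S f \<longleftrightarrow> (\<forall>vs. length vs \<le> k \<longrightarrow> (\<forall>x\<in>S. iter_deriv vs f differentiable (at x)))"

lemma smooth_on_Ck: "smooth_on S f \<longleftrightarrow> (\<forall>k. Ck_on k S f)"
  unfolding smooth_on_def Ck_on_def by blast

lemma iter_deriv_append: "iter_deriv (vs @ ws) f = iter_deriv vs (iter_deriv ws f)"
  by (induction vs) auto

text \<open>The head of the list is the derivative taken last, so the one taken first stands at the
  end. Inductions that begin by differentiating the function itself have to peel off the
  end.\<close>

lemma iter_deriv_snoc: "iter_deriv (vs @ [v]) f = iter_deriv vs (\<lambda>x. frechet_derivative f (at x) v)"
  by (simp add: iter_deriv_append)

text \<open>No differentiability is assumed: \<open>frechet_derivative\<close> is a choice from a
  predicate, and the predicate is the same for both functions, so the chosen values agree in every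
  case.\<close>

lemma frechet_derivative_cong_open:
  assumes "open S" "x \<in> S" "\<And>y. y \<in> S \<Longrightarrow> f y = g y"
  shows "frechet_derivative f (at x) = frechet_derivative g (at x)"
proof -
  have "(f has_derivative D) (at x) = (g has_derivative D) (at x)" for D
    using has_derivative_transform_within_open[of f D x UNIV S g]
      has_derivative_transform_within_open[of g D x UNIV S f] assms by auto
  then show ?thesis unfolding frechet_derivative_def by simp
qed

lemma iter_deriv_cong_open:
  assumes "open S" "\<And>y. y \<in> S \<Longrightarrow> f y = g y" "x \<in> S"
  shows "iter_deriv vs f x = iter_deriv vs g x"
  using assms(3)
proof (induction vs arbitrary: x)
  case (Cons v vs)
  show ?case
    using frechet_derivative_cong_open[OF assms(1) Cons.prems, of "iter_deriv vs f" "iter_deriv vs g"]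
      Cons.IH by simp
qed (use assms in auto)

lemma differentiable_cong_open:
  assumes "open S" "x \<in> S" "\<And>y. y \<in> S \<Longrightarrow> f y = g y"
  shows "f differentiable (at x) \<longleftrightarrow> g differentiable (at x)"
proof -
  have "(f has_derivative D) (at x) = (g has_derivative D) (at x)" for D
    using has_derivative_transform_within_open[of f D x UNIV S g]
      has_derivative_transform_within_open[of g D x UNIV S f] assms by auto
  then show ?thesis unfolding differentiable_def by simp
qed

lemma Ck_on_cong:
  assumes "open S" "\<And>y. y \<in> S \<Longrightarrow> f y = g y"
  shows "Ck_on k S f \<longleftrightarrow> Ck_on k S g"
proof -
  have "iter_deriv vs f differentiable (at x) \<longleftrightarrow> iter_deriv vs g differentiable (at x)" if "x \<in> S" for vs x
    using iter_deriv_cong_open[of S f g] assms that by (intro differentiable_cong_open[of S]) auto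
  then show ?thesis unfolding Ck_on_def by auto
qed

lemma smooth_on_cong:
  assumes "open S" "\<And>y. y \<in> S \<Longrightarrow> f y = g y"
  shows "smooth_on S f \<longleftrightarrow> smooth_on S g"
  using Ck_on_cong[of S f g] assms unfolding smooth_on_Ck by blast

lemma Ck_on_0: "Ck_on 0 S f \<longleftrightarrow> (\<forall>x\<in>S. f differentiable (at x))"
  unfolding Ck_on_def by auto

text \<open>Peeling off the derivative taken first makes \<open>Ck_on\<close> a recursion on the
  order, and turns the closure properties into inductions with the functions left arbitrary.\<close>

lemma Ck_on_Suc:
  "Ck_on (Suc k) S f \<longleftrightarrow>
    (\<forall>x\<in>S. f differentiable (at x)) \<and> (\<forall>v. Ck_on k S (\<lambda>x. frechet_derivative f (at x) v))"
proof
  assume L: "Ck_on (Suc k) S f"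
  have "iter_deriv vs (\<lambda>x. frechet_derivative f (at x) v) differentiable (at x)"
    if "length vs \<le> k" "x \<in> S" for vs v x
    using L that unfolding Ck_on_def iter_deriv_snoc[symmetric] by (auto simp del: iter_deriv.simps)
  moreover have "f differentiable (at x)" if "x \<in> S" for x
    using L[unfolded Ck_on_def, rule_format, of "[]" x] that by simp
  ultimately show "(\<forall>x\<in>S. f differentiable (at x)) \<and>
      (\<forall>v. Ck_on k S (\<lambda>x. frechet_derivative f (at x) v))"
    unfolding Ck_on_def by blast
next
  assume R: "(\<forall>x\<in>S. f differentiable (at x)) \<and>
      (\<forall>v. Ck_on k S (\<lambda>x. frechet_derivative f (at x) v))"
  show "Ck_on (Suc k) S f"
    unfolding Ck_on_def
  proof (intro allI impI ballI)
    fix vs x assume "length (vs::'a list) \<le> Suc k" "x \<in> S"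
    then show "iter_deriv vs f differentiable (at x)"
      using R by (cases vs rule: rev_cases) (auto simp: iter_deriv_snoc Ck_on_def)
  qed
qed

lemma Ck_on_mono: "Ck_on k S f \<Longrightarrow> j \<le> k \<Longrightarrow> T \<subseteq> S \<Longrightarrow> Ck_on j T f"
  unfolding Ck_on_def by (meson le_trans subsetD)

lemma smooth_on_mono: "smooth_on S f \<Longrightarrow> T \<subseteq> S \<Longrightarrow> smooth_on T f"
  unfolding smooth_on_def by blast

text \<open>Derivatives are unique, so any formula \<open>F\<close> may stand in for the chosen
  \<open>frechet_derivative\<close>. A closure property is then proved by recognising
  \<open>F\<close> as composed of functions already known to be of order k.\<close>

lemma Ck_on_SucI:
  assumes "open S" "\<And>x. x \<in> S \<Longrightarrow> (f has_derivative F x) (at x)"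
    and "\<And>v. Ck_on k S (\<lambda>x. F x v)"
  shows "Ck_on (Suc k) S f"
proof -
  have "frechet_derivative f (at x) = F x" if "x \<in> S" for x
    using frechet_derivative_at[OF assms(2)[OF that]] by simp
  then have "Ck_on k S (\<lambda>x. frechet_derivative f (at x) v)" for v
    using assms(3)[of v] Ck_on_cong[OF assms(1), of "\<lambda>x. frechet_derivative f (at x) v" "\<lambda>x. F x v" k] by simp
  moreover have "f differentiable (at x)" if "x \<in> S" for x
    using assms(2)[OF that] unfolding differentiable_def by blast
  ultimately show ?thesis
    unfolding Ck_on_Suc by simp
qed

lemma Ck_on_D:
  assumes "Ck_on k S f" "x \<in> S"
  shows "(f has_derivative frechet_derivative f (at x)) (at x)"
  using assms(1)[unfolded Ck_on_def, rule_format, of "[]" x] assms(2)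
  by (simp add: frechet_derivative_works)

lemma Ck_on_deriv: "Ck_on (Suc k) S f \<Longrightarrow> Ck_on k S (\<lambda>x. frechet_derivative f (at x) v)"
  by (simp add: Ck_on_Suc)

lemma Ck_on_Suc_le: "Ck_on (Suc k) S f \<Longrightarrow> Ck_on k S f"
  by (rule Ck_on_mono) auto

lemma smooth_on_D:
  "smooth_on S f \<Longrightarrow> x \<in> S \<Longrightarrow> (f has_derivative frechet_derivative f (at x)) (at x)"
  using Ck_on_D smooth_on_Ck by blast

lemma smooth_on_iter_deriv: "smooth_on S f \<Longrightarrow> smooth_on S (iter_deriv ws f)"
  unfolding smooth_on_def iter_deriv_append[symmetric] by blast

lemma smooth_on_deriv:
  "smooth_on S f \<Longrightarrow> smooth_on S (\<lambda>x. frechet_derivative f (at x) v)"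
  using smooth_on_iter_deriv[of S f "[v]"] by simp

lemma smooth_on_continuous: "smooth_on S f \<Longrightarrow> continuous_on S f"
  by (intro continuous_at_imp_continuous_on ballI has_derivative_continuous[OF smooth_on_D])

section \<open>Closure properties at finite order\<close>

lemma Ck_on_const: "open S \<Longrightarrow> Ck_on k S (\<lambda>x. c)"
proof (induction k arbitrary: c)
  case (Suc k)
  show ?case by (rule Ck_on_SucI[where F="\<lambda>x v. 0"]) (use Suc in auto)
qed (simp add: Ck_on_0)

lemma Ck_on_bounded_linear:
  assumes "bounded_linear h" "open S"
  shows "Ck_on k S f \<Longrightarrow> Ck_on k S (\<lambda>x. h (f x))"
proof (induction k arbitrary: f)
  case 0
  then show ?case using bounded_linear_imp_differentiable[OF assms(1)]
    by (simp add: Ck_on_0 differentiable_compose)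
next
  case (Suc k)
  show ?case
    by (rule Ck_on_SucI[OF assms(2), where F="\<lambda>x v. h (frechet_derivative f (at x) v)"])
       (auto intro: Suc.IH Ck_on_D[OF Suc(2)] Ck_on_deriv[OF Suc(2)] bounded_linear.has_derivative[OF assms(1)])
qed

lemma Ck_on_add:
  assumes "open S"
  shows "Ck_on k S f \<Longrightarrow> Ck_on k S g \<Longrightarrow> Ck_on k S (\<lambda>x. f x + g x)"
proof (induction k arbitrary: f g)
  case (Suc k)
  show ?case
    by (rule Ck_on_SucI[OF assms, where F="\<lambda>x v. frechet_derivative f (at x) v + frechet_derivative g (at x) v"])
       (auto intro: Suc.IH Ck_on_D[OF Suc(2)] Ck_on_D[OF Suc(3)] Ck_on_deriv[OF Suc(2)] Ck_on_deriv[OF Suc(3)] has_derivative_add)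
qed (simp add: Ck_on_0)

lemma Ck_on_sum:
  assumes "open S" "\<And>i. i \<in> I \<Longrightarrow> Ck_on k S (f i)"
  shows "Ck_on k S (\<lambda>x. \<Sum>i\<in>I. f i x)"
proof (cases "finite I")
  case True
  then show ?thesis using assms(2)
    by (induction I) (auto intro: Ck_on_const[OF assms(1)] Ck_on_add[OF assms(1)])
qed (use Ck_on_const[OF assms(1)] in auto)

lemma Ck_on_bilinear:
  assumes h: "bounded_bilinear h" and S: "open S"
  shows "Ck_on k S f \<Longrightarrow> Ck_on k S g \<Longrightarrow> Ck_on k S (\<lambda>x. h (f x) (g x))"
proof (induction k arbitrary: f g)
  case 0
  then have "(\<lambda>x. h (f x) (g x)) differentiable (at x)" if "x \<in> S" for x
    using bounded_bilinear.FDERIV[OF h Ck_on_D[OF 0(1) that] Ck_on_D[OF 0(2) that]]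
    unfolding differentiable_def by blast
  then show ?case by (simp add: Ck_on_0)
next
  case (Suc k)
  show ?case
  proof (rule Ck_on_SucI[OF S])
    show "((\<lambda>x. h (f x) (g x)) has_derivative
        (\<lambda>v. h (f x) (frechet_derivative g (at x) v) + h (frechet_derivative f (at x) v) (g x))) (at x)"
      if "x \<in> S" for x
      using bounded_bilinear.FDERIV[OF h Ck_on_D[OF Suc(2) that] Ck_on_D[OF Suc(3) that]] .
    show "Ck_on k S (\<lambda>x. h (f x) (frechet_derivative g (at x) v) + h (frechet_derivative f (at x) v) (g x))" for v
      by (intro Ck_on_add[OF S] Suc.IH Ck_on_deriv[OF Suc.prems(1)] Ck_on_deriv[OF Suc.prems(2)]
          Ck_on_Suc_le[OF Suc.prems(1)] Ck_on_Suc_le[OF Suc.prems(2)])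
  qed
qed

text \<open>In the chain rule both the linear map, the derivative of g at f x, and its argument
  depend on x. Expanding the argument in the basis gives a sum of products of a coordinate of the
  derivative of f and a partial derivative of g composed with f. The latter is covered by the
  induction hypothesis because g is arbitrary in it.\<close>

lemma Ck_on_compose:
  fixes f :: "'a::euclidean_space \<Rightarrow> 'b::euclidean_space"
  assumes S: "open S" and T: "open T" and fT: "\<And>x. x \<in> S \<Longrightarrow> f x \<in> T"
  shows "Ck_on k S f \<Longrightarrow> Ck_on k T g \<Longrightarrow> Ck_on k S (\<lambda>x. g (f x))"
proof (induction k arbitrary: g)
  case 0
  have "(\<lambda>x. g (f x)) differentiable (at x)" if "x \<in> S" for x
    using has_derivative_compose[OF Ck_on_D[OF 0(1) that] Ck_on_D[OF 0(2) fT[OF that]]]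
    unfolding differentiable_def by blast
  then show ?case by (simp add: Ck_on_0)
next
  case (Suc k)
  show ?case
  proof (rule Ck_on_SucI[OF S])
    fix x assume x: "x \<in> S"
    have lin: "linear (frechet_derivative g (at (f x)))"
      using Ck_on_D[OF Suc(3) fT[OF x]] has_derivative_linear by blast
    have rep: "frechet_derivative g (at (f x)) v = (\<Sum>j\<in>Basis. (v \<bullet> j) *\<^sub>R frechet_derivative g (at (f x)) j)" for v
    proof -
      have "frechet_derivative g (at (f x)) v = frechet_derivative g (at (f x)) (\<Sum>j\<in>Basis. (v \<bullet> j) *\<^sub>R j)"
        by (simp add: euclidean_representation)
      then show ?thesis
        by (simp add: linear_sum[OF lin] linear_scale[OF lin])
    qed
    show "((\<lambda>x. g (f x)) has_derivative (\<lambda>v. \<Sum>j\<in>Basis.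
        (frechet_derivative f (at x) v \<bullet> j) *\<^sub>R frechet_derivative g (at (f x)) j)) (at x)"
      by (rule has_derivative_eq_rhs[OF has_derivative_compose[OF Ck_on_D[OF Suc(2) x] Ck_on_D[OF Suc(3) fT[OF x]]]])
         (rule ext, rule rep)
  next
    fix v
    show "Ck_on k S (\<lambda>x. \<Sum>j\<in>Basis. (frechet_derivative f (at x) v \<bullet> j) *\<^sub>R frechet_derivative g (at (f x)) j)"
      by (intro Ck_on_sum[OF S] Ck_on_bilinear[OF bounded_bilinear_scaleR S]
            Ck_on_bounded_linear[OF bounded_linear_inner_left S] Suc.IH Ck_on_deriv[OF Suc.prems(1)] Ck_on_deriv[OF Suc.prems(2)]
          Ck_on_Suc_le[OF Suc.prems(1)] Ck_on_Suc_le[OF Suc.prems(2)])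
  qed
qed

section \<open>Closure properties of smooth functions\<close>

context
  fixes S :: "'a::euclidean_space set"
  assumes S: "open S"
begin

lemma smooth_on_const: "smooth_on S (\<lambda>x. c)"
  by (simp add: smooth_on_Ck Ck_on_const[OF S])

lemma smooth_on_bounded_linear: "bounded_linear h \<Longrightarrow> smooth_on S f \<Longrightarrow> smooth_on S (\<lambda>x. h (f x))"
  by (simp add: smooth_on_Ck Ck_on_bounded_linear S)

lemma smooth_on_ident: "smooth_on S (\<lambda>x. x)"
proof -
  have "Ck_on k S (\<lambda>x. x)" for k
  proof (cases k)
    case (Suc j)
    show ?thesis unfolding Suc
      by (rule Ck_on_SucI[OF S, where F="\<lambda>x v. v"]) (auto intro: Ck_on_const S)
  qed (simp add: Ck_on_0)
  then show ?thesis by (simp add: smooth_on_Ck)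
qed

lemma smooth_on_linear: "bounded_linear h \<Longrightarrow> smooth_on S h"
  using smooth_on_bounded_linear[OF _ smooth_on_ident] by blast

lemma smooth_on_add: "smooth_on S f \<Longrightarrow> smooth_on S g \<Longrightarrow> smooth_on S (\<lambda>x. f x + g x)"
  by (simp add: smooth_on_Ck Ck_on_add[OF S])

lemma smooth_on_sum:
  "(\<And>i. i \<in> I \<Longrightarrow> smooth_on S (f i)) \<Longrightarrow> smooth_on S (\<lambda>x. \<Sum>i\<in>I. f i x)"
  by (simp add: smooth_on_Ck Ck_on_sum[OF S])

lemma smooth_on_bilinear:
  "bounded_bilinear h \<Longrightarrow> smooth_on S f \<Longrightarrow> smooth_on S g \<Longrightarrow> smooth_on S (\<lambda>x. h (f x) (g x))"
  by (simp add: smooth_on_Ck Ck_on_bilinear S)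

lemmas smooth_on_mult = smooth_on_bilinear[OF bounded_bilinear_mult]
lemmas smooth_on_inner = smooth_on_bilinear[OF bounded_bilinear_inner]

lemma smooth_on_minus: "smooth_on S f \<Longrightarrow> smooth_on S (\<lambda>x. - f x)"
  by (rule smooth_on_bounded_linear[OF bounded_linear_minus[OF bounded_linear_ident]])

lemma smooth_on_diff: "smooth_on S f \<Longrightarrow> smooth_on S g \<Longrightarrow> smooth_on S (\<lambda>x. f x - g x)"
  using smooth_on_add[OF _ smooth_on_minus, of f g] by simp

lemma smooth_on_compose:
  fixes f :: "'a \<Rightarrow> 'b::euclidean_space"
  shows "open T \<Longrightarrow> smooth_on S f \<Longrightarrow> smooth_on T g \<Longrightarrow> (\<And>x. x \<in> S \<Longrightarrow> f x \<in> T) \<Longrightarrow>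
    smooth_on S (\<lambda>x. g (f x))"
  by (simp add: smooth_on_Ck Ck_on_compose[OF S, of T f _ g])

lemma smooth_on_Pair:
  "smooth_on S f \<Longrightarrow> smooth_on S g \<Longrightarrow> smooth_on S (\<lambda>x. (f x, g x))"
  using smooth_on_add[OF smooth_on_bounded_linear[of "\<lambda>y. (y, 0)" f] smooth_on_bounded_linear[of "\<lambda>y. (0, y)" g]]
  by (simp add: bounded_linear_Pair bounded_linear_zero bounded_linear_ident)

lemma smooth_on_of_real: "smooth_on S f \<Longrightarrow> smooth_on S (\<lambda>x. of_real (f x) :: 'c::real_normed_algebra_1)"
  by (rule smooth_on_bounded_linear[OF bounded_linear_of_real])

end

lemma smooth_on_exp: "smooth_on UNIV (exp :: complex \<Rightarrow> complex)"
proof -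
  have "Ck_on k UNIV (exp :: complex \<Rightarrow> complex)" for k
  proof (induction k)
    case 0
    show ?case unfolding Ck_on_0
      using differentiableI[OF DERIV_exp[unfolded has_field_derivative_def]] by auto
  next
    case (Suc k)
    show ?case
      by (rule Ck_on_SucI[where F="\<lambda>x v. exp x * v"])
         (use Suc in \<open>auto simp: has_field_derivative_imp_has_derivative intro: Ck_on_bounded_linear[OF bounded_linear_mult_left]
            DERIV_exp\<close>)
  qed
  then show ?thesis by (simp add: smooth_on_Ck)
qed

text \<open>The derivative is a product of two factors \<open>inverse x\<close> and the direction,
  so the induction hypothesis for \<open>inverse\<close> itself closes the step.\<close>

lemma smooth_on_inverse: "smooth_on (- {0}) (inverse :: 'a::{euclidean_space,real_normed_field} \<Rightarrow> 'a)"
proof -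
  have "Ck_on k (- {0}) (inverse :: 'a \<Rightarrow> 'a)" for k
  proof (induction k)
    case 0
    show ?case unfolding Ck_on_0
      by (rule ballI, rule differentiableI, rule has_derivative_inverse') simp
  next
    case (Suc k)
    show ?case
    proof (rule Ck_on_SucI[where F="\<lambda>x v. - (inverse x * v * inverse x)"])
      show "(inverse has_derivative (\<lambda>v. - (inverse x * v * inverse x))) (at x)" if "x \<in> - {0}" for x :: 'a
        using has_derivative_inverse' that by auto
      fix v :: 'a
      show "Ck_on k (- {0}) (\<lambda>x. - (inverse x * v * inverse x))"
        by (intro Ck_on_bounded_linear[OF bounded_linear_minus[OF bounded_linear_ident]]
              Ck_on_bilinear[OF bounded_bilinear_mult] Suc Ck_on_const) auto
    qed auto
  qed
  then show ?thesis by (simp add: smooth_on_Ck)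
qed

lemma smooth_on_divide:
  fixes f g :: "'a::euclidean_space \<Rightarrow> 'b::{euclidean_space,real_normed_field}"
  assumes "open S" "smooth_on S f" "smooth_on S g" "\<And>x. x \<in> S \<Longrightarrow> g x \<noteq> 0"
  shows "smooth_on S (\<lambda>x. f x / g x)"
  unfolding divide_inverse
  using assms by (intro smooth_on_mult smooth_on_compose[OF _ _ _ smooth_on_inverse]) auto

lemma smooth_on_cexp:
  fixes f :: "'a::euclidean_space \<Rightarrow> complex"
  assumes "open S" "smooth_on S f"
  shows "smooth_on S (\<lambda>x. exp (f x))"
  using assms by (intro smooth_on_compose[OF _ _ _ smooth_on_exp]) auto

lemma smooth_on_union:
  "smooth_on S f \<Longrightarrow> smooth_on T f \<Longrightarrow> smooth_on (S \<union> T) f"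
  unfolding smooth_on_def by blast

text \<open>The open sets \<open>X\<close> and \<open>- K\<close> cover the space; on the first the
  extension is \<open>b\<close>, on the second it is 0.\<close>

lemma smooth_on_extend_zero:
  fixes b :: "'a::euclidean_space \<Rightarrow> 'b::real_normed_vector"
  assumes "open X" "closed K" "smooth_on X b" "\<And>x. x \<in> X - K \<Longrightarrow> b x = 0" "K \<subseteq> X"
  shows "smooth_on UNIV (\<lambda>x. if x \<in> X then b x else 0)"
proof -
  have "smooth_on X (\<lambda>x. if x \<in> X then b x else 0)"
    using smooth_on_cong[OF assms(1), of "\<lambda>x. if x \<in> X then b x else 0" b] assms(3) by auto
  moreover have "smooth_on (- K) (\<lambda>x. if x \<in> X then b x else 0)"
    using smooth_on_cong[of "- K" "\<lambda>x. if x \<in> X then b x else 0" "\<lambda>x. 0"] assms(2,4)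
      smooth_on_const[of "-K" "0::'b"] by (simp add: open_Compl)
  moreover have "X \<union> - K = UNIV" using assms(5) by auto
  ultimately show ?thesis using smooth_on_union by metis
qed

section \<open>Iterated derivatives of sums and linear images\<close>

lemma frechet_derivative_add:
  "f differentiable (at x) \<Longrightarrow> g differentiable (at x) \<Longrightarrow>
    frechet_derivative (\<lambda>x. f x + g x) (at x) v = frechet_derivative f (at x) v + frechet_derivative g (at x) v"
  using frechet_derivative_at[OF has_derivative_add] unfolding frechet_derivative_works by metis

lemma iter_deriv_add:
  assumes "open S" "smooth_on S f" "smooth_on S g" "x \<in> S"
  shows "iter_deriv vs (\<lambda>x. f x + g x) x = iter_deriv vs f x + iter_deriv vs g x"
  using assms(4)
proof (induction vs arbitrary: x)
  case (Cons v vs)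
  have "frechet_derivative (iter_deriv vs (\<lambda>x. f x + g x)) (at x) =
      frechet_derivative (\<lambda>x. iter_deriv vs f x + iter_deriv vs g x) (at x)"
    by (rule frechet_derivative_cong_open[OF assms(1)]) (use Cons in auto)
  then show ?case
    using assms Cons.prems by (simp add: smooth_on_def frechet_derivative_add)
qed auto

lemma iter_deriv_bounded_linear:
  assumes "bounded_linear h" "open S" "smooth_on S f" "x \<in> S"
  shows "iter_deriv vs (\<lambda>x. h (f x)) x = h (iter_deriv vs f x)"
  using assms(4)
proof (induction vs arbitrary: x)
  case (Cons v vs)
  have "frechet_derivative (iter_deriv vs (\<lambda>x. h (f x))) (at x) =
      frechet_derivative (\<lambda>x. h (iter_deriv vs f x)) (at x)"
    by (rule frechet_derivative_cong_open[OF assms(2)]) (use Cons in auto)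
  also have "\<dots> = (\<lambda>v. h (frechet_derivative (iter_deriv vs f) (at x) v))"
    using assms(3) Cons.prems
    by (intro frechet_derivative_at[symmetric] bounded_linear.has_derivative[OF assms(1)])
       (simp add: smooth_on_def frechet_derivative_works)
  finally show ?case by simp
qed auto

lemma iter_deriv_zero: "iter_deriv vs (\<lambda>x. 0) x = 0"
  using iter_deriv_bounded_linear[OF bounded_linear_zero open_UNIV smooth_on_const[OF open_UNIV, of 0]] by simp

lemma iter_deriv_sum:
  assumes "finite I" "open S" "\<And>i. i \<in> I \<Longrightarrow> smooth_on S (f i)" "x \<in> S"
  shows "iter_deriv vs (\<lambda>x. \<Sum>i\<in>I. f i x) x = (\<Sum>i\<in>I. iter_deriv vs (f i) x)"
  using assms(1,3)
proof (induction I)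
  case (insert i I)
  have "iter_deriv vs (\<lambda>x. f i x + (\<Sum>i\<in>I. f i x)) x = iter_deriv vs (f i) x + iter_deriv vs (\<lambda>x. \<Sum>i\<in>I. f i x) x"
    using insert assms by (intro iter_deriv_add[of S] smooth_on_sum) auto
  then show ?case using insert by simp
qed (simp add: iter_deriv_zero)

subsection \<open>Bump functions and partitions of unity\<close>

text \<open>The flat function exp (-1/t) with negative powers of t in front. With these powers the
  family is closed under differentiation up to linear combinations, so that smoothness can be proved
  for all j at once.\<close>

definition exp_flat :: "nat \<Rightarrow> real \<Rightarrow> real" where
  "exp_flat j t = (if t > 0 then (1/t)^j * exp (- (1/t)) else 0)"

lemma exp_flat_deriv:
  "(exp_flat j has_field_derivative (exp_flat (j+2) t - real j * exp_flat (j+1) t)) (at t)"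
proof -
  consider "t > 0" | "t < 0" | "t = 0" by linarith
  then show ?thesis
  proof cases
    case 1
    have "((\<lambda>t. (1/t)^j * exp (- (1/t))) has_field_derivative
        (exp_flat (j+2) t - real j * exp_flat (j+1) t)) (at t)"
    proof (cases j)
      case (Suc i)
      show ?thesis using 1 unfolding Suc
        by (auto intro!: derivative_eq_intros simp: exp_flat_def field_simps power2_eq_square)
           (cases i; simp)
    qed (use 1 in \<open>auto intro!: derivative_eq_intros simp: exp_flat_def field_simps power2_eq_square\<close>)
    then show ?thesis
      by (rule DERIV_cong_ev[THEN iffD1, rotated 3, OF _ refl _ refl])
         (use 1 in \<open>auto simp: exp_flat_def eventually_nhds_metric dist_real_def intro!: exI[of _ t]\<close>)
  next
    case 2
    have "((\<lambda>t. 0) has_field_derivative (exp_flat (j+2) t - real j * exp_flat (j+1) t)) (at t)"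
      using 2 by (simp add: exp_flat_def)
    then show ?thesis
      by (rule DERIV_cong_ev[THEN iffD1, rotated 3, OF _ refl _ refl])
         (use 2 in \<open>auto simp: exp_flat_def eventually_nhds_metric dist_real_def intro!: exI[of _ "-t"]\<close>)
  next
    case 3
    \<comment> \<open>With x = 1 / h this is the difference quotient at 0 from the right; from the
      left the quotient is 0.\<close>
    have "((\<lambda>x::real. x^(j+1) / exp x) \<longlongrightarrow> 0) at_top" by (rule tendsto_power_div_exp_0)
    then have "((\<lambda>h::real. (inverse h)^(j+1) / exp (inverse h)) \<longlongrightarrow> 0) (at_right 0)"
      by (rule filterlim_compose[OF _ filterlim_inverse_at_top_right])
    then have R: "((\<lambda>h. exp_flat j h / h) \<longlongrightarrow> 0) (at_right 0)"
      by (rule Lim_transform_eventually)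
         (auto simp: exp_flat_def field_simps exp_minus intro!: eventually_mono[OF eventually_at_right_less])
    have L: "((\<lambda>h. exp_flat j h / h) \<longlongrightarrow> 0) (at_left 0)"
      by (rule Lim_transform_eventually[OF tendsto_const])
         (auto simp: exp_flat_def eventually_at_filter)
    have "((\<lambda>h. exp_flat j h / h) \<longlongrightarrow> 0) (at 0)"
      using L R by (simp add: filterlim_split_at)
    then show ?thesis
      using 3 by (simp add: has_field_derivative_iff exp_flat_def)
  qed
qed

lemma smooth_on_exp_flat: "smooth_on UNIV (exp_flat j)"
proof -
  have "Ck_on k UNIV (exp_flat j)" for k
  proof (induction k arbitrary: j)
    case 0
    show ?case unfolding Ck_on_0
      using differentiableI[OF exp_flat_deriv[unfolded has_field_derivative_def]] by auto
  next
    case (Suc k)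
    show ?case
    proof (rule Ck_on_SucI[where F="\<lambda>t v. (exp_flat (j+2) t - real j * exp_flat (j+1) t) * v"])
      show "(exp_flat j has_derivative (\<lambda>v. (exp_flat (j+2) t - real j * exp_flat (j+1) t) * v)) (at t)" for t
        using exp_flat_deriv[of j t] by (simp add: has_field_derivative_def)
      have "Ck_on k UNIV (\<lambda>t. exp_flat (j+2) t * v + exp_flat (j+1) t * (- real j * v))" for v
        by (intro Ck_on_add Ck_on_bounded_linear[OF bounded_linear_mult_left] Suc) auto
      then show "Ck_on k UNIV (\<lambda>t. (exp_flat (j+2) t - real j * exp_flat (j+1) t) * v)" for v
        by (simp add: algebra_simps)
    qed auto
  qed
  then show ?thesis by (simp add: smooth_on_Ck)
qed

definition smooth_step :: "real \<Rightarrow> real" where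
  "smooth_step t = exp_flat 0 t / (exp_flat 0 t + exp_flat 0 (1 - t))"

lemma smooth_on_smooth_step: "smooth_on UNIV smooth_step"
proof -
  have "smooth_on UNIV (\<lambda>t. exp_flat 0 t / (exp_flat 0 t + exp_flat 0 (1 - t)))"
  proof (intro smooth_on_divide smooth_on_add smooth_on_exp_flat open_UNIV)
    show "smooth_on UNIV (\<lambda>t. exp_flat 0 (1 - t))"
      by (rule smooth_on_compose[OF _ _ smooth_on_diff smooth_on_exp_flat])
         (auto intro: smooth_on_const smooth_on_ident)
    show "exp_flat 0 t + exp_flat 0 (1 - t) \<noteq> 0" for t
      by (auto simp: exp_flat_def) (smt (verit) exp_gt_zero)
  qed
  then show ?thesis unfolding smooth_step_def[abs_def] .
qed

lemma smooth_step_0: "t \<le> 0 \<Longrightarrow> smooth_step t = 0"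
  and smooth_step_1: "t \<ge> 1 \<Longrightarrow> smooth_step t = 1"
  by (auto simp: smooth_step_def exp_flat_def)

text \<open>The squared distance keeps the function smooth at the centre. The factor 2 / r^2 makes
  the argument of the step at least 1 where the squared distance is at most r^2 / 2, which includes
  the ball of radius r / 2, and nonpositive from distance r on.\<close>

definition bump :: "'a::euclidean_space \<Rightarrow> real \<Rightarrow> 'a \<Rightarrow> complex" where
  "bump x0 r x = of_real (smooth_step ((r\<^sup>2 - (x - x0) \<bullet> (x - x0)) * (2 / r\<^sup>2)))"

lemma smooth_on_bump: "smooth_on UNIV (bump x0 r)"
proof -
  have "smooth_on UNIV (\<lambda>x. (r\<^sup>2 - (x - x0) \<bullet> (x - x0)) * (2 / r\<^sup>2))"
    by (intro smooth_on_mult smooth_on_diff smooth_on_inner smooth_on_const smooth_on_ident open_UNIV)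
  then show ?thesis
    unfolding bump_def[abs_def]
    by (intro smooth_on_of_real smooth_on_compose[OF _ _ _ smooth_on_smooth_step]) auto
qed

lemma bump_1: "r > 0 \<Longrightarrow> dist x x0 < r / 2 \<Longrightarrow> bump x0 r x = 1"
proof -
  assume r: "r > 0" "dist x x0 < r / 2"
  then have "(norm (x - x0))\<^sup>2 \<le> (r / 2)\<^sup>2" by (intro power_mono) (auto simp: dist_norm)
  moreover have "(r / 2)\<^sup>2 \<le> r\<^sup>2 / 2" by (simp add: power_divide)
  ultimately have "(x - x0) \<bullet> (x - x0) \<le> r\<^sup>2 / 2"
    unfolding power2_norm_eq_inner[symmetric] by linarith
  then have "(r\<^sup>2 - (x - x0) \<bullet> (x - x0)) * (2 / r\<^sup>2) \<ge> 1" using r by (simp add: field_simps)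
  then show ?thesis by (simp add: bump_def smooth_step_1)
qed

lemma bump_0: "r > 0 \<Longrightarrow> dist x x0 \<ge> r \<Longrightarrow> bump x0 r x = 0"
proof -
  assume r: "r > 0" "dist x x0 \<ge> r"
  then have "r\<^sup>2 \<le> (norm (x - x0))\<^sup>2" by (intro power_mono) (auto simp: dist_norm)
  then have "r\<^sup>2 \<le> (x - x0) \<bullet> (x - x0)"
    by (simp add: power2_norm_eq_inner[symmetric])
  then have "(r\<^sup>2 - (x - x0) \<bullet> (x - x0)) * (2 / r\<^sup>2) \<le> 0" by (intro mult_nonpos_nonneg) auto
  then show ?thesis by (simp add: bump_def smooth_step_0)
qed

text \<open>No division by a sum of bumps: a new centre contributes its bump b, and the earlier
  functions are multiplied by 1 - b. If S was the old sum, the new one is b + S * (1 - b), which is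
  1 as soon as b or S is.\<close>

lemma finite_partition:
  fixes F :: "'a::euclidean_space set"
  assumes "finite F" "\<forall>l\<in>F. r l > 0"
  shows "\<exists>\<rho>. (\<forall>l. smooth_on UNIV (\<rho> l)) \<and> (\<forall>l\<in>F. \<forall>x. dist x l \<ge> r l \<longrightarrow> \<rho> l x = 0) \<and>
     (\<forall>x\<in>(\<Union>l\<in>F. ball l (r l / 2)). (\<Sum>l\<in>F. \<rho> l x) = (1::complex))"
  using assms
proof (induction F)
  case empty
  show ?case by (rule exI[of _ "\<lambda>l x. 0"]) (auto intro: smooth_on_const)
next
  case (insert l F)
  have "\<forall>l\<in>F. r l > 0" using insert.prems by simp
  from insert.IH[OF this] obtain \<rho> where \<rho>': "\<forall>l. smooth_on UNIV (\<rho> l)"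
    "\<forall>l\<in>F. \<forall>x. dist x l \<ge> r l \<longrightarrow> \<rho> l x = 0"
    "\<forall>x\<in>(\<Union>l\<in>F. ball l (r l / 2)). (\<Sum>l\<in>F. \<rho> l x) = (1::complex)"
    by (elim exE conjE) (rule that)
  have \<rho>: "\<And>m. smooth_on UNIV (\<rho> m)" "\<And>m x. m \<in> F \<Longrightarrow> dist x m \<ge> r m \<Longrightarrow> \<rho> m x = 0"
    "\<And>x m. m \<in> F \<Longrightarrow> x \<in> ball m (r m / 2) \<Longrightarrow> (\<Sum>m\<in>F. \<rho> m x) = (1::complex)"
    using \<rho>' by blast+
  define \<rho>' where "\<rho>' m x = (if m = l then bump l (r l) x else \<rho> m x * (1 - bump l (r l) x))" for m x
  have "smooth_on UNIV (\<rho>' m)" for m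
    unfolding \<rho>'_def using \<rho>(1)
    by (cases "m = l") (auto intro!: smooth_on_bump smooth_on_mult smooth_on_diff smooth_on_const)
  moreover have "\<rho>' m x = 0" if "m \<in> insert l F" "dist x m \<ge> r m" for m x
    using that \<rho>(2) bump_0[of "r l" x l] insert.prems by (auto simp: \<rho>'_def)
  moreover have "(\<Sum>m\<in>insert l F. \<rho>' m x) = 1" if "m \<in> insert l F" "x \<in> ball m (r m / 2)" for x m
  proof -
    have "(\<Sum>m\<in>insert l F. \<rho>' m x) = \<rho>' l x + (\<Sum>m\<in>F. \<rho>' m x)" using insert by simp
    also have "(\<Sum>m\<in>F. \<rho>' m x) = (\<Sum>m\<in>F. \<rho> m x * (1 - bump l (r l) x))"
      using insert by (intro sum.cong) (auto simp: \<rho>'_def)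
    also have "\<dots> = (\<Sum>m\<in>F. \<rho> m x) * (1 - bump l (r l) x)" by (simp add: sum_distrib_right)
    finally have S: "(\<Sum>m\<in>insert l F. \<rho>' m x) = bump l (r l) x + (\<Sum>m\<in>F. \<rho> m x) * (1 - bump l (r l) x)"
      by (simp add: \<rho>'_def)
    show ?thesis
    proof (cases "m = l")
      case True
      then show ?thesis using S that(2) bump_1[of "r l" x l] insert.prems by (simp add: dist_commute)
    next
      case False
      then show ?thesis using S that \<rho>(3)[of m x] by simp
    qed
  qed
  ultimately show ?case by (intro exI[of _ \<rho>'] conjI allI ballI impI; (erule UN_E)?; blast)
qed

text \<open>The radii are prescribed by local information at each point. The sum is 1 on an open set
  \<open>G\<close> and not merely on \<open>K\<close>, because pairings require cutoffs that are 1
  near a set.\<close>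

lemma compact_partition:
  fixes K :: "'a::euclidean_space set"
  assumes "compact K" "\<And>l. l \<in> K \<Longrightarrow> r l > 0"
  obtains F \<rho> G where "finite F" "F \<subseteq> K" "open G" "K \<subseteq> G" "\<And>l. smooth_on UNIV (\<rho> l)"
    "\<And>l x. l \<in> F \<Longrightarrow> x \<notin> cball l (r l) \<Longrightarrow> \<rho> l x = 0"
    "\<And>x. x \<in> G \<Longrightarrow> (\<Sum>l\<in>F. \<rho> l x) = (1::complex)"
proof -
  have "K \<subseteq> (\<Union>l\<in>K. ball l (r l / 2))" using assms(2) by force
  then obtain F where F: "F \<subseteq> K" "finite F" "K \<subseteq> (\<Union>l\<in>F. ball l (r l / 2))"
    by (rule compactE_image[OF assms(1) open_ball])
  obtain \<rho> where \<rho>: "\<forall>l. smooth_on UNIV (\<rho> l)" "\<forall>l\<in>F. \<forall>x. dist x l \<ge> r l \<longrightarrow> \<rho> l x = 0"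
     "\<forall>x\<in>(\<Union>l\<in>F. ball l (r l / 2)). (\<Sum>l\<in>F. \<rho> l x) = (1::complex)"
  proof -
    have "\<forall>l\<in>F. r l > 0" using assms(2) F(1) by blast
    from finite_partition[OF F(2) this] show ?thesis by (elim exE conjE) (rule that)
  qed
  show ?thesis
  proof (rule that[OF F(2,1) _ F(3), of \<rho>])
    show "\<rho> l x = 0" if "l \<in> F" "x \<notin> cball l (r l)" for l x
      using \<rho>(2) that by (auto simp: dist_commute)
  qed (use \<rho> in auto)
qed

subsection \<open>Test functions\<close>

lemma supp_subsetI: "closed K \<Longrightarrow> (\<And>x. x \<notin> K \<Longrightarrow> \<phi> x = 0) \<Longrightarrow> supp \<phi> \<subseteq> K"
  unfolding supp_def by (rule closure_minimal) auto

lemma not_in_supp: "x \<notin> supp \<phi> \<Longrightarrow> \<phi> x = 0"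
  unfolding supp_def using closure_subset[of "{x. \<phi> x \<noteq> 0}"] by auto

lemma closed_supp: "closed (supp \<phi>)"
  unfolding supp_def by simp

lemma test_funI:
  assumes "smooth_on UNIV \<phi>" "compact K" "K \<subseteq> \<Omega>" "\<And>x. x \<notin> K \<Longrightarrow> \<phi> x = 0"
  shows "\<phi> \<in> test_fun \<Omega>"
proof -
  have "supp \<phi> \<subseteq> K"
    by (rule supp_subsetI) (use assms compact_imp_closed in auto)
  moreover from this have "compact (supp \<phi>)"
    using compact_Int_closed[OF assms(2) closed_supp[of \<phi>]] by (simp add: Int_absorb1)
  ultimately show ?thesis using assms unfolding test_fun_def by blast
qed

lemma test_funD:
  assumes "\<phi> \<in> test_fun \<Omega>"
  shows "smooth_on UNIV \<phi>" "compact (supp \<phi>)" "supp \<phi> \<subseteq> \<Omega>"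
  using assms unfolding test_fun_def by auto

lemma test_fun_mono: "\<phi> \<in> test_fun \<Omega> \<Longrightarrow> \<Omega> \<subseteq> \<Omega>' \<Longrightarrow> \<phi> \<in> test_fun \<Omega>'"
  unfolding test_fun_def by blast

lemma iter_deriv_outside_supp: "x \<notin> supp \<phi> \<Longrightarrow> iter_deriv vs \<phi> x = 0"
  using iter_deriv_cong_open[of "- supp \<phi>" \<phi> "\<lambda>x. 0" x vs] not_in_supp[of _ \<phi>]
    closed_supp[of \<phi>] iter_deriv_zero[of vs x] by (auto simp: open_Compl)

lemma test_fun_zero: "(\<lambda>x. 0) \<in> test_fun \<Omega>"
  by (rule test_funI[where K="{}"]) (auto intro: smooth_on_const)

lemma test_fun_add:
  assumes "\<phi> \<in> test_fun \<Omega>" "\<psi> \<in> test_fun \<Omega>"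
  shows "(\<lambda>x. \<phi> x + \<psi> x) \<in> test_fun \<Omega>"
  by (rule test_funI[where K="supp \<phi> \<union> supp \<psi>"])
     (use test_funD[OF assms(1)] test_funD[OF assms(2)] not_in_supp
       in \<open>auto intro!: smooth_on_add compact_Un simp: not_in_supp\<close>)

text \<open>Off \<open>supp \<theta>\<close> the product is 0 whatever the values of
  \<open>\<psi>\<close>, so smoothness near the support is enough. This admits compositions with a
  map that is smooth only on an open set.\<close>

lemma test_fun_mult_smooth:
  assumes "\<theta> \<in> test_fun \<Omega>" "open X" "supp \<theta> \<subseteq> X" "smooth_on X \<psi>"
  shows "(\<lambda>x. \<theta> x * \<psi> x) \<in> test_fun \<Omega>"
proof (rule test_funI[where K="supp \<theta>"])
  have "smooth_on X (\<lambda>x. \<theta> x * \<psi> x)"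
    by (intro smooth_on_mult assms smooth_on_mono[OF test_funD(1)[OF assms(1)]]) auto
  then have "smooth_on UNIV (\<lambda>x. if x \<in> X then \<theta> x * \<psi> x else 0)"
    by (intro smooth_on_extend_zero[OF assms(2) closed_supp[of \<theta>]]) (use assms not_in_supp[of _ \<theta>] in auto)
  also have "(\<lambda>x. if x \<in> X then \<theta> x * \<psi> x else 0) = (\<lambda>x. \<theta> x * \<psi> x)"
    using assms(3) not_in_supp[of _ \<theta>] by (intro ext) auto
  finally show "smooth_on UNIV (\<lambda>x. \<theta> x * \<psi> x)" .
qed (use test_funD[OF assms(1)] not_in_supp[of _ \<theta>] in auto)

lemma test_fun_cmult: "\<phi> \<in> test_fun \<Omega> \<Longrightarrow> (\<lambda>x. c * \<phi> x) \<in> test_fun \<Omega>"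
  using test_fun_mult_smooth[OF _ open_UNIV subset_UNIV smooth_on_const[OF open_UNIV, of c], of \<phi> \<Omega>]
  by (simp add: mult.commute)

lemma test_fun_diff:
  assumes "\<phi> \<in> test_fun \<Omega>" "\<psi> \<in> test_fun \<Omega>"
  shows "(\<lambda>x. \<phi> x - \<psi> x) \<in> test_fun \<Omega>"
  using test_fun_add[OF assms(1) test_fun_cmult[OF assms(2), of "-1"]] by simp

lemma test_fun_sum:
  assumes "finite I" "\<And>i. i \<in> I \<Longrightarrow> \<phi> i \<in> test_fun \<Omega>"
  shows "(\<lambda>x. \<Sum>i\<in>I. \<phi> i x) \<in> test_fun \<Omega>"
  using assms by (induction I) (auto intro: test_fun_zero test_fun_add)

lemma finite_Basis_lists: "finite {vs :: 'a::euclidean_space list. set vs \<subseteq> Basis \<and> length vs \<le> m}"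
  by (rule finite_lists_length_le) simp

text \<open>\<open>Ck_norm\<close> is a bare supremum of reals and bounds its members only because
  of this: there are finitely many lists of basis vectors, and each gives a continuous function of
  compact support.\<close>

lemma bdd_above_Ck:
  fixes \<phi> :: "'a::euclidean_space \<Rightarrow> complex"
  assumes "\<phi> \<in> test_fun \<Omega>"
  shows "bdd_above {norm (iter_deriv vs \<phi> x) | vs x. set vs \<subseteq> Basis \<and> length vs \<le> m}"
proof -
  have "bdd_above (range (\<lambda>x. norm (iter_deriv vs \<phi> x)))" for vs
  proof -
    have "continuous_on (supp \<phi>) (iter_deriv vs \<phi>)"
      using smooth_on_continuous[OF smooth_on_iter_deriv[OF test_funD(1)[OF assms]]]
      by (rule continuous_on_subset) simp
    then have "bounded (iter_deriv vs \<phi> ` supp \<phi>)"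
      using compact_continuous_image compact_imp_bounded test_funD(2)[OF assms] by blast
    then obtain c where "\<forall>y\<in>iter_deriv vs \<phi> ` supp \<phi>. norm y \<le> c" by (auto simp: bounded_iff)
    then have "norm (iter_deriv vs \<phi> x) \<le> max c 0" for x
      by (cases "x \<in> supp \<phi>") (auto simp: iter_deriv_outside_supp intro: le_max_iff_disj[THEN iffD2])
    then show ?thesis by (intro bdd_aboveI[of _ "max c 0"]) auto
  qed
  then have "bdd_above (\<Union>vs\<in>{vs. set vs \<subseteq> Basis \<and> length vs \<le> m}. range (\<lambda>x. norm (iter_deriv vs \<phi> x)))"
    by (simp add: finite_Basis_lists)
  moreover have "{norm (iter_deriv vs \<phi> x) | vs x. set vs \<subseteq> Basis \<and> length vs \<le> m} =
      (\<Union>vs\<in>{vs. set vs \<subseteq> Basis \<and> length vs \<le> m}. range (\<lambda>x. norm (iter_deriv vs \<phi> x)))"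
    by blast
  ultimately show ?thesis by simp
qed

lemma Ck_norm_upper:
  assumes "\<phi> \<in> test_fun \<Omega>" "set vs \<subseteq> Basis" "length vs \<le> m"
  shows "norm (iter_deriv vs \<phi> x) \<le> Ck_norm m \<phi>"
proof -
  have "norm (iter_deriv vs \<phi> x) \<in> {norm (iter_deriv vs \<phi> x) | vs x. set vs \<subseteq> Basis \<and> length vs \<le> m}"
    using assms(2,3) by (intro CollectI exI[of _ vs] exI[of _ x]) simp
  from cSup_upper[OF this bdd_above_Ck[OF assms(1)]] show ?thesis unfolding Ck_norm_def .
qed

lemma Ck_norm_least:
  assumes "\<And>vs x. set vs \<subseteq> Basis \<Longrightarrow> length vs \<le> m \<Longrightarrow> norm (iter_deriv vs \<phi> x) \<le> M"
  shows "Ck_norm m \<phi> \<le> M"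
  unfolding Ck_norm_def
proof (rule cSup_least)
  show "{norm (iter_deriv vs \<phi> x) |vs x. set vs \<subseteq> Basis \<and> length vs \<le> m} \<noteq> {}"
    by (simp add: ex_in_conv[symmetric]) (metis empty_subsetI list.set(1) list.size(3) zero_le)
qed (use assms in auto)

lemma Ck_norm_nonneg: "\<phi> \<in> test_fun \<Omega> \<Longrightarrow> 0 \<le> Ck_norm m \<phi>"
  using order_trans[OF norm_ge_zero Ck_norm_upper[of \<phi> \<Omega> "[]" m undefined]] by simp

lemma norm_le_Ck_norm: "\<phi> \<in> test_fun \<Omega> \<Longrightarrow> norm (\<phi> x) \<le> Ck_norm m \<phi>"
  using Ck_norm_upper[of \<phi> \<Omega> "[]" m x] by simp

lemma iter_deriv_cmult:
  fixes \<phi> :: "'a::euclidean_space \<Rightarrow> complex"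
  assumes "open S" "smooth_on S \<phi>" "x \<in> S"
  shows "iter_deriv vs (\<lambda>x. c * \<phi> x) x = c * iter_deriv vs \<phi> x"
  by (rule iter_deriv_bounded_linear[OF bounded_linear_mult_right assms])

lemma Ck_norm_add:
  assumes "\<phi> \<in> test_fun \<Omega>" "\<psi> \<in> test_fun \<Omega>"
  shows "Ck_norm m (\<lambda>x. \<phi> x + \<psi> x) \<le> Ck_norm m \<phi> + Ck_norm m \<psi>"
proof (rule Ck_norm_least)
  fix vs :: "'a list" and x :: 'a assume vs: "set vs \<subseteq> Basis" "length vs \<le> m"
  have "iter_deriv vs (\<lambda>x. \<phi> x + \<psi> x) x = iter_deriv vs \<phi> x + iter_deriv vs \<psi> x"
    by (rule iter_deriv_add[of UNIV]) (use assms test_funD in auto)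
  also have "norm \<dots> \<le> Ck_norm m \<phi> + Ck_norm m \<psi>"
    by (intro order_trans[OF norm_triangle_ineq] add_mono Ck_norm_upper[OF _ vs]) (use assms in auto)
  finally show "norm (iter_deriv vs (\<lambda>x. \<phi> x + \<psi> x) x) \<le> Ck_norm m \<phi> + Ck_norm m \<psi>" .
qed

lemma Ck_norm_cmult:
  fixes \<phi> :: "'a::euclidean_space \<Rightarrow> complex"
  assumes "\<phi> \<in> test_fun \<Omega>"
  shows "Ck_norm m (\<lambda>x. c * \<phi> x) = norm c * Ck_norm m \<phi>"
proof -
  have le: "Ck_norm m (\<lambda>x. c * \<phi> x) \<le> norm c * Ck_norm m \<phi>" if "\<phi> \<in> test_fun \<Omega>" for c and \<phi> :: "'a \<Rightarrow> complex"
  proof (rule Ck_norm_least)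
    fix vs :: "'a list" and x :: 'a assume vs: "set vs \<subseteq> Basis" "length vs \<le> m"
    have "iter_deriv vs (\<lambda>x. c * \<phi> x) x = c * iter_deriv vs \<phi> x"
      by (rule iter_deriv_cmult[of UNIV]) (use that test_funD in auto)
    then show "norm (iter_deriv vs (\<lambda>x. c * \<phi> x) x) \<le> norm c * Ck_norm m \<phi>"
      by (simp add: norm_mult mult_left_mono Ck_norm_upper[OF that vs])
  qed
  show ?thesis
  proof (cases "c = 0")
    case True
    have "Ck_norm m (\<lambda>x::'a. 0) \<le> 0" using le[OF assms, of 0] by simp
    moreover have "0 \<le> Ck_norm m (\<lambda>x::'a. 0)" by (rule Ck_norm_nonneg[OF test_fun_zero])
    ultimately show ?thesis using True by simp
  next
    case False
    \<comment> \<open>The reverse inequality is the first one applied to the scaled function and the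
      scalar \<open>inverse c\<close>.\<close>
    have "Ck_norm m (\<lambda>x. inverse c * (c * \<phi> x)) \<le> norm (inverse c) * Ck_norm m (\<lambda>x. c * \<phi> x)"
      by (rule le[OF test_fun_cmult[OF assms]])
    then have "norm c * Ck_norm m \<phi> \<le> Ck_norm m (\<lambda>x. c * \<phi> x)"
      using False by (simp add: norm_divide field_simps)
    then show ?thesis using le[OF assms, of c] by simp
  qed
qed

subsection \<open>Derivatives of compositions, uniformly in a parameter\<close>

lemma continuous_compact_bound:
  fixes b :: "'a::euclidean_space \<Rightarrow> 'b::real_normed_vector"
  assumes "continuous_on S b" "compact K" "K \<subseteq> S"
  obtains c where "c > 0" "\<And>x. x \<in> K \<Longrightarrow> norm (b x) \<le> c"
proof -
  have "bounded (b ` K)"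
    using compact_continuous_image[OF continuous_on_subset[OF assms(1,3)] assms(2)] compact_imp_bounded by blast
  then show thesis using that by (auto simp: bounded_pos)
qed

lemma smooth_on_slice:
  fixes f :: "'a::euclidean_space \<times> 'c::euclidean_space \<Rightarrow> 'b::real_normed_vector"
  assumes "open X" "open P" "smooth_on (X \<times> P) f" "a \<in> P"
  shows "smooth_on X (\<lambda>x. f (x, a))"
  using assms by (intro smooth_on_compose[of X "X \<times> P" "\<lambda>x. (x, a)" f] smooth_on_Pair smooth_on_ident
      smooth_on_const open_Times) auto

lemma slice_has_derivative:
  fixes f :: "'a::euclidean_space \<times> 'c::euclidean_space \<Rightarrow> 'b::real_normed_vector"
  assumes "smooth_on S f" "(x, a) \<in> S"
  shows "((\<lambda>x. f (x, a)) has_derivative (\<lambda>v. frechet_derivative f (at (x, a)) (v, 0))) (at x)"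
proof -
  have "((\<lambda>x. (x, a)) has_derivative (\<lambda>v. (v, 0))) (at x)"
    by (intro derivative_eq_intros) auto
  from has_derivative_compose[OF this smooth_on_D[OF assms]] show ?thesis .
qed

lemma linear_Basis_expansion:
  "linear D \<Longrightarrow> D v = (\<Sum>j\<in>Basis. (v \<bullet> j) *\<^sub>R D j)" for v :: "'a::euclidean_space"
  by (subst euclidean_representation[of v, symmetric])
     (simp only: linear_sum linear_scale)

text \<open>The derivative of b * (\<phi> o f) is again a sum of such products, with \<phi> or its
  partial derivatives and with new amplitudes made from b and f alone. Induction over amplitudes
  therefore yields a constant chosen before \<phi>, M and the parameter a.\<close>

lemma chain_bound_list:
  fixes f :: "'a::euclidean_space \<times> 'c::euclidean_space \<Rightarrow> 'b::euclidean_space"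
    and b :: "'a \<times> 'c \<Rightarrow> complex"
  assumes XP: "open X" "open P" and f: "smooth_on (X \<times> P) f" and b: "smooth_on (X \<times> P) b"
    and Y: "open Y" "f ` (X \<times> P) \<subseteq> Y"
    and KQ: "compact K" "compact Q" "K \<subseteq> X" "Q \<subseteq> P"
  shows "\<exists>c\<ge>0. \<forall>(\<phi> :: 'b \<Rightarrow> complex) M. smooth_on Y \<phi> \<longrightarrow>
    (\<forall>ws. set ws \<subseteq> Basis \<longrightarrow> length ws \<le> length vs \<longrightarrow> (\<forall>x\<in>K. \<forall>a\<in>Q. norm (iter_deriv ws \<phi> (f (x, a))) \<le> M)) \<longrightarrow>
    (\<forall>x\<in>K. \<forall>a\<in>Q. norm (iter_deriv vs (\<lambda>x. b (x, a) * \<phi> (f (x, a))) x) \<le> c * M)"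
  using b
proof (induction vs arbitrary: b rule: rev_induct)
  case Nil
  obtain c where c: "c > 0" "\<And>z. z \<in> K \<times> Q \<Longrightarrow> norm (b z) \<le> c"
    using continuous_compact_bound[OF smooth_on_continuous[OF Nil] compact_Times[OF KQ(1,2)]] KQ by blast
  have "norm (b (x, a) * \<phi> (f (x, a))) \<le> c * M"
    if "\<forall>ws. set ws \<subseteq> Basis \<longrightarrow> length ws \<le> length [] \<longrightarrow> (\<forall>x\<in>K. \<forall>a\<in>Q. norm (iter_deriv ws \<phi> (f (x, a))) \<le> M)"
      "x \<in> K" "a \<in> Q" for \<phi> M x a
  proof -
    have "norm (\<phi> (f (x, a))) \<le> M" using that(1)[rule_format, of "[]" x a] that by simp
    then show ?thesis using c that by (auto simp: norm_mult intro!: mult_mono)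
  qed
  then show ?case using c by (intro exI[of _ c]) auto
next
  case (snoc v vs)
  let ?D = "\<lambda>g z. frechet_derivative g (at z)"
  \<comment> \<open>Directions of the form (v, 0) differentiate in x only; the amplitudes stay
    jointly smooth in x and a, so compactness of K and Q bounds them.\<close>
  define b0 where "b0 = (\<lambda>z. ?D b z (v, 0))"
  define b1 where "b1 = (\<lambda>j z. b z * of_real (?D f z (v, 0) \<bullet> j))"
  have opn: "open (X \<times> P)" by (rule open_Times[OF XP])
  have b0: "smooth_on (X \<times> P) b0" unfolding b0_def by (rule smooth_on_deriv[OF snoc.prems])
  have b1: "smooth_on (X \<times> P) (b1 j)" for j
    unfolding b1_def
    by (intro smooth_on_mult smooth_on_of_real smooth_on_inner smooth_on_const smooth_on_deriv opn snoc.prems f)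
  let ?P = "\<lambda>b c. \<forall>(\<phi> :: 'b \<Rightarrow> complex) M. smooth_on Y \<phi> \<longrightarrow>
    (\<forall>ws. set ws \<subseteq> Basis \<longrightarrow> length ws \<le> length vs \<longrightarrow> (\<forall>x\<in>K. \<forall>a\<in>Q. norm (iter_deriv ws \<phi> (f (x, a))) \<le> M)) \<longrightarrow>
    (\<forall>x\<in>K. \<forall>a\<in>Q. norm (iter_deriv vs (\<lambda>x. b (x, a) * \<phi> (f (x, a))) x) \<le> c * M)"
  obtain c0 where c0: "c0 \<ge> 0" "?P b0 c0" using snoc.IH[OF b0] by blast
  obtain c1 where c1: "\<And>j. c1 j \<ge> 0" "\<And>j. ?P (b1 j) (c1 j)"
    using choice[of "\<lambda>j c. c \<ge> 0 \<and> ?P (b1 j) c"] snoc.IH[OF b1] by blast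
  show ?case
  proof (intro exI[of _ "c0 + (\<Sum>j\<in>Basis. c1 j)"] conjI allI impI ballI)
    show "0 \<le> c0 + (\<Sum>j\<in>Basis. c1 j)" using c0 c1 by (simp add: sum_nonneg)
  next
    fix \<phi> :: "'b \<Rightarrow> complex" and M :: real and x :: 'a and a :: 'c
    assume \<phi>: "smooth_on Y \<phi>" and M: "\<forall>ws. set ws \<subseteq> Basis \<longrightarrow> length ws \<le> length (vs @ [v]) \<longrightarrow>
        (\<forall>x\<in>K. \<forall>a\<in>Q. norm (iter_deriv ws \<phi> (f (x, a))) \<le> M)" and x: "x \<in> K" and a: "a \<in> Q"
    have xX: "x \<in> X" and aP: "a \<in> P" using x a KQ by auto
    define \<phi>1 where "\<phi>1 = (\<lambda>j y. ?D \<phi> y j)"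
    have \<phi>1: "smooth_on Y (\<phi>1 j)" for j unfolding \<phi>1_def by (rule smooth_on_deriv[OF \<phi>])
    have fa: "smooth_on X (\<lambda>x. f (x, a))" "\<And>x. x \<in> X \<Longrightarrow> f (x, a) \<in> Y"
      using smooth_on_slice[OF XP f aP] Y(2) aP by auto
    have sm: "smooth_on X (\<lambda>x. b (x, a) * \<phi> (f (x, a)))"
      if "smooth_on (X \<times> P) b" "smooth_on Y \<phi>" for b :: "'a \<times> 'c \<Rightarrow> complex" and \<phi> :: "'b \<Rightarrow> complex"
      by (rule smooth_on_mult[OF XP(1) smooth_on_slice[OF XP that(1) aP]
            smooth_on_compose[OF XP(1) Y(1) fa(1) that(2) fa(2)]])
    have D: "?D (\<lambda>x. b (x, a) * \<phi> (f (x, a))) x v =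
        b0 (x, a) * \<phi> (f (x, a)) + (\<Sum>j\<in>Basis. b1 j (x, a) * \<phi>1 j (f (x, a)))" if "x \<in> X" for x
    proof -
      have m: "(x, a) \<in> X \<times> P" using that aP by simp
      have hb: "((\<lambda>x. b (x, a)) has_derivative (\<lambda>v. ?D b (x, a) (v, 0))) (at x)"
        by (rule slice_has_derivative[OF snoc.prems m])
      have h\<phi>: "(\<phi> has_derivative ?D \<phi> (f (x, a))) (at (f (x, a)))"
        by (rule smooth_on_D[OF \<phi> fa(2)[OF that]])
      have hc: "((\<lambda>x. \<phi> (f (x, a))) has_derivative (\<lambda>v. ?D \<phi> (f (x, a)) (?D f (x, a) (v, 0)))) (at x)"
        by (rule has_derivative_compose[OF slice_has_derivative[OF f m] h\<phi>])
      have "?D (\<lambda>x. b (x, a) * \<phi> (f (x, a))) x =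
          (\<lambda>v. b (x, a) * ?D \<phi> (f (x, a)) (?D f (x, a) (v, 0)) + ?D b (x, a) (v, 0) * \<phi> (f (x, a)))"
        by (rule frechet_derivative_at[OF has_derivative_mult[OF hb hc], symmetric])
      moreover have "?D \<phi> (f (x, a)) (?D f (x, a) (v, 0)) =
          (\<Sum>j\<in>Basis. (?D f (x, a) (v, 0) \<bullet> j) *\<^sub>R \<phi>1 j (f (x, a)))"
        unfolding \<phi>1_def by (rule linear_Basis_expansion[OF has_derivative_linear[OF h\<phi>]])
      ultimately show ?thesis
        by (simp add: b0_def b1_def sum_distrib_left scaleR_conv_of_real mult.assoc)
    qed
    have "iter_deriv (vs @ [v]) (\<lambda>x. b (x, a) * \<phi> (f (x, a))) x =
      iter_deriv vs (\<lambda>x. b0 (x, a) * \<phi> (f (x, a)) + (\<Sum>j\<in>Basis. b1 j (x, a) * \<phi>1 j (f (x, a)))) x"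
      unfolding iter_deriv_snoc by (rule iter_deriv_cong_open[OF XP(1) D xX])
    also have "\<dots> = iter_deriv vs (\<lambda>x. b0 (x, a) * \<phi> (f (x, a))) x +
        iter_deriv vs (\<lambda>x. \<Sum>j\<in>Basis. b1 j (x, a) * \<phi>1 j (f (x, a))) x"
      by (rule iter_deriv_add[OF XP(1) sm[OF b0 \<phi>] smooth_on_sum[OF XP(1) sm[OF b1 \<phi>1]] xX])
    also have "iter_deriv vs (\<lambda>x. \<Sum>j\<in>Basis. b1 j (x, a) * \<phi>1 j (f (x, a))) x =
        (\<Sum>j\<in>Basis. iter_deriv vs (\<lambda>x. b1 j (x, a) * \<phi>1 j (f (x, a))) x)"
      by (rule iter_deriv_sum[OF finite_Basis XP(1) sm[OF b1 \<phi>1] xX])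
    finally have eq: "iter_deriv (vs @ [v]) (\<lambda>x. b (x, a) * \<phi> (f (x, a))) x =
      iter_deriv vs (\<lambda>x. b0 (x, a) * \<phi> (f (x, a))) x + (\<Sum>j\<in>Basis. iter_deriv vs (\<lambda>x. b1 j (x, a) * \<phi>1 j (f (x, a))) x)" .
    have n0: "norm (iter_deriv vs (\<lambda>x. b0 (x, a) * \<phi> (f (x, a))) x) \<le> c0 * M"
      using c0(2)[rule_format, OF \<phi>, of M x a] M x a by simp
    have n1: "norm (iter_deriv vs (\<lambda>x. b1 j (x, a) * \<phi>1 j (f (x, a))) x) \<le> c1 j * M" if j: "j \<in> Basis" for j
    proof -
      have "norm (iter_deriv ws (\<phi>1 j) (f (x, a))) \<le> M"
        if "set ws \<subseteq> Basis" "length ws \<le> length vs" "x \<in> K" "a \<in> Q" for ws x a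
        using M[rule_format, of "ws @ [j]" x a] that j by (simp add: iter_deriv_snoc \<phi>1_def)
      then show ?thesis using c1(2)[of j, rule_format, OF \<phi>1[of j], of M x a] x a by blast
    qed
    have "norm (iter_deriv (vs @ [v]) (\<lambda>x. b (x, a) * \<phi> (f (x, a))) x) \<le> c0 * M + (\<Sum>j\<in>Basis. c1 j * M)"
      unfolding eq by (intro order_trans[OF norm_triangle_ineq] add_mono n0 order_trans[OF norm_sum] sum_mono n1)
    then show "norm (iter_deriv (vs @ [v]) (\<lambda>x. b (x, a) * \<phi> (f (x, a))) x) \<le> (c0 + (\<Sum>j\<in>Basis. c1 j)) * M"
      by (simp add: distrib_right sum_distrib_right)
  qed
qed

lemma chain_bound:
  fixes f :: "'a::euclidean_space \<times> 'c::euclidean_space \<Rightarrow> 'b::euclidean_space"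
    and b :: "'a \<times> 'c \<Rightarrow> complex"
  assumes XP: "open X" "open P" and f: "smooth_on (X \<times> P) f" and b: "smooth_on (X \<times> P) b"
    and Y: "open Y" "f ` (X \<times> P) \<subseteq> Y"
    and KQ: "compact K" "compact Q" "K \<subseteq> X" "Q \<subseteq> P"
  obtains c where "c \<ge> 0" "\<And>(\<phi> :: 'b \<Rightarrow> complex) M vs x a. smooth_on Y \<phi> \<Longrightarrow>
    (\<And>ws x a. set ws \<subseteq> Basis \<Longrightarrow> length ws \<le> m \<Longrightarrow> x \<in> K \<Longrightarrow> a \<in> Q \<Longrightarrow> norm (iter_deriv ws \<phi> (f (x, a))) \<le> M) \<Longrightarrow>
    set vs \<subseteq> Basis \<Longrightarrow> length vs \<le> m \<Longrightarrow> x \<in> K \<Longrightarrow> a \<in> Q \<Longrightarrow>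
    norm (iter_deriv vs (\<lambda>x. b (x, a) * \<phi> (f (x, a))) x) \<le> c * M"
proof -
  define L where "L = {vs :: 'a list. set vs \<subseteq> Basis \<and> length vs \<le> m}"
  let ?P = "\<lambda>vs c. \<forall>(\<phi> :: 'b \<Rightarrow> complex) M. smooth_on Y \<phi> \<longrightarrow>
    (\<forall>ws. set ws \<subseteq> Basis \<longrightarrow> length ws \<le> length vs \<longrightarrow> (\<forall>x\<in>K. \<forall>a\<in>Q. norm (iter_deriv ws \<phi> (f (x, a))) \<le> M)) \<longrightarrow>
    (\<forall>x\<in>K. \<forall>a\<in>Q. norm (iter_deriv vs (\<lambda>x. b (x, a) * \<phi> (f (x, a))) x) \<le> c * M)"
  have "\<exists>c. c \<ge> 0 \<and> ?P vs c" for vs :: "'a list"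
    using chain_bound_list[OF XP f b Y KQ, of vs] by blast
  then obtain c where c: "\<And>vs. c vs \<ge> 0" "\<And>vs. ?P vs (c vs)"
    using choice[of "\<lambda>vs c. c \<ge> 0 \<and> ?P vs c"] by blast
  have fin: "finite L" unfolding L_def by (rule finite_Basis_lists)
  show thesis
  proof (rule that[of "sum c L"])
    show "0 \<le> sum c L" using c by (simp add: sum_nonneg)
    fix \<phi> :: "'b \<Rightarrow> complex" and M :: real and vs :: "'a list" and x a
    assume \<phi>: "smooth_on Y \<phi>" and M: "\<And>ws x a. set ws \<subseteq> Basis \<Longrightarrow> length ws \<le> m \<Longrightarrow> x \<in> K \<Longrightarrow> a \<in> Q \<Longrightarrow>
        norm (iter_deriv ws \<phi> (f (x, a))) \<le> M"
      and vs: "set vs \<subseteq> Basis" "length vs \<le> m" and x: "x \<in> K" and a: "a \<in> Q"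
    have M0: "M \<ge> 0" using order_trans[OF norm_ge_zero M[of "[]" x a]] x a by simp
    have "norm (iter_deriv vs (\<lambda>x. b (x, a) * \<phi> (f (x, a))) x) \<le> c vs * M"
      using c(2)[rule_format, OF \<phi>, of vs M x a] M vs x a by (meson le_trans)
    also have "\<dots> \<le> sum c L * M"
      using vs fin c M0 by (intro mult_right_mono member_le_sum) (auto simp: L_def)
    finally show "norm (iter_deriv vs (\<lambda>x. b (x, a) * \<phi> (f (x, a))) x) \<le> sum c L * M" .
  qed
qed

subsection \<open>Exponentials\<close>

definition expi :: "'a::euclidean_space \<Rightarrow> 'a \<Rightarrow> complex" where
  "expi k x = exp (- \<i> * of_real (k \<bullet> x))"

lemma norm_expi [simp]: "norm (expi k x) = 1"
  unfolding expi_def by (simp add: norm_exp_eq_Re)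

lemma smooth_on_expi: "open S \<Longrightarrow> smooth_on S (expi k)"
  unfolding expi_def[abs_def]
  by (intro smooth_on_cexp smooth_on_mult smooth_on_const smooth_on_of_real smooth_on_inner smooth_on_ident)

lemma expi_has_derivative: "(expi k has_derivative (\<lambda>v. - \<i> * of_real (k \<bullet> v) * expi k x)) (at x)"
proof -
  have "((\<lambda>x. - \<i> * of_real (k \<bullet> x)) has_derivative (\<lambda>v. - \<i> * of_real (k \<bullet> v))) (at x)"
    by (intro derivative_eq_intros) auto
  from has_derivative_compose[OF this DERIV_exp[unfolded has_field_derivative_def]] show ?thesis
    unfolding expi_def[abs_def] by (simp add: mult_ac)
qed

lemma iter_deriv_expi: "iter_deriv vs (expi k) x = (\<Prod>v\<leftarrow>vs. - \<i> * of_real (k \<bullet> v)) * expi k x"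
proof (induction vs arbitrary: x)
  case (Cons v vs)
  have "((\<lambda>x. (\<Prod>v\<leftarrow>vs. - \<i> * of_real (k \<bullet> v)) * expi k x) has_derivative
      (\<lambda>v. (\<Prod>v\<leftarrow>vs. - \<i> * of_real (k \<bullet> v)) * (- \<i> * of_real (k \<bullet> v) * expi k x))) (at x)"
    by (rule has_derivative_mult_right[OF expi_has_derivative])
  note d = frechet_derivative_at[OF this, symmetric]
  have "iter_deriv vs (expi k) = (\<lambda>x. (\<Prod>v\<leftarrow>vs. - \<i> * of_real (k \<bullet> v)) * expi k x)"
    using Cons.IH by (rule ext)
  then show ?case by (simp only: iter_deriv.simps d) simp
qed simp

lemma norm_iter_deriv_expi:
  assumes "set vs \<subseteq> Basis" "length vs \<le> m"
  shows "norm (iter_deriv vs (expi k) x) \<le> (1 + norm k) ^ m"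
proof -
  have "norm (\<Prod>v\<leftarrow>vs. - \<i> * of_real (k \<bullet> v) :: complex) \<le> (1 + norm k) ^ length vs"
    using assms(1)
  proof (induction vs)
    case (Cons v vs)
    have "\<bar>k \<bullet> v\<bar> \<le> 1 + norm k" using Basis_le_norm[of v k] Cons by auto
    then show ?case using Cons by (auto simp: norm_mult intro!: mult_mono)
  qed simp
  also have "\<dots> \<le> (1 + norm k) ^ m" using assms(2) by (intro power_increasing) auto
  finally show ?thesis by (simp add: iter_deriv_expi norm_mult)
qed

lemma Ck_norm_mult_bound:
  fixes \<theta> :: "'a::euclidean_space \<Rightarrow> complex"
  assumes \<theta>: "\<theta> \<in> test_fun \<Omega>"
  obtains c where "c \<ge> 0" "\<And>(\<phi> :: 'a \<Rightarrow> complex) M. smooth_on UNIV \<phi> \<Longrightarrow>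
    (\<And>ws x. set ws \<subseteq> Basis \<Longrightarrow> length ws \<le> m \<Longrightarrow> x \<in> supp \<theta> \<Longrightarrow> norm (iter_deriv ws \<phi> x) \<le> M) \<Longrightarrow>
    0 \<le> M \<Longrightarrow> Ck_norm m (\<lambda>x. \<theta> x * \<phi> x) \<le> c * M"
proof -
  let ?U = "UNIV :: ('a \<times> real) set"
  \<comment> \<open>\<open>chain_bound\<close> is used for the identity in x; the second component
    is a dummy real parameter, restricted to the value 0.\<close>
  have f: "smooth_on (UNIV \<times> UNIV) (\<lambda>z::'a\<times>real. fst z)"
    by (auto intro!: smooth_on_linear bounded_linear_fst)
  have b: "smooth_on (UNIV \<times> UNIV) (\<lambda>z::'a\<times>real. \<theta> (fst z))"
    by (rule smooth_on_compose[OF _ open_UNIV f test_funD(1)[OF \<theta>]]) auto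
  obtain c where c: "c \<ge> 0" "\<And>(\<phi> :: 'a \<Rightarrow> complex) M vs x a. smooth_on UNIV \<phi> \<Longrightarrow>
    (\<And>ws x a. set ws \<subseteq> Basis \<Longrightarrow> length ws \<le> m \<Longrightarrow> x \<in> supp \<theta> \<Longrightarrow> a \<in> {0::real} \<Longrightarrow>
      norm (iter_deriv ws \<phi> (fst (x, a))) \<le> M) \<Longrightarrow>
    set vs \<subseteq> Basis \<Longrightarrow> length vs \<le> m \<Longrightarrow> x \<in> supp \<theta> \<Longrightarrow> a \<in> {0::real} \<Longrightarrow>
    norm (iter_deriv vs (\<lambda>x. \<theta> (fst (x, a)) * \<phi> (fst (x, a))) x) \<le> c * M"
    by (rule chain_bound[OF open_UNIV open_UNIV f b open_UNIV subset_UNIV test_funD(2)[OF \<theta>], of "{0}" m]) auto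
  show thesis
  proof (rule that[OF c(1)], rule Ck_norm_least)
    fix \<phi> :: "'a \<Rightarrow> complex" and M :: real and vs :: "'a list" and x assume \<phi>: "smooth_on UNIV \<phi>" and
      M: "\<And>ws x. set ws \<subseteq> Basis \<Longrightarrow> length ws \<le> m \<Longrightarrow> x \<in> supp \<theta> \<Longrightarrow> norm (iter_deriv ws \<phi> x) \<le> M" "0 \<le> M"
      and vs: "set vs \<subseteq> Basis" "length vs \<le> m"
    show "norm (iter_deriv vs (\<lambda>x. \<theta> x * \<phi> x) x) \<le> c * M"
    proof (cases "x \<in> supp \<theta>")
      case True
      have "norm (iter_deriv vs (\<lambda>x. \<theta> (fst (x, 0::real)) * \<phi> (fst (x, 0::real))) x) \<le> c * M"
        by (rule c(2)[OF \<phi> _ vs True]) (use M in auto)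
      then show ?thesis by simp
    next
      case False
      have "supp (\<lambda>x. \<theta> x * \<phi> x) \<subseteq> supp \<theta>"
        by (rule supp_subsetI[OF closed_supp]) (simp add: not_in_supp)
      then have "iter_deriv vs (\<lambda>x. \<theta> x * \<phi> x) x = 0" using False by (intro iter_deriv_outside_supp) auto
      then show ?thesis using c(1) M(2) by simp
    qed
  qed
qed

lemma test_fun_expi: "\<theta> \<in> test_fun \<Omega> \<Longrightarrow> (\<lambda>x. \<theta> x * expi k x) \<in> test_fun \<Omega>"
  by (rule test_fun_mult_smooth[OF _ open_UNIV subset_UNIV smooth_on_expi[OF open_UNIV]])

lemma Ck_norm_expi_bound:
  fixes \<theta> :: "'a::euclidean_space \<Rightarrow> complex"
  assumes \<theta>: "\<theta> \<in> test_fun \<Omega>"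
  obtains c where "c \<ge> 0" "\<And>k. Ck_norm m (\<lambda>x. \<theta> x * expi k x) \<le> c * (1 + norm k) ^ m"
proof (rule Ck_norm_mult_bound[OF \<theta>, of m])
  fix c assume c: "c \<ge> 0" "\<And>(\<phi> :: 'a \<Rightarrow> complex) M. smooth_on UNIV \<phi> \<Longrightarrow>
    (\<And>ws x. set ws \<subseteq> Basis \<Longrightarrow> length ws \<le> m \<Longrightarrow> x \<in> supp \<theta> \<Longrightarrow> norm (iter_deriv ws \<phi> x) \<le> M) \<Longrightarrow>
    0 \<le> M \<Longrightarrow> Ck_norm m (\<lambda>x. \<theta> x * \<phi> x) \<le> c * M"
  have "Ck_norm m (\<lambda>x. \<theta> x * expi k x) \<le> c * (1 + norm k) ^ m" for k
    by (rule c(2)[OF smooth_on_expi[OF open_UNIV]]) (simp_all add: norm_iter_deriv_expi)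
  with c(1) show thesis by (rule that)
qed

subsection \<open>Bounded sets of test functions\<close>

lemma sup0_upper: "bdd_above X \<Longrightarrow> x \<in> X \<Longrightarrow> x \<le> sup0 X"
  unfolding sup0_def by (rule cSup_upper) auto

lemma sup0_nonneg: "bdd_above X \<Longrightarrow> 0 \<le> sup0 X"
  unfolding sup0_def by (rule cSup_upper) auto

lemma sup0_least: "(\<And>x. x \<in> X \<Longrightarrow> x \<le> c) \<Longrightarrow> 0 \<le> c \<Longrightarrow> sup0 X \<le> c"
  unfolding sup0_def by (rule cSup_least) auto

text \<open>Covers the seminorms p_B, the conic seminorms and the supremum over the parameter set A.
  Boundedness has to be supplied, as \<open>Sup\<close> is unspecified on unbounded sets of
  reals.\<close>

lemma seminorm_on_sup0:
  assumes q: "\<And>i. i \<in> I \<Longrightarrow> seminorm_on E (q i)"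
    and bdd: "\<And>u. u \<in> E \<Longrightarrow> bdd_above ((\<lambda>i. q i u) ` I)"
  shows "seminorm_on E (\<lambda>u. sup0 ((\<lambda>i. q i u) ` I))"
  unfolding seminorm_on_def
proof (intro conjI ballI allI)
  fix u v assume u: "u \<in> E" and v: "v \<in> E"
  show "0 \<le> sup0 ((\<lambda>i. q i u) ` I)" by (rule sup0_nonneg[OF bdd[OF u]])
  show "sup0 ((\<lambda>i. q i (\<lambda>x. u x + v x)) ` I) \<le> sup0 ((\<lambda>i. q i u) ` I) + sup0 ((\<lambda>i. q i v) ` I)"
  proof (rule sup0_least)
    fix y assume "y \<in> (\<lambda>i. q i (\<lambda>x. u x + v x)) ` I"
    then obtain i where i: "i \<in> I" "y = q i (\<lambda>x. u x + v x)" by blast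
    then have "y \<le> q i u + q i v" using q[OF i(1)] u v by (simp add: seminorm_on_def)
    also have "\<dots> \<le> sup0 ((\<lambda>i. q i u) ` I) + sup0 ((\<lambda>i. q i v) ` I)"
      by (intro add_mono sup0_upper bdd u v imageI i)
    finally show "y \<le> sup0 ((\<lambda>i. q i u) ` I) + sup0 ((\<lambda>i. q i v) ` I)" .
  qed (simp add: add_nonneg_nonneg sup0_nonneg bdd u v)
next
  fix u and c :: complex assume u: "u \<in> E"
  have eq: "q i (\<lambda>x. c * u x) = norm c * q i u" if "i \<in> I" for i
    using q[OF that] u by (simp add: seminorm_on_def)
  show "sup0 ((\<lambda>i. q i (\<lambda>x. c * u x)) ` I) = norm c * sup0 ((\<lambda>i. q i u) ` I)"
  proof (rule antisym)
    show "sup0 ((\<lambda>i. q i (\<lambda>x. c * u x)) ` I) \<le> norm c * sup0 ((\<lambda>i. q i u) ` I)"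
    proof (rule sup0_least)
      fix y assume "y \<in> (\<lambda>i. q i (\<lambda>x. c * u x)) ` I"
      then obtain i where "i \<in> I" "y = norm c * q i u" using eq by auto
      then show "y \<le> norm c * sup0 ((\<lambda>i. q i u) ` I)"
        by (auto intro!: mult_left_mono sup0_upper bdd u)
    qed (simp add: sup0_nonneg bdd u)
    show "norm c * sup0 ((\<lambda>i. q i u) ` I) \<le> sup0 ((\<lambda>i. q i (\<lambda>x. c * u x)) ` I)"
    proof (cases "c = 0")
      case False
      have img: "(\<lambda>i. q i (\<lambda>x. c * u x)) ` I = (\<lambda>i. norm c * q i u) ` I" using eq by (rule image_cong[OF refl])
      obtain M where M: "\<And>i. i \<in> I \<Longrightarrow> q i u \<le> M" using bdd[OF u] by (auto simp: bdd_above_def)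
      have b: "bdd_above ((\<lambda>i. norm c * q i u) ` I)"
        by (rule bdd_aboveI[of _ "norm c * M"]) (auto intro!: mult_left_mono M)
      have "sup0 ((\<lambda>i. q i u) ` I) \<le> sup0 ((\<lambda>i. norm c * q i u) ` I) / norm c"
      proof (rule sup0_least)
        fix y assume "y \<in> (\<lambda>i. q i u) ` I"
        then obtain i where i: "i \<in> I" "y = q i u" by blast
        have "norm c * q i u \<le> sup0 ((\<lambda>i. norm c * q i u) ` I)" by (rule sup0_upper[OF b]) (use i in auto)
        then show "y \<le> sup0 ((\<lambda>i. norm c * q i u) ` I) / norm c"
          using False i by (simp add: field_simps)
      qed (simp add: sup0_nonneg[OF b])
      then show ?thesis unfolding img using False by (simp add: field_simps)
    next
      case True
      have "bdd_above ((\<lambda>i. q i (\<lambda>x. c * u x)) ` I)"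
        by (rule bdd_aboveI[of _ 0]) (use eq True in auto)
      then show ?thesis using True sup0_nonneg by fastforce
    qed
  qed
qed

text \<open>On functions supported in one compact set a continuous seminorm is at most a multiple of
  a single \<open>Ck_norm\<close>.\<close>

lemma test_boundedI:
  assumes "B \<subseteq> test_fun \<Omega>" "compact K" "K \<subseteq> \<Omega>" "\<And>\<phi>. \<phi> \<in> B \<Longrightarrow> supp \<phi> \<subseteq> K"
    and "\<And>m. \<exists>M. \<forall>\<phi>\<in>B. Ck_norm m \<phi> \<le> M"
  shows "test_bounded \<Omega> B"
  unfolding test_bounded_def
proof (intro conjI allI impI assms(1))
  fix p assume "test_seminorm \<Omega> p"
  then obtain c m where c: "\<And>\<phi>. \<phi> \<in> test_fun \<Omega> \<Longrightarrow> supp \<phi> \<subseteq> K \<Longrightarrow> p \<phi> \<le> c * Ck_norm m \<phi>"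
    unfolding test_seminorm_def using assms(2,3) by metis
  obtain M where M: "\<And>\<phi>. \<phi> \<in> B \<Longrightarrow> Ck_norm m \<phi> \<le> M" using assms(5)[of m] by blast
  have "p \<phi> \<le> \<bar>c\<bar> * M" if "\<phi> \<in> B" for \<phi>
  proof -
    have "p \<phi> \<le> c * Ck_norm m \<phi>" using c assms that by blast
    also have "\<dots> \<le> \<bar>c\<bar> * M"
      by (intro mult_mono M that Ck_norm_nonneg) (use assms(1) that in auto)
    finally show ?thesis .
  qed
  then show "bdd_above (p ` B)" by (intro bdd_aboveI[of _ "\<bar>c\<bar> * M"]) auto
qed

text \<open>\<open>Ck_norm m\<close> is itself a continuous seminorm, so the definition of
  boundedness applies to it.\<close>

lemma test_bounded_Ck:
  fixes \<Omega> :: "'a::euclidean_space set"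
  assumes "test_bounded \<Omega> B"
  obtains M where "\<And>\<phi>. \<phi> \<in> B \<Longrightarrow> Ck_norm m \<phi> \<le> M"
proof -
  have "test_seminorm \<Omega> (Ck_norm m)"
    unfolding test_seminorm_def seminorm_on_def
  proof (intro conjI allI ballI impI)
    fix K :: "'a set"
    show "\<exists>c k. \<forall>\<phi>\<in>test_fun \<Omega>. supp \<phi> \<subseteq> K \<longrightarrow> Ck_norm m \<phi> \<le> c * Ck_norm k \<phi>"
      by (intro exI[of _ 1] exI[of _ m]) simp
  qed (simp_all add: Ck_norm_nonneg Ck_norm_add Ck_norm_cmult)
  then have "bdd_above (Ck_norm m ` B)" using assms unfolding test_bounded_def by simp
  then show thesis using that by (auto simp: bdd_above_def)
qed

text \<open>If the supports escape every compact set, pick points \<open>x n\<close> in them leaving all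
  compact sets; the seminorm \<open>sup n * |\<phi> (x n)| / |\<psi> n (x n)|\<close> is then
  continuous but unbounded.\<close>

lemma test_bounded_supp:
  fixes \<Omega> :: "'a::euclidean_space set"
  assumes "open \<Omega>" "test_bounded \<Omega> B"
  obtains K where "compact K" "K \<subseteq> \<Omega>" "\<And>\<phi>. \<phi> \<in> B \<Longrightarrow> supp \<phi> \<subseteq> K"
proof (rule ccontr)
  assume "\<not> thesis"
  then have neg: "\<not> (\<exists>K. compact K \<and> K \<subseteq> \<Omega> \<and> (\<forall>\<phi>\<in>B. supp \<phi> \<subseteq> K))" using that by blast
  obtain C where C: "\<And>n::nat. compact (C n)" "\<And>n. C n \<subseteq> \<Omega>"
    "\<And>K. compact K \<Longrightarrow> K \<subseteq> \<Omega> \<Longrightarrow> \<exists>N. \<forall>n\<ge>N. K \<subseteq> C n"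
    using open_Union_compact_subsets[OF assms(1)] by metis
  have "\<exists>\<phi> x. \<phi> \<in> B \<and> x \<notin> C n \<and> \<phi> x \<noteq> 0" for n
  proof (rule ccontr)
    assume "\<not> ?thesis"
    then have "\<forall>\<phi>\<in>B. supp \<phi> \<subseteq> C n"
      by (intro ballI supp_subsetI compact_imp_closed C(1)) blast
    with neg C show False by blast
  qed
  then obtain \<psi> x where \<psi>: "\<And>n. \<psi> n \<in> B" "\<And>n. x n \<notin> C n" "\<And>n. \<psi> n (x n) \<noteq> 0" by metis
  have B: "B \<subseteq> test_fun \<Omega>" using assms(2) by (simp add: test_bounded_def)
  define q where "q n \<phi> = real n / norm (\<psi> n (x n)) * norm (\<phi> (x n))" for n and \<phi> :: "'a \<Rightarrow> complex"
  define p where "p \<phi> = sup0 ((\<lambda>n. q n \<phi>) ` UNIV)" for \<phi>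
  have pK: "\<exists>c. \<forall>\<phi>\<in>test_fun \<Omega>. supp \<phi> \<subseteq> K \<longrightarrow> (\<forall>n. q n \<phi> \<le> c * Ck_norm 0 \<phi>)"
    if K: "compact K" "K \<subseteq> \<Omega>" for K
  proof -
    obtain N where N: "\<And>n. n \<ge> N \<Longrightarrow> K \<subseteq> C n" using C(3)[OF K] by blast
    \<comment> \<open>A function supported in K vanishes at \<open>x n\<close> for n >= N, hence
      finitely many weights decide the bound on K.\<close>
    let ?c = "\<Sum>n<N. real n / norm (\<psi> n (x n))"
    have "q n \<phi> \<le> ?c * Ck_norm 0 \<phi>" if "\<phi> \<in> test_fun \<Omega>" "supp \<phi> \<subseteq> K" for n \<phi>
    proof (cases "n < N")
      case True
      have "real n / norm (\<psi> n (x n)) \<le> ?c"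
        by (rule member_le_sum) (use True in auto)
      then show ?thesis
        unfolding q_def by (intro mult_mono norm_le_Ck_norm[OF that(1)]) (auto intro: sum_nonneg)
    next
      case False
      have "\<phi> (x n) = 0" using N[of n] False \<psi>(2)[of n] that(2) by (intro not_in_supp) auto
      moreover have "0 \<le> ?c" by (intro sum_nonneg) simp
      ultimately show ?thesis using Ck_norm_nonneg[OF that(1), of 0] by (simp add: q_def)
    qed
    then show ?thesis by blast
  qed
  have bdd: "bdd_above ((\<lambda>n. q n \<phi>) ` UNIV)" if "\<phi> \<in> test_fun \<Omega>" for \<phi>
  proof -
    note t = that
    obtain c where "\<forall>n. q n \<phi> \<le> c * Ck_norm 0 \<phi>" using pK[of "supp \<phi>"] test_funD[OF t] t by blast
    then show ?thesis by (intro bdd_aboveI[of _ "c * Ck_norm 0 \<phi>"]) auto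
  qed
  have "seminorm_on (test_fun \<Omega>) (\<lambda>\<phi>. sup0 ((\<lambda>n. q n \<phi>) ` UNIV))"
  proof (rule seminorm_on_sup0[OF _ bdd])
    fix n
    have "q n (\<lambda>x. u x + v x) \<le> q n u + q n v" for u v
      unfolding q_def distrib_left[symmetric] by (intro mult_left_mono norm_triangle_ineq) auto
    then show "seminorm_on (test_fun \<Omega>) (q n)"
      by (simp add: seminorm_on_def) (simp add: q_def norm_mult)
  qed
  moreover have "\<exists>c m. \<forall>\<phi>\<in>test_fun \<Omega>. supp \<phi> \<subseteq> K \<longrightarrow> p \<phi> \<le> c * Ck_norm m \<phi>"
    if K: "compact K" "K \<subseteq> \<Omega>" for K
  proof -
    obtain c where c: "\<forall>\<phi>\<in>test_fun \<Omega>. supp \<phi> \<subseteq> K \<longrightarrow> (\<forall>n. q n \<phi> \<le> c * Ck_norm 0 \<phi>)"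
      using pK[OF K] by blast
    have "p \<phi> \<le> \<bar>c\<bar> * Ck_norm 0 \<phi>" if "\<phi> \<in> test_fun \<Omega>" "supp \<phi> \<subseteq> K" for \<phi>
      unfolding p_def
    proof (rule sup0_least)
      fix y assume "y \<in> range (\<lambda>n. q n \<phi>)"
      then have "y \<le> c * Ck_norm 0 \<phi>" using c that by auto
      also have "\<dots> \<le> \<bar>c\<bar> * Ck_norm 0 \<phi>" by (intro mult_right_mono Ck_norm_nonneg[OF that(1)]) auto
      finally show "y \<le> \<bar>c\<bar> * Ck_norm 0 \<phi>" .
    qed (simp add: Ck_norm_nonneg[OF that(1)])
    then show ?thesis by blast
  qed
  ultimately have "test_seminorm \<Omega> p" unfolding test_seminorm_def p_def by blast
  then have "bdd_above (p ` B)" using assms(2) unfolding test_bounded_def by simp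
  then obtain M where M: "\<And>\<phi>. \<phi> \<in> B \<Longrightarrow> p \<phi> \<le> M" by (auto simp: bdd_above_def)
  obtain n :: nat where n: "M < real n" using reals_Archimedean2 by blast
  have "real n = q n (\<psi> n)" using \<psi>(3)[of n] by (simp add: q_def)
  also have "\<dots> \<le> p (\<psi> n)"
    unfolding p_def by (rule sup0_upper[OF bdd]) (use \<psi>(1) B in auto)
  also have "\<dots> \<le> M" by (rule M[OF \<psi>(1)])
  finally show False using n by simp
qed

subsection \<open>Integration by parts\<close>

lemma test_fun_integrable:
  assumes "\<phi> \<in> test_fun \<Omega>"
  shows "integrable lborel \<phi>"
proof -
  have "integrable lborel (\<lambda>x. indicator (supp \<phi>) x *\<^sub>R \<phi> x)"
    by (intro borel_integrable_compact test_funD(2)[OF assms]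
        continuous_on_subset[OF smooth_on_continuous[OF test_funD(1)[OF assms]]]) auto
  also have "(\<lambda>x. indicator (supp \<phi>) x *\<^sub>R \<phi> x) = \<phi>"
    by (auto simp: indicator_def not_in_supp)
  finally show ?thesis .
qed

lemma lborel_integral_translate:
  fixes \<phi> :: "'a::euclidean_space \<Rightarrow> complex"
  assumes "integrable lborel \<phi>"
  shows "(\<integral>x. \<phi> (c + x) \<partial>lborel) = (\<integral>x. \<phi> x \<partial>lborel)"
    and "integrable lborel (\<lambda>x. \<phi> (c + x))"
proof -
  have m: "\<phi> \<in> borel_measurable borel" using borel_measurable_integrable[OF assms] by simp
  have "(\<integral>x. \<phi> x \<partial>lborel) = (\<integral>x. \<phi> x \<partial>distr lborel borel ((+) c))" by (simp add: lborel_distr_plus)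
  also have "\<dots> = (\<integral>x. \<phi> (c + x) \<partial>lborel)" by (rule integral_distr) (use m in auto)
  finally show "(\<integral>x. \<phi> (c + x) \<partial>lborel) = (\<integral>x. \<phi> x \<partial>lborel)" by simp
  have "integrable (distr lborel borel ((+) c)) \<phi>" using assms by (simp add: lborel_distr_plus)
  then show "integrable lborel (\<lambda>x. \<phi> (c + x))" by (rule integrable_distr[rotated]) simp
qed

lemma test_fun_deriv:
  assumes "\<phi> \<in> test_fun \<Omega>"
  shows "iter_deriv vs \<phi> \<in> test_fun \<Omega>" "supp (iter_deriv vs \<phi>) \<subseteq> supp \<phi>"
  using test_funD[OF assms] iter_deriv_outside_supp[of _ \<phi> vs]
  by (auto intro!: test_funI[of _ "supp \<phi>"] supp_subsetI closed_supp smooth_on_iter_deriv)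
     (use supp_subsetI[OF closed_supp] in blast)

lemma has_derivative_line:
  assumes "(\<phi> has_derivative D) (at (x + t *\<^sub>R v))"
  shows "((\<lambda>t. \<phi> (x + t *\<^sub>R v)) has_derivative (\<lambda>s. D (s *\<^sub>R v))) (at t)"
proof -
  have "((\<lambda>t. x + t *\<^sub>R v) has_derivative (\<lambda>s. s *\<^sub>R v)) (at t)"
    by (auto intro!: derivative_eq_intros)
  from has_derivative_compose[OF this assms] show ?thesis .
qed

text \<open>Difference quotients have integral 0 by translation invariance, and dominated
  convergence carries this over to the derivative.\<close>

lemma integral_deriv_zero:
  fixes \<phi> :: "'a::euclidean_space \<Rightarrow> complex"
  assumes \<phi>: "\<phi> \<in> test_fun \<Omega>"
  shows "(\<integral>x. frechet_derivative \<phi> (at x) v \<partial>lborel) = 0"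
proof -
  let ?D = "\<lambda>x. frechet_derivative \<phi> (at x)"
  note sm = test_funD(1)[OF \<phi>]
  have D: "(\<phi> has_derivative ?D x) (at x)" for x using smooth_on_D[OF sm] by simp
  have lin: "linear (?D x)" for x using D has_derivative_linear by blast
  have Dt: "(\<lambda>x. ?D x v) \<in> test_fun \<Omega>" using test_fun_deriv(1)[OF \<phi>, of "[v]"] by simp
  obtain R where R: "\<And>x. x \<in> supp \<phi> \<Longrightarrow> norm x \<le> R"
    using compact_imp_bounded[OF test_funD(2)[OF \<phi>]] by (auto simp: bounded_iff)
  obtain B where B: "B \<ge> 0" "\<And>x. norm (?D x v) \<le> B"
  proof
    show "Ck_norm 0 (\<lambda>x. ?D x v) \<ge> 0" by (rule Ck_norm_nonneg[OF Dt])
    show "norm (?D x v) \<le> Ck_norm 0 (\<lambda>x. ?D x v)" for x by (rule norm_le_Ck_norm[OF Dt])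
  qed
  define t where "t n = inverse (real (Suc n))" for n
  have t: "t n > 0" "t n \<le> 1" for n by (auto simp: t_def field_simps)
  define s where "s n x = (\<phi> (t n *\<^sub>R v + x) - \<phi> x) /\<^sub>R t n" for n x
  have int: "integrable lborel \<phi>" by (rule test_fun_integrable[OF \<phi>])
  have s0: "(\<integral>x. s n x \<partial>lborel) = 0" for n
    unfolding s_def using lborel_integral_translate[OF int] int by simp
  have "(\<lambda>n. \<integral>x. s n x \<partial>lborel) \<longlonglongrightarrow> (\<integral>x. ?D x v \<partial>lborel)"
  proof (rule integral_dominated_convergence)
    show "(\<lambda>x. ?D x v) \<in> borel_measurable lborel"
      using borel_measurable_integrable[OF test_fun_integrable[OF Dt]] .
    show "s n \<in> borel_measurable lborel" for n
    proof -
      have "integrable lborel (s n)"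
        unfolding s_def using lborel_integral_translate[OF int] int by simp
      then show ?thesis by (rule borel_measurable_integrable)
    qed
    \<comment> \<open>As t n <= 1, all difference quotients live in the ball of radius R + norm v;
      the mean value inequality bounds them there by B.\<close>
    show "integrable lborel (\<lambda>x. indicator (cball 0 (R + norm v)) x *\<^sub>R B)"
      by (rule borel_integrable_compact) auto
    have "(\<lambda>n. s n x) \<longlonglongrightarrow> ?D x v" for x
    proof -
      have "((\<lambda>h. \<phi> (x + h *\<^sub>R v)) has_vector_derivative ?D x v) (at 0)"
        using has_derivative_line[of \<phi> "?D x" x 0 v] D[of x]
        by (simp add: has_vector_derivative_def linear_scale[OF lin])
      then have "((\<lambda>h. norm (\<phi> (x + h *\<^sub>R v) - \<phi> x - h *\<^sub>R ?D x v) / norm h) \<longlongrightarrow> 0) (at 0)"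
        unfolding has_vector_derivative_def has_derivative_at by simp
      note lim = this
      have "norm (\<phi> (x + h *\<^sub>R v) - \<phi> x - h *\<^sub>R ?D x v) / norm h =
          norm ((\<phi> (x + h *\<^sub>R v) - \<phi> x) /\<^sub>R h - ?D x v)" if "h \<noteq> 0" for h
      proof -
        have "(\<phi> (x + h *\<^sub>R v) - \<phi> x) /\<^sub>R h - ?D x v = (\<phi> (x + h *\<^sub>R v) - \<phi> x - h *\<^sub>R ?D x v) /\<^sub>R h"
          using that by (simp add: scaleR_diff_right)
        then show ?thesis by (simp add: divide_inverse mult.commute)
      qed
      then have ev: "\<forall>\<^sub>F h in at 0. norm (\<phi> (x + h *\<^sub>R v) - \<phi> x - h *\<^sub>R ?D x v) / norm h =
          norm ((\<phi> (x + h *\<^sub>R v) - \<phi> x) /\<^sub>R h - ?D x v)"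
        by (auto simp: eventually_at_filter)
      have "((\<lambda>h. norm ((\<phi> (x + h *\<^sub>R v) - \<phi> x) /\<^sub>R h - ?D x v)) \<longlongrightarrow> 0) (at 0)"
        by (rule Lim_transform_eventually[OF lim ev])
      then have "((\<lambda>h. (\<phi> (x + h *\<^sub>R v) - \<phi> x) /\<^sub>R h - ?D x v) \<longlongrightarrow> 0) (at 0)"
        by (rule tendsto_norm_zero_cancel)
      then have "((\<lambda>h. (\<phi> (x + h *\<^sub>R v) - \<phi> x) /\<^sub>R h) \<longlongrightarrow> ?D x v) (at 0)"
        by (rule LIM_zero_cancel)
      moreover have "filterlim t (at 0) sequentially"
        unfolding filterlim_at t_def using LIMSEQ_inverse_real_of_nat by auto
      ultimately have "(\<lambda>n. (\<phi> (x + t n *\<^sub>R v) - \<phi> x) /\<^sub>R t n) \<longlonglongrightarrow> ?D x v"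
        by (rule filterlim_compose)
      then show ?thesis by (simp add: s_def add.commute)
    qed
    then show "AE x in lborel. (\<lambda>n. s n x) \<longlonglongrightarrow> ?D x v" by simp
    have "norm (s n x) \<le> indicator (cball 0 (R + norm v)) x *\<^sub>R B" for n x
    proof (cases "x \<in> cball 0 (R + norm v)")
      case True
      have "\<exists>h\<in>{0<..<t n}. norm (\<phi> (x + t n *\<^sub>R v) - \<phi> (x + 0 *\<^sub>R v)) \<le> norm (?D (x + h *\<^sub>R v) ((t n - 0) *\<^sub>R v))"
      proof (rule mvt_general[OF t(1)])
        show "continuous_on {0..t n} (\<lambda>h. \<phi> (x + h *\<^sub>R v))"
          by (rule continuous_on_compose2[OF smooth_on_continuous[OF sm]])
             (simp_all add: continuous_on_add continuous_on_scaleR)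
      qed (intro has_derivative_line D)
      then obtain h where "norm (\<phi> (x + t n *\<^sub>R v) - \<phi> x) \<le> t n * norm (?D (x + h *\<^sub>R v) v)"
        using t(1)[of n] by (auto simp: linear_scale[OF lin])
      also have "\<dots> \<le> t n * B" using B t(1)[of n] by (intro mult_left_mono) auto
      finally have "norm (\<phi> (x + t n *\<^sub>R v) - \<phi> x) / t n \<le> B"
        using t(1)[of n] by (simp add: pos_divide_le_eq mult.commute)
      moreover have "norm (s n x) = norm (\<phi> (x + t n *\<^sub>R v) - \<phi> x) / t n"
        using t(1)[of n] by (simp add: s_def add.commute divide_inverse mult.commute)
      ultimately have "norm (s n x) \<le> B" by simp
      then show ?thesis using True by simp
    next
      case False
      then have nx: "norm x > R + norm v" by auto
      have "norm (t n *\<^sub>R v) \<le> norm v" using t[of n] by (simp add: mult_left_le_one_le)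
      then have "norm (t n *\<^sub>R v + x) > R" using nx norm_triangle_ineq4[of "t n *\<^sub>R v + x" "t n *\<^sub>R v"] by simp
      then have "\<phi> (t n *\<^sub>R v + x) = 0" using R by (intro not_in_supp) force
      moreover have "\<phi> x = 0" using R nx by (intro not_in_supp) (smt (verit) norm_ge_zero)
      ultimately show ?thesis using False by (simp add: s_def)
    qed
    then show "AE x in lborel. norm (s n x) \<le> indicator (cball 0 (R + norm v)) x *\<^sub>R B" for n by simp
  qed
  then have "(\<lambda>n::nat. 0::complex) \<longlonglongrightarrow> (\<integral>x. ?D x v \<partial>lborel)" by (simp add: s0)
  then show ?thesis by (simp add: LIMSEQ_const_iff)
qed

subsection \<open>Fourier series\<close>

definition cube :: "real \<Rightarrow> 'a::euclidean_space set" where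
  "cube L = {x. \<forall>b\<in>Basis. \<bar>x \<bullet> b\<bar> \<le> pi * L}"

text \<open>Opposite faces of the closed cube are congruent modulo the periods. At interior points
  no other point of the closed cube is, which is what uniqueness of Fourier coefficients
  needs.\<close>

definition icube :: "real \<Rightarrow> 'a::euclidean_space set" where
  "icube L = {x. \<forall>b\<in>Basis. \<bar>x \<bullet> b\<bar> < pi * L}"

text \<open>The frequencies of the exponentials with period 2 pi L in each coordinate, that is, the
  integer lattice divided by L; \<open>cube L\<close> is a period cell.\<close>

definition lattice :: "real \<Rightarrow> 'a::euclidean_space set" where
  "lattice L = {k. \<forall>b\<in>Basis. L * (k \<bullet> b) \<in> \<int>}"

lemma icube_subset: "icube L \<subseteq> cube L"
  unfolding cube_def icube_def by (auto simp: less_imp_le)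

lemma cube_cbox: "cube L = cbox (- (pi * L) *\<^sub>R One) ((pi * L) *\<^sub>R (One::'a::euclidean_space))"
proof -
  have "\<bar>x \<bullet> b\<bar> \<le> pi * L \<longleftrightarrow> - (pi * L) \<le> x \<bullet> b \<and> x \<bullet> b \<le> pi * L" for x b :: 'a by linarith
  then show ?thesis unfolding cube_def by (auto simp: mem_box)
qed

lemma icube_box: "icube L = box (- (pi * L) *\<^sub>R One) ((pi * L) *\<^sub>R (One::'a::euclidean_space))"
proof -
  have "\<bar>x \<bullet> b\<bar> < pi * L \<longleftrightarrow> - (pi * L) < x \<bullet> b \<and> x \<bullet> b < pi * L" for x b :: 'a by linarith
  then show ?thesis unfolding icube_def by (auto simp: mem_box)
qed

lemma compact_cube: "compact (cube L)" and open_icube: "open (icube L)"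
  unfolding cube_cbox icube_box by (auto intro: compact_cbox open_box)

lemma bounded_subset_icube:
  fixes S :: "'a::euclidean_space set"
  assumes "bounded S"
  obtains L where "L \<ge> 1" "S \<subseteq> icube L"
proof -
  obtain R where R: "\<And>x. x \<in> S \<Longrightarrow> norm x \<le> R" using assms by (auto simp: bounded_iff)
  show thesis
  proof
    show "max 1 R \<ge> 1" by simp
    show "S \<subseteq> icube (max 1 R)"
    proof
      fix x assume "x \<in> S"
      have "\<bar>x \<bullet> b\<bar> < pi * max 1 R" if b: "b \<in> Basis" for b
      proof -
        have "\<bar>x \<bullet> b\<bar> \<le> max 1 R" using Basis_le_norm[OF b, of x] R[OF \<open>x \<in> S\<close>] by simp
        also have "\<dots> < pi * max 1 R" using pi_gt3 by (simp add: mult_less_cancel_right1)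
        finally show ?thesis .
      qed
      then show "x \<in> icube (max 1 R)" by (simp add: icube_def)
    qed
  qed
qed

lemma lattice_add: "k \<in> lattice L \<Longrightarrow> l \<in> lattice L \<Longrightarrow> k + l \<in> lattice L"
  unfolding lattice_def by (auto simp: inner_add_left distrib_left)

lemma lattice_uminus: "k \<in> lattice L \<Longrightarrow> - k \<in> lattice L"
  unfolding lattice_def by (auto intro: Ints_minus)

lemma zero_lattice: "0 \<in> lattice L"
  unfolding lattice_def by auto

lemma Basis_lattice: "L > 0 \<Longrightarrow> b \<in> Basis \<Longrightarrow> (1 / L) *\<^sub>R b \<in> lattice L"
  unfolding lattice_def by (auto simp: inner_Basis)

section \<open>Orthogonality of the exponentials on the cube\<close>

lemma lborel_integral_prod:
  fixes g :: "'a::euclidean_space \<Rightarrow> real \<Rightarrow> complex"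
  assumes "\<And>b. b \<in> Basis \<Longrightarrow> integrable lborel (g b)"
  shows "(\<integral>x. (\<Prod>b\<in>Basis. g b (x \<bullet> b)) \<partial>lborel) = (\<Prod>b\<in>Basis. integral\<^sup>L lborel (g b))"
proof -
  interpret product_sigma_finite "\<lambda>b::'a. lborel :: real measure" by standard
  have m: "g b \<in> borel_measurable borel" if "b \<in> Basis" for b
    using borel_measurable_integrable[OF assms[OF that]] by simp
  have "(\<integral>x. (\<Prod>b\<in>Basis. g b (x \<bullet> b)) \<partial>lborel) =
      (\<integral>x. (\<Prod>b\<in>Basis. g b (x \<bullet> b)) \<partial>distr (\<Pi>\<^sub>M b\<in>Basis. lborel) borel (\<lambda>f. \<Sum>b\<in>Basis. f b *\<^sub>R (b::'a)))"
    by (subst lborel_eq) simp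
  also have "\<dots> = (\<integral>f. (\<Prod>b\<in>Basis. g b ((\<Sum>b\<in>Basis. f b *\<^sub>R b) \<bullet> (b::'a))) \<partial>(\<Pi>\<^sub>M b\<in>Basis. lborel))"
    by (rule integral_distr) (use m in measurable)
  also have "\<dots> = (\<integral>f. (\<Prod>b\<in>Basis. g b (f b)) \<partial>(\<Pi>\<^sub>M b\<in>(Basis::'a set). lborel))"
    by (intro Bochner_Integration.integral_cong prod.cong refl) simp
  also have "\<dots> = (\<Prod>b\<in>Basis. integral\<^sup>L lborel (g b))"
    by (rule product_integral_prod) (use assms in auto)
  finally show ?thesis .
qed

text \<open>The antiderivative takes equal values at both ends, because the phase changes by 2 pi
  times the integer L * c.\<close>

lemma integral_exp_interval:
  fixes c L :: real
  assumes "c \<noteq> 0" "L * c \<in> \<int>" "L > 0"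
  shows "(\<integral>t. indicator {- (pi * L)..pi * L} t *\<^sub>R exp (- \<i> * of_real (c * t)) \<partial>lborel) = 0"
proof -
  let ?F = "\<lambda>t. exp (- \<i> * of_real (c * t)) / (- \<i> * of_real c)"
  obtain m where m: "L * c = of_int m" using assms(2) Ints_cases by blast
  have "(\<integral>t. indicator {- (pi * L)..pi * L} t *\<^sub>R exp (- \<i> * of_real (c * t)) \<partial>lborel) =
      ?F (pi * L) - ?F (- (pi * L))"
  proof (rule integral_FTC_atLeastAtMost)
    show "- (pi * L) \<le> pi * L" using assms by simp
    show "continuous_on {- (pi * L)..pi * L} (\<lambda>t. exp (- \<i> * of_real (c * t)))"
      by (intro continuous_intros)
    fix t
    have "((\<lambda>t. exp (- \<i> * of_real (c * t))) has_vector_derivative (- \<i> * of_real c) * exp (- \<i> * of_real (c * t))) (at t)"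
    proof -
      have "((\<lambda>t. - \<i> * of_real (c * t)) has_derivative (\<lambda>s. - \<i> * of_real (c * s))) (at t)"
        by (intro derivative_eq_intros) auto
      from has_derivative_compose[OF this DERIV_exp[unfolded has_field_derivative_def]] show ?thesis
        by (simp add: has_vector_derivative_def mult_ac scaleR_conv_of_real)
    qed
    then have "(?F has_vector_derivative (- \<i> * of_real c) * exp (- \<i> * of_real (c * t)) / (- \<i> * of_real c)) (at t)"
      by (rule has_vector_derivative_divide)
    then show "(?F has_vector_derivative exp (- \<i> * of_real (c * t))) (at t within {- (pi * L)..pi * L})"
      using assms(1) by (auto intro: has_vector_derivative_at_within)
  qed
  also have "exp (- \<i> * of_real (c * (pi * L))) = exp (- \<i> * of_real (c * - (pi * L)))"
  proof -
    have e: "c * (pi * L) = pi * of_int m" "c * - (pi * L) = - (pi * of_int m)"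
      using m by (simp_all add: algebra_simps)
    have "exp (- \<i> * of_real (pi * of_int m)) = exp (\<i> * of_real (pi * of_int m))"
      unfolding exp_eq by (intro exI[of _ "- m"]) (simp add: algebra_simps)
    then show ?thesis unfolding e by simp
  qed
  finally show ?thesis by simp
qed

lemma integral_cube_expi:
  fixes k :: "'a::euclidean_space"
  assumes "k \<in> lattice L" "L > 0"
  shows "(\<integral>x. indicator (cube L) x *\<^sub>R expi k x \<partial>lborel) = (if k = 0 then of_real (measure lborel (cube L :: 'a set)) else 0)"
proof (cases "k = 0")
  case True
  have "(\<integral>x. indicator (cube L :: 'a set) x *\<^sub>R (1::complex) \<partial>lborel) = measure lborel (cube L :: 'a set) *\<^sub>R 1"
    unfolding cube_cbox by (subst integral_scaleR_left) (simp_all add: emeasure_lborel_cbox_eq)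
  then show ?thesis using True by (simp add: expi_def scaleR_conv_of_real)
next
  case False
  define g where "g b t = indicator {- (pi * L)..pi * L} t *\<^sub>R exp (- \<i> * of_real ((k \<bullet> b) * t))" for b t
  obtain b where b: "b \<in> Basis" "k \<bullet> b \<noteq> 0" using False euclidean_all_zero_iff by blast
  have "indicator (cube L) x *\<^sub>R expi k x = (\<Prod>b\<in>Basis. g b (x \<bullet> b))" for x
  proof -
    have "expi k x = (\<Prod>b\<in>Basis. exp (- \<i> * of_real ((k \<bullet> b) * (x \<bullet> b))))"
      unfolding expi_def euclidean_inner[of k x] by (simp add: sum_distrib_left exp_sum[symmetric])
    moreover have "indicator (cube L) x = (\<Prod>b\<in>Basis. indicator {- (pi * L)..pi * L} (x \<bullet> b) :: real)"
    proof (cases "x \<in> cube L")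
      case True
      then have "x \<bullet> b \<in> {- (pi * L)..pi * L}" if "b \<in> Basis" for b
        using that by (auto simp: cube_def abs_le_iff minus_le_iff)
      then show ?thesis using True by simp
    next
      case False
      then obtain b where "b \<in> Basis" "\<not> \<bar>x \<bullet> b\<bar> \<le> pi * L" by (auto simp: cube_def)
      then have "\<exists>b\<in>Basis. indicator {- (pi * L)..pi * L} (x \<bullet> b) = (0::real)"
        by (intro bexI[of _ b]) (auto simp: indicator_def)
      then show ?thesis using False by simp
    qed
    ultimately show ?thesis
      unfolding g_def by (simp add: scaleR_conv_of_real prod.distrib)
  qed
  then have "(\<integral>x. indicator (cube L) x *\<^sub>R expi k x \<partial>lborel) = (\<integral>x. (\<Prod>b\<in>Basis. g b (x \<bullet> b)) \<partial>lborel)" by simp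
  also have "\<dots> = (\<Prod>b\<in>Basis. integral\<^sup>L lborel (g b))"
    by (rule lborel_integral_prod) (auto simp: g_def[abs_def] intro!: borel_integrable_compact continuous_intros)
  also have "integral\<^sup>L lborel (g b) = 0"
    unfolding g_def[abs_def] using b assms by (intro integral_exp_interval) (auto simp: lattice_def)
  then have "(\<Prod>b\<in>Basis. integral\<^sup>L lborel (g b)) = 0" using b(1) by (intro prod_zero) auto
  finally show ?thesis using False by simp
qed

lemma integral_cube_mult:
  fixes f :: "'a::euclidean_space \<Rightarrow> 'b::{banach, second_countable_topology}"
  assumes "continuous_on (cube L) f"
  shows "integrable lborel (\<lambda>x. indicator (cube L) x *\<^sub>R f x)"
  by (rule borel_integrable_compact[OF compact_cube assms])

section \<open>Uniqueness of Fourier coefficients\<close>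

lemma expi_cos:
  "of_real (cos (t \<bullet> (x - x0))) = (expi t x * expi (- t) x0 + expi (- t) x * expi t x0) / 2"
  unfolding expi_def exp_add[symmetric]
  by (simp add: cos_of_real[symmetric] cos_exp_eq inner_diff_right algebra_simps)

text \<open>A continuous function on the cube that is orthogonal to all exponentials is orthogonal to
  all powers of the trigonometric polynomial \<open>q\<close>, which has a strict maximum at \<open>x0\<close>.\<close>

lemma fourier_unique:
  fixes h :: "'a::euclidean_space \<Rightarrow> complex"
  assumes h: "continuous_on (cube L) h" and L: "L > 0"
    and orth: "\<And>k. k \<in> lattice L \<Longrightarrow> (\<integral>x. indicator (cube L) x *\<^sub>R (h x * expi k x) \<partial>lborel) = 0"
    and x0: "x0 \<in> icube L"
  shows "h x0 = 0"
proof (rule ccontr)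
  assume nz: "h x0 \<noteq> 0"
  define d where "d = real DIM('a)"
  have d: "d > 0" by (simp add: d_def)
  \<comment> \<open>The average over the coordinates of (1 + cos) / 2, each cosine having period 2
    pi L. Hence q lies between 0 and 1, and q x = 1 forces every coordinate of x - x0 to be a
    multiple of the period.\<close>
  define q where "q x = (\<Sum>b\<in>Basis. (1 + cos (((1 / L) *\<^sub>R b) \<bullet> (x - x0))) / 2) / d" for x
  have q01: "0 \<le> q x" "q x \<le> 1" for x
  proof -
    have c: "0 \<le> (1 + cos (((1 / L) *\<^sub>R b) \<bullet> (x - x0))) / 2" "(1 + cos (((1 / L) *\<^sub>R b) \<bullet> (x - x0))) / 2 \<le> 1" for b
      using cos_ge_minus_one[of "((1 / L) *\<^sub>R b) \<bullet> (x - x0)"] cos_le_one[of "((1 / L) *\<^sub>R b) \<bullet> (x - x0)"] by (simp_all del: cos_ge_minus_one cos_le_one)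
    show "0 \<le> q x" unfolding q_def using d c(1) by (intro divide_nonneg_pos sum_nonneg) auto
    have "(\<Sum>b\<in>Basis. (1 + cos (((1 / L) *\<^sub>R b) \<bullet> (x - x0))) / 2) \<le> (\<Sum>b\<in>(Basis::'a set). 1)"
      by (intro sum_mono c(2))
    then show "q x \<le> 1" unfolding q_def using d by (simp add: d_def)
  qed
  have qx0: "q x0 = 1" unfolding q_def using d by (simp add: d_def)
  have qlt: "q x < 1" if x: "x \<in> cube L" "x \<noteq> x0" for x
  proof -
    obtain b where b: "b \<in> Basis" "(x - x0) \<bullet> b \<noteq> 0"
      using x(2) euclidean_all_zero_iff[of "x - x0"] by auto
    let ?t = "((1 / L) *\<^sub>R b) \<bullet> (x - x0)"
    \<comment> \<open>x0 is interior, so the coordinates differ by strictly less than one period and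
      the cosine cannot return to 1.\<close>
    have "\<bar>x \<bullet> b\<bar> \<le> pi * L" "\<bar>x0 \<bullet> b\<bar> < pi * L" using x(1) x0 b(1) by (auto simp: cube_def icube_def)
    then have "\<bar>(x - x0) \<bullet> b\<bar> < 2 * pi * L" by (simp add: inner_diff_left)
    then have "\<bar>?t\<bar> < 2 * pi" using L by (simp add: inner_commute abs_mult field_simps)
    moreover have "?t \<noteq> 0" using b L by (simp add: inner_commute)
    ultimately have "cos ?t \<noteq> 1"
    proof (intro notI)
      assume a: "\<bar>?t\<bar> < 2 * pi" "?t \<noteq> 0" "cos ?t = 1"
      then obtain n :: int where n: "?t = of_int n * 2 * pi" using cos_one_2pi_int[of ?t] by blast
      have "n \<noteq> 0" using a(2) n by auto
      then have "1 \<le> \<bar>real_of_int n\<bar>" by linarith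
      then have "2 * pi \<le> \<bar>real_of_int n\<bar> * (2 * pi)" by simp
      then show False using a(1) unfolding n by (simp add: abs_mult)
    qed
    then have "(1 + cos ?t) / 2 < 1" using cos_le_one[of ?t] by (simp add: less_le del: cos_le_one)
    moreover have "(1 + cos (((1 / L) *\<^sub>R b) \<bullet> (x - x0))) / 2 \<le> 1" for b
      using cos_le_one[of "((1 / L) *\<^sub>R b) \<bullet> (x - x0)"] by simp
    ultimately have "(\<Sum>b\<in>Basis. (1 + cos (((1 / L) *\<^sub>R b) \<bullet> (x - x0))) / 2) < (\<Sum>b\<in>(Basis::'a set). 1)"
      using b(1) by (intro sum_strict_mono_ex1) auto
    then show ?thesis unfolding q_def using d by (simp add: d_def)
  qed
  have qcont: "continuous_on S q" for S unfolding q_def using d by (intro continuous_intros) auto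
  \<comment> \<open>Multiplication by q sends \<open>expi k\<close> to a combination of
    \<open>expi k\<close> and its shifts by \<plusminus> b / L, all with frequencies in the lattice;
    hence the induction on N for all k together.\<close>
  have orthq: "(\<integral>x. indicator (cube L) x *\<^sub>R (h x * of_real (q x) ^ N * expi k x) \<partial>lborel) = 0"
    if "k \<in> lattice L" for N k
    using that
  proof (induction N arbitrary: k)
    case (Suc N)
    let ?g = "\<lambda>k x. indicator (cube L) x *\<^sub>R (h x * of_real (q x) ^ N * expi k x)"
    have cont: "continuous_on (cube L) (\<lambda>x. h x * of_real (q x) ^ N * expi k x)" for k
      by (intro continuous_intros h qcont smooth_on_continuous smooth_on_mono[OF smooth_on_expi[OF open_UNIV]]) auto
    have ig: "integrable lborel (?g k)" for k by (rule integral_cube_mult[OF cont])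
    have "of_real (q x) = (\<Sum>b\<in>Basis. 1 / (2 * of_real d) + expi (- ((1 / L) *\<^sub>R b)) x0 / (4 * of_real d) * expi ((1 / L) *\<^sub>R b) x
         + expi ((1 / L) *\<^sub>R b) x0 / (4 * of_real d) * expi (- ((1 / L) *\<^sub>R b)) x)" for x
      unfolding q_def of_real_divide of_real_sum of_real_add expi_cos sum_divide_distrib
      by (intro sum.cong refl) (use d in \<open>simp add: field_simps\<close>)
    moreover have e: "expi k x * expi l x = expi (k + l) x" for k l x :: 'a
      unfolding expi_def by (simp add: exp_add[symmetric] inner_add_left algebra_simps)
    ultimately have eq: "indicator (cube L) x *\<^sub>R (h x * of_real (q x) ^ Suc N * expi k x) =
       (\<Sum>b\<in>Basis. 1 / (2 * of_real d) * ?g k x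
         + expi (- ((1 / L) *\<^sub>R b)) x0 / (4 * of_real d) * ?g (k + (1 / L) *\<^sub>R b) x
         + expi ((1 / L) *\<^sub>R b) x0 / (4 * of_real d) * ?g (k + - ((1 / L) *\<^sub>R b)) x)" for x
    proof -
      assume Q: "\<And>x. of_real (q x) = (\<Sum>b\<in>Basis. 1 / (2 * of_real d) + expi (- ((1 / L) *\<^sub>R b)) x0 / (4 * of_real d) * expi ((1 / L) *\<^sub>R b) x
         + expi ((1 / L) *\<^sub>R b) x0 / (4 * of_real d) * expi (- ((1 / L) *\<^sub>R b)) x)"
      have "indicator (cube L) x *\<^sub>R (h x * of_real (q x) ^ Suc N * expi k x) = of_real (q x) * ?g k x"
        by simp
      also have "\<dots> = (\<Sum>b\<in>Basis. (1 / (2 * of_real d) + expi (- ((1 / L) *\<^sub>R b)) x0 / (4 * of_real d) * expi ((1 / L) *\<^sub>R b) x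
         + expi ((1 / L) *\<^sub>R b) x0 / (4 * of_real d) * expi (- ((1 / L) *\<^sub>R b)) x) * ?g k x)"
        unfolding Q sum_distrib_right ..
      also have "\<dots> = (\<Sum>b\<in>Basis. 1 / (2 * of_real d) * ?g k x
         + expi (- ((1 / L) *\<^sub>R b)) x0 / (4 * of_real d) * ?g (k + (1 / L) *\<^sub>R b) x
         + expi ((1 / L) *\<^sub>R b) x0 / (4 * of_real d) * ?g (k + - ((1 / L) *\<^sub>R b)) x)"
        unfolding e[symmetric] by (intro sum.cong refl) (simp only: scaleR_conv_of_real distrib_right distrib_left mult_ac)
      finally show ?thesis .
    qed
    have lat: "k + (1 / L) *\<^sub>R b \<in> lattice L" "k + - ((1 / L) *\<^sub>R b) \<in> lattice L" if "b \<in> Basis" for b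
      using Suc.prems Basis_lattice[OF L that] lattice_add lattice_uminus by blast+
    have lin: "integrable lborel (\<lambda>x. \<alpha> * f x + \<beta> * g x + \<gamma> * w x) \<and>
        (\<integral>x. \<alpha> * f x + \<beta> * g x + \<gamma> * w x \<partial>lborel) = 0"
      if "integrable lborel f" "integrable lborel g" "integrable lborel w"
        "integral\<^sup>L lborel f = 0" "integral\<^sup>L lborel g = 0" "integral\<^sup>L lborel w = 0"
      for \<alpha> \<beta> \<gamma> and f g w :: "'a \<Rightarrow> complex"
      using that by simp
    show ?case
      unfolding eq
    proof (subst Bochner_Integration.integral_sum, goal_cases)
      case (1 b)
      then show ?case
        by (intro conjunct1[OF lin] ig Suc.IH Suc.prems lat)
    next
      case 2
      show ?case
        by (intro sum.neutral ballI conjunct2[OF lin] ig Suc.IH Suc.prems lat)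
    qed
  qed (use orth in simp)
  \<comment> \<open>The factor \<open>cnj (h x0)\<close> rotates h so that g x0 is the squared
    modulus of h x0; by continuity g exceeds half of this value near x0.\<close>
  define g where "g x = Re (cnj (h x0) * h x)" for x
  have gcont: "continuous_on (cube L) g" unfolding g_def by (intro continuous_intros h)
  have gq: "(\<integral>x. indicator (cube L) x * (g x * q x ^ N) \<partial>lborel) = 0" for N
  proof -
    let ?f = "\<lambda>x. indicator (cube L) x *\<^sub>R (h x * of_real (q x) ^ N * expi 0 x)"
    have i: "integrable lborel ?f"
      by (rule integral_cube_mult) (intro continuous_intros h qcont smooth_on_continuous smooth_on_expi[OF open_UNIV] smooth_on_mono[OF smooth_on_expi[OF open_UNIV]]; simp)
    have "(\<integral>x. indicator (cube L) x * (g x * q x ^ N) \<partial>lborel) = (\<integral>x. Re (cnj (h x0) * ?f x) \<partial>lborel)"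
      by (intro Bochner_Integration.integral_cong refl)
         (simp add: g_def expi_def indicator_def algebra_simps flip: of_real_power)
    also have "\<dots> = Re (\<integral>x. cnj (h x0) * ?f x \<partial>lborel)"
      by (rule integral_Re) (rule integrable_mult_right[OF i])
    also have "(\<integral>x. cnj (h x0) * ?f x \<partial>lborel) = cnj (h x0) * (\<integral>x. ?f x \<partial>lborel)"
      by (rule integral_mult_right_zero)
    finally show ?thesis using orthq[OF zero_lattice, of N] by simp
  qed
  define c where "c = g x0 / 2"
  have c: "c > 0" using nz by (simp add: c_def g_def complex_mult_cnj[symmetric] mult.commute cmod_power2[symmetric] flip: complex_norm_square)
  have x0c: "x0 \<in> cube L" using x0 icube_subset by blast
  have "continuous_on (icube L) g" by (rule continuous_on_subset[OF gcont icube_subset])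
  then have "open ({x \<in> icube L. g x > c})"
    using continuous_open_preimage[OF _ open_icube open_greaterThan, of L g c] by (simp add: vimage_def Int_def)
  moreover have "x0 \<in> {x \<in> icube L. g x > c}" using x0 c by (simp add: c_def)
  ultimately obtain \<delta> where \<delta>: "\<delta> > 0" "ball x0 \<delta> \<subseteq> {x \<in> icube L. g x > c}" by (auto elim: openE)
  have cK: "compact (cube L - ball x0 \<delta>)" by (intro compact_diff compact_cube open_ball)
  obtain s where s: "0 \<le> s" "s < 1" "\<And>x. x \<in> cube L - ball x0 \<delta> \<Longrightarrow> q x \<le> s"
  proof (cases "cube L - ball x0 \<delta> = {}")
    case True
    show thesis by (rule that[of 0]) (use True in auto)
  next
    case False
    obtain y where "y \<in> cube L - ball x0 \<delta>" "\<And>x. x \<in> cube L - ball x0 \<delta> \<Longrightarrow> q x \<le> q y"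
      using continuous_attains_sup[OF cK False qcont] by blast
    note y = this
    have "y \<noteq> x0" using y(1) \<delta>(1) by auto
    then have "q y < 1" using qlt[of y] y(1) by simp
    then show thesis using that[of "q y"] q01(1)[of y] y(2) by blast
  qed
  \<comment> \<open>Strictly between the bound s of q away from x0 and the value 1 at x0, so that
    r^N outgrows s^N.\<close>
  define r where "r = (1 + s) / 2"
  have r: "s < r" "r < 1" "0 < r" using s by (auto simp: r_def)
  have "open ({x \<in> ball x0 \<delta>. q x > r})"
    using continuous_open_preimage[OF qcont open_ball open_greaterThan, of x0 \<delta> r] by (simp add: vimage_def Int_def)
  moreover have "x0 \<in> {x \<in> ball x0 \<delta>. q x > r}" using qx0 r \<delta> by simp
  ultimately obtain \<eta> where \<eta>: "\<eta> > 0" "ball x0 \<eta> \<subseteq> {x \<in> ball x0 \<delta>. q x > r}" by (rule openE)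
  obtain M where M: "M > 0" "\<And>x. x \<in> cube L \<Longrightarrow> norm (g x) \<le> M"
    using continuous_compact_bound[OF gcont compact_cube subset_refl] by blast
  let ?b = "measure lborel (ball x0 \<eta>)" and ?v = "measure lborel (cube L :: 'a set)"
  have bpos: "?b > 0" using \<eta>(1) content_ball_pos by simp
  \<comment> \<open>The integral of g * q^N is 0. Near x0 it gains at least c * r^N on the small
    ball, elsewhere it loses at most M * s^N per unit volume.\<close>
  have key: "c * r ^ N * ?b \<le> M * s ^ N * ?v" for N
  proof -
    have pw: "indicator (ball x0 \<eta>) x * (c * r ^ N) - indicator (cube L) x * (M * s ^ N) \<le> indicator (cube L) x * (g x * q x ^ N)" for x
    proof (cases "x \<in> cube L")
      case True
      show ?thesis
      proof (cases "x \<in> ball x0 \<delta>")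
        case False
        then have "x \<notin> ball x0 \<eta>" using \<eta> by blast
        moreover have "- (M * s ^ N) \<le> g x * q x ^ N"
        proof -
          have "\<bar>g x * q x ^ N\<bar> \<le> M * s ^ N"
            unfolding abs_mult using M(2)[OF True] s(3)[of x] True False q01[of x] s(1)
            by (intro mult_mono) (auto intro: power_mono)
          then show ?thesis by linarith
        qed
        ultimately show ?thesis using True by simp
      next
        case in\<delta>: True
        then have gc: "g x > c" using \<delta> by auto
        show ?thesis
        proof (cases "x \<in> ball x0 \<eta>")
          case True
          then have "q x > r" using \<eta> by auto
          then have "c * r ^ N \<le> g x * q x ^ N" using gc c r by (intro mult_mono power_mono) auto
          moreover have "0 \<le> M * s ^ N" using M s by simp
          ultimately show ?thesis using True \<open>x \<in> cube L\<close> by simp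
        next
          case False
          have "0 \<le> M * s ^ N" "0 \<le> g x * q x ^ N" using M s gc c q01[of x] by auto
          then show ?thesis using False \<open>x \<in> cube L\<close> by simp
        qed
      qed
    next
      case False
      then have "x \<notin> ball x0 \<eta>" using \<eta> \<delta> icube_subset by blast
      then show ?thesis using False by simp
    qed
    have i1: "integrable lborel (\<lambda>x. indicator (ball x0 \<eta>) x * (c * r ^ N) :: real)"
      by (intro integrable_mult_left integrable_real_indicator) (use emeasure_bounded_finite[OF bounded_ball, of x0 \<eta>] in auto)
    have i2: "integrable lborel (\<lambda>x. indicator (cube L) x * (M * s ^ N) :: real)"
      using integral_cube_mult[of L "\<lambda>x. M * s ^ N"] by (simp add: continuous_on_const)
    have i3: "integrable lborel (\<lambda>x. indicator (cube L) x * (g x * q x ^ N))"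
      using integral_cube_mult[of L "\<lambda>x. g x * q x ^ N"] gcont qcont by (simp add: continuous_on_mult continuous_on_power)
    have "(\<integral>x. indicator (ball x0 \<eta>) x * (c * r ^ N) - indicator (cube L) x * (M * s ^ N) \<partial>lborel) \<le>
        (\<integral>x. indicator (cube L) x * (g x * q x ^ N) \<partial>lborel)"
      by (rule integral_mono[OF Bochner_Integration.integrable_diff[OF i1 i2] i3 pw])
    then have "(\<integral>x. indicator (ball x0 \<eta>) x * (c * r ^ N) \<partial>lborel) - (\<integral>x. indicator (cube L :: 'a set) x * (M * s ^ N) \<partial>lborel) \<le> 0"
      using gq[of N] Bochner_Integration.integral_diff[OF i1 i2] by simp
    then show ?thesis by (simp add: cube_cbox algebra_simps)
  qed
  have "(\<lambda>N. (s / r) ^ N) \<longlonglongrightarrow> 0" using r s by (intro LIMSEQ_power_zero) simp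
  then have "(\<lambda>N. M * ?v * (s / r) ^ N) \<longlonglongrightarrow> M * ?v * 0" by (rule tendsto_mult_left)
  moreover have "c * ?b \<le> M * ?v * (s / r) ^ N" for N
    using key[of N] r by (simp add: power_divide field_simps)
  ultimately have "c * ?b \<le> 0" by (intro LIMSEQ_le_const[of "\<lambda>N. M * ?v * (s / r) ^ N"]) auto
  then show False using c bpos by (simp add: mult_le_0_iff)
qed

text \<open>The exponent is twice the dimension, so that the weight splits into one factor (1 + norm
  k)^(-2) per coordinate, each summable in that coordinate.\<close>

definition weight :: "'a::euclidean_space \<Rightarrow> real" where
  "weight k = inverse ((1 + norm k) ^ (2 * DIM('a)))"

lemma weight_pos: "weight k > 0"
  unfolding weight_def by (simp add: add_pos_nonneg)

text \<open>The right side is made to telescope: equality holds at M = 0, and the two new terms 2 /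
  (1 + m^2) with m = M + 1 are at most 4 / (m (m + 1)) = 4 / m - 4 / (m + 1).\<close>

lemma sum_inverse_squares_int:
  "(\<Sum>j\<in>{- int M..int M}. 1 / (1 + (real_of_int j)\<^sup>2)) \<le> 5 - 4 / (real M + 1)"
proof (induction M)
  case (Suc M)
  have "{- int (Suc M)..int (Suc M)} = insert (int (Suc M)) (insert (- int (Suc M)) {- int M..int M})" by auto
  then have "(\<Sum>j\<in>{- int (Suc M)..int (Suc M)}. 1 / (1 + (real_of_int j)\<^sup>2)) =
      2 / (1 + (real M + 1)\<^sup>2) + (\<Sum>j\<in>{- int M..int M}. 1 / (1 + (real_of_int j)\<^sup>2))"
    by (simp add: add.commute power2_eq_square algebra_simps)
  also have "\<dots> \<le> 2 / (1 + (real M + 1)\<^sup>2) + (5 - 4 / (real M + 1))" using Suc.IH by simp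
  also have "2 / (1 + (real M + 1)\<^sup>2) \<le> 4 / ((real M + 1) * (real M + 2))"
    by (simp add: divide_simps power2_eq_square) (simp add: algebra_simps add_pos_nonneg)
  also have "4 / ((real M + 1) * (real M + 2)) = 4 / (real M + 1) - 4 / (real M + 2)"
    by (simp add: field_simps)
  finally show ?case by (simp add: add.commute)
qed simp

text \<open>A finite part of the lattice is embedded by its integer coordinates in a box. There the
  weight is at most a product of functions of one coordinate, and the sum of products over the box
  is a product of sums.\<close>

lemma weight_summable:
  fixes L :: real
  assumes L: "L \<ge> 1"
  shows "(weight :: 'a::euclidean_space \<Rightarrow> real) summable_on lattice L"
proof (rule nonneg_bdd_above_summable_on)
  show "weight k \<ge> 0" for k :: 'a using weight_pos[of k] by simp
  \<comment> \<open>The factor L^2 comes from 1 + L^2 t^2 <= L^2 (1 + t^2), which uses L >=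
    1.\<close>
  define h where "h j = L\<^sup>2 * (1 / (1 + (real_of_int j)\<^sup>2))" for j
  have h0: "h j \<ge> 0" for j by (simp add: h_def)
  show "bdd_above (sum weight ` {F. F \<subseteq> (lattice L :: 'a set) \<and> finite F})"
  proof (rule bdd_aboveI2)
    fix F assume "F \<in> {F. F \<subseteq> (lattice L :: 'a set) \<and> finite F}"
    then have F: "F \<subseteq> lattice L" "finite F" by auto
    define g where "g k = restrict (\<lambda>b. \<lfloor>L * (k \<bullet> b)\<rfloor>) Basis" for k :: 'a
    have g: "real_of_int (g k b) = L * (k \<bullet> b)" if "k \<in> F" "b \<in> Basis" for k b
    proof -
      have "L * (k \<bullet> b) \<in> \<int>" using that F by (auto simp: lattice_def)
      then show ?thesis using that by (simp add: g_def)
    qed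
    \<comment> \<open>A crude size of the box: the sum over F bounds each of its terms, and so all
      integer coordinates.\<close>
    define M where "M = nat \<lceil>\<Sum>k\<in>F. L * norm k\<rceil>"
    have gM: "g k \<in> Basis \<rightarrow>\<^sub>E {- int M..int M}" if k: "k \<in> F" for k
    proof -
      have "\<bar>g k b\<bar> \<le> int M" if b: "b \<in> Basis" for b
      proof -
        have "real_of_int \<bar>g k b\<bar> = L * \<bar>k \<bullet> b\<bar>" using g[OF k b] L by (simp add: abs_mult)
        also have "\<dots> \<le> L * norm k" using Basis_le_norm[OF b, of k] L by (intro mult_left_mono) auto
        also have "\<dots> \<le> (\<Sum>k\<in>F. L * norm k)" using k F L by (intro member_le_sum) auto
        also have "\<dots> \<le> real_of_int \<lceil>\<Sum>k\<in>F. L * norm k\<rceil>" by (rule le_of_int_ceiling)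
        also have "\<dots> \<le> real_of_int (int M)" unfolding M_def by simp
        finally show ?thesis by linarith
      qed
      then show ?thesis by (auto simp: g_def abs_le_iff PiE_iff) (force simp: abs_le_iff)+
    qed
    have inj: "inj_on g F"
    proof (rule inj_onI)
      fix k l assume kl: "k \<in> F" "l \<in> F" "g k = g l"
      have "k \<bullet> b = l \<bullet> b" if "b \<in> Basis" for b
        using g[OF kl(1) that] g[OF kl(2) that] kl(3) L by simp
      then show "k = l" by (rule euclidean_eqI)
    qed
    have le: "weight k \<le> (\<Prod>b\<in>Basis. h (g k b))" if k: "k \<in> F" for k
    proof -
      have "weight k = (\<Prod>b\<in>(Basis::'a set). inverse ((1 + norm k)\<^sup>2))"
        by (simp add: weight_def power_mult power_inverse)
      also have "\<dots> \<le> (\<Prod>b\<in>Basis. h (g k b))"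
      proof (rule prod_mono, intro conjI)
        fix b :: 'a assume b: "b \<in> Basis"
        show "0 \<le> inverse ((1 + norm k)\<^sup>2)" by simp
        have "1 + (L * (k \<bullet> b))\<^sup>2 \<le> L\<^sup>2 * (1 + (k \<bullet> b)\<^sup>2)"
          using L by (simp add: power_mult_distrib algebra_simps one_le_power)
        also have "\<dots> \<le> L\<^sup>2 * (1 + norm k)\<^sup>2"
        proof (rule mult_left_mono)
          have "(k \<bullet> b)\<^sup>2 \<le> (norm k)\<^sup>2" using Basis_le_norm[OF b, of k] by (simp add: abs_le_square_iff[symmetric])
          then show "1 + (k \<bullet> b)\<^sup>2 \<le> (1 + norm k)\<^sup>2" by (simp add: power2_sum add_increasing2)
        qed simp
        finally have le: "1 + (L * (k \<bullet> b))\<^sup>2 \<le> L\<^sup>2 * (1 + norm k)\<^sup>2" .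
        have "0 < 1 + norm k" by (simp add: add_pos_nonneg)
        then have p1: "0 < (1 + norm k)\<^sup>2" by simp
        have p2: "0 < 1 + (L * (k \<bullet> b))\<^sup>2" by (simp add: add_pos_nonneg)
        have "1 / (1 + norm k)\<^sup>2 \<le> L\<^sup>2 / (1 + (L * (k \<bullet> b))\<^sup>2)"
          using le by (simp add: pos_divide_le_eq[OF p1] pos_le_divide_eq[OF p2])
        then show "inverse ((1 + norm k)\<^sup>2) \<le> h (g k b)"
          unfolding h_def g[OF k b] by (simp add: inverse_eq_divide)
      qed
      finally show ?thesis .
    qed
    have "sum weight F \<le> (\<Sum>k\<in>F. \<Prod>b\<in>Basis. h (g k b))" by (rule sum_mono[OF le])
    also have "\<dots> = (\<Sum>\<gamma>\<in>g ` F. \<Prod>b\<in>Basis. h (\<gamma> b))" by (simp add: sum.reindex[OF inj])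
    also have "\<dots> \<le> (\<Sum>\<gamma>\<in>(Basis::'a set) \<rightarrow>\<^sub>E {- int M..int M}. \<Prod>b\<in>Basis. h (\<gamma> b))"
      by (rule sum_mono2) (use gM in \<open>auto intro!: finite_PiE prod_nonneg h0\<close>)
    also have "\<dots> = (\<Prod>b\<in>(Basis::'a set). \<Sum>j\<in>{- int M..int M}. h j)"
      by (rule prod_sum_PiE[symmetric]) auto
    also have "\<dots> \<le> (\<Prod>b\<in>(Basis::'a set). L\<^sup>2 * 5)"
    proof (rule prod_mono, intro conjI sum_nonneg h0)
      have "(\<Sum>j\<in>{- int M..int M}. h j) = L\<^sup>2 * (\<Sum>j\<in>{- int M..int M}. 1 / (1 + (real_of_int j)\<^sup>2))"
        by (simp add: h_def sum_distrib_left)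
      also have "\<dots> \<le> L\<^sup>2 * 5"
        by (rule mult_left_mono[OF order_trans[OF sum_inverse_squares_int]]) auto
      finally show "(\<Sum>j\<in>{- int M..int M}. h j) \<le> L\<^sup>2 * 5" .
    qed
    finally show "sum weight F \<le> (\<Prod>b\<in>(Basis::'a set). L\<^sup>2 * 5)" .
  qed
qed

text \<open>As \<open>expi k x\<close> is $e^{-ik\cdot x}$, this is the coefficient of $e^{-ik\cdot x}$ in the Fourier series on the cube.\<close>

definition fcoef :: "real \<Rightarrow> ('a::euclidean_space \<Rightarrow> complex) \<Rightarrow> 'a \<Rightarrow> complex" where
  "fcoef L \<psi> k = (\<integral>x. \<psi> x * expi (- k) x \<partial>lborel) / of_real (measure lborel (cube L :: 'a set))"

lemma measure_cube_pos: "L > 0 \<Longrightarrow> measure lborel (cube L :: 'a::euclidean_space set) > 0"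
  unfolding cube_cbox by (subst content_pos_lt_eq) auto

text \<open>Integration by parts: the product of \<psi> and the exponential is a test function, so
  the integral of its derivative vanishes.\<close>

lemma fcoef_deriv:
  assumes \<psi>: "\<psi> \<in> test_fun \<Omega>"
  shows "fcoef L (\<lambda>x. frechet_derivative \<psi> (at x) v) k = - \<i> * of_real (k \<bullet> v) * fcoef L \<psi> k"
proof -
  let ?D = "\<lambda>x. frechet_derivative \<psi> (at x) v"
  have t: "(\<lambda>x. \<psi> x * expi (- k) x) \<in> test_fun \<Omega>" by (rule test_fun_expi[OF \<psi>])
  have D: "(\<lambda>x. ?D x * expi (- k) x) \<in> test_fun \<Omega>"
    using test_fun_expi[OF test_fun_deriv(1)[OF \<psi>, of "[v]"]] by simp
  have "frechet_derivative (\<lambda>x. \<psi> x * expi (- k) x) (at x) v =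
      \<i> * of_real (k \<bullet> v) * (\<psi> x * expi (- k) x) + ?D x * expi (- k) x" for x
  proof -
    have d: "(\<psi> has_derivative frechet_derivative \<psi> (at x)) (at x)"
      using smooth_on_D[OF test_funD(1)[OF \<psi>]] by simp
    show ?thesis
      unfolding frechet_derivative_at[OF has_derivative_mult[OF d expi_has_derivative], symmetric]
      by (simp add: algebra_simps)
  qed
  then have "(\<integral>x. \<i> * of_real (k \<bullet> v) * (\<psi> x * expi (- k) x) + ?D x * expi (- k) x \<partial>lborel) = 0"
    using integral_deriv_zero[OF t, of v] by simp
  then have "\<i> * of_real (k \<bullet> v) * (\<integral>x. \<psi> x * expi (- k) x \<partial>lborel) + (\<integral>x. ?D x * expi (- k) x \<partial>lborel) = 0"
    using test_fun_integrable[OF t] test_fun_integrable[OF D] by simp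
  then have "(\<integral>x. ?D x * expi (- k) x \<partial>lborel) = - \<i> * of_real (k \<bullet> v) * (\<integral>x. \<psi> x * expi (- k) x \<partial>lborel)"
    by (simp add: add_eq_0_iff)
  then show ?thesis unfolding fcoef_def by simp
qed

lemma fcoef_iter_deriv:
  assumes \<psi>: "\<psi> \<in> test_fun \<Omega>"
  shows "fcoef L (iter_deriv vs \<psi>) k = (\<Prod>v\<leftarrow>vs. - \<i> * of_real (k \<bullet> v)) * fcoef L \<psi> k"
proof (induction vs)
  case (Cons v vs)
  show ?case using fcoef_deriv[OF test_fun_deriv(1)[OF \<psi>, of vs], of L v k] Cons by simp
qed simp

section \<open>Decay of Fourier coefficients\<close>

lemma fcoef_bounded:
  assumes \<psi>: "\<psi> \<in> test_fun \<Omega>"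
  obtains C where "C \<ge> 0" "\<And>k. norm (fcoef L \<psi> k) \<le> C"
proof -
  have "norm (fcoef L \<psi> k) \<le> (\<integral>x. norm (\<psi> x) \<partial>lborel) / \<bar>measure lborel (cube L :: 'a set)\<bar>" for k
  proof -
    have "norm (\<integral>x. \<psi> x * expi (- k) x \<partial>lborel) \<le> (\<integral>x. norm (\<psi> x * expi (- k) x) \<partial>lborel)"
      by (rule integral_norm_bound)
    then show ?thesis unfolding fcoef_def by (simp add: norm_divide norm_mult divide_right_mono)
  qed
  then show thesis by (intro that[of "(\<integral>x. norm (\<psi> x) \<partial>lborel) / \<bar>measure lborel (cube L :: 'a set)\<bar>"]) auto
qed

lemma one_plus_power_le:
  fixes t :: real
  assumes "t \<ge> 0"
  shows "(1 + t) ^ M \<le> 2 ^ M * (1 + t ^ M)"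
proof (cases "t \<le> 1")
  case True
  then have "(1 + t) ^ M \<le> 2 ^ M" using assms by (intro power_mono) auto
  also have "\<dots> \<le> 2 ^ M * (1 + t ^ M)" using assms by simp
  finally show ?thesis .
next
  case False
  then have "(1 + t) ^ M \<le> (2 * t) ^ M" by (intro power_mono) auto
  also have "\<dots> \<le> 2 ^ M * (1 + t ^ M)" by (simp add: power_mult_distrib)
  finally show ?thesis .
qed

text \<open>Only pure powers of single coordinates occur, matching the derivatives along
  \<open>replicate M b\<close>. The norm is at most the dimension times the largest
  coordinate.\<close>

lemma norm_power_le_coord:
  fixes k :: "'a::euclidean_space"
  shows "(1 + norm k) ^ M \<le> 2 ^ M * (1 + real DIM('a) ^ M * (\<Sum>b\<in>Basis. \<bar>k \<bullet> b\<bar> ^ M))"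
proof -
  have 1: "(1 + norm k) ^ M \<le> 2 ^ M * (1 + norm k ^ M)"
    by (rule one_plus_power_le) simp
  define m where "m = Max ((\<lambda>b. \<bar>k \<bullet> b\<bar>) ` Basis)"
  have "m \<in> (\<lambda>b. \<bar>k \<bullet> b\<bar>) ` Basis" unfolding m_def by (rule Max_in) auto
  then obtain b where b: "b \<in> Basis" "m = \<bar>k \<bullet> b\<bar>" by blast
  have "norm k \<le> (\<Sum>c\<in>Basis. \<bar>k \<bullet> c\<bar>)" by (rule norm_le_l1)
  also have "\<dots> \<le> (\<Sum>c\<in>(Basis::'a set). m)" unfolding m_def by (intro sum_mono Max_ge) auto
  finally have "norm k \<le> real DIM('a) * \<bar>k \<bullet> b\<bar>" using b by simp
  then have "norm k ^ M \<le> (real DIM('a) * \<bar>k \<bullet> b\<bar>) ^ M" by (intro power_mono) auto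
  also have "\<dots> \<le> real DIM('a) ^ M * (\<Sum>b\<in>Basis. \<bar>k \<bullet> b\<bar> ^ M)"
    unfolding power_mult_distrib using b(1) by (intro mult_left_mono member_le_sum) auto
  finally show ?thesis using 1 by (smt (verit) mult_left_mono zero_le_power)
qed

lemma fcoef_decay:
  fixes \<psi> :: "'a::euclidean_space \<Rightarrow> complex"
  assumes \<psi>: "\<psi> \<in> test_fun \<Omega>"
  obtains C where "C \<ge> 0" "\<And>k. (1 + norm k) ^ M * norm (fcoef L \<psi> k) \<le> C"
proof -
  obtain C0 where C0: "C0 \<ge> 0" "\<And>k. norm (fcoef L \<psi> k) \<le> C0" using fcoef_bounded[OF \<psi>] by blast
  have "\<exists>C. C \<ge> 0 \<and> (\<forall>k. norm (fcoef L (iter_deriv (replicate M b) \<psi>) k) \<le> C)" for b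
    using fcoef_bounded[OF test_fun_deriv(1)[OF \<psi>, of "replicate M b"], of L] by metis
  then obtain C1 where C1: "\<And>b. C1 b \<ge> 0" "\<And>b k. norm (fcoef L (iter_deriv (replicate M b) \<psi>) k) \<le> C1 b"
    by metis
  have b: "\<bar>k \<bullet> b\<bar> ^ M * norm (fcoef L \<psi> k) \<le> C1 b" for k b
    using C1(2)[of b k] unfolding fcoef_iter_deriv[OF \<psi>] by (simp add: norm_mult norm_power)
  show thesis
  proof
    show "2 ^ M * (C0 + real DIM('a) ^ M * (\<Sum>b\<in>(Basis::'a set). C1 b)) \<ge> 0"
      using C0 C1 by (simp add: sum_nonneg)
    fix k
    have "(1 + norm k) ^ M * norm (fcoef L \<psi> k) \<le>
        2 ^ M * (1 + real DIM('a) ^ M * (\<Sum>b\<in>Basis. \<bar>k \<bullet> b\<bar> ^ M)) * norm (fcoef L \<psi> k)"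
      by (rule mult_right_mono[OF norm_power_le_coord]) simp
    also have "\<dots> = 2 ^ M * (norm (fcoef L \<psi> k) + real DIM('a) ^ M * (\<Sum>b\<in>Basis. \<bar>k \<bullet> b\<bar> ^ M * norm (fcoef L \<psi> k)))"
      by (simp add: sum_distrib_right sum_distrib_left algebra_simps)
    also have "\<dots> \<le> 2 ^ M * (C0 + real DIM('a) ^ M * (\<Sum>b\<in>(Basis::'a set). C1 b))"
      by (intro mult_left_mono add_mono sum_mono b C0) auto
    finally show "(1 + norm k) ^ M * norm (fcoef L \<psi> k) \<le> 2 ^ M * (C0 + real DIM('a) ^ M * (\<Sum>b\<in>(Basis::'a set). C1 b))" .
  qed
qed

text \<open>Of m + 2 * DIM powers of decay, m pay for the derivatives and the others leave
  \<open>weight\<close>.\<close>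

lemma fcoef_deriv_weight:
  fixes \<psi> :: "'a::euclidean_space \<Rightarrow> complex"
  assumes \<psi>: "\<psi> \<in> test_fun \<Omega>"
  obtains C where "C \<ge> 0" "\<And>k ws. set ws \<subseteq> Basis \<Longrightarrow> length ws \<le> m \<Longrightarrow> norm (fcoef L (iter_deriv ws \<psi>) k) \<le> C * weight k"
proof -
  obtain C where C: "C \<ge> 0" "\<And>k. (1 + norm k) ^ (m + 2 * DIM('a)) * norm (fcoef L \<psi> k) \<le> C"
    using fcoef_decay[OF \<psi>, of "m + 2 * DIM('a)" L] by blast
  have "norm (fcoef L (iter_deriv ws \<psi>) k) \<le> C * weight k" if "set ws \<subseteq> Basis" "length ws \<le> m" for ws k
  proof -
    have "norm (\<Prod>v\<leftarrow>ws. - \<i> * of_real (k \<bullet> v) :: complex) \<le> (1 + norm k) ^ m"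
      using norm_iter_deriv_expi[OF that, of k 0] by (simp add: iter_deriv_expi norm_mult)
    then have "norm (fcoef L (iter_deriv ws \<psi>) k) \<le> (1 + norm k) ^ m * norm (fcoef L \<psi> k)"
      unfolding fcoef_iter_deriv[OF \<psi>] norm_mult by (rule mult_right_mono) simp
    also have "\<dots> = ((1 + norm k) ^ (m + 2 * DIM('a)) * norm (fcoef L \<psi> k)) * weight k"
      by (simp add: weight_def power_add field_simps add_nonneg_eq_0_iff)
    also have "\<dots> \<le> C * weight k" using C(2)[of k] weight_pos[of k] by (intro mult_right_mono) auto
    finally show ?thesis .
  qed
  then show thesis using C(1) that by blast
qed

section \<open>Fourier inversion\<close>

lemma eventually_finite_superset:
  assumes "a \<in> A"
  shows "eventually (\<lambda>F. finite F \<and> F \<subseteq> A \<and> a \<in> F) (finite_subsets_at_top A)"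
  unfolding eventually_finite_subsets_at_top by (rule exI[of _ "{a}"]) (use assms in auto)

lemma continuous_expi: "continuous_on S (expi k)"
  by (rule continuous_on_subset[OF smooth_on_continuous[OF smooth_on_expi[OF open_UNIV]]]) simp

text \<open>The series converges uniformly to a continuous S. As \<psi> - S is orthogonal to all
  exponentials of the lattice, it vanishes at interior points of the cube.\<close>

lemma fourier_inversion:
  fixes \<psi> :: "'a::euclidean_space \<Rightarrow> complex"
  assumes \<psi>: "\<psi> \<in> test_fun \<Omega>" and s: "supp \<psi> \<subseteq> icube L" and L: "L \<ge> 1" and x: "x \<in> icube L"
  shows "((\<lambda>k. fcoef L \<psi> k * expi k x) has_sum \<psi> x) (lattice L)"
proof -
  let ?v = "measure lborel (cube L :: 'a set)"
  have L0: "L > 0" using L by simp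
  have v: "?v > 0" by (rule measure_cube_pos[OF L0])
  obtain C where C0: "C \<ge> 0" "\<And>k ws. set ws \<subseteq> Basis \<Longrightarrow> length ws \<le> 0 \<Longrightarrow> norm (fcoef L (iter_deriv ws \<psi>) k) \<le> C * weight k"
    using fcoef_deriv_weight[OF \<psi>, of 0 L] by blast
  have C: "C \<ge> 0" "\<And>k. norm (fcoef L \<psi> k) \<le> C * weight k"
    using C0(1) C0(2)[of "[]"] by simp_all
  have summ: "(\<lambda>k. C * weight (k::'a)) summable_on lattice L"
    by (rule summable_on_cmult_right[OF weight_summable[OF L]])
  define S where "S x = (\<Sum>\<^sub>\<infinity>k\<in>lattice L. fcoef L \<psi> k * expi k x)" for x
  have bnd: "norm (fcoef L \<psi> k * expi k x) \<le> C * weight k" for k x using C(2)[of k] by (simp add: norm_mult)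
  have ul: "uniform_limit UNIV (\<lambda>F x. \<Sum>k\<in>F. fcoef L \<psi> k * expi k x) S (finite_subsets_at_top (lattice L))"
    unfolding S_def by (rule Weierstrass_m_test_general[OF bnd summ])
  have Scont: "continuous_on (cube L) S"
    by (rule uniform_limit_theorem[OF always_eventually uniform_limit_on_subset[OF ul]])
       (auto intro!: continuous_intros continuous_expi)
  have \<psi>cont: "continuous_on (cube L) \<psi>"
    by (rule continuous_on_subset[OF smooth_on_continuous[OF test_funD(1)[OF \<psi>]]]) simp
  have "\<psi> x - S x = 0"
  proof (rule fourier_unique[OF _ L0 _ x])
    show "continuous_on (cube L) (\<lambda>x. \<psi> x - S x)" by (intro continuous_intros \<psi>cont Scont)
    fix n :: 'a assume n: "n \<in> lattice L"
    let ?I = "\<integral>x. indicator (cube L) x *\<^sub>R ((\<psi> x - S x) * expi n x) \<partial>lborel"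
    have "norm ?I \<le> ?v * \<epsilon>" if \<epsilon>: "\<epsilon> > 0" for \<epsilon>
    proof -
      have "eventually (\<lambda>F. \<forall>x\<in>UNIV. dist (\<Sum>k\<in>F. fcoef L \<psi> k * expi k x) (S x) < \<epsilon>) (finite_subsets_at_top (lattice L))"
        using uniform_limitD[OF ul \<epsilon>] .
      \<comment> \<open>Pairing with \<open>expi n\<close> picks out the frequency - n. A partial
        sum containing - n has the same coefficient there as \<psi>, so only the uniformly small
        remainder contributes to the integral.\<close>
      from eventually_happens'[OF finite_subsets_at_top_neq_bot
          eventually_conj[OF this eventually_finite_superset[OF lattice_uminus[OF n]]]]
      obtain F where close': "\<forall>x\<in>UNIV. dist (\<Sum>k\<in>F. fcoef L \<psi> k * expi k x) (S x) < \<epsilon>"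
        and F: "finite F" "F \<subseteq> lattice L" "- n \<in> F"
        by (elim exE conjE) (rule that)
      have close: "dist (\<Sum>k\<in>F. fcoef L \<psi> k * expi k x) (S x) < \<epsilon>" for x
        by (rule bspec[OF close' UNIV_I])
      let ?S = "\<lambda>x. \<Sum>k\<in>F. fcoef L \<psi> k * expi k x"
      have Fcont: "continuous_on (cube L) ?S" by (intro continuous_intros continuous_expi)
      have i1: "integrable lborel (\<lambda>x. indicator (cube L) x *\<^sub>R (\<psi> x * expi n x))"
        by (rule integral_cube_mult) (intro continuous_intros continuous_expi \<psi>cont)
      have i2: "integrable lborel (\<lambda>x. indicator (cube L) x *\<^sub>R (?S x * expi n x))"
        by (rule integral_cube_mult) (intro continuous_intros continuous_expi Fcont)
      have i3: "integrable lborel (\<lambda>x. indicator (cube L) x *\<^sub>R ((?S x - S x) * expi n x))"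
        by (rule integral_cube_mult) (intro continuous_intros continuous_expi Fcont Scont)
      have i4: "integrable lborel (\<lambda>x. indicator (cube L) x *\<^sub>R expi k x)" for k :: 'a
        by (rule integral_cube_mult[OF continuous_expi])
      have "indicator (cube L) x *\<^sub>R (\<psi> x * expi n x) = \<psi> x * expi (- (- n)) x" for x
        using s icube_subset not_in_supp[of x \<psi>] by (cases "x \<in> cube L") auto
      then have e1: "(\<integral>x. indicator (cube L) x *\<^sub>R (\<psi> x * expi n x) \<partial>lborel) = ?v * fcoef L \<psi> (- n)"
        using v by (simp add: fcoef_def)
      have e2: "(\<integral>x. indicator (cube L) x *\<^sub>R (?S x * expi n x) \<partial>lborel) = ?v * fcoef L \<psi> (- n)"
      proof -
        have e: "expi k x * expi n x = expi (k + n) x" for k x :: 'a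
          unfolding expi_def by (simp add: exp_add[symmetric] inner_add_left algebra_simps)
        have "(\<integral>x. indicator (cube L) x *\<^sub>R (?S x * expi n x) \<partial>lborel) =
            (\<integral>x. (\<Sum>k\<in>F. fcoef L \<psi> k * (indicator (cube L) x *\<^sub>R expi (k + n) x)) \<partial>lborel)"
          unfolding e[symmetric] by (intro Bochner_Integration.integral_cong refl)
            (simp add: sum_distrib_right sum_distrib_left scaleR_sum_right mult_ac)
        also have "\<dots> = (\<Sum>k\<in>F. fcoef L \<psi> k * (\<integral>x. indicator (cube L) x *\<^sub>R expi (k + n) x \<partial>lborel))"
          by (subst Bochner_Integration.integral_sum, rule integrable_mult_right[OF i4])
             (simp only: integral_mult_right_zero)
        also have "\<dots> = (\<Sum>k\<in>F. if k = - n then fcoef L \<psi> k * ?v else 0)"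
          using F(2) n by (intro sum.cong refl) (auto simp: integral_cube_expi lattice_add zero_lattice L0 add_eq_0_iff2)
        also have "\<dots> = ?v * fcoef L \<psi> (- n)" using F by simp
        finally show ?thesis .
      qed
      have "?I = (\<integral>x. indicator (cube L) x *\<^sub>R (\<psi> x * expi n x) - indicator (cube L) x *\<^sub>R (?S x * expi n x)
          + indicator (cube L) x *\<^sub>R ((?S x - S x) * expi n x) \<partial>lborel)"
        by (intro Bochner_Integration.integral_cong refl) (simp add: algebra_simps)
      also have "\<dots> = (\<integral>x. indicator (cube L) x *\<^sub>R ((?S x - S x) * expi n x) \<partial>lborel)"
        using i1 i2 i3 by (simp only: Bochner_Integration.integral_add Bochner_Integration.integral_diff
            Bochner_Integration.integrable_diff e1 e2) simp
      finally have "?I = (\<integral>x. indicator (cube L) x *\<^sub>R ((?S x - S x) * expi n x) \<partial>lborel)" .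
      then have "norm ?I \<le> (\<integral>x. norm (indicator (cube L) x *\<^sub>R ((?S x - S x) * expi n x)) \<partial>lborel)"
        by (simp only: integral_norm_bound)
      also have "\<dots> \<le> (\<integral>x. indicator (cube L :: 'a set) x *\<^sub>R \<epsilon> \<partial>lborel)"
      proof (rule integral_mono)
        show "integrable lborel (\<lambda>x. norm (indicator (cube L) x *\<^sub>R ((?S x - S x) * expi n x)))" by (rule integrable_norm[OF i3])
        show "integrable lborel (\<lambda>x. indicator (cube L :: 'a set) x *\<^sub>R \<epsilon>)" by (rule integral_cube_mult) simp
        show "norm (indicator (cube L) x *\<^sub>R ((?S x - S x) * expi n x)) \<le> indicator (cube L) x *\<^sub>R \<epsilon>" for x
          using close[of x] by (cases "x \<in> cube L") (simp_all only: norm_scaleR norm_mult norm_expi dist_norm indicator_simps, simp_all add: less_imp_le)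
      qed
      also have "\<dots> = ?v * \<epsilon>" by (simp add: cube_cbox)
      finally show ?thesis .
    qed
    note le = this
    have le': "norm ?I / ?v \<le> 0 + \<epsilon>" if "\<epsilon> > 0" for \<epsilon>
      using le[OF that] by (simp only: add_0 pos_divide_le_eq[OF v] mult.commute[of \<epsilon>])
    have "norm ?I / ?v \<le> 0" by (rule field_le_epsilon[OF le'])
    then have "norm ?I \<le> 0" using v by (simp only: pos_divide_le_eq[OF v] mult_zero_left)
    then show "?I = 0" by (simp only: norm_le_zero_iff)
  qed
  then have "\<psi> x = S x" by simp
  moreover have "((\<lambda>k. fcoef L \<psi> k * expi k x) has_sum S x) (lattice L)"
    unfolding S_def
    by (rule has_sum_infsum, rule Infinite_Sum.abs_summable_summable, rule Infinite_Sum.abs_summable_on_comparison_test'[OF summ], rule bnd)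
  ultimately show ?thesis by simp
qed

subsection \<open>Distributions applied to Fourier series\<close>

lemma distr_add: "u \<in> distributions \<Omega> \<Longrightarrow> \<phi> \<in> test_fun \<Omega> \<Longrightarrow> \<psi> \<in> test_fun \<Omega> \<Longrightarrow> u (\<lambda>x. \<phi> x + \<psi> x) = u \<phi> + u \<psi>"
  and distr_cmult: "u \<in> distributions \<Omega> \<Longrightarrow> \<phi> \<in> test_fun \<Omega> \<Longrightarrow> u (\<lambda>x. c * \<phi> x) = c * u \<phi>"
  unfolding distributions_def by auto

lemma distr_zero: "u \<in> distributions \<Omega> \<Longrightarrow> u (\<lambda>x. 0) = 0"
  using distr_cmult[OF _ test_fun_zero, of u \<Omega> 0] by simp

lemma distr_diff:
  assumes "u \<in> distributions \<Omega>" "\<phi> \<in> test_fun \<Omega>" "\<psi> \<in> test_fun \<Omega>"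
  shows "u (\<lambda>x. \<phi> x - \<psi> x) = u \<phi> - u \<psi>"
  using distr_add[OF assms(1,2) test_fun_cmult[OF assms(3), of "-1"]] distr_cmult[OF assms(1,3), of "-1"] by simp

lemma distr_sum:
  assumes "u \<in> distributions \<Omega>" "finite I" "\<And>i. i \<in> I \<Longrightarrow> \<phi> i \<in> test_fun \<Omega>"
  shows "u (\<lambda>x. \<Sum>i\<in>I. \<phi> i x) = (\<Sum>i\<in>I. u (\<phi> i))"
  using assms(2,3)
proof (induction I)
  case (insert i I)
  have "u (\<lambda>x. \<phi> i x + (\<Sum>i\<in>I. \<phi> i x)) = u (\<phi> i) + u (\<lambda>x. \<Sum>i\<in>I. \<phi> i x)"
    by (rule distr_add[OF assms(1)]) (use insert in \<open>auto intro: test_fun_sum\<close>)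
  then show ?case using insert by simp
qed (simp add: distr_zero[OF assms(1)])

lemma distr_order:
  assumes "u \<in> distributions \<Omega>" "compact K" "K \<subseteq> \<Omega>"
  obtains c m where "c \<ge> 0" "\<And>\<phi>. \<phi> \<in> test_fun \<Omega> \<Longrightarrow> supp \<phi> \<subseteq> K \<Longrightarrow> norm (u \<phi>) \<le> c * Ck_norm m \<phi>"
proof -
  have "\<forall>K. compact K \<and> K \<subseteq> \<Omega> \<longrightarrow>
      (\<exists>c m. \<forall>\<phi>\<in>test_fun \<Omega>. supp \<phi> \<subseteq> K \<longrightarrow> norm (u \<phi>) \<le> c * Ck_norm m \<phi>)"
    using assms(1) unfolding distributions_def by simp
  then obtain c m where c: "\<forall>\<phi>\<in>test_fun \<Omega>. supp \<phi> \<subseteq> K \<longrightarrow> norm (u \<phi>) \<le> c * Ck_norm m \<phi>"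
    using assms(2,3) by blast
  show thesis
  proof (rule that[of "\<bar>c\<bar>" m])
    fix \<phi> assume \<phi>: "\<phi> \<in> test_fun \<Omega>" "supp \<phi> \<subseteq> K"
    have "norm (u \<phi>) \<le> c * Ck_norm m \<phi>" using c \<phi> by blast
    also have "\<dots> \<le> \<bar>c\<bar> * Ck_norm m \<phi>" by (intro mult_right_mono Ck_norm_nonneg[OF \<phi>(1)]) auto
    finally show "norm (u \<phi>) \<le> \<bar>c\<bar> * Ck_norm m \<phi>" .
  qed simp
qed

text \<open>The Fourier series converges with all derivatives up to order m on
  \<open>supp \<theta>\<close>, and u has some finite order m there. The order influences the speed
  of convergence but not the value of the sum, so later bounds on the terms are free of it.\<close>

lemma distr_fourier:
  fixes \<psi> \<theta> :: "'a::euclidean_space \<Rightarrow> complex"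
  assumes u: "u \<in> distributions \<Omega>" and \<theta>: "\<theta> \<in> test_fun \<Omega>" "supp \<theta> \<subseteq> icube L"
    and \<psi>: "\<psi> \<in> test_fun \<Omega>'" "supp \<psi> \<subseteq> icube L" and L: "L \<ge> 1"
  shows "((\<lambda>k. fcoef L \<psi> k * u (\<lambda>x. \<theta> x * expi k x)) has_sum u (\<lambda>x. \<theta> x * \<psi> x)) (lattice L)"
proof -
  obtain c m where c: "c \<ge> 0" "\<And>\<phi>. \<phi> \<in> test_fun \<Omega> \<Longrightarrow> supp \<phi> \<subseteq> supp \<theta> \<Longrightarrow> norm (u \<phi>) \<le> c * Ck_norm m \<phi>"
    using distr_order[OF u test_funD(2,3)[OF \<theta>(1)]] by metis
  obtain c1 where c1: "c1 \<ge> 0" "\<And>(\<phi> :: 'a \<Rightarrow> complex) M. smooth_on UNIV \<phi> \<Longrightarrow>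
    (\<And>ws x. set ws \<subseteq> Basis \<Longrightarrow> length ws \<le> m \<Longrightarrow> x \<in> supp \<theta> \<Longrightarrow> norm (iter_deriv ws \<phi> x) \<le> M) \<Longrightarrow>
    0 \<le> M \<Longrightarrow> Ck_norm m (\<lambda>x. \<theta> x * \<phi> x) \<le> c1 * M"
    using Ck_norm_mult_bound[OF \<theta>(1), of m] by blast
  obtain C where C: "C \<ge> 0" "\<And>k ws. set ws \<subseteq> Basis \<Longrightarrow> length ws \<le> m \<Longrightarrow> norm (fcoef L (iter_deriv ws \<psi>) k) \<le> C * weight k"
    using fcoef_deriv_weight[OF \<psi>(1), of m L] by blast
  define W where "W = infsum weight (lattice L :: 'a set)"
  have W: "(weight has_sum W) (lattice L :: 'a set)" unfolding W_def by (rule has_sum_infsum[OF weight_summable[OF L]])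
  let ?s = "\<lambda>F. \<Sum>k\<in>F. fcoef L \<psi> k * u (\<lambda>x. \<theta> x * expi k x)"
  have key: "norm (?s F - u (\<lambda>x. \<theta> x * \<psi> x)) \<le> c * (c1 * (C * (W - sum weight F)))"
    if F: "finite F" "F \<subseteq> lattice L" for F
  proof -
    \<comment> \<open>Error of a partial sum. Its derivatives are tails of the series of the
      derivatives of \<psi>, all bounded by the tail of the summed weights.\<close>
    define h where "h x = (\<Sum>k\<in>F. fcoef L \<psi> k * expi k x) + (- 1) * \<psi> x" for x
    have sF: "smooth_on UNIV (\<lambda>x. fcoef L \<psi> k * expi k x)" for k
      by (intro smooth_on_mult smooth_on_const smooth_on_expi open_UNIV)
    have sm: "smooth_on UNIV h"
      unfolding h_def by (intro smooth_on_add smooth_on_sum sF smooth_on_mult smooth_on_const test_funD(1)[OF \<psi>(1)] open_UNIV)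
    have t: "(weight has_sum (W - sum weight F)) (lattice L - F)"
      by (rule has_sum_Diff[OF W has_sum_finite[OF F(1)] F(2)])
    have t0: "0 \<le> W - sum weight F"
      by (rule has_sum_nonneg[OF t]) (use weight_pos less_imp_le in blast)
    have hb: "norm (iter_deriv ws h x) \<le> C * (W - sum weight F)"
      if ws: "set ws \<subseteq> Basis" "length ws \<le> m" and x: "x \<in> supp \<theta>" for ws x
    proof -
      have "iter_deriv ws h x = iter_deriv ws (\<lambda>x. \<Sum>k\<in>F. fcoef L \<psi> k * expi k x) x + iter_deriv ws (\<lambda>x. (- 1) * \<psi> x) x"
        unfolding h_def
        by (rule iter_deriv_add[OF open_UNIV]) (intro smooth_on_sum sF smooth_on_mult smooth_on_const test_funD(1)[OF \<psi>(1)] open_UNIV UNIV_I)+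
      also have "iter_deriv ws (\<lambda>x. (- 1) * \<psi> x) x = (- 1) * iter_deriv ws \<psi> x"
        by (rule iter_deriv_cmult[OF open_UNIV test_funD(1)[OF \<psi>(1)] UNIV_I])
      also have "iter_deriv ws (\<lambda>x. \<Sum>k\<in>F. fcoef L \<psi> k * expi k x) x = (\<Sum>k\<in>F. iter_deriv ws (\<lambda>x. fcoef L \<psi> k * expi k x) x)"
        by (rule iter_deriv_sum[OF F(1) open_UNIV sF UNIV_I])
      also have "\<dots> = (\<Sum>k\<in>F. fcoef L (iter_deriv ws \<psi>) k * expi k x)"
        by (intro sum.cong refl)
           (simp add: iter_deriv_cmult[OF open_UNIV smooth_on_expi[OF open_UNIV] UNIV_I] iter_deriv_expi fcoef_iter_deriv[OF \<psi>(1)])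
      finally have eq: "iter_deriv ws h x = (\<Sum>k\<in>F. fcoef L (iter_deriv ws \<psi>) k * expi k x) - iter_deriv ws \<psi> x" by simp
      have x': "x \<in> icube L" using x \<theta>(2) by blast
      have s: "supp (iter_deriv ws \<psi>) \<subseteq> icube L" using test_fun_deriv(2)[OF \<psi>(1)] \<psi>(2) by blast
      have "((\<lambda>k. fcoef L (iter_deriv ws \<psi>) k * expi k x) has_sum
          (iter_deriv ws \<psi> x - (\<Sum>k\<in>F. fcoef L (iter_deriv ws \<psi>) k * expi k x))) (lattice L - F)"
        by (rule has_sum_Diff[OF fourier_inversion[OF test_fun_deriv(1)[OF \<psi>(1)] s L x'] has_sum_finite[OF F(1)] F(2)])
      from norm_infsum_le[OF this has_sum_cmult_right[OF t, of C]]
      have "norm (iter_deriv ws \<psi> x - (\<Sum>k\<in>F. fcoef L (iter_deriv ws \<psi>) k * expi k x)) \<le> C * (W - sum weight F)"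
        using C(2)[OF ws] by (simp add: norm_mult)
      then show ?thesis unfolding eq by (simp add: norm_minus_commute)
    qed
    have tf: "(\<lambda>x. \<theta> x * h x) \<in> test_fun \<Omega>" by (rule test_fun_mult_smooth[OF \<theta>(1) open_UNIV subset_UNIV sm])
    have "supp (\<lambda>x. \<theta> x * h x) \<subseteq> supp \<theta>" by (rule supp_subsetI[OF closed_supp]) (simp add: not_in_supp)
    then have "norm (u (\<lambda>x. \<theta> x * h x)) \<le> c * Ck_norm m (\<lambda>x. \<theta> x * h x)" by (rule c(2)[OF tf])
    also have "\<dots> \<le> c * (c1 * (C * (W - sum weight F)))"
      by (intro mult_left_mono c(1) c1(2)[OF sm hb]) (use C t0 in auto)
    also have "(\<lambda>x. \<theta> x * h x) = (\<lambda>x. (\<Sum>k\<in>F. fcoef L \<psi> k * (\<theta> x * expi k x)) - \<theta> x * \<psi> x)"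
      unfolding h_def by (rule ext) (simp add: algebra_simps sum_distrib_left)
    also have "u \<dots> = u (\<lambda>x. \<Sum>k\<in>F. fcoef L \<psi> k * (\<theta> x * expi k x)) - u (\<lambda>x. \<theta> x * \<psi> x)"
      by (intro distr_diff[OF u] test_fun_sum F(1) test_fun_cmult test_fun_expi[OF \<theta>(1)]
           test_fun_mult_smooth[OF \<theta>(1) open_UNIV subset_UNIV test_funD(1)[OF \<psi>(1)]])
    also have "u (\<lambda>x. \<Sum>k\<in>F. fcoef L \<psi> k * (\<theta> x * expi k x)) = (\<Sum>k\<in>F. u (\<lambda>x. fcoef L \<psi> k * (\<theta> x * expi k x)))"
      by (intro distr_sum[OF u F(1)] test_fun_cmult test_fun_expi[OF \<theta>(1)])
    also have "\<dots> = ?s F" by (simp add: distr_cmult[OF u test_fun_expi[OF \<theta>(1)]])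
    finally show ?thesis .
  qed
  have "((\<lambda>F. c * (c1 * (C * (W - sum weight F)))) \<longlongrightarrow> c * (c1 * (C * (W - W)))) (finite_subsets_at_top (lattice L :: 'a set))"
    using W unfolding has_sum_def by (intro tendsto_intros)
  then have lim0: "((\<lambda>F. c * (c1 * (C * (W - sum weight F)))) \<longlongrightarrow> 0) (finite_subsets_at_top (lattice L :: 'a set))" by simp
  have "((\<lambda>F. ?s F - u (\<lambda>x. \<theta> x * \<psi> x)) \<longlongrightarrow> 0) (finite_subsets_at_top (lattice L))"
    by (rule Lim_null_comparison[OF eventually_finite_subsets_at_top_weakI lim0]) (rule key)
  then show ?thesis unfolding has_sum_def by (rule LIM_zero_cancel)
qed

lemma distr_fourier_bound:
  fixes \<psi> \<theta> :: "'a::euclidean_space \<Rightarrow> complex"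
  assumes u: "u \<in> distributions \<Omega>" and \<theta>: "\<theta> \<in> test_fun \<Omega>" "supp \<theta> \<subseteq> icube L"
    and \<psi>: "\<psi> \<in> test_fun \<Omega>'" "supp \<psi> \<subseteq> icube L" and L: "L \<ge> 1"
    and B: "\<And>k. k \<in> lattice L \<Longrightarrow> norm (fcoef L \<psi> k) * norm (u (\<lambda>x. \<theta> x * expi k x)) \<le> B * weight k"
  shows "norm (u (\<lambda>x. \<theta> x * \<psi> x)) \<le> B * infsum weight (lattice L :: 'a set)"
  by (rule norm_infsum_le[OF distr_fourier[OF u \<theta> \<psi> L]
        has_sum_cmult_right[OF has_sum_infsum[OF weight_summable[OF L]]]])
     (simp add: norm_mult B)

subsection \<open>Nonstationary phase\<close>

lemma open_slice: "open S \<Longrightarrow> open {x. (x, p) \<in> S}"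
  using open_vimage[of S "\<lambda>x. (x, p)"] by (simp add: vimage_def continuous_on_Pair)

lemma smooth_on_slice_open:
  fixes f :: "'a::euclidean_space \<times> 'p::euclidean_space \<Rightarrow> 'b::real_normed_vector"
  assumes "open S" "smooth_on S f"
  shows "smooth_on {x. (x, p) \<in> S} (\<lambda>x. f (x, p))"
  by (rule smooth_on_compose[where T=S and f="\<lambda>x. (x, p)" and g=f])
     (use assms in \<open>auto intro!: open_slice smooth_on_Pair smooth_on_ident smooth_on_const\<close>)

lemma test_fun_restrict:
  fixes K :: "'a::euclidean_space set" and g :: "'a \<Rightarrow> complex"
  assumes "open X" "compact K" "K \<subseteq> X" "smooth_on X g" "\<And>x. x \<in> X - K \<Longrightarrow> g x = 0"
  shows "(\<lambda>x. if x \<in> K then g x else 0) \<in> test_fun X" (is "?F \<in> _")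
proof (rule test_funI[OF _ assms(2,3)])
  have "smooth_on UNIV (\<lambda>x. if x \<in> X then g x else 0)"
    by (rule smooth_on_extend_zero[OF assms(1) compact_imp_closed[OF assms(2)] assms(4,5,3)])
  also have "(\<lambda>x. if x \<in> X then g x else 0) = ?F" using assms(3,5) by (intro ext) auto
  finally show "smooth_on UNIV ?F" .
qed simp

text \<open>Phase and amplitude are controlled only on an open set of pairs (x, p), whose slices
  vary with p. Cutting off at K gives a function on the whole space for every p.\<close>

definition osc_integrand ::
    "'a::euclidean_space set \<Rightarrow> ('a \<times> 'p::euclidean_space \<Rightarrow> complex) \<Rightarrow> ('a \<times> 'p \<Rightarrow> real) \<Rightarrow> real \<Rightarrow> 'p \<Rightarrow> 'a \<Rightarrow> complex" where
  "osc_integrand K b \<phi> t p x = (if x \<in> K then b (x, p) * exp (\<i> * of_real (t * \<phi> (x, p))) else 0)"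

lemma osc_integrand_test_fun:
  fixes b :: "'a::euclidean_space \<times> 'p::euclidean_space \<Rightarrow> complex"
  assumes O: "open O'" "smooth_on O' \<phi>" "smooth_on O' b" "\<And>x p. (x, p) \<in> O' \<Longrightarrow> x \<notin> K \<Longrightarrow> b (x, p) = 0"
    and K: "compact K" "K \<times> Q \<subseteq> O'" and p: "p \<in> Q"
  shows "osc_integrand K b \<phi> t p \<in> test_fun UNIV"
proof -
  let ?X = "{x. (x, p) \<in> O'}"
  have oX: "open ?X" by (rule open_slice[OF O(1)])
  have KX: "K \<subseteq> ?X" using K p by auto
  have "smooth_on ?X (\<lambda>x. b (x, p) * exp (\<i> * of_real (t * \<phi> (x, p))))"
    by (intro smooth_on_mult smooth_on_cexp smooth_on_of_real smooth_on_const oX smooth_on_slice_open O)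
  from test_fun_restrict[OF oX K(1) KX this] have "(\<lambda>x. if x \<in> K then b (x, p) * exp (\<i> * of_real (t * \<phi> (x, p))) else 0) \<in> test_fun ?X"
    using O(4) by auto
  then show ?thesis unfolding osc_integrand_def[abs_def] by (rule test_fun_mono) simp
qed

lemma norm_integral_le_measure:
  fixes F :: "'a::euclidean_space \<Rightarrow> complex"
  assumes "integrable lborel F" "compact K" "\<And>x. x \<notin> K \<Longrightarrow> F x = 0" "\<And>x. x \<in> K \<Longrightarrow> norm (F x) \<le> c" 
  shows "norm (\<integral>x. F x \<partial>lborel) \<le> c * measure lborel K"
proof -
  have "norm (\<integral>x. F x \<partial>lborel) \<le> (\<integral>x. norm (F x) \<partial>lborel)" by (rule integral_norm_bound)
  also have "\<dots> \<le> (\<integral>x. indicator K x *\<^sub>R c \<partial>lborel)"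
  proof (rule integral_mono)
    show "integrable lborel (\<lambda>x. norm (F x))" using assms(1) by simp
    show "integrable lborel (\<lambda>x. indicator K x *\<^sub>R c)" by (rule borel_integrable_compact[OF assms(2)]) simp
    show "norm (F x) \<le> indicator K x *\<^sub>R c" for x using assms(3,4)[of x] by (cases "x \<in> K") auto
  qed
  also have "\<dots> = c * measure lborel K" using assms(2) by (simp add: compact_imp_closed)
  finally show ?thesis .
qed

lemma osc_integral_bounded:
  fixes b :: "'a::euclidean_space \<times> 'p::euclidean_space \<Rightarrow> complex"
  assumes O: "open O'" "smooth_on O' \<phi>" "smooth_on O' b" "\<And>x p. (x, p) \<in> O' \<Longrightarrow> x \<notin> K \<Longrightarrow> b (x, p) = 0"
    and K: "compact K" "compact Q" "K \<times> Q \<subseteq> O'"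
  obtains C where "C \<ge> 0" "\<And>p t. p \<in> Q \<Longrightarrow> norm (\<integral>x. osc_integrand K b \<phi> t p x \<partial>lborel) \<le> C"
proof -
  obtain c where c: "c > 0" "\<And>z. z \<in> K \<times> Q \<Longrightarrow> norm (b z) \<le> c"
    using continuous_compact_bound[OF smooth_on_continuous[OF O(3)] compact_Times[OF K(1,2)] K(3)] by blast
  show thesis
  proof (rule that[of "c * measure lborel K"])
    fix p t assume p: "p \<in> Q"
    show "norm (\<integral>x. osc_integrand K b \<phi> t p x \<partial>lborel) \<le> c * measure lborel K"
      by (rule norm_integral_le_measure[OF test_fun_integrable[OF osc_integrand_test_fun[OF O K(1,3) p]] K(1)])
         (use c p in \<open>auto simp: osc_integrand_def norm_mult norm_exp_eq_Re\<close>)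
  qed (use c in simp)
qed

text \<open>With G the x-gradient of \<phi>, put c_j = b * G_j / |G|^2. The divergence of c * exp (i
  t \<phi>) is (b' + i t b) * exp (i t \<phi>) with b' = div c, and its integral is 0; so a factor t
  is traded for the amplitude b', which again vanishes off K. Joint smoothness in x and p together
  with compactness of K and Q makes the final constant uniform in p.\<close>

lemma nonstationary_phase:
  fixes b :: "'a::euclidean_space \<times> 'p::euclidean_space \<Rightarrow> complex"
  assumes O: "open O'" "smooth_on O' \<phi>"
    and K: "compact K" "compact Q" "K \<times> Q \<subseteq> O'"
    and grad: "\<And>z. z \<in> O' \<Longrightarrow> \<exists>j\<in>Basis. frechet_derivative \<phi> (at z) (j, 0) \<noteq> 0"
    and b: "smooth_on O' b" "\<And>x p. (x, p) \<in> O' \<Longrightarrow> x \<notin> K \<Longrightarrow> b (x, p) = 0"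
  shows "\<exists>C\<ge>0. \<forall>p\<in>Q. \<forall>t>0. t ^ N * norm (\<integral>x. osc_integrand K b \<phi> t p x \<partial>lborel) \<le> C"
  using b
proof (induction N arbitrary: b)
  case 0
  obtain C where "C \<ge> 0" "\<And>p t. p \<in> Q \<Longrightarrow> norm (\<integral>x. osc_integrand K b \<phi> t p x \<partial>lborel) \<le> C"
    using osc_integral_bounded[OF O 0 K] by blast
  then show ?case by (intro exI[of _ C]) simp
next
  case (Suc N)
  define G where "G j z = frechet_derivative \<phi> (at z) (j, 0)" for j z
  define H where "H z = (\<Sum>j\<in>Basis. G j z * G j z)" for z
  have Gs: "smooth_on O' (G j)" for j unfolding G_def by (rule smooth_on_deriv[OF O(2)])
  have Hs: "smooth_on O' H" unfolding H_def by (intro smooth_on_sum smooth_on_mult Gs O(1))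
  have Hpos: "H z \<noteq> 0" if z: "z \<in> O'" for z
  proof -
    obtain j where j: "j \<in> Basis" "G j z \<noteq> 0" using grad[OF z] unfolding G_def by blast
    have "0 < G j z * G j z" using j(2) not_real_square_gt_zero[of "G j z"] by blast
    also have "\<dots> \<le> H z" unfolding H_def by (rule member_le_sum) (use j(1) in auto)
    finally show ?thesis by simp
  qed
  define c where "c j z = b z * of_real (G j z / H z)" for j z
  have cs: "smooth_on O' (c j)" for j
    unfolding c_def by (intro smooth_on_mult smooth_on_of_real smooth_on_divide Suc.prems(1) Gs Hs Hpos O(1))
  have c0: "c j (x, p) = 0" if "(x, p) \<in> O'" "x \<notin> K" for j x p
    unfolding c_def using Suc.prems(2)[OF that] by simp
  define b' where "b' z = (\<Sum>j\<in>Basis. frechet_derivative (c j) (at z) (j, 0))" for z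
  have b's: "smooth_on O' b'" unfolding b'_def by (intro smooth_on_sum smooth_on_deriv cs O(1))
  have b'0: "b' (x, p) = 0" if "(x, p) \<in> O'" "x \<notin> K" for x p
  proof -
    have o: "open (O' \<inter> ((- K) \<times> UNIV))"
      by (intro open_Int O(1) open_Times open_Compl compact_imp_closed K(1) open_UNIV)
    have "frechet_derivative (c j) (at (x, p)) = frechet_derivative (\<lambda>z. 0) (at (x, p))" for j
      by (rule frechet_derivative_cong_open[OF o]) (use that c0 in auto)
    then show ?thesis by (simp add: b'_def)
  qed
  obtain C where C: "C \<ge> 0" "\<forall>p\<in>Q. \<forall>t>0. t ^ N * norm (\<integral>x. osc_integrand K b' \<phi> t p x \<partial>lborel) \<le> C"
    using Suc.IH[OF b's b'0] by blast
  have "t * norm (\<integral>x. osc_integrand K b \<phi> t p x \<partial>lborel) = norm (\<integral>x. osc_integrand K b' \<phi> t p x \<partial>lborel)"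
    if p: "p \<in> Q" and t: "t > 0" for p t
  proof -
    let ?T = "\<lambda>j. osc_integrand K (c j) \<phi> t p"
    have T: "?T j \<in> test_fun UNIV" for j
      by (rule osc_integrand_test_fun[OF O cs c0 K(1,3) p])
    have Tb: "osc_integrand K b \<phi> t p \<in> test_fun UNIV" "osc_integrand K b' \<phi> t p \<in> test_fun UNIV"
      using osc_integrand_test_fun[OF O Suc.prems K(1,3) p] osc_integrand_test_fun[OF O b's b'0 K(1,3) p] by auto
    have D: "(\<Sum>j\<in>Basis. frechet_derivative (?T j) (at x) j) =
        osc_integrand K b' \<phi> t p x + \<i> * of_real t * osc_integrand K b \<phi> t p x" for x
    proof (cases "x \<in> K")
      case False
      have "frechet_derivative (?T j) (at x) = frechet_derivative (\<lambda>z. 0) (at x)" for j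
        by (rule frechet_derivative_cong_open[of "- K"])
           (use False compact_imp_closed[OF K(1)] in \<open>auto simp: osc_integrand_def\<close>)
      then show ?thesis using False by (simp add: osc_integrand_def)
    next
      case True
      let ?e = "exp (\<i> * of_real (t * \<phi> (x, p)))"
      have m: "(x, p) \<in> O'" using True p K by auto
      have "frechet_derivative (?T j) (at x) j =
          frechet_derivative (c j) (at (x, p)) (j, 0) * ?e + \<i> * of_real t * (c j (x, p) * of_real (G j (x, p))) * ?e" for j
      proof -
        have "frechet_derivative (?T j) (at x) = frechet_derivative (\<lambda>x. c j (x, p) * exp (\<i> * of_real (t * \<phi> (x, p)))) (at x)"
          by (rule frechet_derivative_cong_open[OF open_slice[OF O(1)], of _ p])
             (use m c0 in \<open>auto simp: osc_integrand_def\<close>)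
        moreover have "((\<lambda>x. \<i> * of_real (t * \<phi> (x, p)) :: complex) has_derivative (\<lambda>v. \<i> * of_real (t * frechet_derivative \<phi> (at (x, p)) (v, 0)))) (at x)"
          by (intro bounded_linear.has_derivative[OF bounded_linear_mult_right] bounded_linear.has_derivative[OF bounded_linear_of_real]
                slice_has_derivative[OF O(2) m])
        from has_derivative_compose[OF this DERIV_exp[unfolded has_field_derivative_def]]
        have de: "((\<lambda>x. exp (\<i> * of_real (t * \<phi> (x, p)))) has_derivative
            (\<lambda>v. ?e * (\<i> * of_real (t * frechet_derivative \<phi> (at (x, p)) (v, 0))))) (at x)" .
        from frechet_derivative_at[OF has_derivative_mult[OF slice_has_derivative[OF cs m] de], symmetric]
        have "frechet_derivative (\<lambda>x. c j (x, p) * exp (\<i> * of_real (t * \<phi> (x, p)))) (at x) =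
           (\<lambda>v. c j (x, p) * (?e * (\<i> * of_real (t * frechet_derivative \<phi> (at (x, p)) (v, 0)))) +
              frechet_derivative (c j) (at (x, p)) (v, 0) * ?e)" .
        ultimately show ?thesis by (simp add: G_def algebra_simps)
      qed
      then have "(\<Sum>j\<in>Basis. frechet_derivative (?T j) (at x) j) = b' (x, p) * ?e +
          \<i> * of_real t * (\<Sum>j\<in>Basis. c j (x, p) * of_real (G j (x, p))) * ?e"
        by (simp add: b'_def sum.distrib sum_distrib_left sum_distrib_right)
      also have "(\<Sum>j\<in>Basis. c j (x, p) * of_real (G j (x, p))) = b (x, p) * of_real (\<Sum>j\<in>Basis. G j (x, p) * G j (x, p) / H (x, p))"
        by (simp add: c_def sum_distrib_left mult.assoc)
      also have "(\<Sum>j\<in>Basis. G j (x, p) * G j (x, p) / H (x, p)) = 1"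
        unfolding sum_divide_distrib[symmetric] using Hpos[OF m] by (simp add: H_def)
      finally have s: "(\<Sum>j\<in>Basis. frechet_derivative (?T j) (at x) j) = b' (x, p) * ?e + \<i> * of_real t * (b (x, p) * of_real 1) * ?e" .
      have r: "osc_integrand K b' \<phi> t p x = b' (x, p) * ?e" "osc_integrand K b \<phi> t p x = b (x, p) * ?e"
        using True by (simp_all add: osc_integrand_def)
      show ?thesis unfolding s r by (simp add: mult.assoc)
    qed
    have Dint: "integrable lborel (\<lambda>x. frechet_derivative (?T j) (at x) j)" for j
      using test_fun_integrable[OF test_fun_deriv(1)[OF T, of "[j]"]] by simp
    have "(\<integral>x. osc_integrand K b' \<phi> t p x + \<i> * of_real t * osc_integrand K b \<phi> t p x \<partial>lborel) =
        (\<Sum>j\<in>Basis. \<integral>x. frechet_derivative (?T j) (at x) j \<partial>lborel)"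
      unfolding D[symmetric] by (rule Bochner_Integration.integral_sum[OF Dint])
    also have "\<dots> = 0" by (intro sum.neutral ballI integral_deriv_zero[OF T])
    finally have "(\<integral>x. osc_integrand K b' \<phi> t p x \<partial>lborel) + \<i> * of_real t * (\<integral>x. osc_integrand K b \<phi> t p x \<partial>lborel) = 0"
      using test_fun_integrable[OF Tb(1)] test_fun_integrable[OF Tb(2)] by simp
    then have "(\<integral>x. osc_integrand K b' \<phi> t p x \<partial>lborel) = - (\<i> * of_real t * (\<integral>x. osc_integrand K b \<phi> t p x \<partial>lborel))"
      by (simp add: add_eq_0_iff2)
    then show ?thesis using t by (simp add: norm_mult)
  qed
  note step = this
  have "t ^ Suc N * norm (\<integral>x. osc_integrand K b \<phi> t p x \<partial>lborel) \<le> C" if "p \<in> Q" "t > 0" for p t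
    using C(2)[rule_format, OF that] by (simp only: power_Suc2 mult.assoc step[OF that])
  then show ?case using C(1) by (intro exI[of _ C]) auto
qed

subsection \<open>The local estimate\<close>

text \<open>The covector $k \circ d_xf(\cdot,a)$, expressed by the joint derivative of \<open>f\<close>.\<close>

definition pullc :: "('a::euclidean_space \<times> 'c::euclidean_space \<Rightarrow> 'b::euclidean_space) \<Rightarrow> 'a \<Rightarrow> 'c \<Rightarrow> 'b \<Rightarrow> 'a" where
  "pullc f x a k = (\<Sum>i\<in>Basis. (k \<bullet> frechet_derivative f (at (x, a)) (i, 0)) *\<^sub>R i)"

lemma pullc_eq_pull_covector:
  assumes "smooth_on S f" "(x, a) \<in> S"
  shows "pull_covector (\<lambda>x. f (x, a)) x k = pullc f x a k"
  unfolding pull_covector_def pullc_def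
    frechet_derivative_at[OF slice_has_derivative[OF assms], symmetric]
  by (intro sum.cong refl arg_cong[where f="\<lambda>t. t *\<^sub>R _"] euclidean_inner[symmetric])

lemma pullc_scale: "pullc f x a (t *\<^sub>R k) = t *\<^sub>R pullc f x a k"
  unfolding pullc_def by (simp add: scaleR_sum_right)

lemma pullc_continuous:
  assumes "smooth_on (X \<times> P) f"
  shows "continuous_on (X \<times> P \<times> UNIV) (\<lambda>(x, a, k). pullc f x a k)"
proof -
  have "continuous_on (X \<times> P \<times> UNIV) (\<lambda>z. frechet_derivative f (at (fst z, fst (snd z))) (i, 0))" for i
    by (rule continuous_on_compose2[OF smooth_on_continuous[OF smooth_on_deriv[OF assms, of "(i, 0)"]]])
       (auto intro!: continuous_intros)
  then show ?thesis
    unfolding pullc_def case_prod_beta by (intro continuous_intros)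
qed

text \<open>The bound \<open>S\<close> combines a conic seminorm, for frequencies \<open>l\<close> in \<open>W\<close> of size at least \<open>\<epsilon> * norm k\<close>, and
  the seminorm of the bounded set \<open>B\<close>, for the frequencies where the phase is nonstationary.\<close>

lemma core_estimate:
  fixes f :: "'a::euclidean_space \<times> 'c::euclidean_space \<Rightarrow> 'b::euclidean_space"
    and b :: "'a \<times> 'c \<Rightarrow> complex"
  assumes XP: "open X" "open P" and f: "smooth_on (X \<times> P) f" and b: "smooth_on (X \<times> P) b"
    and KQ: "compact K" "compact Q" "K \<subseteq> X" "Q \<subseteq> P"
    and b0: "\<And>x a. x \<in> X - K \<Longrightarrow> a \<in> P \<Longrightarrow> b (x, a) = 0"
    and V: "closed V" "conic_set V" and W: "open W" "conic_set W"
    and nz: "\<And>x a k. x \<in> K \<Longrightarrow> a \<in> Q \<Longrightarrow> k \<in> V \<Longrightarrow> k \<noteq> 0 \<Longrightarrow> pullc f x a k \<in> W \<and> pullc f x a k \<noteq> 0"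
    and \<theta>: "\<theta> \<in> test_fun \<Omega>"
  obtains B N1 c where "test_bounded \<Omega> B" "c \<ge> 0"
    "\<And>u S a k. u \<in> distributions \<Omega> \<Longrightarrow> 0 \<le> S \<Longrightarrow>
      (\<And>l. l \<in> W \<Longrightarrow> (1 + norm l) ^ N1 * norm (u (\<lambda>x. \<theta> x * expi l x)) \<le> S) \<Longrightarrow>
      (\<And>\<phi>. \<phi> \<in> B \<Longrightarrow> norm (u \<phi>) \<le> S) \<Longrightarrow> a \<in> Q \<Longrightarrow> k \<in> V \<Longrightarrow>
      (1 + norm k) ^ N * norm (u (\<lambda>x. \<theta> x * (if x \<in> K then b (x, a) * expi k (f (x, a)) else 0))) \<le> c * S"
proof -
  define d where "d = DIM('a)"
  have "bounded (supp \<theta> \<union> K)" using compact_imp_bounded test_funD(2)[OF \<theta>] KQ(1) by auto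
  then obtain L where L0: "L \<ge> 1" "supp \<theta> \<union> K \<subseteq> icube L"
    by (rule bounded_subset_icube)
  then have L: "L \<ge> 1" "supp \<theta> \<subseteq> icube L" "K \<subseteq> icube L" by simp_all
  define vol where "vol = measure lborel (cube L :: 'a set)"
  have vol: "vol > 0" unfolding vol_def using L(1) by (intro measure_cube_pos) simp
  obtain \<epsilon> where \<epsilon>: "\<epsilon> > 0" "\<And>x a k. x \<in> K \<Longrightarrow> a \<in> Q \<Longrightarrow> k \<in> V \<Longrightarrow> k \<noteq> 0 \<Longrightarrow> \<epsilon> * norm k < norm (pullc f x a k)"
  proof -
    let ?S = "K \<times> Q \<times> (V \<inter> sphere 0 1)"
    have cS: "compact ?S" by (intro compact_Times KQ closed_Int_compact V compact_sphere)
    have cont: "continuous_on ?S (\<lambda>(x, a, k). norm (pullc f x a k))"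
      using continuous_on_norm[OF continuous_on_subset[OF pullc_continuous[OF f], of ?S]] KQ
      by (auto simp: case_prod_beta)
    have "\<exists>m>0. \<forall>x\<in>K. \<forall>a\<in>Q. \<forall>k\<in>V \<inter> sphere 0 1. m \<le> norm (pullc f x a k)"
    proof (cases "?S = {}")
      case True
      then show ?thesis by (intro exI[of _ 1]) auto
    next
      case False
      from continuous_attains_inf[OF cS False cont] obtain x0 a0 k0 where
        m: "x0 \<in> K" "a0 \<in> Q" "k0 \<in> V \<inter> sphere 0 1"
           "\<forall>z\<in>?S. norm (pullc f x0 a0 k0) \<le> (case z of (x, a, k) \<Rightarrow> norm (pullc f x a k))" by auto
      have "k0 \<noteq> 0" using m(3) by auto
      then have "pullc f x0 a0 k0 \<noteq> 0" using nz[of x0 a0 k0] m(1-3) by blast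
      then show ?thesis using m(4) by (intro exI[of _ "norm (pullc f x0 a0 k0)"]) auto
    qed
    then obtain m where m: "m > 0" "\<And>x a k. x \<in> K \<Longrightarrow> a \<in> Q \<Longrightarrow> k \<in> V \<inter> sphere 0 1 \<Longrightarrow> m \<le> norm (pullc f x a k)" by blast
    \<comment> \<open>Halving the minimum gives the strict inequality that separates l with norm l
      <= \<epsilon> * norm k from the pulled back covector.\<close>
    show thesis
    proof (rule that[of "m / 2"])
      fix x a k assume k: "x \<in> K" "a \<in> Q" "k \<in> V" "k \<noteq> 0"
      have "(1 / norm k) *\<^sub>R k \<in> V" using V(2) k unfolding conic_set_def by simp
      then have "m \<le> norm (pullc f x a ((1 / norm k) *\<^sub>R k))" using m(2)[OF k(1,2)] k(4) by simp
      then have "m * norm k \<le> norm (pullc f x a k)" using k(4) by (simp add: pullc_scale field_simps)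
      moreover have "m / 2 * norm k < m * norm k" using m(1) k(4) by simp
      ultimately show "m / 2 * norm k < norm (pullc f x a k)" by linarith
    qed (use m in simp)
  qed
  \<comment> \<open>The frequencies to be handled by nonstationary phase. The complement leaves norm
    k < norm l / \<epsilon>, which converts decay in l into decay in k.\<close>
  define bad where "bad k l \<longleftrightarrow> l \<notin> W \<or> norm l \<le> \<epsilon> * norm k" for k :: 'b and l :: 'a
  define Q' where "Q' = {(a, k, l). a \<in> Q \<and> k \<in> V \<and> norm k + norm l = 1 \<and> bad k l}"
  \<comment> \<open>The open set of parameters where the phase l . x - k . f(x, a) has nonzero
    x-gradient, this gradient being l - \<open>pullc f x a k\<close>.\<close>
  define O' where "O' = {(x, a, k, l). x \<in> X \<and> a \<in> P \<and> pullc f x a k \<noteq> l}"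
  define \<phi> where "\<phi> = (\<lambda>(x, a, k, l). l \<bullet> x - k \<bullet> f (x, a))"
  define b1 where "b1 = (\<lambda>(x, a, k :: 'b, l :: 'a). b (x, a))"
  have oXP: "open (X \<times> P \<times> (UNIV :: ('b \<times> 'a) set))" using XP by (intro open_Times) auto
  have fs: "smooth_on (X \<times> P \<times> (UNIV :: ('b \<times> 'a) set)) (\<lambda>z. g (fst z, fst (snd z)))"
    if "smooth_on (X \<times> P) g" for g :: "'a \<times> 'c \<Rightarrow> 'd::real_normed_vector"
    by (rule smooth_on_compose[OF oXP open_Times[OF XP] _ that])
       (auto intro!: smooth_on_linear[OF oXP] bounded_linear_Pair bounded_linear_fst bounded_linear_compose[OF bounded_linear_fst bounded_linear_snd])
  have sub: "O' \<subseteq> X \<times> P \<times> UNIV" by (auto simp: O'_def)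
  have oO: "open O'"
  proof -
    have cont: "continuous_on (X \<times> P \<times> (UNIV :: ('b \<times> 'a) set)) (\<lambda>z. pullc f (fst z) (fst (snd z)) (fst (snd (snd z))) - snd (snd (snd z)))"
    proof -
      have "continuous_on (X \<times> P \<times> (UNIV :: ('b \<times> 'a) set)) (\<lambda>z. (\<lambda>(x, a, k). pullc f x a k) (fst z, fst (snd z), fst (snd (snd z))))"
        by (rule continuous_on_compose2[OF pullc_continuous[OF f]]) (auto intro!: continuous_intros)
      then show ?thesis by (auto intro!: continuous_intros)
    qed
    have "open ((X \<times> P \<times> (UNIV :: ('b \<times> 'a) set)) \<inter> (\<lambda>z. pullc f (fst z) (fst (snd z)) (fst (snd (snd z))) - snd (snd (snd z))) -` (- {0}))"
      by (rule continuous_open_preimage[OF cont oXP open_Compl[OF closed_singleton]])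
    also have "(X \<times> P \<times> (UNIV :: ('b \<times> 'a) set)) \<inter> (\<lambda>z. pullc f (fst z) (fst (snd z)) (fst (snd (snd z))) - snd (snd (snd z))) -` (- {0}) = O'"
      by (auto simp: O'_def)
    finally show ?thesis .
  qed
  have \<phi>s: "smooth_on O' \<phi>"
  proof -
    have "smooth_on (X \<times> P \<times> UNIV) (\<lambda>z. snd (snd (snd z)) \<bullet> fst z - fst (snd (snd z)) \<bullet> f (fst z, fst (snd z)))"
      by (intro smooth_on_diff smooth_on_inner oXP fs[OF f] smooth_on_linear[OF oXP]
            bounded_linear_fst bounded_linear_snd bounded_linear_compose[OF bounded_linear_fst]
            bounded_linear_compose[OF bounded_linear_snd])
    then show ?thesis unfolding \<phi>_def case_prod_beta by (rule smooth_on_mono[OF _ sub])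
  qed
  have b1s: "smooth_on O' b1"
    unfolding b1_def case_prod_beta by (rule smooth_on_mono[OF fs[OF b] sub])
  have b10: "b1 (x, p) = 0" if "(x, p) \<in> O'" "x \<notin> K" for x p
    using that b0 by (auto simp: O'_def b1_def)
  have Q'c: "compact Q'"
  proof -
    have e: "Q' = (Q \<times> (V \<inter> cball 0 1) \<times> cball 0 1) \<inter>
        {z. norm (fst (snd z)) + norm (snd (snd z)) = 1} \<inter>
        (UNIV \<times> UNIV \<times> (- W) \<union> {z. norm (snd (snd z)) \<le> \<epsilon> * norm (fst (snd z))})"
    proof -
      have "norm k + norm l = 1 \<Longrightarrow> norm k \<le> 1 \<and> norm l \<le> 1" for k :: 'b and l :: 'a
        using norm_ge_zero[of k] norm_ge_zero[of l] by linarith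
      then show ?thesis by (auto simp: Q'_def bad_def)
    qed
    have "compact (Q \<times> (V \<inter> cball 0 1) \<times> cball (0::'a) 1)"
      by (intro compact_Times KQ closed_Int_compact V compact_cball)
    moreover have "closed {z::'c \<times> 'b \<times> 'a. norm (fst (snd z)) + norm (snd (snd z)) = 1}"
      by (intro closed_Collect_eq continuous_intros)
    moreover have "closed ((UNIV :: 'c set) \<times> (UNIV :: 'b set) \<times> (- W) \<union> {z. norm (snd (snd z)) \<le> \<epsilon> * norm (fst (snd z))})"
      by (intro closed_Un closed_Times closed_UNIV closed_Collect_le continuous_intros) (use W in auto)
    ultimately show ?thesis unfolding e by (intro compact_Int_closed)
  qed
  \<comment> \<open>Three ways to differ from the pulled back covector: l lies outside W, or l is
    too short, or k = 0, and then l has norm 1 while the pulled back covector is 0.\<close>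
  have KQ': "K \<times> Q' \<subseteq> O'"
  proof safe
    fix x a k l assume x: "x \<in> K" and q: "(a, k, l) \<in> Q'"
    have "pullc f x a k \<noteq> l"
    proof (cases "k = 0")
      case True
      then have "pullc f x a k = 0" by (simp add: pullc_def)
      then show ?thesis using q True by (auto simp: Q'_def)
    next
      case False
      have a: "a \<in> Q" and kV: "k \<in> V" and bad: "bad k l" using q by (auto simp: Q'_def)
      show ?thesis using bad nz[OF x a kV False] \<epsilon>(2)[OF x a kV False] by (auto simp: bad_def)
    qed
    then show "(x, a, k, l) \<in> O'" using x q KQ by (auto simp: O'_def Q'_def)
  qed
  have grad: "\<exists>j\<in>Basis. frechet_derivative \<phi> (at z) (j, 0) \<noteq> 0" if z: "z \<in> O'" for z
  proof -
    obtain x a k l where zz: "z = (x, a, k, l)" by (cases z) auto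
    have m: "(x, a) \<in> X \<times> P" "pullc f x a k \<noteq> l" using z by (auto simp: O'_def zz)
    have 1: "((\<lambda>x. \<phi> (x, a, k, l)) has_derivative (\<lambda>v. frechet_derivative \<phi> (at z) (v, 0))) (at x)"
      unfolding zz by (rule slice_has_derivative[OF \<phi>s]) (use z zz in simp)
    have "((\<lambda>x. l \<bullet> x - k \<bullet> f (x, a)) has_derivative
        (\<lambda>v. l \<bullet> v - k \<bullet> frechet_derivative f (at (x, a)) (v, 0))) (at x)"
      by (intro has_derivative_diff bounded_linear.has_derivative[OF bounded_linear_inner_right]
            has_derivative_ident slice_has_derivative[OF f m(1)])
    then have 2: "((\<lambda>x. \<phi> (x, a, k, l)) has_derivative
        (\<lambda>v. l \<bullet> v - k \<bullet> frechet_derivative f (at (x, a)) (v, 0))) (at x)"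
      by (simp add: \<phi>_def)
    have eq: "frechet_derivative \<phi> (at z) (j, 0) = (l - pullc f x a k) \<bullet> j" if "j \<in> Basis" for j
      using fun_cong[OF has_derivative_unique[OF 1 2], of j] that
      by (simp add: pullc_def inner_diff_left)
    have "l - pullc f x a k \<noteq> 0" using m(2) by simp
    then obtain j where "j \<in> Basis" "(l - pullc f x a k) \<bullet> j \<noteq> 0" using euclidean_all_zero_iff by blast
    then show ?thesis using eq by auto
  qed
  define \<psi> where "\<psi> a k = (\<lambda>x. if x \<in> K then b (x, a) * expi k (f (x, a)) else 0)" for a k
  have \<psi>t: "\<psi> a k \<in> test_fun X" if a: "a \<in> P" for a k
    unfolding \<psi>_def
  proof (rule test_fun_restrict[OF XP(1) KQ(1,3)])
    show "smooth_on X (\<lambda>x. b (x, a) * expi k (f (x, a)))"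
      by (intro smooth_on_mult XP smooth_on_slice[OF XP b a]
            smooth_on_compose[OF XP(1) open_UNIV smooth_on_slice[OF XP f a] smooth_on_expi[OF open_UNIV]] UNIV_I)
  qed (use b0 a in auto)
  have \<psi>s: "supp (\<psi> a k) \<subseteq> K" for a k
    by (rule supp_subsetI[OF compact_imp_closed[OF KQ(1)]]) (simp add: \<psi>_def)
  obtain cb where cb: "cb > 0" "\<And>z. z \<in> K \<times> Q \<Longrightarrow> norm (b z) \<le> cb"
    using continuous_compact_bound[OF smooth_on_continuous[OF b] compact_Times[OF KQ(1,2)]] KQ by blast
  \<comment> \<open>The trivial bound on the coefficients, uniform in a, k and l. It serves the good
    frequencies and the summand 1 in 1 + t^M.\<close>
  define C0 where "C0 = cb * measure lborel K / vol"
  have C0: "C0 \<ge> 0" using cb vol by (simp add: C0_def)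
  have fc0: "norm (fcoef L (\<psi> a k) l) \<le> C0" if a: "a \<in> Q" for a k l
  proof -
    have aP: "a \<in> P" using a KQ by auto
    have "norm (\<integral>x. \<psi> a k x * expi (- l) x \<partial>lborel) \<le> cb * measure lborel K"
      by (rule norm_integral_le_measure[OF test_fun_integrable[OF test_fun_expi[OF \<psi>t[OF aP]]] KQ(1)])
         (use cb a in \<open>auto simp: \<psi>_def norm_mult\<close>)
    then show ?thesis using vol by (simp add: fcoef_def C0_def norm_divide vol_def[symmetric] divide_right_mono)
  qed
  \<comment> \<open>The phase is linear in (k, l), so scaling both by t multiplies the phase by
    t.\<close>
  have osc: "fcoef L (\<psi> a (t *\<^sub>R k)) (t *\<^sub>R l) = (\<integral>x. osc_integrand K b1 \<phi> t (a, k, l) x \<partial>lborel) / of_real vol" for a k l t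
  proof -
    have "\<psi> a (t *\<^sub>R k) x * expi (- (t *\<^sub>R l)) x = osc_integrand K b1 \<phi> t (a, k, l) x" for x
      by (simp add: \<psi>_def osc_integrand_def b1_def \<phi>_def expi_def mult.assoc exp_add[symmetric] algebra_simps)
    then show ?thesis by (simp add: fcoef_def vol_def)
  qed
  have decay: "\<exists>C\<ge>0. \<forall>a\<in>Q. \<forall>k\<in>V. \<forall>l. bad k l \<longrightarrow> (1 + norm k + norm l) ^ M * norm (fcoef L (\<psi> a k) l) \<le> C" for M
  proof -
    obtain C where C: "C \<ge> 0" "\<forall>p\<in>Q'. \<forall>t>0. t ^ M * norm (\<integral>x. osc_integrand K b1 \<phi> t p x \<partial>lborel) \<le> C"
      using nonstationary_phase[OF oO \<phi>s KQ(1) Q'c KQ' grad b1s b10] by blast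
    have "(1 + norm k + norm l) ^ M * norm (fcoef L (\<psi> a k) l) \<le> 2 ^ M * (C0 + (C0 + C / vol))"
      if a: "a \<in> Q" and k: "k \<in> V" and bd: "bad k l" for a k l
    proof -
      define t where "t = norm k + norm l"
      have t0: "t \<ge> 0" by (simp add: t_def)
      have tM: "t ^ M * norm (fcoef L (\<psi> a k) l) \<le> C0 + C / vol"
      proof (cases "t = 0")
        case True
        then have "t ^ M * norm (fcoef L (\<psi> a k) l) \<le> 1 * norm (fcoef L (\<psi> a k) l)"
          by (intro mult_right_mono) (auto simp: power_0_left)
        also have "\<dots> \<le> C0 + C / vol" using fc0[OF a, of k l] C(1) vol by (simp add: add_increasing2)
        finally show ?thesis .
      next
        case False
        then have tp: "t > 0" using t0 by simp
        have "(a, (1 / t) *\<^sub>R k, (1 / t) *\<^sub>R l) \<in> Q'"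
        proof -
          have "(1 / t) *\<^sub>R k \<in> V" using V(2) k tp unfolding conic_set_def by simp
          moreover have "norm ((1 / t) *\<^sub>R k) + norm ((1 / t) *\<^sub>R l) = 1"
            using tp by (simp add: add_divide_distrib[symmetric] t_def[symmetric])
          moreover have "bad ((1 / t) *\<^sub>R k) ((1 / t) *\<^sub>R l)"
          proof (cases "l \<in> W")
            case False
            have "(1 / t) *\<^sub>R l \<notin> W"
            proof
              assume "(1 / t) *\<^sub>R l \<in> W"
              then have "t *\<^sub>R ((1 / t) *\<^sub>R l) \<in> W" using W(2) tp unfolding conic_set_def by blast
              then show False using False tp by simp
            qed
            then show ?thesis by (simp add: bad_def)
          next
            case True
            then show ?thesis using bd tp by (simp add: bad_def divide_right_mono)
          qed
          ultimately show ?thesis using a by (simp add: Q'_def)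
        qed
        from C(2)[rule_format, OF this tp]
        have "t ^ M * norm (fcoef L (\<psi> a (t *\<^sub>R (1 / t) *\<^sub>R k)) (t *\<^sub>R (1 / t) *\<^sub>R l)) \<le> C / vol"
          unfolding osc using vol by (simp add: norm_divide divide_right_mono)
        then show ?thesis using tp C0 by simp
      qed
      have "(1 + t) ^ M \<le> 2 ^ M * (1 + t ^ M)" by (rule one_plus_power_le[OF t0])
      then have "(1 + t) ^ M * norm (fcoef L (\<psi> a k) l) \<le> 2 ^ M * (1 + t ^ M) * norm (fcoef L (\<psi> a k) l)"
        by (rule mult_right_mono) simp
      also have "\<dots> = 2 ^ M * (norm (fcoef L (\<psi> a k) l) + t ^ M * norm (fcoef L (\<psi> a k) l))" by (simp add: algebra_simps)
      also have "\<dots> \<le> 2 ^ M * (C0 + (C0 + C / vol))"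
        by (intro mult_left_mono add_mono fc0 a tM) auto
      finally show ?thesis by (simp add: t_def add.assoc)
    qed
    then show ?thesis using C0 C(1) vol by (intro exI[of _ "2 ^ M * (C0 + (C0 + C / vol))"]) auto
  qed
  have "\<exists>C. C \<ge> 0 \<and> (\<forall>a\<in>Q. \<forall>k\<in>V. \<forall>l. bad k l \<longrightarrow> (1 + norm k + norm l) ^ M * norm (fcoef L (\<psi> a k) l) \<le> C)" for M
    using decay[of M] by blast
  then obtain C where C: "\<And>M. C M \<ge> 0"
    "\<And>M a k l. a \<in> Q \<Longrightarrow> k \<in> V \<Longrightarrow> bad k l \<Longrightarrow> (1 + norm k + norm l) ^ M * norm (fcoef L (\<psi> a k) l) \<le> C M"
    by metis
  \<comment> \<open>The factors are the gain wanted in k and the inverse of \<open>weight\<close> in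
    l. Further powers of 1 + norm l, coming from derivatives of the exponential, are absorbed by the
    decay of the coefficient, so the functions in B stay bounded in every
    \<open>Ck_norm\<close>.\<close>
  define \<gamma> where "\<gamma> a k l = of_real ((1 + norm k) ^ N * (1 + norm l) ^ (2 * d)) * fcoef L (\<psi> a k) l" for a k l
  define B where "B = {\<lambda>x. \<gamma> a k l * (\<theta> x * expi l x) | a k l. a \<in> Q \<and> k \<in> V \<and> bad k l}"
  have \<gamma>b: "norm (\<gamma> a k l) * (1 + norm l) ^ m \<le> C (N + 2 * d + m)" if a: "a \<in> Q" "k \<in> V" "bad k l" for a k l m
  proof -
    have "norm (\<gamma> a k l) * (1 + norm l) ^ m = ((1 + norm k) ^ N * (1 + norm l) ^ (2 * d) * (1 + norm l) ^ m) * norm (fcoef L (\<psi> a k) l)"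
      by (simp add: \<gamma>_def norm_mult norm_power abs_of_nonneg flip: of_real_power of_real_add)
    also have "\<dots> \<le> ((1 + norm k + norm l) ^ N * (1 + norm k + norm l) ^ (2 * d) * (1 + norm k + norm l) ^ m) * norm (fcoef L (\<psi> a k) l)"
      by (intro mult_right_mono mult_mono power_mono) auto
    also have "\<dots> \<le> C (N + 2 * d + m)" using C(2)[OF a, of "N + 2 * d + m"] by (simp add: power_add)
    finally show ?thesis .
  qed
  have Bt: "test_bounded \<Omega> B"
  proof (rule test_boundedI[OF _ test_funD(2,3)[OF \<theta>]])
    show "B \<subseteq> test_fun \<Omega>" unfolding B_def using test_fun_cmult[OF test_fun_expi[OF \<theta>]] by auto
    show "supp \<phi> \<subseteq> supp \<theta>" if "\<phi> \<in> B" for \<phi>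
      by (rule supp_subsetI[OF closed_supp]) (use that in \<open>auto simp: B_def not_in_supp\<close>)
    fix m
    obtain e where e: "e \<ge> 0" "\<And>l. Ck_norm m (\<lambda>x. \<theta> x * expi l x) \<le> e * (1 + norm l) ^ m"
      using Ck_norm_expi_bound[OF \<theta>, of m] by blast
    have "Ck_norm m (\<lambda>x. \<gamma> a k l * (\<theta> x * expi l x)) \<le> e * C (N + 2 * d + m)"
      if a: "a \<in> Q" "k \<in> V" "bad k l" for a k l
    proof -
      have "Ck_norm m (\<lambda>x. \<gamma> a k l * (\<theta> x * expi l x)) = norm (\<gamma> a k l) * Ck_norm m (\<lambda>x. \<theta> x * expi l x)"
        by (rule Ck_norm_cmult[OF test_fun_expi[OF \<theta>]])
      also have "\<dots> \<le> norm (\<gamma> a k l) * (e * (1 + norm l) ^ m)" by (intro mult_left_mono e) simp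
      also have "\<dots> = e * (norm (\<gamma> a k l) * (1 + norm l) ^ m)" by (simp add: mult_ac)
      also have "\<dots> \<le> e * C (N + 2 * d + m)" by (intro mult_left_mono \<gamma>b a e)
      finally show ?thesis .
    qed
    then show "\<exists>M. \<forall>\<phi>\<in>B. Ck_norm m \<phi> \<le> M" by (intro exI[of _ "e * C (N + 2 * d + m)"]) (auto simp: B_def)
  qed
  \<comment> \<open>The second entry is for good frequencies, where 1 + norm k <= (1 + 1 /
    \<epsilon>) * (1 + norm l); the entry 1 is for bad ones. Accordingly N1 = N + 2 d: N powers are
    turned into decay in k and 2 d produce the weight.\<close>
  define A where "A = max 1 ((1 + 1 / \<epsilon>) ^ N * C0)"
  have A: "A \<ge> 1" "(1 + 1 / \<epsilon>) ^ N * C0 \<le> A" by (auto simp: A_def)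
  define Wt where "Wt = infsum weight (lattice L :: 'a set)"
  have Wt: "Wt \<ge> 0" unfolding Wt_def by (rule infsum_nonneg) (use weight_pos less_imp_le in blast)
  show thesis
  proof (rule that[OF Bt])
    show "0 \<le> A * Wt" using A Wt by simp
    fix u S a and k :: 'b
    assume u: "u \<in> distributions \<Omega>" and S: "0 \<le> S"
      and SW: "\<And>l. l \<in> W \<Longrightarrow> (1 + norm l) ^ (N + 2 * d) * norm (u (\<lambda>x. \<theta> x * expi l x)) \<le> S"
      and SB: "\<And>\<phi>. \<phi> \<in> B \<Longrightarrow> norm (u \<phi>) \<le> S" and a: "a \<in> Q" and k: "k \<in> V"
    have aP: "a \<in> P" using a KQ by auto
    let ?n = "(1 + norm k) ^ N"
    have n0: "?n > 0" by (simp add: add_pos_nonneg)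
    have wt: "(1 + norm l) ^ (2 * d) * weight l = 1" for l :: 'a
    proof -
      have "1 + norm l \<noteq> 0" using norm_ge_zero[of l] by linarith
      then show ?thesis by (simp add: weight_def d_def)
    qed
    have main: "?n * (norm (fcoef L (\<psi> a k) l) * norm (u (\<lambda>x. \<theta> x * expi l x))) \<le> A * S * weight l" for l
    proof (cases "bad k l")
      case True
      have "(\<lambda>x. \<gamma> a k l * (\<theta> x * expi l x)) \<in> B" unfolding B_def using a k True by blast
      from SB[OF this] have "norm (\<gamma> a k l) * norm (u (\<lambda>x. \<theta> x * expi l x)) \<le> S"
        by (simp add: distr_cmult[OF u test_fun_expi[OF \<theta>]] norm_mult)
      moreover have "norm (\<gamma> a k l) = ?n * (1 + norm l) ^ (2 * d) * norm (fcoef L (\<psi> a k) l)"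
        by (simp add: \<gamma>_def norm_mult norm_power abs_of_nonneg flip: of_real_power of_real_add)
      ultimately have le: "?n * (1 + norm l) ^ (2 * d) * norm (fcoef L (\<psi> a k) l) * norm (u (\<lambda>x. \<theta> x * expi l x)) \<le> S" by simp
      have "?n * (norm (fcoef L (\<psi> a k) l) * norm (u (\<lambda>x. \<theta> x * expi l x))) =
          (?n * (1 + norm l) ^ (2 * d) * norm (fcoef L (\<psi> a k) l) * norm (u (\<lambda>x. \<theta> x * expi l x))) * weight l"
        using arg_cong[OF wt[of l], of "\<lambda>z. ?n * (norm (fcoef L (\<psi> a k) l) * norm (u (\<lambda>x. \<theta> x * expi l x))) * z"]
        by (simp add: mult_ac)
      also have "\<dots> \<le> S * weight l" by (rule mult_right_mono[OF le]) (use weight_pos[of l] in simp)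
      also have "\<dots> \<le> A * S * weight l"
        using A(1) S weight_pos[of l] by (intro mult_right_mono) (auto simp: mult_le_cancel_right1 intro: mult_right_mono[of 1 A S, simplified])
      finally show ?thesis .
    next
      case False
      then have lW: "l \<in> W" and nl: "\<epsilon> * norm k < norm l" by (auto simp: bad_def)
      have "norm k \<le> norm l / \<epsilon>" using nl \<epsilon>(1) by (simp add: field_simps)
      also have "\<dots> \<le> (1 / \<epsilon>) * (1 + norm l)" using \<epsilon>(1) by (simp add: field_simps)
      finally have "1 + norm k \<le> (1 + 1 / \<epsilon>) * (1 + norm l)" using norm_ge_zero[of l] by (simp add: distrib_right del: norm_ge_zero)
      then have "?n \<le> ((1 + 1 / \<epsilon>) * (1 + norm l)) ^ N" by (intro power_mono) auto
      then have nle: "?n \<le> (1 + 1 / \<epsilon>) ^ N * (1 + norm l) ^ N" by (simp add: power_mult_distrib)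
      have "?n * (norm (fcoef L (\<psi> a k) l) * norm (u (\<lambda>x. \<theta> x * expi l x))) \<le>
          ((1 + 1 / \<epsilon>) ^ N * (1 + norm l) ^ N) * (C0 * norm (u (\<lambda>x. \<theta> x * expi l x)))"
        by (intro mult_mono nle mult_right_mono fc0 a mult_nonneg_nonneg) (use \<epsilon>(1) in auto)
      also have "\<dots> = ((1 + 1 / \<epsilon>) ^ N * C0) * ((1 + norm l) ^ (N + 2 * d) * norm (u (\<lambda>x. \<theta> x * expi l x))) * weight l"
        using arg_cong[OF wt[of l], of "\<lambda>z. ((1 + 1 / \<epsilon>) ^ N * (1 + norm l) ^ N) * (C0 * norm (u (\<lambda>x. \<theta> x * expi l x))) * z"]
        by (simp add: power_add mult_ac)
      also have "\<dots> \<le> A * S * weight l"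
        by (intro mult_right_mono mult_mono A SW lW) (use weight_pos[of l] A in auto)
      finally show ?thesis .
    qed
    have "norm (u (\<lambda>x. \<theta> x * \<psi> a k x)) \<le> (A * S / ?n) * Wt"
      unfolding Wt_def
    proof (rule distr_fourier_bound[OF u \<theta> L(2) \<psi>t[OF aP] order_trans[OF \<psi>s L(3)] L(1)])
      fix l :: 'a
      show "norm (fcoef L (\<psi> a k) l) * norm (u (\<lambda>x. \<theta> x * expi l x)) \<le> A * S / ?n * weight l"
        using main[of l] n0 by (simp add: field_simps)
    qed
    then have "?n * norm (u (\<lambda>x. \<theta> x * \<psi> a k x)) \<le> A * Wt * S"
      using n0 by (simp add: field_simps)
    then show "?n * norm (u (\<lambda>x. \<theta> x * (if x \<in> K then b (x, a) * expi k (f (x, a)) else 0))) \<le> A * Wt * S"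
      unfolding \<psi>_def .
  qed
qed

subsection \<open>Supports and pairings\<close>

text \<open>A partition of unity on the support splits \<phi> into finitely many pieces small enough
  for the local hypothesis.\<close>

lemma distr_local_zero:
  assumes u: "u \<in> distributions \<Omega>" and \<phi>: "\<phi> \<in> test_fun \<Omega>"
    and loc: "\<And>x. x \<in> supp \<phi> \<Longrightarrow> \<exists>r>0. \<forall>\<psi>\<in>test_fun \<Omega>. supp \<psi> \<subseteq> cball x r \<longrightarrow> u \<psi> = 0"
  shows "u \<phi> = 0"
proof -
  obtain r where r: "\<forall>x\<in>supp \<phi>. r x > 0 \<and> (\<forall>\<psi>\<in>test_fun \<Omega>. supp \<psi> \<subseteq> cball x (r x) \<longrightarrow> u \<psi> = 0)"
    using bchoice[of "supp \<phi>" "\<lambda>x r. r > 0 \<and> (\<forall>\<psi>\<in>test_fun \<Omega>. supp \<psi> \<subseteq> cball x r \<longrightarrow> u \<psi> = 0)"] loc by blast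
  have rp: "r l > 0" if "l \<in> supp \<phi>" for l using r that by blast
  obtain F \<rho> G where F: "finite F" "F \<subseteq> supp \<phi>" "open G" "supp \<phi> \<subseteq> G" and \<rho>: "\<And>l. smooth_on UNIV (\<rho> l)"
    and \<rho>0: "\<And>l x. l \<in> F \<Longrightarrow> x \<notin> cball l (r l) \<Longrightarrow> \<rho> l x = 0"
    and \<rho>1: "\<And>x. x \<in> G \<Longrightarrow> (\<Sum>l\<in>F. \<rho> l x) = (1::complex)"
    by (rule compact_partition[OF test_funD(2)[OF \<phi>] rp]) (assumption | (rule that; assumption))+
  have t: "(\<lambda>x. \<phi> x * \<rho> l x) \<in> test_fun \<Omega>" for l
    by (rule test_fun_mult_smooth[OF \<phi> open_UNIV subset_UNIV \<rho>])
  have z: "u (\<lambda>x. \<phi> x * \<rho> l x) = 0" if l: "l \<in> F" for l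
  proof -
    have "supp (\<lambda>x. \<phi> x * \<rho> l x) \<subseteq> cball l (r l)"
      by (rule supp_subsetI) (use \<rho>0[OF l] in auto)
    then show ?thesis using r t l F(2) by blast
  qed
  have "\<phi> x = (\<Sum>l\<in>F. \<phi> x * \<rho> l x)" for x
    using \<rho>1[of x] F(4) not_in_supp[of x \<phi>] by (cases "x \<in> supp \<phi>") (auto simp: sum_distrib_left[symmetric])
  then have "u \<phi> = u (\<lambda>x. \<Sum>l\<in>F. \<phi> x * \<rho> l x)" by presburger
  also have "\<dots> = (\<Sum>l\<in>F. u (\<lambda>x. \<phi> x * \<rho> l x))" by (rule distr_sum[OF u F(1) t])
  finally show ?thesis using z by simp
qed

lemma distr_zero_off_dsupp:
  assumes u: "u \<in> distributions \<Omega>" and \<phi>: "\<phi> \<in> test_fun \<Omega>" and disj: "supp \<phi> \<inter> dsupp \<Omega> u = {}"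
  shows "u \<phi> = 0"
proof (rule distr_local_zero[OF u \<phi>])
  fix x assume x: "x \<in> supp \<phi>"
  then have "x \<in> \<Omega>" "x \<notin> dsupp \<Omega> u" using test_funD(3)[OF \<phi>] disj by auto
  then obtain W where W: "open W" "x \<in> W" "W \<subseteq> \<Omega>" "\<forall>\<psi>\<in>test_fun W. u \<psi> = 0"
    unfolding dsupp_def by blast
  obtain r where r: "r > 0" "cball x r \<subseteq> W" using open_contains_cball_eq[OF W(1)] W(2) by blast
  have "u \<psi> = 0" if "\<psi> \<in> test_fun \<Omega>" "supp \<psi> \<subseteq> cball x r" for \<psi>
  proof -
    have "\<psi> \<in> test_fun W" using that r unfolding test_fun_def by blast
    then show ?thesis using W(4) by blast
  qed
  then show "\<exists>r>0. \<forall>\<psi>\<in>test_fun \<Omega>. supp \<psi> \<subseteq> cball x r \<longrightarrow> u \<psi> = 0" using r(1) by blast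
qed

text \<open>Expresses the support condition by linear equations in u, from which stability under
  sums and multiples is immediate.\<close>

lemma dsupp_subset_iff:
  assumes "open \<Omega>" "closedin (top_of_set \<Omega>) C" "u \<in> distributions \<Omega>"
  shows "dsupp \<Omega> u \<subseteq> C \<longleftrightarrow> (\<forall>\<phi>\<in>test_fun \<Omega>. supp \<phi> \<inter> C = {} \<longrightarrow> u \<phi> = 0)"
proof (intro iffI ballI impI)
  fix \<phi> assume "dsupp \<Omega> u \<subseteq> C" "\<phi> \<in> test_fun \<Omega>" "supp \<phi> \<inter> C = {}"
  then show "u \<phi> = 0" by (intro distr_zero_off_dsupp[OF assms(3)]) auto
next
  assume z: "\<forall>\<phi>\<in>test_fun \<Omega>. supp \<phi> \<inter> C = {} \<longrightarrow> u \<phi> = 0"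
  show "dsupp \<Omega> u \<subseteq> C"
  proof
    fix x assume x: "x \<in> dsupp \<Omega> u"
    show "x \<in> C"
    proof (rule ccontr)
      assume xC: "x \<notin> C"
      have "openin (top_of_set \<Omega>) (\<Omega> - C)" using assms(2) by (simp add: openin_diff)
      then have "open (\<Omega> - C)" using assms(1) openin_open_eq by blast
      moreover have "x \<in> \<Omega> - C" using x xC by (simp add: dsupp_def)
      moreover have "\<forall>W. open W \<and> x \<in> W \<and> W \<subseteq> \<Omega> \<longrightarrow> (\<exists>\<phi>\<in>test_fun W. u \<phi> \<noteq> 0)"
        using x unfolding dsupp_def by simp
      ultimately have "\<exists>\<phi>\<in>test_fun (\<Omega> - C). u \<phi> \<noteq> 0" by blast
      then obtain \<phi> where \<phi>: "\<phi> \<in> test_fun (\<Omega> - C)" "u \<phi> \<noteq> 0" by blast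
      then have "\<phi> \<in> test_fun \<Omega>" "supp \<phi> \<inter> C = {}"
        using test_funD(3)[OF \<phi>(1)] test_fun_mono[OF \<phi>(1)] by auto
      then show False using z \<phi>(2) by blast
    qed
  qed
qed

text \<open>Two admissible cutoffs agree near the intersection of the supports, so their difference
  times \<psi> is supported off \<open>dsupp \<Omega> u\<close>. Exhibiting one cutoff then
  determines the value of \<open>THE\<close>.\<close>

lemma pairing_eq:
  assumes \<Omega>: "open \<Omega>" and u: "u \<in> distributions \<Omega>" and \<psi>: "smooth_on \<Omega> \<psi>"
    and \<theta>: "\<theta> \<in> test_fun \<Omega>" and W: "open W" "dsupp \<Omega> u \<inter> closure {x \<in> \<Omega>. \<psi> x \<noteq> 0} \<subseteq> W" "\<And>x. x \<in> W \<Longrightarrow> \<theta> x = 1"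
  shows "pairing \<Omega> u \<psi> = u (\<lambda>x. \<theta> x * \<psi> x)"
proof -
  have uniq: "u (\<lambda>x. \<theta>' x * \<psi> x) = u (\<lambda>x. \<theta> x * \<psi> x)"
    if \<theta>': "\<theta>' \<in> test_fun \<Omega>" and W': "open W'" "dsupp \<Omega> u \<inter> closure {x \<in> \<Omega>. \<psi> x \<noteq> 0} \<subseteq> W'" "\<forall>x\<in>W'. \<theta>' x = 1" for \<theta>' W'
  proof -
    have t: "(\<lambda>x. \<theta> x * \<psi> x) \<in> test_fun \<Omega>" "(\<lambda>x. \<theta>' x * \<psi> x) \<in> test_fun \<Omega>"
      using test_fun_mult_smooth[OF \<theta> \<Omega> test_funD(3)[OF \<theta>] \<psi>] test_fun_mult_smooth[OF \<theta>' \<Omega> test_funD(3)[OF \<theta>'] \<psi>] by auto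
    let ?g = "\<lambda>x. \<theta>' x * \<psi> x - \<theta> x * \<psi> x"
    have "supp ?g \<inter> dsupp \<Omega> u = {}"
    proof (rule ccontr)
      assume "supp ?g \<inter> dsupp \<Omega> u \<noteq> {}"
      then obtain x where x: "x \<in> supp ?g" "x \<in> dsupp \<Omega> u" by blast
      have "{x. ?g x \<noteq> 0} \<subseteq> {x \<in> \<Omega>. \<psi> x \<noteq> 0}"
      proof
        fix x assume x: "x \<in> {x. ?g x \<noteq> 0}"
        then have "\<theta> x \<noteq> 0 \<or> \<theta>' x \<noteq> 0" by auto
        then have "x \<in> supp \<theta> \<or> x \<in> supp \<theta>'" using not_in_supp by blast
        then show "x \<in> {x \<in> \<Omega>. \<psi> x \<noteq> 0}" using x test_funD(3)[OF \<theta>] test_funD(3)[OF \<theta>'] by auto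
      qed
      then have "x \<in> closure {x \<in> \<Omega>. \<psi> x \<noteq> 0}" using x(1) closure_mono unfolding supp_def by blast
      then have xW: "x \<in> W \<inter> W'" using x(2) W W' by blast
      have "supp ?g \<subseteq> - (W \<inter> W')"
        by (rule supp_subsetI) (use W W' in \<open>auto simp: open_Int\<close>)
      then show False using x(1) xW by blast
    qed
    then have "u ?g = 0" by (rule distr_zero_off_dsupp[OF u test_fun_diff[OF t(2,1)]])
    then show ?thesis using distr_diff[OF u t(2,1)] by simp
  qed
  show ?thesis
    unfolding pairing_def
  proof (rule the_equality)
    show "\<forall>\<theta>'\<in>test_fun \<Omega>. (\<exists>W. open W \<and> dsupp \<Omega> u \<inter> closure {x \<in> \<Omega>. \<psi> x \<noteq> 0} \<subseteq> W \<and> (\<forall>x\<in>W. \<theta>' x = 1)) \<longrightarrow>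
       u (\<lambda>x. \<theta>' x * \<psi> x) = u (\<lambda>x. \<theta> x * \<psi> x)"
      using uniq by blast
    fix z
    assume "\<forall>\<theta>'\<in>test_fun \<Omega>. (\<exists>W. open W \<and> dsupp \<Omega> u \<inter> closure {x \<in> \<Omega>. \<psi> x \<noteq> 0} \<subseteq> W \<and> (\<forall>x\<in>W. \<theta>' x = 1)) \<longrightarrow>
       u (\<lambda>x. \<theta>' x * \<psi> x) = z"
    from bspec[OF this \<theta>] show "z = u (\<lambda>x. \<theta> x * \<psi> x)" using W by blast
  qed
qed

text \<open>The modulus of a distribution is a continuous seminorm on test functions.\<close>

lemma distr_bounded:
  assumes u: "u \<in> distributions \<Omega>" and B: "test_bounded \<Omega> B"
  shows "bdd_above ((\<lambda>\<phi>. norm (u \<phi>)) ` B)"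
proof -
  have "test_seminorm \<Omega> (\<lambda>\<phi>. norm (u \<phi>))"
    unfolding test_seminorm_def seminorm_on_def
  proof (intro conjI ballI allI impI)
    fix \<phi> \<psi> and c :: complex assume "\<phi> \<in> test_fun \<Omega>" "\<psi> \<in> test_fun \<Omega>"
    then show "norm (u (\<lambda>x. \<phi> x + \<psi> x)) \<le> norm (u \<phi>) + norm (u \<psi>)"
      by (simp add: distr_add[OF u] norm_triangle_ineq)
  next
    fix \<phi> and c :: complex assume "\<phi> \<in> test_fun \<Omega>"
    then show "norm (u (\<lambda>x. c * \<phi> x)) = norm c * norm (u \<phi>)" by (simp add: distr_cmult[OF u] norm_mult)
  next
    fix K assume "compact K \<and> K \<subseteq> \<Omega>"
    then show "\<exists>c m. \<forall>\<phi>\<in>test_fun \<Omega>. supp \<phi> \<subseteq> K \<longrightarrow> norm (u \<phi>) \<le> c * Ck_norm m \<phi>"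
      using distr_order[OF u, of K] by metis
  qed auto
  then show ?thesis using B unfolding test_bounded_def by simp
qed

subsection \<open>Cones and wave front sets\<close>

text \<open>The directions within \<delta> of the direction of k0, with both norms multiplied out to
  avoid division. The set contains 0, as a closed cone must; the strict version excludes 0.\<close>

definition cone_nbhd :: "'a::euclidean_space \<Rightarrow> real \<Rightarrow> 'a set" where
  "cone_nbhd k0 \<delta> = {k. norm (norm k0 *\<^sub>R k - norm k *\<^sub>R k0) \<le> \<delta> * norm k * norm k0}"

definition open_cone_nbhd :: "'a::euclidean_space \<Rightarrow> real \<Rightarrow> 'a set" where
  "open_cone_nbhd k0 \<delta> = {k. norm (norm k0 *\<^sub>R k - norm k *\<^sub>R k0) < \<delta> * norm k * norm k0}"

lemma closed_cone_nbhd: "closed (cone_nbhd k0 \<delta>)"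
  and open_open_cone_nbhd: "open (open_cone_nbhd k0 \<delta>)"
  unfolding cone_nbhd_def open_cone_nbhd_def
  by (intro closed_Collect_le open_Collect_less continuous_intros)+

lemma cone_scale:
  assumes "t > 0"
  shows "norm (norm k0 *\<^sub>R (t *\<^sub>R k) - norm (t *\<^sub>R k) *\<^sub>R k0) = t * norm (norm k0 *\<^sub>R k - norm k *\<^sub>R k0)"
proof -
  have "norm k0 *\<^sub>R (t *\<^sub>R k) - norm (t *\<^sub>R k) *\<^sub>R k0 = t *\<^sub>R (norm k0 *\<^sub>R k - norm k *\<^sub>R k0)"
    using assms by (simp add: scaleR_diff_right mult.commute)
  then show ?thesis using assms by simp
qed

lemma conic_cone_nbhd: "conic_set (cone_nbhd k0 \<delta>)" and conic_open_cone_nbhd: "conic_set (open_cone_nbhd k0 \<delta>)"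
proof -
  have eq: "\<delta> * norm (t *\<^sub>R k) * norm k0 = t * (\<delta> * norm k * norm k0)" if "t > 0" for t and k :: 'a
    using that by simp
  show "conic_set (cone_nbhd k0 \<delta>)" "conic_set (open_cone_nbhd k0 \<delta>)"
    unfolding conic_set_def cone_nbhd_def open_cone_nbhd_def
    by (intro ballI allI impI; simp only: mem_Collect_eq cone_scale eq mult_le_cancel_left_pos mult_less_cancel_left_pos)+
qed

lemma open_cone_nbhd_subset: "open_cone_nbhd k0 \<delta> \<subseteq> cone_nbhd k0 \<delta>"
  unfolding open_cone_nbhd_def cone_nbhd_def by auto

lemma open_cone_nbhd_self: "\<delta> > 0 \<Longrightarrow> k0 \<noteq> 0 \<Longrightarrow> k0 \<in> open_cone_nbhd k0 \<delta>"
  unfolding open_cone_nbhd_def by simp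

lemma cone_nbhd_normalize:
  assumes "k \<in> cone_nbhd k0 \<delta>" "k \<noteq> 0" "k0 \<noteq> 0"
  shows "dist ((norm k0 / norm k) *\<^sub>R k) k0 \<le> \<delta> * norm k0"
proof -
  have "(norm k0 / norm k) *\<^sub>R k - k0 = (1 / norm k) *\<^sub>R (norm k0 *\<^sub>R k - norm k *\<^sub>R k0)"
    using assms by (simp add: scaleR_diff_right)
  then have "dist ((norm k0 / norm k) *\<^sub>R k) k0 = norm (norm k0 *\<^sub>R k - norm k *\<^sub>R k0) / norm k"
    by (simp add: dist_norm)
  also have "\<dots> \<le> \<delta> * norm k0"
    using assms by (simp add: cone_nbhd_def pos_divide_le_eq mult_ac)
  finally show ?thesis .
qed

lemma cone_nbhd_inside:
  fixes V :: "'a::euclidean_space set"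
  assumes V: "open V" "conic_set V" and k0: "k0 \<in> V" "k0 \<noteq> 0"
  obtains \<delta> where "\<delta> > 0" "cone_nbhd k0 \<delta> - {0} \<subseteq> V"
proof -
  obtain e where e: "e > 0" "cball k0 e \<subseteq> V" using open_contains_cball_eq[OF V(1)] k0(1) by blast
  show thesis
  proof (rule that[of "e / norm k0"])
    show "cone_nbhd k0 (e / norm k0) - {0} \<subseteq> V"
    proof
      fix k assume k: "k \<in> cone_nbhd k0 (e / norm k0) - {0}"
      then have "dist ((norm k0 / norm k) *\<^sub>R k) k0 \<le> e"
        using cone_nbhd_normalize[of k k0 "e / norm k0"] k0 by simp
      then have "(norm k0 / norm k) *\<^sub>R k \<in> V" using e by (auto simp: dist_commute)
      moreover have "0 < norm k / norm k0" using k k0 by simp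
      ultimately have "(norm k / norm k0) *\<^sub>R (norm k0 / norm k) *\<^sub>R k \<in> V"
        using V(2) unfolding conic_set_def by blast
      then show "k \<in> V" using k k0 by simp
    qed
  qed (use e k0 in simp)
qed

text \<open>A product neighbourhood of (x, k0) misses \<Gamma>, and conicity of \<Gamma> spreads its
  second factor to a cone. The origin in \<open>cone_nbhd\<close> does no harm, since \<Gamma> has
  no zero covectors.\<close>

lemma closed_cone_avoid:
  fixes \<Omega> :: "'a::euclidean_space set"
  assumes \<Omega>: "open \<Omega>" and \<Gamma>: "closed_cone \<Omega> \<Gamma>" and p: "(x, k0) \<in> dotT \<Omega>" "(x, k0) \<notin> \<Gamma>"
  obtains r \<delta> where "r > 0" "\<delta> > 0" "cball x r \<subseteq> \<Omega>" "(cball x r \<times> cone_nbhd k0 \<delta>) \<inter> \<Gamma> = {}"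
proof -
  have od: "open (dotT \<Omega>)" unfolding dotT_def by (intro open_Times \<Omega>) auto
  have cl: "closedin (top_of_set (dotT \<Omega>)) \<Gamma>" and cone: "\<And>x k t. (x, k) \<in> \<Gamma> \<Longrightarrow> t > 0 \<Longrightarrow> (x, t *\<^sub>R k) \<in> \<Gamma>"
    using \<Gamma> unfolding closed_cone_def by auto
  have \<Gamma>d: "\<Gamma> \<subseteq> dotT \<Omega>" using closedin_subset[OF cl] by simp
  have "openin (top_of_set (dotT \<Omega>)) (dotT \<Omega> - \<Gamma>)" using cl by (simp add: openin_diff)
  then have "open (dotT \<Omega> - \<Gamma>)" using od openin_open_eq by blast
  then obtain A B where AB: "open A" "open B" "x \<in> A" "k0 \<in> B" "A \<times> B \<subseteq> dotT \<Omega> - \<Gamma>"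
    using p by (auto elim!: open_prod_elim)
  obtain r where r: "r > 0" "cball x r \<subseteq> A" using open_contains_cball_eq[OF AB(1)] AB(3) by blast
  obtain e where e: "e > 0" "cball k0 e \<subseteq> B" using open_contains_cball_eq[OF AB(2)] AB(4) by blast
  have k0: "k0 \<noteq> 0" using p by (simp add: dotT_def)
  show thesis
  proof (rule that[OF r(1), of "e / norm k0"])
    show "cball x r \<subseteq> \<Omega>" using r(2) AB by (auto simp: dotT_def)
    show "(cball x r \<times> cone_nbhd k0 (e / norm k0)) \<inter> \<Gamma> = {}"
    proof (rule ccontr)
      assume "\<not> ?thesis"
      then obtain y k where y: "y \<in> cball x r" "k \<in> cone_nbhd k0 (e / norm k0)" "(y, k) \<in> \<Gamma>" by blast
      have k: "k \<noteq> 0" using y(3) \<Gamma>d by (auto simp: dotT_def)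
      have "(norm k0 / norm k) *\<^sub>R k \<in> B"
        using cone_nbhd_normalize[OF y(2) k k0] k0 e by (auto simp: dist_commute)
      moreover have "(y, (norm k0 / norm k) *\<^sub>R k) \<in> \<Gamma>" using cone[OF y(3)] k k0 by simp
      ultimately show False using AB(5) r(2) y(1) by blast
    qed
  qed (use e k0 in simp)
qed

section \<open>Rapid decay and its localisation\<close>

definition rapid_decay :: "'a::euclidean_space distr \<Rightarrow> ('a \<Rightarrow> complex) \<Rightarrow> 'a set \<Rightarrow> bool" where
  "rapid_decay u \<theta> V \<longleftrightarrow> (\<forall>N::nat. bdd_above ((\<lambda>k. (1 + norm k) ^ N * norm (fourier_loc u \<theta> k)) ` V))"

lemma fourier_loc_expi: "fourier_loc u \<theta> k = u (\<lambda>x. \<theta> x * expi k x)"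
  unfolding fourier_loc_def expi_def ..

lemma rapid_decay_mono: "rapid_decay u \<theta> V \<Longrightarrow> V' \<subseteq> V \<Longrightarrow> rapid_decay u \<theta> V'"
  unfolding rapid_decay_def by (meson bdd_above_mono image_mono)

lemma rapid_decay_UN:
  assumes "finite D" "\<And>i. i \<in> D \<Longrightarrow> rapid_decay u \<theta> (V i)"
  shows "rapid_decay u \<theta> (\<Union>i\<in>D. V i)"
  using assms unfolding rapid_decay_def by (simp add: image_UN bdd_above_UN)

lemma rapid_decay_sum:
  assumes u: "u \<in> distributions \<Omega>" and F: "finite F" and t: "\<And>l. l \<in> F \<Longrightarrow> \<phi> l \<in> test_fun \<Omega>"
    and d: "\<And>l. l \<in> F \<Longrightarrow> rapid_decay u (\<phi> l) V"
  shows "rapid_decay u (\<lambda>x. \<Sum>l\<in>F. \<phi> l x) V"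
  unfolding rapid_decay_def
proof
  fix N
  have "\<forall>l\<in>F. \<exists>M. \<forall>k\<in>V. (1 + norm k) ^ N * norm (fourier_loc u (\<phi> l) k) \<le> M"
    using d unfolding rapid_decay_def bdd_above_def by blast
  then obtain M where M: "\<And>l k. l \<in> F \<Longrightarrow> k \<in> V \<Longrightarrow> (1 + norm k) ^ N * norm (fourier_loc u (\<phi> l) k) \<le> M l"
    using bchoice[of F "\<lambda>l M. \<forall>k\<in>V. (1 + norm k) ^ N * norm (fourier_loc u (\<phi> l) k) \<le> M"] by blast
  have "(1 + norm k) ^ N * norm (fourier_loc u (\<lambda>x. \<Sum>l\<in>F. \<phi> l x) k) \<le> sum M F" if k: "k \<in> V" for k
  proof -
    have "fourier_loc u (\<lambda>x. \<Sum>l\<in>F. \<phi> l x) k = (\<Sum>l\<in>F. fourier_loc u (\<phi> l) k)"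
      unfolding fourier_loc_expi sum_distrib_right
      by (rule distr_sum[OF u F]) (rule test_fun_expi[OF t])
    then have "(1 + norm k) ^ N * norm (fourier_loc u (\<lambda>x. \<Sum>l\<in>F. \<phi> l x) k) \<le>
        (1 + norm k) ^ N * (\<Sum>l\<in>F. norm (fourier_loc u (\<phi> l) k))"
      by (simp add: mult_left_mono norm_sum)
    also have "\<dots> = (\<Sum>l\<in>F. (1 + norm k) ^ N * norm (fourier_loc u (\<phi> l) k))" by (rule sum_distrib_left)
    also have "\<dots> \<le> sum M F" by (intro sum_mono M k)
    finally show ?thesis .
  qed
  then show "bdd_above ((\<lambda>k. (1 + norm k) ^ N * norm (fourier_loc u (\<lambda>x. \<Sum>l\<in>F. \<phi> l x) k)) ` V)"
    by (intro bdd_aboveI[of _ "sum M F"]) auto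
qed

lemma pullc_fst: "pullc (fst :: 'a::euclidean_space \<times> 'c::euclidean_space \<Rightarrow> 'a) x a k = k"
proof -
  have "frechet_derivative (fst :: 'a \<times> 'c \<Rightarrow> 'a) (at (x, a)) = fst"
    by (rule frechet_derivative_at[symmetric]) (rule bounded_linear_imp_has_derivative[OF bounded_linear_fst])
  then show ?thesis by (simp add: pullc_def euclidean_representation)
qed

text \<open>The core estimate for the identity map and the amplitude \<open>\<rho> / \<theta>\<close>.\<close>

lemma rapid_decay_localize:
  fixes \<Omega> :: "'a::euclidean_space set"
  assumes u: "u \<in> distributions \<Omega>" and \<theta>: "\<theta> \<in> test_fun \<Omega>" and V: "open V" "conic_set V" "rapid_decay u \<theta> V"
    and \<rho>: "\<rho> \<in> test_fun \<Omega>" "supp \<rho> \<subseteq> {x. \<theta> x \<noteq> 0}" and V': "closed V'" "conic_set V'" "V' - {0} \<subseteq> V"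
  shows "rapid_decay u \<rho> V'"
  unfolding rapid_decay_def
proof
  fix N
  let ?X = "{x. \<theta> x \<noteq> 0}"
  have X: "open ?X"
    by (rule open_Collect_neq[OF smooth_on_continuous[OF test_funD(1)[OF \<theta>]] continuous_on_const])
  \<comment> \<open>Again the identity with a dummy real parameter.\<close>
  have f: "smooth_on (?X \<times> UNIV) (fst :: 'a \<times> real \<Rightarrow> 'a)"
    by (intro smooth_on_linear open_Times X open_UNIV bounded_linear_fst)
  have g: "smooth_on (?X \<times> UNIV) (\<lambda>z :: 'a \<times> real. \<phi> (fst z))" if "\<phi> \<in> test_fun \<Omega>" for \<phi>
    by (rule smooth_on_compose[OF open_Times[OF X open_UNIV] open_UNIV f test_funD(1)[OF that]]) simp
  have b: "smooth_on (?X \<times> UNIV) (\<lambda>z :: 'a \<times> real. \<rho> (fst z) / \<theta> (fst z))"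
    by (rule smooth_on_divide[OF open_Times[OF X open_UNIV] g[OF \<rho>(1)] g[OF \<theta>]]) auto
  have b0: "\<rho> (fst (x, a)) / \<theta> (fst (x, a)) = 0" if "x \<in> ?X - supp \<rho>" "a \<in> UNIV" for x and a :: real
    using that by (simp add: not_in_supp)
  have nz: "pullc fst x a k \<in> V \<and> pullc fst x a k \<noteq> 0" if "x \<in> supp \<rho>" "a \<in> {0}" "k \<in> V'" "k \<noteq> 0" for x k and a :: real
    using that V'(3) by (auto simp: pullc_fst)
  obtain B N1 c where B: "test_bounded \<Omega> B" "c \<ge> 0" and est:
    "\<And>u S (a::real) k. u \<in> distributions \<Omega> \<Longrightarrow> 0 \<le> S \<Longrightarrow>
      (\<And>l. l \<in> V \<Longrightarrow> (1 + norm l) ^ N1 * norm (u (\<lambda>x. \<theta> x * expi l x)) \<le> S) \<Longrightarrow>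
      (\<And>\<phi>. \<phi> \<in> B \<Longrightarrow> norm (u \<phi>) \<le> S) \<Longrightarrow> a \<in> {0} \<Longrightarrow> k \<in> V' \<Longrightarrow>
      (1 + norm k) ^ N * norm (u (\<lambda>x. \<theta> x * (if x \<in> supp \<rho> then \<rho> (fst (x, a)) / \<theta> (fst (x, a)) * expi k (fst (x, a)) else 0))) \<le> c * S"
  proof (rule core_estimate[where N=N, OF X open_UNIV f b test_funD(2)[OF \<rho>(1)] compact_sing[of "0::real"] \<rho>(2) subset_UNIV b0 V'(1,2) V(1,2) nz \<theta>], goal_cases)
    case (7 B N1 c)
    show ?case
    proof (rule that[of B c N1, OF 7(2,3)], goal_cases)
      case (1 u S a k)
      show ?case by (rule 7(4)[OF 1])
    qed
  qed
  obtain S1 where S1: "\<And>l. l \<in> V \<Longrightarrow> (1 + norm l) ^ N1 * norm (u (\<lambda>x. \<theta> x * expi l x)) \<le> S1"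
    using V(3) unfolding rapid_decay_def bdd_above_def fourier_loc_expi by blast
  obtain S2 where S2: "\<And>\<phi>. \<phi> \<in> B \<Longrightarrow> norm (u \<phi>) \<le> S2"
    using distr_bounded[OF u B(1)] unfolding bdd_above_def by blast
  define S where "S = max 0 (max S1 S2)"
  have S: "0 \<le> S" "\<And>l. l \<in> V \<Longrightarrow> (1 + norm l) ^ N1 * norm (u (\<lambda>x. \<theta> x * expi l x)) \<le> S" "\<And>\<phi>. \<phi> \<in> B \<Longrightarrow> norm (u \<phi>) \<le> S"
    using S1 S2 unfolding S_def by (force simp: le_max_iff_disj)+
  have "(1 + norm k) ^ N * norm (fourier_loc u \<rho> k) \<le> c * S" if k: "k \<in> V'" for k
  proof -
    have "(\<lambda>x. \<theta> x * (if x \<in> supp \<rho> then \<rho> (fst (x, 0::real)) / \<theta> (fst (x, 0::real)) * expi k (fst (x, 0::real)) else 0)) = (\<lambda>x. \<rho> x * expi k x)"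
      using \<rho>(2) by (intro ext) (auto simp: not_in_supp)
    then show ?thesis using est[OF u S, of "0::real" k] k unfolding fourier_loc_expi by simp
  qed
  then show "bdd_above ((\<lambda>k. (1 + norm k) ^ N * norm (fourier_loc u \<rho> k)) ` V')"
    by (intro bdd_aboveI[of _ "c * S"]) auto
qed

text \<open>The definition of \<open>WF\<close> provides a single cutoff that is nonzero at x.
  Localisation extends the decay to all cutoffs supported near x, at the price of a smaller
  cone.\<close>

lemma rapid_decay_near:
  fixes \<Omega> :: "'a::euclidean_space set"
  assumes \<Omega>: "open \<Omega>" and u: "u \<in> distributions \<Omega>" and p: "(x, k0) \<in> dotT \<Omega>" "(x, k0) \<notin> WF \<Omega> u"
  shows "\<exists>r>0. \<exists>V. open V \<and> conic_set V \<and> k0 \<in> V \<and> (\<forall>\<rho>\<in>test_fun \<Omega>. supp \<rho> \<subseteq> cball x r \<longrightarrow> rapid_decay u \<rho> V)"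
proof -
  obtain \<theta> V where \<theta>: "\<theta> \<in> test_fun \<Omega>" "\<theta> x \<noteq> 0" and V: "open V" "conic_set V" "k0 \<in> V" "rapid_decay u \<theta> V"
    using p unfolding WF_def rapid_decay_def by auto
  have k0: "k0 \<noteq> 0" using p by (simp add: dotT_def)
  obtain \<delta> where \<delta>: "\<delta> > 0" "cone_nbhd k0 \<delta> - {0} \<subseteq> V" by (rule cone_nbhd_inside[OF V(1,2,3) k0])
  have o: "open {x. \<theta> x \<noteq> 0}"
    by (rule open_Collect_neq[OF smooth_on_continuous[OF test_funD(1)[OF \<theta>(1)]] continuous_on_const])
  obtain r where r: "r > 0" "cball x r \<subseteq> {x. \<theta> x \<noteq> 0}"
    using open_contains_cball_eq[OF o] \<theta>(2) by blast
  have "rapid_decay u \<rho> (open_cone_nbhd k0 \<delta>)" if "\<rho> \<in> test_fun \<Omega>" "supp \<rho> \<subseteq> cball x r" for \<rho>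
    by (rule rapid_decay_mono[OF rapid_decay_localize[OF u \<theta>(1) V(1,2,4) that(1) order_trans[OF that(2) r(2)]
          closed_cone_nbhd conic_cone_nbhd \<delta>(2)] open_cone_nbhd_subset])
  then show ?thesis
    using r(1) open_open_cone_nbhd conic_open_cone_nbhd open_cone_nbhd_self[OF \<delta>(1) k0] by blast
qed

text \<open>Compactness twice: finitely many directions cover V at each point of the support, and
  finitely many balls cover the support.\<close>

lemma rapid_decay_off_WF:
  fixes \<Omega> :: "'a::euclidean_space set"
  assumes \<Omega>: "open \<Omega>" and u: "u \<in> distributions \<Omega>" and \<theta>: "\<theta> \<in> test_fun \<Omega>"
    and V: "closed V" "conic_set V" and disj: "(supp \<theta> \<times> V) \<inter> WF \<Omega> u = {}"
  shows "rapid_decay u \<theta> V"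
proof -
  have A: "\<exists>r>0. \<forall>\<rho>\<in>test_fun \<Omega>. supp \<rho> \<subseteq> cball x r \<longrightarrow> rapid_decay u \<rho> V" if x: "x \<in> supp \<theta>" for x
  proof -
    let ?S = "V \<inter> sphere 0 1"
    have cS: "compact ?S" by (intro closed_Int_compact V compact_sphere)
    have xO: "x \<in> \<Omega>" using x test_funD(3)[OF \<theta>] by blast
    have "\<forall>k\<in>?S. \<exists>rW. fst rW > 0 \<and> open (snd rW) \<and> conic_set (snd rW) \<and> k \<in> snd rW \<and>
        (\<forall>\<rho>\<in>test_fun \<Omega>. supp \<rho> \<subseteq> cball x (fst rW) \<longrightarrow> rapid_decay u \<rho> (snd rW))"
    proof
      fix k assume k: "k \<in> ?S"
      have "(x, k) \<in> dotT \<Omega>" "(x, k) \<notin> WF \<Omega> u" using k xO x disj by (auto simp: dotT_def)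
      from rapid_decay_near[OF \<Omega> u this] show "\<exists>rW. fst rW > 0 \<and> open (snd rW) \<and> conic_set (snd rW) \<and> k \<in> snd rW \<and>
        (\<forall>\<rho>\<in>test_fun \<Omega>. supp \<rho> \<subseteq> cball x (fst rW) \<longrightarrow> rapid_decay u \<rho> (snd rW))" by (simp only: split_paired_Ex fst_conv snd_conv) blast
    qed
    from bchoice[OF this] obtain rW where rW: "\<And>k. k \<in> ?S \<Longrightarrow> fst (rW k) > 0" "\<And>k. k \<in> ?S \<Longrightarrow> open (snd (rW k))"
      "\<And>k. k \<in> ?S \<Longrightarrow> conic_set (snd (rW k))" "\<And>k. k \<in> ?S \<Longrightarrow> k \<in> snd (rW k)"
      "\<And>k \<rho>. k \<in> ?S \<Longrightarrow> \<rho> \<in> test_fun \<Omega> \<Longrightarrow> supp \<rho> \<subseteq> cball x (fst (rW k)) \<Longrightarrow> rapid_decay u \<rho> (snd (rW k))" by blast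
    have "?S \<subseteq> (\<Union>k\<in>?S. snd (rW k))" using rW(4) by blast
    from compactE_image[OF cS rW(2) this] obtain D where D: "D \<subseteq> ?S" "finite D" "?S \<subseteq> (\<Union>k\<in>D. snd (rW k))" by blast
    \<comment> \<open>The entry 1 gives \<open>Min\<close> a value when D is empty.\<close>
    define r where "r = Min (insert 1 ((\<lambda>k. fst (rW k)) ` D))"
    have "\<forall>k\<in>D. fst (rW k) > 0" using D(1) rW(1) by blast
    then have r: "r > 0" unfolding r_def using D(2) by (subst Min_gr_iff) auto
    have rle: "r \<le> fst (rW k)" if "k \<in> D" for k unfolding r_def using D(2) that by (intro Min_le) auto
    \<comment> \<open>The origin cannot be rescaled to the sphere and is added by hand; at a single
      frequency decay is trivial.\<close>
    have VU: "V \<subseteq> (\<Union>k\<in>D. snd (rW k)) \<union> {0}"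
    proof
      fix k assume k: "k \<in> V"
      show "k \<in> (\<Union>k\<in>D. snd (rW k)) \<union> {0}"
      proof (cases "k = 0")
        case False
        have "(1 / norm k) *\<^sub>R k \<in> ?S" using V(2) k False unfolding conic_set_def by simp
        then obtain l where l: "l \<in> D" "(1 / norm k) *\<^sub>R k \<in> snd (rW l)" using D(3) by blast
        have "conic_set (snd (rW l))" using rW(3) l(1) D(1) by blast
        moreover have "norm k > 0" using False by simp
        ultimately have "norm k *\<^sub>R (1 / norm k) *\<^sub>R k \<in> snd (rW l)"
          using l(2) unfolding conic_set_def by blast
        then show ?thesis using l False by auto
      qed simp
    qed
    have "rapid_decay u \<rho> V" if \<rho>: "\<rho> \<in> test_fun \<Omega>" "supp \<rho> \<subseteq> cball x r" for \<rho>
    proof -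
      have "rapid_decay u \<rho> (\<Union>k\<in>D. snd (rW k))"
      proof (rule rapid_decay_UN[OF D(2)])
        fix k assume k: "k \<in> D"
        have "supp \<rho> \<subseteq> cball x (fst (rW k))" using \<rho>(2) rle[OF k] by (meson order_trans subset_cball)
        then show "rapid_decay u \<rho> (snd (rW k))" using rW(5) \<rho>(1) k D(1) by blast
      qed
      then have "rapid_decay u \<rho> ((\<Union>k\<in>D. snd (rW k)) \<union> {0})" unfolding rapid_decay_def by (simp add: image_Un)
      then show ?thesis by (rule rapid_decay_mono[OF _ VU])
    qed
    then show ?thesis using r by blast
  qed
  then obtain r where r: "\<forall>x\<in>supp \<theta>. r x > 0 \<and> (\<forall>\<rho>\<in>test_fun \<Omega>. supp \<rho> \<subseteq> cball x (r x) \<longrightarrow> rapid_decay u \<rho> V)"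
    using bchoice[of "supp \<theta>" "\<lambda>x r. r > 0 \<and> (\<forall>\<rho>\<in>test_fun \<Omega>. supp \<rho> \<subseteq> cball x r \<longrightarrow> rapid_decay u \<rho> V)"] by blast
  have rp: "r l > 0" if "l \<in> supp \<theta>" for l using r that by blast
  obtain F \<rho> G where F: "finite F" "F \<subseteq> supp \<theta>" "open G" "supp \<theta> \<subseteq> G" and \<rho>: "\<And>l. smooth_on UNIV (\<rho> l)"
    and \<rho>0: "\<And>l x. l \<in> F \<Longrightarrow> x \<notin> cball l (r l) \<Longrightarrow> \<rho> l x = 0"
    and \<rho>1: "\<And>x. x \<in> G \<Longrightarrow> (\<Sum>l\<in>F. \<rho> l x) = (1::complex)"
    by (rule compact_partition[OF test_funD(2)[OF \<theta>] rp]) (assumption | (rule that; assumption))+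
  have t: "(\<lambda>x. \<theta> x * \<rho> l x) \<in> test_fun \<Omega>" for l
    by (rule test_fun_mult_smooth[OF \<theta> open_UNIV subset_UNIV \<rho>])
  have "rapid_decay u (\<lambda>x. \<Sum>l\<in>F. \<theta> x * \<rho> l x) V"
  proof (rule rapid_decay_sum[OF u F(1) t])
    fix l assume l: "l \<in> F"
    have "supp (\<lambda>x. \<theta> x * \<rho> l x) \<subseteq> cball l (r l)"
      by (rule supp_subsetI) (use \<rho>0[OF l] in auto)
    then show "rapid_decay u (\<lambda>x. \<theta> x * \<rho> l x) V" using r t l F(2) by blast
  qed
  moreover have "(\<lambda>x. \<Sum>l\<in>F. \<theta> x * \<rho> l x) = \<theta>"
  proof
    fix x show "(\<Sum>l\<in>F. \<theta> x * \<rho> l x) = \<theta> x"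
      using \<rho>1[of x] F(4) not_in_supp[of x \<theta>] by (cases "x \<in> supp \<theta>") (auto simp: sum_distrib_left[symmetric])
  qed
  ultimately show ?thesis by simp
qed

text \<open>Membership becomes finiteness of conic seminorms. In this form linearity of the space is
  visible, and push-forwards can be shown to belong to it by estimates alone.\<close>

lemma distributions_WF_iff:
  fixes \<Omega> :: "'a::euclidean_space set"
  assumes \<Omega>: "open \<Omega>" and \<Gamma>: "closed_cone \<Omega> \<Gamma>"
  shows "u \<in> distributions_WF \<Omega> \<Gamma> \<longleftrightarrow> u \<in> distributions \<Omega> \<and>
    (\<forall>\<theta> V. \<theta> \<in> test_fun \<Omega> \<longrightarrow> closed V \<longrightarrow> conic_set V \<longrightarrow> (supp \<theta> \<times> V) \<inter> \<Gamma> = {} \<longrightarrow> rapid_decay u \<theta> V)"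
proof (intro iffI conjI allI impI)
  assume u: "u \<in> distributions_WF \<Omega> \<Gamma>"
  then show "u \<in> distributions \<Omega>" by (simp add: distributions_WF_def)
  fix \<theta> V assume "\<theta> \<in> test_fun \<Omega>" "closed V" "conic_set V" "(supp \<theta> \<times> V) \<inter> \<Gamma> = {}"
  then show "rapid_decay u \<theta> V"
    using u by (intro rapid_decay_off_WF[OF \<Omega>]) (auto simp: distributions_WF_def)
next
  assume R: "u \<in> distributions \<Omega> \<and>
    (\<forall>\<theta> V. \<theta> \<in> test_fun \<Omega> \<longrightarrow> closed V \<longrightarrow> conic_set V \<longrightarrow> (supp \<theta> \<times> V) \<inter> \<Gamma> = {} \<longrightarrow> rapid_decay u \<theta> V)"
  have "WF \<Omega> u \<subseteq> \<Gamma>"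
  proof
    fix z assume z: "z \<in> WF \<Omega> u"
    obtain x k0 where zz: "z = (x, k0)" by (cases z)
    have d: "(x, k0) \<in> dotT \<Omega>" using z by (auto simp: WF_def zz)
    show "z \<in> \<Gamma>"
    proof (rule ccontr)
      assume "z \<notin> \<Gamma>"
      then obtain r \<delta> where r: "r > 0" "\<delta> > 0" "cball x r \<subseteq> \<Omega>" "(cball x r \<times> cone_nbhd k0 \<delta>) \<inter> \<Gamma> = {}"
        using closed_cone_avoid[OF \<Omega> \<Gamma> d] zz by blast
      have k0: "k0 \<noteq> 0" using d by (simp add: dotT_def)
      have t: "bump x r \<in> test_fun \<Omega>"
        by (rule test_funI[OF smooth_on_bump compact_cball r(3)]) (auto intro!: bump_0[OF r(1)] simp: dist_commute)
      have s: "supp (bump x r) \<subseteq> cball x r"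
        by (rule supp_subsetI) (auto intro!: bump_0[OF r(1)] simp: dist_commute)
      have "(supp (bump x r) \<times> cone_nbhd k0 \<delta>) \<inter> \<Gamma> = {}" using s r(4) by blast
      then have "rapid_decay u (bump x r) (cone_nbhd k0 \<delta>)"
        using R t closed_cone_nbhd conic_cone_nbhd by blast
      then have "rapid_decay u (bump x r) (open_cone_nbhd k0 \<delta>)"
        by (rule rapid_decay_mono[OF _ open_cone_nbhd_subset])
      moreover have "bump x r x \<noteq> 0" using bump_1[OF r(1), of x x] r(1) by simp
      ultimately have "z \<notin> WF \<Omega> u"
        unfolding WF_def rapid_decay_def zz
        using t open_open_cone_nbhd[of k0 \<delta>] conic_open_cone_nbhd[of k0 \<delta>] open_cone_nbhd_self[OF r(2) k0] by auto
      then show False using z by simp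
    qed
  qed
  then show "u \<in> distributions_WF \<Omega> \<Gamma>" using R by (simp add: distributions_WF_def)
qed

section \<open>Finiteness of the seminorms of the normal topology\<close>

lemma bounded_seminorm_on:
  assumes "test_bounded \<Omega> B"
  shows "seminorm_on (distributions \<Omega>) (bounded_seminorm B)"
proof -
  have "seminorm_on (distributions \<Omega>) (\<lambda>u. sup0 ((\<lambda>\<phi>. norm (u \<phi>)) ` B))"
    by (rule seminorm_on_sup0[OF _ distr_bounded[OF _ assms]])
       (auto simp: seminorm_on_def norm_triangle_ineq norm_mult)
  then show ?thesis unfolding bounded_seminorm_def .
qed

lemma bounded_seminorm_upper:
  assumes "test_bounded \<Omega> B" "u \<in> distributions \<Omega>" "\<phi> \<in> B"
  shows "norm (u \<phi>) \<le> bounded_seminorm B u"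
  unfolding bounded_seminorm_def by (rule sup0_upper[OF distr_bounded[OF assms(2,1)]]) (use assms in auto)

lemma conic_seminorm_bdd:
  assumes \<Omega>: "open \<Omega>" and \<theta>: "\<theta> \<in> test_fun \<Omega>" "closed V" "conic_set V" "(supp \<theta> \<times> V) \<inter> \<Gamma> = {}"
    and u: "u \<in> distributions_WF \<Omega> \<Gamma>"
  shows "bdd_above ((\<lambda>k. (1 + norm k) ^ N * norm (fourier_loc u \<theta> k)) ` V)"
proof -
  have "rapid_decay u \<theta> V"
    by (rule rapid_decay_off_WF[OF \<Omega> _ \<theta>(1-3)]) (use u \<theta>(4) in \<open>auto simp: distributions_WF_def\<close>)
  then show ?thesis unfolding rapid_decay_def by simp
qed

lemma conic_seminorm_on:
  assumes \<Omega>: "open \<Omega>" and \<theta>: "\<theta> \<in> test_fun \<Omega>" "closed V" "conic_set V" "(supp \<theta> \<times> V) \<inter> \<Gamma> = {}"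
  shows "seminorm_on (distributions_WF \<Omega> \<Gamma>) (conic_seminorm N V \<theta>)"
proof -
  have "seminorm_on (distributions_WF \<Omega> \<Gamma>) (\<lambda>u. sup0 ((\<lambda>k. (1 + norm k) ^ N * norm (fourier_loc u \<theta> k)) ` V))"
  proof (rule seminorm_on_sup0[OF _ conic_seminorm_bdd[OF \<Omega> \<theta>]])
    fix k
    show "seminorm_on (distributions_WF \<Omega> \<Gamma>) (\<lambda>u. (1 + norm k) ^ N * norm (fourier_loc u \<theta> k))"
      unfolding seminorm_on_def fourier_loc_expi
      by (simp add: norm_mult distrib_left[symmetric] mult_left_mono norm_triangle_ineq)
  qed
  then show ?thesis unfolding conic_seminorm_def .
qed

lemma conic_seminorm_upper:
  assumes \<Omega>: "open \<Omega>" and \<theta>: "\<theta> \<in> test_fun \<Omega>" "closed V" "conic_set V" "(supp \<theta> \<times> V) \<inter> \<Gamma> = {}"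
    and u: "u \<in> distributions_WF \<Omega> \<Gamma>" and k: "k \<in> V"
  shows "(1 + norm k) ^ N * norm (u (\<lambda>x. \<theta> x * expi k x)) \<le> conic_seminorm N V \<theta> u"
  unfolding conic_seminorm_def fourier_loc_expi[symmetric]
  by (rule sup0_upper[OF conic_seminorm_bdd[OF \<Omega> \<theta> u]]) (use k in auto)

lemma normal_seminorm_on:
  assumes "open \<Omega>" "p \<in> normal_seminorms \<Omega> \<Gamma>"
  shows "seminorm_on (distributions_WF \<Omega> \<Gamma>) p"
proof -
  from assms(2) consider B where "p = bounded_seminorm B" "test_bounded \<Omega> B"
    | N V \<theta> where "p = conic_seminorm N V \<theta>" "\<theta> \<in> test_fun \<Omega>" "closed V" "conic_set V" "(supp \<theta> \<times> V) \<inter> \<Gamma> = {}"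
    unfolding normal_seminorms_def by blast
  then show ?thesis
  proof cases
    case 1
    then show ?thesis using bounded_seminorm_on[of \<Omega> B]
      unfolding seminorm_on_def distributions_WF_def by auto
  next
    case 2
    then show ?thesis using conic_seminorm_on[OF assms(1) 2(2-5)] by simp
  qed
qed

lemma normal_seminorm_nonneg:
  assumes "open \<Omega>" "p \<in> normal_seminorms \<Omega> \<Gamma>" "u \<in> distributions_WF \<Omega> \<Gamma>"
  shows "0 \<le> p u"
  using normal_seminorm_on[OF assms(1,2)] assms(3) unfolding seminorm_on_def by blast

lemma test_cutoff:
  fixes \<Omega> :: "'a::euclidean_space set"
  assumes "open \<Omega>" "compact K" "K \<subseteq> \<Omega>"
  obtains \<theta> G where "\<theta> \<in> test_fun \<Omega>" "open G" "K \<subseteq> G" "\<And>x. x \<in> G \<Longrightarrow> \<theta> x = 1"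
proof -
  have "\<forall>l\<in>K. \<exists>r>0. cball l r \<subseteq> \<Omega>"
    using open_contains_cball_eq[OF assms(1)] assms(3) by blast
  then obtain r where r: "\<forall>l\<in>K. r l > 0 \<and> cball l (r l) \<subseteq> \<Omega>"
    using bchoice[of K "\<lambda>l r. r > 0 \<and> cball l r \<subseteq> \<Omega>"] by blast
  have rp: "r l > 0" if "l \<in> K" for l using r that by blast
  obtain F \<rho> G where F: "finite F" "F \<subseteq> K" "open G" "K \<subseteq> G" and \<rho>: "\<And>l. smooth_on UNIV (\<rho> l)"
    and \<rho>0: "\<And>l x. l \<in> F \<Longrightarrow> x \<notin> cball l (r l) \<Longrightarrow> \<rho> l x = 0"
    and \<rho>1: "\<And>x. x \<in> G \<Longrightarrow> (\<Sum>l\<in>F. \<rho> l x) = (1::complex)"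
    by (rule compact_partition[OF assms(2) rp]) (assumption | (rule that; assumption))+
  have "(\<lambda>x. \<Sum>l\<in>F. \<rho> l x) \<in> test_fun \<Omega>"
  proof (rule test_fun_sum[OF F(1)])
    fix l assume l: "l \<in> F"
    show "\<rho> l \<in> test_fun \<Omega>"
      by (rule test_funI[OF \<rho> compact_cball[of l "r l"]]) (use l F(2) r \<rho>0[OF l] in blast)+
  qed
  then show thesis by (rule that[OF _ F(3,4) \<rho>1])
qed

subsection \<open>A proper family of push-forwards\<close>

locale push_family =
  fixes \<Omega>1 :: "'a::euclidean_space set" and \<Omega>2 :: "'b::euclidean_space set"
    and A U :: "'c::euclidean_space set" and \<Gamma> :: "('a \<times> 'a) set" and \<Xi> :: "('b \<times> 'b) set"
    and f :: "'a \<times> 'c \<Rightarrow> 'b" and C :: "'a set"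
  assumes open1: "open \<Omega>1" and open2: "open \<Omega>2" and AU: "A \<subseteq> U" and compactA: "compact A" and openU: "open U"
    and \<Gamma>: "closed_cone \<Omega>1 \<Gamma>" and f: "smooth_on (\<Omega>1 \<times> U) f" and f_into: "f ` (\<Omega>1 \<times> U) \<subseteq> \<Omega>2"
    and C: "closedin (top_of_set \<Omega>1) C" and proper: "proper_map (top_of_set (C \<times> A)) (top_of_set \<Omega>2) f"
    and \<Gamma>C: "fst ` \<Gamma> \<subseteq> C"
    and \<Xi>: "\<Xi> = (\<Union>a\<in>A. push_cone \<Omega>1 \<Omega>2 C (\<lambda>x. f (x, a)) \<Gamma>)"
begin

abbreviation push :: "'c \<Rightarrow> 'a distr \<Rightarrow> 'b distr" where
  "push a \<equiv> push_distr \<Omega>1 \<Omega>2 (\<lambda>x. f (x, a))"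

definition E1 :: "'a distr set" where
  "E1 = {u \<in> distributions_WF \<Omega>1 \<Gamma>. dsupp \<Omega>1 u \<subseteq> C}"

lemma C_subset: "C \<subseteq> \<Omega>1"
  using closedin_subset[OF C] by simp

lemma E1D: "u \<in> E1 \<Longrightarrow> u \<in> distributions_WF \<Omega>1 \<Gamma>" "u \<in> E1 \<Longrightarrow> u \<in> distributions \<Omega>1" "u \<in> E1 \<Longrightarrow> dsupp \<Omega>1 u \<subseteq> C"
  unfolding E1_def distributions_WF_def by auto

text \<open>The form in which properness enters: C may be noncompact, but the part of C x A lying
  over a compact set is compact.\<close>

lemma compact_preimage:
  assumes "compact K" "K \<subseteq> \<Omega>2"
  shows "compact {z \<in> C \<times> A. f z \<in> K}"
proof -
  have "compactin (top_of_set \<Omega>2) K" using assms by (simp add: compactin_subtopology)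
  from compactin_proper_map_preimage[OF proper this]
  show ?thesis by (simp add: compactin_subtopology)
qed

lemma slice_smooth: "a \<in> A \<Longrightarrow> smooth_on \<Omega>1 (\<lambda>x. f (x, a))"
  using smooth_on_slice[OF open1 openU f] AU by auto

text \<open>A point of C in the closure of the set where \<kappa> o f(., a) is nonzero is mapped
  into \<open>supp \<kappa>\<close> by continuity. Hence a cutoff has to be 1 only near the points
  of C over that support.\<close>

lemma push_eq:
  assumes u: "u \<in> distributions \<Omega>1" "dsupp \<Omega>1 u \<subseteq> C" and a: "a \<in> A" and \<kappa>: "\<kappa> \<in> test_fun \<Omega>2"
    and \<zeta>: "\<zeta> \<in> test_fun \<Omega>1" "open G" "{x \<in> C. f (x, a) \<in> supp \<kappa>} \<subseteq> G" "\<And>x. x \<in> G \<Longrightarrow> \<zeta> x = 1"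
  shows "push a u \<kappa> = u (\<lambda>x. \<zeta> x * \<kappa> (f (x, a)))"
proof -
  have sm: "smooth_on \<Omega>1 (\<kappa> \<circ> (\<lambda>x. f (x, a)))"
    unfolding o_def by (rule smooth_on_compose[OF open1 open_UNIV slice_smooth[OF a] test_funD(1)[OF \<kappa>]]) simp
  have "dsupp \<Omega>1 u \<inter> closure {x \<in> \<Omega>1. (\<kappa> \<circ> (\<lambda>x. f (x, a))) x \<noteq> 0} \<subseteq> G"
  proof
    fix x assume x: "x \<in> dsupp \<Omega>1 u \<inter> closure {x \<in> \<Omega>1. (\<kappa> \<circ> (\<lambda>x. f (x, a))) x \<noteq> 0}"
    have xC: "x \<in> C" using x u by blast
    have "f (x, a) \<in> supp \<kappa>"
    proof (rule ccontr)
      assume n: "f (x, a) \<notin> supp \<kappa>"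
      let ?O = "\<Omega>1 \<inter> (\<lambda>x. f (x, a)) -` (- supp \<kappa>)"
      have "open ?O"
        by (rule continuous_open_preimage[OF smooth_on_continuous[OF slice_smooth[OF a]] open1]) (simp add: closed_supp open_Compl)
      moreover have "x \<in> ?O" using xC C_subset n by auto
      ultimately obtain y where "y \<in> ?O" "y \<in> {x \<in> \<Omega>1. (\<kappa> \<circ> (\<lambda>x. f (x, a))) x \<noteq> 0}"
        using x by (meson IntD2 closure_iff_nhds_not_empty disjoint_iff subset_refl)
      then show False using not_in_supp[of "f (y, a)" \<kappa>] by auto
    qed
    then show "x \<in> G" using xC \<zeta>(3) by blast
  qed
  from pairing_eq[OF open1 u(1) sm \<zeta>(1,2) this \<zeta>(4)]
  show ?thesis using \<kappa> by (simp add: push_distr_def comp_def)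
qed

text \<open>One cutoff, equal to 1 near the projection of the compact preimage, serves all
  parameters and all test functions supported in K. The last bound is uniform in a because
  \<open>chain_bound\<close> is applied with the whole of A as parameter set.\<close>

lemma uniform_cutoff:
  assumes "compact K" "K \<subseteq> \<Omega>2"
  obtains \<zeta> where "\<zeta> \<in> test_fun \<Omega>1"
    "\<And>u a \<kappa>. u \<in> distributions \<Omega>1 \<Longrightarrow> dsupp \<Omega>1 u \<subseteq> C \<Longrightarrow> a \<in> A \<Longrightarrow> \<kappa> \<in> test_fun \<Omega>2 \<Longrightarrow> supp \<kappa> \<subseteq> K \<Longrightarrow>
       push a u \<kappa> = u (\<lambda>x. \<zeta> x * \<kappa> (f (x, a)))"
    "\<And>a \<kappa>. a \<in> A \<Longrightarrow> \<kappa> \<in> test_fun \<Omega>2 \<Longrightarrow> (\<lambda>x. \<zeta> x * \<kappa> (f (x, a))) \<in> test_fun \<Omega>1"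
    "\<And>m. \<exists>c\<ge>0. \<forall>a\<in>A. \<forall>\<kappa>\<in>test_fun \<Omega>2. Ck_norm m (\<lambda>x. \<zeta> x * \<kappa> (f (x, a))) \<le> c * Ck_norm m \<kappa>"
proof -
  let ?K1 = "fst ` {z \<in> C \<times> A. f z \<in> K}"
  have cK1: "compact ?K1" by (intro compact_continuous_image compact_preimage assms continuous_on_fst continuous_on_id)
  have K1: "?K1 \<subseteq> \<Omega>1" using C_subset by auto
  obtain \<zeta> G where \<zeta>: "\<zeta> \<in> test_fun \<Omega>1" "open G" "?K1 \<subseteq> G" "\<And>x. x \<in> G \<Longrightarrow> \<zeta> x = 1"
    by (rule test_cutoff[OF open1 cK1 K1]) (rule that; assumption)
  have s: "smooth_on \<Omega>1 (\<lambda>x. \<kappa> (f (x, a)))" if "a \<in> A" "\<kappa> \<in> test_fun \<Omega>2" for a \<kappa>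
    by (rule smooth_on_compose[OF open1 open_UNIV slice_smooth[OF that(1)] test_funD(1)[OF that(2)]]) simp
  show thesis
  proof (rule that[OF \<zeta>(1)])
    fix u a \<kappa> assume u: "u \<in> distributions \<Omega>1" "dsupp \<Omega>1 u \<subseteq> C" and a: "a \<in> A" and \<kappa>: "\<kappa> \<in> test_fun \<Omega>2" "supp \<kappa> \<subseteq> K"
    have "{x \<in> C. f (x, a) \<in> supp \<kappa>} \<subseteq> G"
    proof
      fix x assume "x \<in> {x \<in> C. f (x, a) \<in> supp \<kappa>}"
      then have "(x, a) \<in> {z \<in> C \<times> A. f z \<in> K}" using a \<kappa>(2) by auto
      then have "fst (x, a) \<in> ?K1" by (rule imageI)
      then show "x \<in> G" using \<zeta>(3) by auto
    qed
    then show "push a u \<kappa> = u (\<lambda>x. \<zeta> x * \<kappa> (f (x, a)))" by (rule push_eq[OF u a \<kappa>(1) \<zeta>(1,2) _ \<zeta>(4)])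
  next
    fix a \<kappa> assume "a \<in> A" "\<kappa> \<in> test_fun \<Omega>2"
    then show "(\<lambda>x. \<zeta> x * \<kappa> (f (x, a))) \<in> test_fun \<Omega>1"
      by (intro test_fun_mult_smooth[OF \<zeta>(1) open1 test_funD(3)[OF \<zeta>(1)]] s)
  next
    fix m
    have fst: "smooth_on (\<Omega>1 \<times> U) (fst :: 'a \<times> 'c \<Rightarrow> 'a)"
      by (intro smooth_on_linear open_Times open1 openU bounded_linear_fst)
    have b: "smooth_on (\<Omega>1 \<times> U) (\<lambda>z. \<zeta> (fst z))"
      by (rule smooth_on_compose[OF open_Times[OF open1 openU] open_UNIV fst test_funD(1)[OF \<zeta>(1)]]) simp
    obtain c where c: "c \<ge> 0" "\<And>(\<phi> :: 'b \<Rightarrow> complex) M vs x a. smooth_on UNIV \<phi> \<Longrightarrow>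
      (\<And>ws x a. set ws \<subseteq> Basis \<Longrightarrow> length ws \<le> m \<Longrightarrow> x \<in> supp \<zeta> \<Longrightarrow> a \<in> A \<Longrightarrow> norm (iter_deriv ws \<phi> (f (x, a))) \<le> M) \<Longrightarrow>
      set vs \<subseteq> Basis \<Longrightarrow> length vs \<le> m \<Longrightarrow> x \<in> supp \<zeta> \<Longrightarrow> a \<in> A \<Longrightarrow>
      norm (iter_deriv vs (\<lambda>x. \<zeta> (fst (x, a)) * \<phi> (f (x, a))) x) \<le> c * M"
    proof (rule chain_bound[OF open1 openU f b open_UNIV subset_UNIV test_funD(2)[OF \<zeta>(1)] compactA test_funD(3)[OF \<zeta>(1)] AU, of m], goal_cases)
      case (1 c)
      note bound = 1(3)
      show ?case
      proof (rule 1(1)[OF 1(2)], goal_cases)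
        case (1 \<phi> M vs x a)
        show ?case by (rule bound[OF 1])
      qed
    qed
    have "Ck_norm m (\<lambda>x. \<zeta> x * \<kappa> (f (x, a))) \<le> c * Ck_norm m \<kappa>" if a: "a \<in> A" and \<kappa>: "\<kappa> \<in> test_fun \<Omega>2" for a \<kappa>
    proof (rule Ck_norm_least)
      fix vs :: "'a list" and x assume vs: "set vs \<subseteq> Basis" "length vs \<le> m"
      show "norm (iter_deriv vs (\<lambda>x. \<zeta> x * \<kappa> (f (x, a))) x) \<le> c * Ck_norm m \<kappa>"
      proof (cases "x \<in> supp \<zeta>")
        case True
        show ?thesis using c(2)[OF test_funD(1)[OF \<kappa>] Ck_norm_upper[OF \<kappa>] vs True a] by simp
      next
        case False
        have "supp (\<lambda>x. \<zeta> x * \<kappa> (f (x, a))) \<subseteq> supp \<zeta>"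
          by (rule supp_subsetI[OF closed_supp]) (simp add: not_in_supp)
        then have "iter_deriv vs (\<lambda>x. \<zeta> x * \<kappa> (f (x, a))) x = 0" using False by (intro iter_deriv_outside_supp) auto
        then show ?thesis using c(1) Ck_norm_nonneg[OF \<kappa>, of m] by simp
      qed
    qed
    then show "\<exists>c\<ge>0. \<forall>a\<in>A. \<forall>\<kappa>\<in>test_fun \<Omega>2. Ck_norm m (\<lambda>x. \<zeta> x * \<kappa> (f (x, a))) \<le> c * Ck_norm m \<kappa>"
      using c(1) by blast
  qed
qed

lemma push_distribution:
  assumes u: "u \<in> distributions \<Omega>1" "dsupp \<Omega>1 u \<subseteq> C" and a: "a \<in> A"
  shows "push a u \<in> distributions \<Omega>2"
  unfolding distributions_def
proof (intro CollectI conjI ballI allI impI)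
  fix \<phi> \<psi> assume \<phi>: "\<phi> \<in> test_fun \<Omega>2" and \<psi>: "\<psi> \<in> test_fun \<Omega>2"
  have K: "compact (supp \<phi> \<union> supp \<psi>)" "supp \<phi> \<union> supp \<psi> \<subseteq> \<Omega>2"
    using test_funD[OF \<phi>] test_funD[OF \<psi>] by auto
  obtain \<zeta> where \<zeta>: "\<zeta> \<in> test_fun \<Omega>1"
    "\<And>u a \<kappa>. u \<in> distributions \<Omega>1 \<Longrightarrow> dsupp \<Omega>1 u \<subseteq> C \<Longrightarrow> a \<in> A \<Longrightarrow> \<kappa> \<in> test_fun \<Omega>2 \<Longrightarrow> supp \<kappa> \<subseteq> supp \<phi> \<union> supp \<psi> \<Longrightarrow>
       push a u \<kappa> = u (\<lambda>x. \<zeta> x * \<kappa> (f (x, a)))"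
    "\<And>a \<kappa>. a \<in> A \<Longrightarrow> \<kappa> \<in> test_fun \<Omega>2 \<Longrightarrow> (\<lambda>x. \<zeta> x * \<kappa> (f (x, a))) \<in> test_fun \<Omega>1"
    by (rule uniform_cutoff[OF K]) (rule that; assumption)
  have s: "supp (\<lambda>x. \<phi> x + \<psi> x) \<subseteq> supp \<phi> \<union> supp \<psi>"
    by (rule supp_subsetI) (auto simp: closed_supp not_in_supp intro: closed_Un)
  have "push a u (\<lambda>x. \<phi> x + \<psi> x) = u (\<lambda>x. \<zeta> x * \<phi> (f (x, a)) + \<zeta> x * \<psi> (f (x, a)))"
    using \<zeta>(2)[OF u a test_fun_add[OF \<phi> \<psi>] s] by (simp add: distrib_left)
  also have "\<dots> = u (\<lambda>x. \<zeta> x * \<phi> (f (x, a))) + u (\<lambda>x. \<zeta> x * \<psi> (f (x, a)))"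
    by (rule distr_add[OF u(1) \<zeta>(3)[OF a \<phi>] \<zeta>(3)[OF a \<psi>]])
  also have "\<dots> = push a u \<phi> + push a u \<psi>"
    using \<zeta>(2)[OF u a \<phi>] \<zeta>(2)[OF u a \<psi>] by simp
  finally show "push a u (\<lambda>x. \<phi> x + \<psi> x) = push a u \<phi> + push a u \<psi>" .
next
  fix \<phi> and c :: complex assume \<phi>: "\<phi> \<in> test_fun \<Omega>2"
  obtain \<zeta> where \<zeta>: "\<zeta> \<in> test_fun \<Omega>1"
    "\<And>u a \<kappa>. u \<in> distributions \<Omega>1 \<Longrightarrow> dsupp \<Omega>1 u \<subseteq> C \<Longrightarrow> a \<in> A \<Longrightarrow> \<kappa> \<in> test_fun \<Omega>2 \<Longrightarrow> supp \<kappa> \<subseteq> supp \<phi> \<Longrightarrow>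
       push a u \<kappa> = u (\<lambda>x. \<zeta> x * \<kappa> (f (x, a)))"
    "\<And>a \<kappa>. a \<in> A \<Longrightarrow> \<kappa> \<in> test_fun \<Omega>2 \<Longrightarrow> (\<lambda>x. \<zeta> x * \<kappa> (f (x, a))) \<in> test_fun \<Omega>1"
    by (rule uniform_cutoff[OF test_funD(2,3)[OF \<phi>]]) (rule that; assumption)
  have s: "supp (\<lambda>x. c * \<phi> x) \<subseteq> supp \<phi>"
    by (rule supp_subsetI) (auto simp: closed_supp not_in_supp)
  have "push a u (\<lambda>x. c * \<phi> x) = u (\<lambda>x. c * (\<zeta> x * \<phi> (f (x, a))))"
    using \<zeta>(2)[OF u a test_fun_cmult[OF \<phi>] s] by (simp add: mult.left_commute)
  also have "\<dots> = c * u (\<lambda>x. \<zeta> x * \<phi> (f (x, a)))"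
    by (rule distr_cmult[OF u(1) \<zeta>(3)[OF a \<phi>]])
  finally show "push a u (\<lambda>x. c * \<phi> x) = c * push a u \<phi>" using \<zeta>(2)[OF u a \<phi>] by simp
next
  fix K assume K: "compact K \<and> K \<subseteq> \<Omega>2"
  obtain \<zeta> where \<zeta>: "\<zeta> \<in> test_fun \<Omega>1"
    "\<And>u a \<kappa>. u \<in> distributions \<Omega>1 \<Longrightarrow> dsupp \<Omega>1 u \<subseteq> C \<Longrightarrow> a \<in> A \<Longrightarrow> \<kappa> \<in> test_fun \<Omega>2 \<Longrightarrow> supp \<kappa> \<subseteq> K \<Longrightarrow>
       push a u \<kappa> = u (\<lambda>x. \<zeta> x * \<kappa> (f (x, a)))"
    "\<And>a \<kappa>. a \<in> A \<Longrightarrow> \<kappa> \<in> test_fun \<Omega>2 \<Longrightarrow> (\<lambda>x. \<zeta> x * \<kappa> (f (x, a))) \<in> test_fun \<Omega>1"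
    "\<And>m. \<exists>c\<ge>0. \<forall>a\<in>A. \<forall>\<kappa>\<in>test_fun \<Omega>2. Ck_norm m (\<lambda>x. \<zeta> x * \<kappa> (f (x, a))) \<le> c * Ck_norm m \<kappa>"
    by (rule uniform_cutoff[OF conjunct1[OF K] conjunct2[OF K]]) (rule that; assumption)
  obtain c m where c: "c \<ge> 0" "\<And>\<phi>. \<phi> \<in> test_fun \<Omega>1 \<Longrightarrow> supp \<phi> \<subseteq> supp \<zeta> \<Longrightarrow> norm (u \<phi>) \<le> c * Ck_norm m \<phi>"
    using distr_order[OF u(1) test_funD(2,3)[OF \<zeta>(1)]] by metis
  obtain c' where c': "c' \<ge> 0" "\<forall>a\<in>A. \<forall>\<kappa>\<in>test_fun \<Omega>2. Ck_norm m (\<lambda>x. \<zeta> x * \<kappa> (f (x, a))) \<le> c' * Ck_norm m \<kappa>"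
    using \<zeta>(4)[of m] by blast
  have "norm (push a u \<phi>) \<le> c * c' * Ck_norm m \<phi>" if \<phi>: "\<phi> \<in> test_fun \<Omega>2" "supp \<phi> \<subseteq> K" for \<phi>
  proof -
    have "supp (\<lambda>x. \<zeta> x * \<phi> (f (x, a))) \<subseteq> supp \<zeta>"
      by (rule supp_subsetI[OF closed_supp]) (simp add: not_in_supp)
    then have "norm (push a u \<phi>) \<le> c * Ck_norm m (\<lambda>x. \<zeta> x * \<phi> (f (x, a)))"
      unfolding \<zeta>(2)[OF u a \<phi>] by (rule c(2)[OF \<zeta>(3)[OF a \<phi>(1)]])
    also have "\<dots> \<le> c * (c' * Ck_norm m \<phi>)" using c'(2) a \<phi>(1) by (intro mult_left_mono c(1)) blast
    finally show ?thesis by (simp add: mult.assoc)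
  qed
  then show "\<exists>c m. \<forall>\<phi>\<in>test_fun \<Omega>2. supp \<phi> \<subseteq> K \<longrightarrow> norm (push a u \<phi>) \<le> c * Ck_norm m \<phi>" by blast
next
  fix \<phi> assume "\<phi> \<notin> test_fun \<Omega>2"
  then show "push a u \<phi> = 0" by (simp add: push_distr_def)
qed

text \<open>A bounded set has its supports in one compact set, so one cutoff serves all of it;
  \<open>B1\<close> consists of all cut off pullbacks, for all a together.\<close>

lemma push_bounded:
  assumes B: "test_bounded \<Omega>2 B"
  obtains B1 where "test_bounded \<Omega>1 B1"
    "\<And>u a \<phi>. u \<in> distributions \<Omega>1 \<Longrightarrow> dsupp \<Omega>1 u \<subseteq> C \<Longrightarrow> a \<in> A \<Longrightarrow> \<phi> \<in> B \<Longrightarrow> norm (push a u \<phi>) \<le> bounded_seminorm B1 u"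
proof -
  obtain K where K: "compact K" "K \<subseteq> \<Omega>2" "\<And>\<phi>. \<phi> \<in> B \<Longrightarrow> supp \<phi> \<subseteq> K"
    using test_bounded_supp[OF open2 B] by blast
  have Bt: "B \<subseteq> test_fun \<Omega>2" using B by (simp add: test_bounded_def)
  obtain \<zeta> where \<zeta>: "\<zeta> \<in> test_fun \<Omega>1"
    "\<And>u a \<kappa>. u \<in> distributions \<Omega>1 \<Longrightarrow> dsupp \<Omega>1 u \<subseteq> C \<Longrightarrow> a \<in> A \<Longrightarrow> \<kappa> \<in> test_fun \<Omega>2 \<Longrightarrow> supp \<kappa> \<subseteq> K \<Longrightarrow>
       push a u \<kappa> = u (\<lambda>x. \<zeta> x * \<kappa> (f (x, a)))"
    "\<And>a \<kappa>. a \<in> A \<Longrightarrow> \<kappa> \<in> test_fun \<Omega>2 \<Longrightarrow> (\<lambda>x. \<zeta> x * \<kappa> (f (x, a))) \<in> test_fun \<Omega>1"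
    "\<And>m. \<exists>c\<ge>0. \<forall>a\<in>A. \<forall>\<kappa>\<in>test_fun \<Omega>2. Ck_norm m (\<lambda>x. \<zeta> x * \<kappa> (f (x, a))) \<le> c * Ck_norm m \<kappa>"
    by (rule uniform_cutoff[OF K(1,2)]) (rule that; assumption)
  define B1 where "B1 = (\<lambda>(a, \<kappa>) x. \<zeta> x * \<kappa> (f (x, a))) ` (A \<times> B)"
  have B1: "test_bounded \<Omega>1 B1"
  proof (rule test_boundedI[OF _ test_funD(2,3)[OF \<zeta>(1)]])
    show "B1 \<subseteq> test_fun \<Omega>1" unfolding B1_def using \<zeta>(3) Bt by auto
    show "supp \<phi> \<subseteq> supp \<zeta>" if "\<phi> \<in> B1" for \<phi>
      by (rule supp_subsetI[OF closed_supp]) (use that in \<open>auto simp: B1_def not_in_supp\<close>)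
    fix m
    obtain M where M: "\<And>\<phi>. \<phi> \<in> B \<Longrightarrow> Ck_norm m \<phi> \<le> M" using test_bounded_Ck[OF B] by metis
    obtain c where c: "c \<ge> 0" "\<forall>a\<in>A. \<forall>\<kappa>\<in>test_fun \<Omega>2. Ck_norm m (\<lambda>x. \<zeta> x * \<kappa> (f (x, a))) \<le> c * Ck_norm m \<kappa>"
      using \<zeta>(4)[of m] by blast
    have "Ck_norm m (\<lambda>x. \<zeta> x * \<kappa> (f (x, a))) \<le> c * M" if "a \<in> A" "\<kappa> \<in> B" for a \<kappa>
    proof -
      have "Ck_norm m (\<lambda>x. \<zeta> x * \<kappa> (f (x, a))) \<le> c * Ck_norm m \<kappa>" using c(2) that Bt by blast
      also have "\<dots> \<le> c * M" by (intro mult_left_mono M that c(1))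
      finally show ?thesis .
    qed
    then show "\<exists>M. \<forall>\<phi>\<in>B1. Ck_norm m \<phi> \<le> M" by (intro exI[of _ "c * M"]) (auto simp: B1_def)
  qed
  show thesis
  proof (rule that[OF B1])
    fix u a \<phi> assume u: "u \<in> distributions \<Omega>1" "dsupp \<Omega>1 u \<subseteq> C" and a: "a \<in> A" and \<phi>: "\<phi> \<in> B"
    have eq: "push a u \<phi> = u (\<lambda>x. \<zeta> x * \<phi> (f (x, a)))" using \<zeta>(2)[OF u a _ K(3)[OF \<phi>]] Bt \<phi> by blast
    have "(\<lambda>x. \<zeta> x * \<phi> (f (x, a))) \<in> B1" unfolding B1_def using a \<phi> by (intro image_eqI[of _ _ "(a, \<phi>)"]) auto
    then show "norm (push a u \<phi>) \<le> bounded_seminorm B1 u"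
      unfolding eq by (rule bounded_seminorm_upper[OF B1 u(1)])
  qed
qed

end

lemma bounded_seminorm_nonneg:
  assumes "test_bounded \<Omega> B" "u \<in> distributions \<Omega>"
  shows "0 \<le> bounded_seminorm B u"
  unfolding bounded_seminorm_def by (rule sup0_nonneg[OF distr_bounded[OF assms(2,1)]])

section \<open>Bounds by finitely many normal seminorms\<close>

context push_family
begin

text \<open>The concrete form of continuity for a seminorm on \<open>E1\<close>. Asking it of
  arbitrary real functions allows upper bounds to be added and scaled without proving them to be
  seminorms.\<close>

definition dominated :: "('a distr \<Rightarrow> real) \<Rightarrow> bool" where
  "dominated q \<longleftrightarrow> (\<exists>P0 c. finite P0 \<and> P0 \<subseteq> normal_seminorms \<Omega>1 \<Gamma> \<and> c \<ge> 0 \<and> (\<forall>u\<in>E1. q u \<le> c * (\<Sum>p\<in>P0. p u)))"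

lemma dominatedI:
  assumes "p \<in> normal_seminorms \<Omega>1 \<Gamma>" "\<And>u. u \<in> E1 \<Longrightarrow> q u \<le> p u"
  shows "dominated q"
  unfolding dominated_def using assms by (intro exI[of _ "{p}"] exI[of _ 1]) auto

lemma sum_seminorms_mono:
  assumes "finite P1" "P0 \<subseteq> P1" "P1 \<subseteq> normal_seminorms \<Omega>1 \<Gamma>" "u \<in> E1"
  shows "(\<Sum>p\<in>P0. p u) \<le> (\<Sum>p\<in>P1. p u)"
  by (rule sum_mono2[OF assms(1,2)])
     (use assms E1D(1)[OF assms(4)] normal_seminorm_nonneg[OF open1] in blast)

lemma dominated_cmult: "dominated q \<Longrightarrow> c \<ge> 0 \<Longrightarrow> dominated (\<lambda>u. c * q u)"
proof -
  assume "dominated q" and c: "c \<ge> 0"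
  then obtain P0 c0 where P: "finite P0" "P0 \<subseteq> normal_seminorms \<Omega>1 \<Gamma>" "c0 \<ge> 0" "\<forall>u\<in>E1. q u \<le> c0 * (\<Sum>p\<in>P0. p u)"
    unfolding dominated_def by blast
  have "c * q u \<le> (c * c0) * (\<Sum>p\<in>P0. p u)" if "u \<in> E1" for u
    using mult_left_mono[OF bspec[OF P(4) that] c] by (simp add: mult.assoc)
  then show ?thesis unfolding dominated_def
    using P c by (intro exI[of _ P0] exI[of _ "c * c0"]) auto
qed

lemma dominated_add:
  assumes "dominated q" "dominated q'"
  shows "dominated (\<lambda>u. q u + q' u)"
proof -
  obtain P0 c0 where P: "finite P0" "P0 \<subseteq> normal_seminorms \<Omega>1 \<Gamma>" "c0 \<ge> 0" "\<forall>u\<in>E1. q u \<le> c0 * (\<Sum>p\<in>P0. p u)"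
    using assms(1) unfolding dominated_def by blast
  obtain P1 c1 where P': "finite P1" "P1 \<subseteq> normal_seminorms \<Omega>1 \<Gamma>" "c1 \<ge> 0" "\<forall>u\<in>E1. q' u \<le> c1 * (\<Sum>p\<in>P1. p u)"
    using assms(2) unfolding dominated_def by blast
  have "q u + q' u \<le> (c0 + c1) * (\<Sum>p\<in>P0 \<union> P1. p u)" if u: "u \<in> E1" for u
  proof -
    have "q u \<le> c0 * (\<Sum>p\<in>P0. p u)" "q' u \<le> c1 * (\<Sum>p\<in>P1. p u)" using P(4) P'(4) u by auto
    moreover have "c0 * (\<Sum>p\<in>P0. p u) \<le> c0 * (\<Sum>p\<in>P0 \<union> P1. p u)"
      by (intro mult_left_mono sum_seminorms_mono u P(3)) (use P P' in auto)
    moreover have "c1 * (\<Sum>p\<in>P1. p u) \<le> c1 * (\<Sum>p\<in>P0 \<union> P1. p u)"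
      by (intro mult_left_mono sum_seminorms_mono u P'(3)) (use P P' in auto)
    ultimately show ?thesis by (simp add: distrib_right)
  qed
  then show ?thesis unfolding dominated_def
    using P P' by (intro exI[of _ "P0 \<union> P1"] exI[of _ "c0 + c1"]) auto
qed

lemma dominated_sum:
  assumes "finite I" "\<And>i. i \<in> I \<Longrightarrow> dominated (q i)"
  shows "dominated (\<lambda>u. \<Sum>i\<in>I. q i u)"
  using assms
proof (induction I)
  case empty
  show ?case unfolding dominated_def by (intro exI[of _ "{}"] exI[of _ 0]) auto
qed (simp add: dominated_add)

text \<open>A dominated function may be negative. A nonnegative majorant is needed to bound a single
  term by a sum, or a \<open>sup0\<close>, which is never below 0 for bounded sets.\<close>

lemma dominated_nonneg_bound:
  assumes "dominated q"
  obtains q' where "dominated q'" "\<And>u. u \<in> E1 \<Longrightarrow> q u \<le> q' u" "\<And>u. u \<in> E1 \<Longrightarrow> 0 \<le> q' u"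
proof -
  obtain P0 c0 where P: "finite P0" "P0 \<subseteq> normal_seminorms \<Omega>1 \<Gamma>" "c0 \<ge> 0" "\<forall>u\<in>E1. q u \<le> c0 * (\<Sum>p\<in>P0. p u)"
    using assms unfolding dominated_def by blast
  show thesis
  proof (rule that[of "\<lambda>u. c0 * (\<Sum>p\<in>P0. p u)"])
    show "dominated (\<lambda>u. c0 * (\<Sum>p\<in>P0. p u))" unfolding dominated_def using P by blast
    show "0 \<le> c0 * (\<Sum>p\<in>P0. p u)" if "u \<in> E1" for u
      by (intro mult_nonneg_nonneg P(3) sum_nonneg normal_seminorm_nonneg[OF open1 _ E1D(1)[OF that]]) (use P(2) in auto)
  qed (use P in auto)
qed

text \<open>Neighbourhoods of \<open>x\<close>, \<open>a0\<close> and \<open>k0\<close> on which the hypotheses of \<open>core_estimate\<close> hold, with a cutoff \<open>\<theta>\<close>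
  and a closed cone \<open>Wc\<close> that define a seminorm of the normal topology.\<close>

definition cover_data :: "'c \<Rightarrow> 'b \<Rightarrow> 'a \<Rightarrow> real \<times> ('a \<Rightarrow> complex) \<times> 'a set \<times> 'a set \<times> 'c set \<times> 'b set \<Rightarrow> bool" where
  "cover_data a0 k0 x = (\<lambda>(r, \<theta>, W, Wc, A', V').
     r > 0 \<and> cball x r \<subseteq> \<Omega>1 \<and> \<theta> \<in> test_fun \<Omega>1 \<and> (\<forall>y\<in>cball x r. \<theta> y = 1) \<and>
     open W \<and> conic_set W \<and> W \<subseteq> Wc \<and> closed Wc \<and> conic_set Wc \<and> (supp \<theta> \<times> Wc) \<inter> \<Gamma> = {} \<and>
     open A' \<and> a0 \<in> A' \<and> A' \<subseteq> U \<and> open V' \<and> k0 \<in> V' \<and>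
     (\<forall>y\<in>cball x r. \<forall>a\<in>A'. \<forall>k\<in>V'. pullc f y a k \<in> W \<and> pullc f y a k \<noteq> 0))"

text \<open>Since (f(x, a0), k0) is not in \<Xi>, the pulled back covector l0 is neither 0 nor in
  \<Gamma>. Closedness of \<Gamma> puts a cone around l0, and continuity of \<open>pullc\<close>
  keeps nearby covectors inside it.\<close>

lemma cover_data_exists:
  assumes a0: "a0 \<in> A" and k0: "k0 \<noteq> 0" and x: "x \<in> C" and n: "(f (x, a0), k0) \<notin> \<Xi>"
  shows "\<exists>z. cover_data a0 k0 x z"
proof -
  have x1: "x \<in> \<Omega>1" and aU: "a0 \<in> U" using x C_subset a0 AU by auto
  define l0 where "l0 = pullc f x a0 k0"
  have pc: "pull_covector (\<lambda>x. f (x, a0)) x k0 = l0"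
    unfolding l0_def by (rule pullc_eq_pull_covector[OF f]) (use x1 aU in simp)
  have "(f (x, a0), k0) \<in> dotT \<Omega>2" using x1 aU k0 f_into by (auto simp: dotT_def)
  then have "(x, l0) \<notin> \<Gamma> \<union> C \<times> {0}"
    using n a0 x1 unfolding \<Xi> push_cone_def pc[symmetric] by auto
  then have l0: "l0 \<noteq> 0" "(x, l0) \<notin> \<Gamma>" using x by auto
  then have d: "(x, l0) \<in> dotT \<Omega>1" using x1 by (simp add: dotT_def)
  obtain r \<delta> where r: "r > 0" "\<delta> > 0" "cball x r \<subseteq> \<Omega>1" "(cball x r \<times> cone_nbhd l0 \<delta>) \<inter> \<Gamma> = {}"
    by (rule closed_cone_avoid[OF open1 \<Gamma> d l0(2)])
  let ?W = "open_cone_nbhd l0 \<delta>"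
  let ?S = "(\<Omega>1 \<times> U \<times> UNIV) \<inter> (\<lambda>(x, a, k). pullc f x a k) -` ?W"
  have "open ?S"
    by (rule continuous_open_preimage[OF pullc_continuous[OF f] _ open_open_cone_nbhd])
       (intro open_Times open1 openU open_UNIV)
  moreover have "(x, a0, k0) \<in> ?S"
    using x1 aU open_cone_nbhd_self[OF r(2) l0(1)] by (simp add: l0_def)
  ultimately obtain X' R' where X': "open X'" "open R'" "x \<in> X'" "(a0, k0) \<in> R'" "X' \<times> R' \<subseteq> ?S"
    by (rule open_prod_elim) auto
  obtain A' V' where A': "open A'" "open V'" "a0 \<in> A'" "k0 \<in> V'" "A' \<times> V' \<subseteq> R'"
    using open_prod_elim[OF X'(2,4)] by (metis mem_Sigma_iff)
  obtain s where s: "s > 0" "cball x s \<subseteq> X'" using open_contains_cball_eq[OF X'(1)] X'(3) by blast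
  \<comment> \<open>Within the radius of continuity, and below r / 2, where \<open>bump x r\<close>
    equals 1.\<close>
  define r' where "r' = min s (r / 3)"
  have r': "r' > 0" "r' \<le> s" "r' < r / 2" using s(1) r(1) by (auto simp: r'_def)
  have t: "bump x r \<in> test_fun \<Omega>1"
    by (rule test_funI[OF smooth_on_bump compact_cball r(3)]) (auto intro!: bump_0[OF r(1)] simp: dist_commute)
  have ts: "supp (bump x r) \<subseteq> cball x r"
    by (rule supp_subsetI) (auto intro!: bump_0[OF r(1)] simp: dist_commute)
  have in_W: "pullc f y a k \<in> ?W" if "y \<in> cball x r'" "a \<in> A'" "k \<in> V'" for y a k
  proof -
    have "(y, a, k) \<in> X' \<times> R'" using that r'(2) s(2) A'(5) by auto
    then show ?thesis using X'(5) by auto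
  qed
  have "cover_data a0 k0 x (r', bump x r, ?W, cone_nbhd l0 \<delta>, A' \<inter> U, V')"
    unfolding cover_data_def split_conv
  proof (intro conjI ballI)
    have "r' \<le> r" using r' r(1) by linarith
    then show "cball x r' \<subseteq> \<Omega>1" using subset_cball[of r' r x] r(3) by blast
    show "?W \<subseteq> cone_nbhd l0 \<delta>" by (rule open_cone_nbhd_subset)
    show "bump x r y = 1" if "y \<in> cball x r'" for y
      using that r' by (intro bump_1[OF r(1)]) (auto simp: dist_commute)
    show "(supp (bump x r) \<times> cone_nbhd l0 \<delta>) \<inter> \<Gamma> = {}" using ts r(4) by blast
    show "open (A' \<inter> U)" using A'(1) openU by blast
    show "a0 \<in> A' \<inter> U" using A'(3) aU by simp
    fix y a k assume "y \<in> cball x r'" "a \<in> A' \<inter> U" "k \<in> V'"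
    then have "pullc f y a k \<in> ?W" using in_W by blast
    then show "pullc f y a k \<in> ?W" "pullc f y a k \<noteq> 0"
      by (auto simp: open_cone_nbhd_def)
  qed (use r' t A' open_open_cone_nbhd conic_open_cone_nbhd closed_cone_nbhd conic_cone_nbhd in auto)
  then show ?thesis by blast
qed

text \<open>The fibre \<open>K0\<close> over \<open>supp \<kappa>\<close> at a0 is compact, so
  finitely many cover data suffice there; the same cover still works for parameters near a0.\<close>

lemma push_conic_local:
  assumes \<kappa>: "\<kappa> \<in> test_fun \<Omega>2" and V: "closed V" "conic_set V" and disj: "(supp \<kappa> \<times> V) \<inter> \<Xi> = {}"
    and a0: "a0 \<in> A" and k0: "k0 \<in> V" "k0 \<noteq> 0"
  shows "\<exists>A' V' q. open A' \<and> a0 \<in> A' \<and> open V' \<and> conic_set V' \<and> k0 \<in> V' \<and> dominated q \<and>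
    (\<forall>u\<in>E1. \<forall>a\<in>A \<inter> A'. \<forall>k\<in>V \<inter> V'. (1 + norm k) ^ N * norm (fourier_loc (push a u) \<kappa> k) \<le> q u)"
proof -
  let ?KK = "{z \<in> C \<times> A. f z \<in> supp \<kappa>}"
  have cKK: "compact ?KK" by (rule compact_preimage[OF test_funD(2,3)[OF \<kappa>]])
  define K0 where "K0 = {x \<in> C. f (x, a0) \<in> supp \<kappa>}"
  have "compact (?KK \<inter> (UNIV \<times> {a0}))" by (intro compact_Int_closed cKK closed_Times) auto
  then have "compact (fst ` (?KK \<inter> (UNIV \<times> {a0})))"
    by (intro compact_continuous_image continuous_on_fst continuous_on_id)
  moreover have "fst ` (?KK \<inter> (UNIV \<times> {a0})) = K0"
    using a0 by (auto simp: K0_def intro!: image_eqI)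
  ultimately have cK0: "compact K0" by simp
  have "\<forall>x\<in>K0. \<exists>z. cover_data a0 k0 x z"
  proof
    fix x assume x: "x \<in> K0"
    have "(f (x, a0), k0) \<notin> \<Xi>" using x k0 disj by (auto simp: K0_def)
    then show "\<exists>z. cover_data a0 k0 x z" using cover_data_exists[OF a0 k0(2)] x by (auto simp: K0_def)
  qed
  from bchoice[OF this] obtain z where z: "\<forall>x\<in>K0. cover_data a0 k0 x (z x)" by blast
  define r where "r x = fst (z x)" for x
  define \<theta> where "\<theta> x = fst (snd (z x))" for x
  define W where "W x = fst (snd (snd (z x)))" for x
  define Wc where "Wc x = fst (snd (snd (snd (z x))))" for x
  define A' where "A' x = fst (snd (snd (snd (snd (z x)))))" for x
  define V' where "V' x = snd (snd (snd (snd (snd (z x)))))" for x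
  have cd: "r x > 0" "cball x (r x) \<subseteq> \<Omega>1" "\<theta> x \<in> test_fun \<Omega>1" "\<forall>y\<in>cball x (r x). \<theta> x y = 1"
     "open (W x)" "conic_set (W x)" "W x \<subseteq> Wc x" "closed (Wc x)" "conic_set (Wc x)" "(supp (\<theta> x) \<times> Wc x) \<inter> \<Gamma> = {}"
     "open (A' x)" "a0 \<in> A' x" "A' x \<subseteq> U" "open (V' x)" "k0 \<in> V' x"
     "\<forall>y\<in>cball x (r x). \<forall>a\<in>A' x. \<forall>k\<in>V' x. pullc f y a k \<in> W x \<and> pullc f y a k \<noteq> 0" if "x \<in> K0" for x
    using bspec[OF z that] unfolding cover_data_def case_prod_beta r_def \<theta>_def W_def Wc_def A'_def V'_def by blast+
  obtain F \<rho> G where F: "finite F" "F \<subseteq> K0" "open G" "K0 \<subseteq> G" and \<rho>: "\<And>l. smooth_on UNIV (\<rho> l)"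
    and \<rho>0: "\<And>l x. l \<in> F \<Longrightarrow> x \<notin> cball l (r l) \<Longrightarrow> \<rho> l x = 0"
    and \<rho>1: "\<And>x. x \<in> G \<Longrightarrow> (\<Sum>l\<in>F. \<rho> l x) = (1::complex)"
    by (rule compact_partition[OF cK0 cd(1)]) (assumption | (rule that; assumption))+
  have FK: "l \<in> K0" if "l \<in> F" for l using that F(2) by blast
  \<comment> \<open>The points of the compact preimage outside G project to a compact set of
    parameters that misses a0. For parameters off this set the whole fibre stays in G.\<close>
  define A2 where "A2 = - (snd ` (?KK \<inter> ((- G) \<times> UNIV)))"
  have "compact (snd ` (?KK \<inter> ((- G) \<times> UNIV)))"
    by (intro compact_continuous_image continuous_on_snd continuous_on_id compact_Int_closed cKK closed_Times) (use F(3) in auto)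
  then have oA2: "open A2" unfolding A2_def by (simp add: compact_imp_closed open_Compl)
  have a0A2: "a0 \<in> A2" using F(4) unfolding A2_def K0_def by auto
  have KaG: "{x \<in> C. f (x, a) \<in> supp \<kappa>} \<subseteq> G" if a: "a \<in> A" "a \<in> A2" for a
  proof
    fix x assume x: "x \<in> {x \<in> C. f (x, a) \<in> supp \<kappa>}"
    show "x \<in> G"
    proof (rule ccontr)
      assume "x \<notin> G"
      then have "(x, a) \<in> ?KK \<inter> ((- G) \<times> UNIV)" using x a by auto
      then have "snd (x, a) \<in> snd ` (?KK \<inter> ((- G) \<times> UNIV))" by (rule imageI)
      then show False using a(2) by (simp add: A2_def)
    qed
  qed
  have oA: "open (A2 \<inter> (\<Inter>l\<in>F. A' l))" by (intro open_Int oA2 open_INT F(1) ballI cd(11) FK)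
  have "a0 \<in> A2 \<inter> (\<Inter>l\<in>F. A' l)" using a0A2 cd(12) FK by blast
  then obtain e where e: "e > 0" "cball a0 e \<subseteq> A2 \<inter> (\<Inter>l\<in>F. A' l)"
    using bspec[OF oA[unfolded open_contains_cball]] by metis
  \<comment> \<open>A closed ball, so that Q is compact as \<open>core_estimate\<close>
    requires.\<close>
  define Q where "Q = A \<inter> cball a0 e"
  have cQ: "compact Q" unfolding Q_def by (intro compact_Int_closed compactA closed_cball)
  have QU: "Q \<subseteq> U" using AU by (auto simp: Q_def)
  have oV: "open (\<Inter>l\<in>F. V' l)" by (intro open_INT F(1) ballI cd(14) FK)
  have "k0 \<in> (\<Inter>l\<in>F. V' l)" using cd(15) FK by blast
  then obtain e' where e': "e' > 0" "cball k0 e' \<subseteq> (\<Inter>l\<in>F. V' l)"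
    using open_contains_cball_eq[OF oV] by blast
  \<comment> \<open>After rescaling to the length of k0, the vectors of a cone with this aperture
    lie within e' of k0.\<close>
  define \<delta> where "\<delta> = e' / norm k0"
  have \<delta>: "\<delta> > 0" using e' k0 by (simp add: \<delta>_def)
  have nz: "pullc f y a k \<in> W l \<and> pullc f y a k \<noteq> 0"
    if l: "l \<in> F" and y: "y \<in> cball l (r l)" and a: "a \<in> Q" and k: "k \<in> cone_nbhd k0 \<delta>" "k \<noteq> 0" for l y a k
  proof -
    let ?t = "norm k0 / norm k"
    have t: "?t > 0" using k k0 by simp
    have "?t *\<^sub>R k \<in> cball k0 e'" using cone_nbhd_normalize[OF k k0(2)] k0 by (simp add: \<delta>_def dist_commute)
    then have "?t *\<^sub>R k \<in> V' l" using e'(2) l by blast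
    moreover have "a \<in> A' l" using a e(2) l by (auto simp: Q_def)
    ultimately have "?t *\<^sub>R pullc f y a k \<in> W l \<and> ?t *\<^sub>R pullc f y a k \<noteq> 0"
      using cd(16)[OF FK[OF l]] y unfolding pullc_scale[symmetric] by blast
    moreover from this have "inverse ?t *\<^sub>R ?t *\<^sub>R pullc f y a k \<in> W l"
      using cd(6)[OF FK[OF l]] t unfolding conic_set_def by (meson inverse_positive_iff_positive)
    ultimately show ?thesis using t by simp
  qed
  have sf: "smooth_on (\<Omega>1 \<times> U) (\<lambda>z. \<rho> l (fst z) * \<kappa> (f z))" for l
  proof (intro smooth_on_mult open_Times open1 openU)
    show "smooth_on (\<Omega>1 \<times> U) (\<lambda>z. \<rho> l (fst z))"
      by (rule smooth_on_compose[OF open_Times[OF open1 openU] open_UNIV _ \<rho>])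
         (auto intro: smooth_on_linear[OF open_Times[OF open1 openU]] bounded_linear_fst)
    show "smooth_on (\<Omega>1 \<times> U) (\<lambda>z. \<kappa> (f z))"
      by (rule smooth_on_compose[OF open_Times[OF open1 openU] open_UNIV f test_funD(1)[OF \<kappa>]]) simp
  qed
  define psi where "psi l a k x = \<rho> l x * (\<kappa> (f (x, a)) * expi k (f (x, a)))" for l a k x
  have "\<exists>q. dominated q \<and> (\<forall>u\<in>E1. \<forall>a\<in>Q. \<forall>k\<in>cone_nbhd k0 \<delta>. (1 + norm k) ^ N * norm (u (psi l a k)) \<le> q u)"
    if l: "l \<in> F" for l
  proof -
    note lK = FK[OF l]
    have b0: "\<rho> l (fst (x, a)) * \<kappa> (f (x, a)) = 0" if "x \<in> \<Omega>1 - cball l (r l)" "a \<in> U" for x a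
      using \<rho>0[OF l] that by simp
    show ?thesis
    proof (rule core_estimate[where N=N, OF open1 openU f sf[of l] compact_cball[of l "r l"] cQ cd(2)[OF lK] QU b0
          closed_cone_nbhd[of k0 \<delta>] conic_cone_nbhd cd(5,6)[OF lK] nz[OF l] cd(3)[OF lK]], goal_cases)
      case (7 B N1 c)
      note B = 7(1,2) and est = 7(3)
      have B': "bounded_seminorm B \<in> normal_seminorms \<Omega>1 \<Gamma>" unfolding normal_seminorms_def using B(1) by blast
      have S': "conic_seminorm N1 (Wc l) (\<theta> l) \<in> normal_seminorms \<Omega>1 \<Gamma>"
        unfolding normal_seminorms_def using cd(3,8,9,10)[OF lK] by blast
      show ?case
      proof (intro exI[of _ "\<lambda>u. c * (bounded_seminorm B u + conic_seminorm N1 (Wc l) (\<theta> l) u)"] conjI ballI)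
        show "dominated (\<lambda>u. c * (bounded_seminorm B u + conic_seminorm N1 (Wc l) (\<theta> l) u))"
          by (intro dominated_cmult dominated_add B(2) dominatedI[OF B'] dominatedI[OF S']) auto
        fix u a k assume u: "u \<in> E1" and a: "a \<in> Q" and k: "k \<in> cone_nbhd k0 \<delta>"
        \<comment> \<open>\<open>core_estimate\<close> wants one number above both kinds of bounds;
          the sum of two nonnegative seminorms is one.\<close>
        let ?S = "bounded_seminorm B u + conic_seminorm N1 (Wc l) (\<theta> l) u"
        have n1: "0 \<le> bounded_seminorm B u" "0 \<le> conic_seminorm N1 (Wc l) (\<theta> l) u"
          using normal_seminorm_nonneg[OF open1 B' E1D(1)[OF u]] normal_seminorm_nonneg[OF open1 S' E1D(1)[OF u]] .
        have S0: "0 \<le> ?S" using n1 by simp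
        have SW: "(1 + norm m) ^ N1 * norm (u (\<lambda>x. \<theta> l x * expi m x)) \<le> ?S" if "m \<in> W l" for m
          using conic_seminorm_upper[OF open1 cd(3,8,9,10)[OF lK] E1D(1)[OF u], of m N1] that cd(7)[OF lK] n1 by force
        have SB: "norm (u \<phi>) \<le> ?S" if "\<phi> \<in> B" for \<phi>
          using bounded_seminorm_upper[OF B(1) E1D(2)[OF u] that] n1 by linarith
        \<comment> \<open>As \<open>\<theta> l\<close> is 1 on the ball carrying
          \<open>\<rho> l\<close>, the function in the estimate is \<open>psi l a k\<close>
          itself.\<close>
        have "(\<lambda>x. \<theta> l x * (if x \<in> cball l (r l) then \<rho> l (fst (x, a)) * \<kappa> (f (x, a)) * expi k (f (x, a)) else 0)) = psi l a k"
          using cd(4)[OF lK] \<rho>0[OF l] by (intro ext) (auto simp: psi_def)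
        then show "(1 + norm k) ^ N * norm (u (psi l a k)) \<le> c * ?S"
          using est[OF E1D(2)[OF u] S0 SW SB a k] by simp
      qed
    qed
  qed
  then have "\<forall>l\<in>F. \<exists>q. dominated q \<and> (\<forall>u\<in>E1. \<forall>a\<in>Q. \<forall>k\<in>cone_nbhd k0 \<delta>. (1 + norm k) ^ N * norm (u (psi l a k)) \<le> q u)" by blast
  from bchoice[OF this] obtain q where q: "\<And>l. l \<in> F \<Longrightarrow> dominated (q l)"
    "\<And>l u a k. l \<in> F \<Longrightarrow> u \<in> E1 \<Longrightarrow> a \<in> Q \<Longrightarrow> k \<in> cone_nbhd k0 \<delta> \<Longrightarrow> (1 + norm k) ^ N * norm (u (psi l a k)) \<le> q l u" by blast
  show ?thesis
  proof (intro exI[of _ "ball a0 e"] exI[of _ "open_cone_nbhd k0 \<delta>"] exI[of _ "\<lambda>u. \<Sum>l\<in>F. q l u"] conjI ballI)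
    show "dominated (\<lambda>u. \<Sum>l\<in>F. q l u)" by (rule dominated_sum[OF F(1) q(1)])
    fix u a k assume u: "u \<in> E1" and a: "a \<in> A \<inter> ball a0 e" and k: "k \<in> V \<inter> open_cone_nbhd k0 \<delta>"
    have aQ: "a \<in> Q" using a by (auto simp: Q_def)
    have aA: "a \<in> A" "a \<in> A2" using aQ e(2) by (auto simp: Q_def)
    have kc: "k \<in> cone_nbhd k0 \<delta>" using k open_cone_nbhd_subset by blast
    have \<rho>t: "\<rho> l \<in> test_fun \<Omega>1" if "l \<in> F" for l
      by (rule test_funI[OF \<rho> compact_cball cd(2)[OF FK[OF that]] \<rho>0[OF that]])
    have \<zeta>: "(\<lambda>x. \<Sum>l\<in>F. \<rho> l x) \<in> test_fun \<Omega>1" by (rule test_fun_sum[OF F(1) \<rho>t])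
    have sub: "supp (\<lambda>y. \<kappa> y * expi k y) \<subseteq> supp \<kappa>"
      by (rule supp_subsetI[OF closed_supp]) (simp add: not_in_supp)
    then have subG: "{x \<in> C. f (x, a) \<in> supp (\<lambda>y. \<kappa> y * expi k y)} \<subseteq> G" using KaG[OF aA] by blast
    have "fourier_loc (push a u) \<kappa> k = u (\<lambda>x. (\<Sum>l\<in>F. \<rho> l x) * (\<kappa> (f (x, a)) * expi k (f (x, a))))"
      unfolding fourier_loc_expi by (rule push_eq[OF E1D(2,3)[OF u] aA(1) test_fun_expi[OF \<kappa>] \<zeta> F(3) subG \<rho>1])
    also have "(\<lambda>x. (\<Sum>l\<in>F. \<rho> l x) * (\<kappa> (f (x, a)) * expi k (f (x, a)))) = (\<lambda>x. \<Sum>l\<in>F. psi l a k x)"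
      unfolding psi_def by (simp only: sum_distrib_right)
    also have "u \<dots> = (\<Sum>l\<in>F. u (psi l a k))"
    proof (rule distr_sum[OF E1D(2)[OF u] F(1)])
      fix l assume l: "l \<in> F"
      have "smooth_on \<Omega>1 (\<lambda>x. \<kappa> (f (x, a)) * expi k (f (x, a)))"
        by (intro smooth_on_mult open1 smooth_on_compose[OF open1 open_UNIV slice_smooth[OF aA(1)] test_funD(1)[OF \<kappa>]]
              smooth_on_compose[OF open1 open_UNIV slice_smooth[OF aA(1)] smooth_on_expi[OF open_UNIV]] UNIV_I)
      then show "psi l a k \<in> test_fun \<Omega>1"
        unfolding psi_def[abs_def] by (rule test_fun_mult_smooth[OF \<rho>t[OF l] open1 test_funD(3)[OF \<rho>t[OF l]]])
    qed
    finally have "(1 + norm k) ^ N * norm (fourier_loc (push a u) \<kappa> k) \<le> (1 + norm k) ^ N * (\<Sum>l\<in>F. norm (u (psi l a k)))"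
      by (simp add: mult_left_mono norm_sum)
    also have "\<dots> = (\<Sum>l\<in>F. (1 + norm k) ^ N * norm (u (psi l a k)))" by (rule sum_distrib_left)
    also have "\<dots> \<le> (\<Sum>l\<in>F. q l u)" by (intro sum_mono q(2) u aQ kc)
    finally show "(1 + norm k) ^ N * norm (fourier_loc (push a u) \<kappa> k) \<le> (\<Sum>l\<in>F. q l u)" .
  qed (use e \<delta> k0 open_open_cone_nbhd conic_open_cone_nbhd open_cone_nbhd_self in auto)
qed

text \<open>The local bounds hold on products of open sets of parameters and open cones. Finitely
  many of these cover A times the unit vectors of V, and conicity extends the bound to all nonzero
  k.\<close>

lemma push_conic:
  assumes \<kappa>: "\<kappa> \<in> test_fun \<Omega>2" and V: "closed V" "conic_set V" and disj: "(supp \<kappa> \<times> V) \<inter> \<Xi> = {}"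
  shows "\<exists>q. dominated q \<and> (\<forall>u\<in>E1. \<forall>a\<in>A. \<forall>k\<in>V. (1 + norm k) ^ N * norm (fourier_loc (push a u) \<kappa> k) \<le> q u)"
proof -
  let ?S = "A \<times> (V \<inter> sphere 0 1)"
  have cS: "compact ?S" by (intro compact_Times compactA closed_Int_compact V compact_sphere)
  let ?P = "\<lambda>z (A', V', q). open A' \<and> fst z \<in> A' \<and> open V' \<and> conic_set V' \<and> snd z \<in> V' \<and> dominated q \<and>
    (\<forall>u\<in>E1. \<forall>a\<in>A \<inter> A'. \<forall>k\<in>V \<inter> V'. (1 + norm k) ^ N * norm (fourier_loc (push a u) \<kappa> k) \<le> q u)"
  have "\<forall>z\<in>?S. \<exists>d. ?P z d"
  proof
    fix z assume z: "z \<in> ?S"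
    then have "fst z \<in> A" "snd z \<in> V" "snd z \<noteq> 0" by auto
    from push_conic_local[OF \<kappa> V disj this, of N] show "\<exists>d. ?P z d" by (elim exE) (intro exI[of _ "(_, _, _)"], simp only: split_conv)
  qed
  from bchoice[OF this] obtain d where d: "\<forall>z\<in>?S. ?P z (d z)" by blast
  define A' where "A' z = fst (d z)" for z
  define V' where "V' z = fst (snd (d z))" for z
  define q where "q z = snd (snd (d z))" for z
  have D: "open (A' z)" "fst z \<in> A' z" "open (V' z)" "conic_set (V' z)" "snd z \<in> V' z" "dominated (q z)"
    "\<forall>u\<in>E1. \<forall>a\<in>A \<inter> A' z. \<forall>k\<in>V \<inter> V' z. (1 + norm k) ^ N * norm (fourier_loc (push a u) \<kappa> k) \<le> q z u" if "z \<in> ?S" for z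
    using bspec[OF d that] unfolding A'_def V'_def q_def case_prod_beta by blast+
  have o: "open (A' z \<times> V' z)" if "z \<in> ?S" for z by (intro open_Times D that)
  have "?S \<subseteq> (\<Union>z\<in>?S. A' z \<times> V' z)"
  proof
    fix z assume z: "z \<in> ?S"
    then have "z \<in> A' z \<times> V' z" using D(2,5)[OF z] by (simp add: mem_Times_iff)
    then show "z \<in> (\<Union>z\<in>?S. A' z \<times> V' z)" using z by blast
  qed
  from compactE_image[OF cS o this] obtain F where F: "F \<subseteq> ?S" "finite F" "?S \<subseteq> (\<Union>z\<in>F. A' z \<times> V' z)" by blast
  \<comment> \<open>Nonnegative majorants, so that the bound at one z is below the sum over
    F.\<close>
  have "\<forall>z\<in>F. \<exists>q'. dominated q' \<and> (\<forall>u\<in>E1. q z u \<le> q' u) \<and> (\<forall>u\<in>E1. 0 \<le> q' u)"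
  proof
    fix z assume "z \<in> F"
    then have "dominated (q z)" using D(6) F(1) by blast
    from dominated_nonneg_bound[OF this] show "\<exists>q'. dominated q' \<and> (\<forall>u\<in>E1. q z u \<le> q' u) \<and> (\<forall>u\<in>E1. 0 \<le> q' u)" by metis
  qed
  from bchoice[OF this] obtain q' where q': "\<And>z. z \<in> F \<Longrightarrow> dominated (q' z)"
    "\<And>z u. z \<in> F \<Longrightarrow> u \<in> E1 \<Longrightarrow> q z u \<le> q' z u" "\<And>z u. z \<in> F \<Longrightarrow> u \<in> E1 \<Longrightarrow> 0 \<le> q' z u" by blast
  \<comment> \<open>For k = 0, which no cone around a unit vector has to contain; there the Fourier
    transform is the value at \<kappa>.\<close>
  have \<kappa>b: "test_bounded \<Omega>2 {\<kappa>}"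
    by (rule test_boundedI[OF _ test_funD(2,3)[OF \<kappa>]]) (use \<kappa> in auto)
  obtain B1 where B1: "test_bounded \<Omega>1 B1"
    "\<And>u a \<phi>. u \<in> distributions \<Omega>1 \<Longrightarrow> dsupp \<Omega>1 u \<subseteq> C \<Longrightarrow> a \<in> A \<Longrightarrow> \<phi> \<in> {\<kappa>} \<Longrightarrow> norm (push a u \<phi>) \<le> bounded_seminorm B1 u"
    by (rule push_bounded[OF \<kappa>b]) (rule that; assumption)
  have B1n: "bounded_seminorm B1 \<in> normal_seminorms \<Omega>1 \<Gamma>" unfolding normal_seminorms_def using B1(1) by blast
  have B10: "0 \<le> bounded_seminorm B1 u" if "u \<in> E1" for u
    by (rule bounded_seminorm_nonneg[OF B1(1) E1D(2)[OF that]])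
  show ?thesis
  proof (intro exI[of _ "\<lambda>u. bounded_seminorm B1 u + (\<Sum>z\<in>F. q' z u)"] conjI ballI)
    show "dominated (\<lambda>u. bounded_seminorm B1 u + (\<Sum>z\<in>F. q' z u))"
      by (intro dominated_add dominated_sum F(2) q'(1) dominatedI[OF B1n]) auto
    fix u a k assume u: "u \<in> E1" and a: "a \<in> A" and k: "k \<in> V"
    have s0: "0 \<le> (\<Sum>z\<in>F. q' z u)" by (intro sum_nonneg q'(3) u)
    show "(1 + norm k) ^ N * norm (fourier_loc (push a u) \<kappa> k) \<le> bounded_seminorm B1 u + (\<Sum>z\<in>F. q' z u)"
    proof (cases "k = 0")
      case True
      have "fourier_loc (push a u) \<kappa> k = push a u \<kappa>" using True by (simp add: fourier_loc_def)
      then show ?thesis using B1(2)[OF E1D(2,3)[OF u] a, of \<kappa>] s0 True by simp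
    next
      case False
      have "(1 / norm k) *\<^sub>R k \<in> V \<inter> sphere 0 1" using V(2) k False unfolding conic_set_def by simp
      then obtain z where z: "z \<in> F" "a \<in> A' z" "(1 / norm k) *\<^sub>R k \<in> V' z" using F(3) a by blast
      have zS: "z \<in> ?S" using z F(1) by blast
      have np: "norm k > 0" using False by simp
      have "norm k *\<^sub>R (1 / norm k) *\<^sub>R k \<in> V' z" using D(4)[OF zS] z(3) np unfolding conic_set_def by blast
      then have "k \<in> V' z" using False by simp
      then have "(1 + norm k) ^ N * norm (fourier_loc (push a u) \<kappa> k) \<le> q z u" using D(7)[OF zS] u a k z(2) by blast
      also have "\<dots> \<le> q' z u" by (rule q'(2)[OF z(1) u])
      also have "\<dots> \<le> (\<Sum>z\<in>F. q' z u)" by (rule member_le_sum) (use z(1) F(2) q'(3) u in auto)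
      also have "\<dots> \<le> bounded_seminorm B1 u + (\<Sum>z\<in>F. q' z u)" using B10[OF u] by simp
      finally show ?thesis .
    qed
  qed
qed

end

subsection \<open>Topologies defined by seminorms\<close>

lemma seminorm_on_add: "seminorm_on E p \<Longrightarrow> u \<in> E \<Longrightarrow> v \<in> E \<Longrightarrow> p (\<lambda>x. u x + v x) \<le> p u + p v"
  and seminorm_on_scale: "seminorm_on E p \<Longrightarrow> u \<in> E \<Longrightarrow> p (\<lambda>x. c * u x) = norm c * p u"
  by (simp_all add: seminorm_on_def)

text \<open>Induction over the generation of the topology. A subbasic semiball of radius r centred
  at u that contains 0 also contains, by the triangle inequality, the semiball around 0 of radius r
  - p (-u).\<close>

lemma seminorm_nbhd:
  assumes sn: "\<And>p. p \<in> P \<Longrightarrow> seminorm_on E p"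
    and E0: "(\<lambda>x. 0) \<in> E" and Ec: "\<And>u c. u \<in> E \<Longrightarrow> (\<lambda>x. c * u x) \<in> E"
    and S: "openin (seminorm_topology E P) S" "(\<lambda>x. 0) \<in> S"
  shows "\<exists>P0 \<delta>. finite P0 \<and> P0 \<subseteq> P \<and> \<delta> > 0 \<and> {v \<in> E. \<forall>p\<in>P0. p v < \<delta>} \<subseteq> S"
proof -
  have "generate_topology_on {{v \<in> E. p (\<lambda>x. v x - u x) < r} | p u r. p \<in> P \<and> u \<in> E \<and> 0 < r} S"
    using S(1) unfolding seminorm_topology_def by (simp add: openin_topology_generated_by_iff)
  then show ?thesis using S(2)
  proof induction
    case (Int a b)
    obtain P1 \<delta>1 where 1: "finite P1" "P1 \<subseteq> P" "\<delta>1 > 0" "{v \<in> E. \<forall>p\<in>P1. p v < \<delta>1} \<subseteq> a" using Int by auto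
    obtain P2 \<delta>2 where 2: "finite P2" "P2 \<subseteq> P" "\<delta>2 > 0" "{v \<in> E. \<forall>p\<in>P2. p v < \<delta>2} \<subseteq> b" using Int by auto
    have "{v \<in> E. \<forall>p\<in>P1 \<union> P2. p v < min \<delta>1 \<delta>2} \<subseteq> a \<inter> b" using 1(4) 2(4) by auto
    then show ?case using 1 2 by (intro exI[of _ "P1 \<union> P2"] exI[of _ "min \<delta>1 \<delta>2"]) auto
  next
    case (UN K)
    then obtain k where k: "k \<in> K" "(\<lambda>x. 0) \<in> k" by blast
    obtain P1 \<delta>1 where "finite P1" "P1 \<subseteq> P" "\<delta>1 > 0" "{v \<in> E. \<forall>p\<in>P1. p v < \<delta>1} \<subseteq> k"
      using UN.IH[OF k] by (elim exE conjE) (rule that)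
    then show ?case using k by (intro exI[of _ P1] exI[of _ \<delta>1]) blast
  next
    case (Basis s)
    then obtain p u r where s: "s = {v \<in> E. p (\<lambda>x. v x - u x) < r}" "p \<in> P" "u \<in> E" by blast
    have mu: "(\<lambda>x. - u x) \<in> E" using Ec[OF s(3), of "-1"] by simp
    have "p (\<lambda>x. - u x) < r" using Basis(2) s(1) by simp
    moreover have "p (\<lambda>x. v x - u x) \<le> p v + p (\<lambda>x. - u x)" if "v \<in> E" for v
    proof -
      have "p (\<lambda>x. v x + - u x) \<le> p v + p (\<lambda>x. - u x)" by (rule seminorm_on_add[OF sn[OF s(2)] that mu])
      then show ?thesis by simp
    qed
    ultimately have "{v \<in> E. \<forall>p\<in>{p}. p v < r - p (\<lambda>x. - u x)} \<subseteq> s" unfolding s(1) by force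
    then show ?case using s(2) \<open>p (\<lambda>x. - u x) < r\<close>
      by (intro exI[of _ "{p}"] exI[of _ "r - p (\<lambda>x. - u x)"]) auto
  qed auto
qed

text \<open>Rescaling: a neighbourhood of 0 on which q < 1 contains a finite intersection of
  semiballs, and homogeneity turns this into a linear bound.\<close>

lemma continuous_seminorm_bound:
  assumes sn: "\<And>p. p \<in> P \<Longrightarrow> seminorm_on E p"
    and E0: "(\<lambda>x. 0) \<in> E" and Ec: "\<And>u c. u \<in> E \<Longrightarrow> (\<lambda>x. c * u x) \<in> E"
    and top: "topspace (seminorm_topology E P) = E"
    and q: "seminorm_on E q" "continuous_map (seminorm_topology E P) euclideanreal q"
  obtains P0 c where "finite P0" "P0 \<subseteq> P" "c \<ge> 0" "\<And>v. v \<in> E \<Longrightarrow> q v \<le> c * (\<Sum>p\<in>P0. p v)"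
proof -
  have q0: "q (\<lambda>x. 0) = 0"
  proof -
    have "\<forall>u\<in>E. \<forall>c. q (\<lambda>x. c * u x) = norm c * q u" using q(1) unfolding seminorm_on_def by simp
    from bspec[OF this E0, THEN spec, of 0] show ?thesis by simp
  qed
  have "openin (seminorm_topology E P) {v \<in> topspace (seminorm_topology E P). q v \<in> {..<1}}"
    by (rule openin_continuous_map_preimage[OF q(2)]) simp
  then have "openin (seminorm_topology E P) {v \<in> E. q v < 1}" by (simp add: top)
  from seminorm_nbhd[OF sn E0 Ec this] obtain P0 \<delta> where
    P0: "finite P0" "P0 \<subseteq> P" "\<delta> > 0" "{v \<in> E. \<forall>p\<in>P0. p v < \<delta>} \<subseteq> {v \<in> E. q v < 1}"
    using E0 q0 by auto
  show thesis
  proof (rule that[OF P0(1,2), of "1 / \<delta>"])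
    fix v assume v: "v \<in> E"
    let ?s = "\<Sum>p\<in>P0. p v"
    have pn: "0 \<le> p v" if "p \<in> P0" for p using sn[of p] that P0(2) v unfolding seminorm_on_def by blast
    have s0: "0 \<le> ?s" by (intro sum_nonneg pn)
    \<comment> \<open>The sum may vanish at v, so v is scaled by means of
      \<open>?s + \<epsilon>\<close>, and \<epsilon> is removed afterwards.\<close>
    have "q v \<le> (?s + \<epsilon>) / \<delta>" if \<epsilon>: "\<epsilon> > 0" for \<epsilon>
    proof -
      define t where "t = \<delta> / (?s + \<epsilon>)"
      have t: "t > 0" using P0(3) s0 \<epsilon> by (simp add: t_def)
      have tv: "(\<lambda>x. of_real t * v x) \<in> E" by (rule Ec[OF v])
      have "p (\<lambda>x. of_real t * v x) < \<delta>" if p: "p \<in> P0" for p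
      proof -
        have "p (\<lambda>x. of_real t * v x) = norm (of_real t :: complex) * p v"
          by (rule seminorm_on_scale[OF sn v]) (use p P0(2) in blast)
        also have "\<dots> = t * p v" using t by simp
        also have "\<dots> \<le> t * ?s" by (intro mult_left_mono member_le_sum p P0(1)) (use pn t in auto)
        also have "\<dots> < t * (?s + \<epsilon>)" using t \<epsilon> by simp
        also have "\<dots> = \<delta>" using s0 \<epsilon> by (simp add: t_def)
        finally show ?thesis .
      qed
      then have "q (\<lambda>x. of_real t * v x) < 1" using P0(4) tv by blast
      moreover have "q (\<lambda>x. of_real t * v x) = norm (of_real t :: complex) * q v"
        using q(1) v unfolding seminorm_on_def by blast
      ultimately have "t * q v < 1" using t by simp
      then have "q v < 1 / t" using t by (simp add: pos_less_divide_eq mult.commute)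
      also have "1 / t = (?s + \<epsilon>) / \<delta>" by (simp add: t_def)
      finally show ?thesis by simp
    qed
    then have "q v * \<delta> \<le> ?s + \<epsilon>" if "\<epsilon> > 0" for \<epsilon> using that P0(3) by (simp add: pos_le_divide_eq)
    then have "q v * \<delta> \<le> ?s" by (rule field_le_epsilon)
    then show "q v \<le> 1 / \<delta> * ?s" using P0(3) by (simp add: pos_le_divide_eq)
  qed (use P0 in simp)
qed

text \<open>The converse, on a subspace with the induced topology: differences stay in E', so the
  bound applied to v - u gives continuity at u.\<close>

lemma continuous_seminormI:
  assumes top: "topspace (seminorm_topology E P) = E" and E': "E' = E \<inter> S"
    and E'd: "\<And>u v. u \<in> E' \<Longrightarrow> v \<in> E' \<Longrightarrow> (\<lambda>x. u x - v x) \<in> E'"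
    and q: "seminorm_on E' q" and P0: "finite P0" "P0 \<subseteq> P" "c \<ge> 0" "\<And>v. v \<in> E' \<Longrightarrow> q v \<le> c * (\<Sum>p\<in>P0. p v)"
    and p0: "\<And>p. p \<in> P0 \<Longrightarrow> p (\<lambda>x. 0) = 0"
  shows "continuous_map (subtopology (seminorm_topology E P) S) euclideanreal q"
proof -
  let ?X = "subtopology (seminorm_topology E P) S"
  have tX: "topspace ?X = E'" using top E' by simp
  have "openin ?X {x \<in> topspace ?X. q x \<in> U}" if U: "open U" for U
  proof (subst openin_subopen, intro ballI)
    fix u assume u: "u \<in> {x \<in> topspace ?X. q x \<in> U}"
    then have uE: "u \<in> E'" and uU: "q u \<in> U" using tX by auto
    obtain \<epsilon> where \<epsilon>: "\<epsilon> > 0" "ball (q u) \<epsilon> \<subseteq> U" using openE[OF U uU] by blast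
    \<comment> \<open>The summand 1 makes the denominator positive even for c = 0 or empty
      \<open>P0\<close>, and gives a strict inequality in the end.\<close>
    define \<eta> where "\<eta> = \<epsilon> / (c * real (card P0) + 1)"
    have cp: "c * real (card P0) + 1 > 0" using P0(3) by (simp add: add_nonneg_pos)
    have \<eta>: "\<eta> > 0" using \<epsilon>(1) cp by (simp add: \<eta>_def)
    define T where "T = (\<Inter>p\<in>P0. {v \<in> E'. p (\<lambda>x. v x - u x) < \<eta>}) \<inter> topspace ?X"
    have T_iff: "v \<in> T \<longleftrightarrow> v \<in> E' \<and> (\<forall>p\<in>P0. p (\<lambda>x. v x - u x) < \<eta>)" for v
      unfolding T_def tX by blast
    have "openin ?X T"
      unfolding T_def
    proof (rule openin_INT[OF P0(1)])
      fix p assume p: "p \<in> P0"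
      have "openin (seminorm_topology E P) {v \<in> E. p (\<lambda>x. v x - u x) < \<eta>}"
        unfolding seminorm_topology_def
        by (rule topology_generated_by_Basis) (use p P0(2) uE E' \<eta> in blast)
      then have "openin ?X (S \<inter> {v \<in> E. p (\<lambda>x. v x - u x) < \<eta>})" by (rule openin_subtopology_Int2)
      also have "S \<inter> {v \<in> E. p (\<lambda>x. v x - u x) < \<eta>} = {v \<in> E'. p (\<lambda>x. v x - u x) < \<eta>}" using E' by blast
      finally show "openin ?X {v \<in> E'. p (\<lambda>x. v x - u x) < \<eta>}" .
    qed
    moreover have "u \<in> T"
    proof -
      have "p (\<lambda>x. u x - u x) < \<eta>" if "p \<in> P0" for p using p0[OF that] \<eta> by simp
      then show ?thesis using uE unfolding T_iff by blast
    qed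
    moreover have "T \<subseteq> {x \<in> topspace ?X. q x \<in> U}"
    proof
      fix v assume v: "v \<in> T"
      have vE: "v \<in> E'" using v by (simp add: T_iff)
      have key: "q (\<lambda>x. w x - w' x) < \<epsilon>" if w: "w \<in> E'" "w' \<in> E'" and lt: "\<And>p. p \<in> P0 \<Longrightarrow> p (\<lambda>x. w x - w' x) \<le> \<eta>" for w w'
      proof -
        have "q (\<lambda>x. w x - w' x) \<le> c * (\<Sum>p\<in>P0. p (\<lambda>x. w x - w' x))" by (rule P0(4)[OF E'd[OF w]])
        also have "\<dots> \<le> c * (real (card P0) * \<eta>)"
          by (intro mult_left_mono P0(3) sum_bounded_above lt)
        also have "\<dots> < (c * real (card P0) + 1) * \<eta>" using \<eta> by (simp add: distrib_right mult.assoc)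
        also have "\<dots> = \<epsilon>" using cp by (simp add: \<eta>_def)
        finally show ?thesis .
      qed
      have d: "q (\<lambda>x. v x - u x) < \<epsilon>"
        by (rule key[OF vE uE]) (use v in \<open>auto simp: T_iff intro: less_imp_le\<close>)
      have tri: "q w \<le> q w' + q (\<lambda>x. w x - w' x)" if "w \<in> E'" "w' \<in> E'" for w w'
      proof -
        have "q (\<lambda>x. w' x + (w x - w' x)) \<le> q w' + q (\<lambda>x. w x - w' x)"
          by (rule seminorm_on_add[OF q that(2) E'd[OF that]])
        then show ?thesis by simp
      qed
      have "q (\<lambda>x. u x - v x) = q (\<lambda>x. v x - u x)"
      proof -
        have "q (\<lambda>x. (-1) * (v x - u x)) = norm (-1 :: complex) * q (\<lambda>x. v x - u x)"
          by (rule seminorm_on_scale[OF q E'd[OF vE uE]])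
        then show ?thesis by simp
      qed
      then have "\<bar>q v - q u\<bar> < \<epsilon>" using tri[OF vE uE] tri[OF uE vE] d by linarith
      then have "q v \<in> ball (q u) \<epsilon>" by (simp add: dist_real_def abs_minus_commute)
      then show "v \<in> {x \<in> topspace ?X. q x \<in> U}" using vE tX \<epsilon>(2) by auto
    qed
    ultimately show "\<exists>T. openin ?X T \<and> u \<in> T \<and> T \<subseteq> {x \<in> topspace ?X. q x \<in> U}" by blast
  qed
  then show ?thesis unfolding continuous_map_def by (simp add: Pi_iff)
qed

section \<open>Linear structure of the spaces of distributions\<close>

lemma distributions_zero: "(\<lambda>\<phi>. 0) \<in> distributions \<Omega>"
  unfolding distributions_def by (auto intro!: exI[of _ 0])

lemma distributions_add:
  assumes u: "u \<in> distributions \<Omega>" and v: "v \<in> distributions \<Omega>"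
  shows "(\<lambda>\<phi>. u \<phi> + v \<phi>) \<in> distributions \<Omega>"
  unfolding distributions_def
proof (intro CollectI conjI ballI allI impI)
  fix K assume K: "compact K \<and> K \<subseteq> \<Omega>"
  obtain c m where c: "c \<ge> 0" "\<And>\<phi>. \<phi> \<in> test_fun \<Omega> \<Longrightarrow> supp \<phi> \<subseteq> K \<Longrightarrow> norm (u \<phi>) \<le> c * Ck_norm m \<phi>"
    using distr_order[OF u conjunct1[OF K] conjunct2[OF K]] by metis
  obtain c' m' where c': "c' \<ge> 0" "\<And>\<phi>. \<phi> \<in> test_fun \<Omega> \<Longrightarrow> supp \<phi> \<subseteq> K \<Longrightarrow> norm (v \<phi>) \<le> c' * Ck_norm m' \<phi>"
    using distr_order[OF v conjunct1[OF K] conjunct2[OF K]] by metis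
  have mono: "Ck_norm j \<phi> \<le> Ck_norm (max m m') \<phi>" if "\<phi> \<in> test_fun \<Omega>" "j \<le> max m m'" for j \<phi>
    by (rule Ck_norm_least) (use Ck_norm_upper[OF that(1)] that(2) in \<open>meson le_trans\<close>)
  have "norm (u \<phi> + v \<phi>) \<le> (c + c') * Ck_norm (max m m') \<phi>" if \<phi>: "\<phi> \<in> test_fun \<Omega>" "supp \<phi> \<subseteq> K" for \<phi>
  proof -
    have "norm (u \<phi> + v \<phi>) \<le> c * Ck_norm m \<phi> + c' * Ck_norm m' \<phi>"
      by (intro order_trans[OF norm_triangle_ineq] add_mono c(2) c'(2) \<phi>)
    also have "\<dots> \<le> c * Ck_norm (max m m') \<phi> + c' * Ck_norm (max m m') \<phi>"
      by (intro add_mono mult_left_mono mono \<phi> c c') auto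
    finally show ?thesis by (simp add: distrib_right)
  qed
  then show "\<exists>c m. \<forall>\<phi>\<in>test_fun \<Omega>. supp \<phi> \<subseteq> K \<longrightarrow> norm (u \<phi> + v \<phi>) \<le> c * Ck_norm m \<phi>" by blast
next
  fix \<phi> assume "\<phi> \<notin> test_fun \<Omega>"
  then show "u \<phi> + v \<phi> = 0" using u v by (simp add: distributions_def)
qed (auto simp: distr_add[OF u] distr_add[OF v] distr_cmult[OF u] distr_cmult[OF v] distrib_left)

lemma distributions_cmult:
  assumes u: "u \<in> distributions \<Omega>"
  shows "(\<lambda>\<phi>. c * u \<phi>) \<in> distributions \<Omega>"
  unfolding distributions_def
proof (intro CollectI conjI ballI allI impI)
  fix K assume K: "compact K \<and> K \<subseteq> \<Omega>"
  obtain d m where d: "d \<ge> 0" "\<And>\<phi>. \<phi> \<in> test_fun \<Omega> \<Longrightarrow> supp \<phi> \<subseteq> K \<Longrightarrow> norm (u \<phi>) \<le> d * Ck_norm m \<phi>"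
    using distr_order[OF u conjunct1[OF K] conjunct2[OF K]] by metis
  have "norm (c * u \<phi>) \<le> (norm c * d) * Ck_norm m \<phi>" if \<phi>: "\<phi> \<in> test_fun \<Omega>" "supp \<phi> \<subseteq> K" for \<phi>
    using mult_left_mono[OF d(2)[OF \<phi>] norm_ge_zero[of c]] by (simp add: norm_mult mult.assoc)
  then show "\<exists>d m. \<forall>\<phi>\<in>test_fun \<Omega>. supp \<phi> \<subseteq> K \<longrightarrow> norm (c * u \<phi>) \<le> d * Ck_norm m \<phi>" by blast
next
  fix \<phi> assume "\<phi> \<notin> test_fun \<Omega>"
  then show "c * u \<phi> = 0" using u by (simp add: distributions_def)
qed (auto simp: distr_add[OF u] distr_cmult[OF u] distrib_left)

lemma rapid_decay_add:
  assumes "rapid_decay u \<theta> V" "rapid_decay v \<theta> V"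
  shows "rapid_decay (\<lambda>\<phi>. u \<phi> + v \<phi>) \<theta> V"
  unfolding rapid_decay_def
proof
  fix N
  obtain M1 M2 where M: "\<forall>k\<in>V. (1 + norm k) ^ N * norm (fourier_loc u \<theta> k) \<le> M1"
      "\<forall>k\<in>V. (1 + norm k) ^ N * norm (fourier_loc v \<theta> k) \<le> M2"
    using assms unfolding rapid_decay_def bdd_above_def by (meson imageI)
  have "(1 + norm k) ^ N * norm (fourier_loc (\<lambda>\<phi>. u \<phi> + v \<phi>) \<theta> k) \<le> M1 + M2" if k: "k \<in> V" for k
  proof -
    have "(1 + norm k) ^ N * norm (fourier_loc (\<lambda>\<phi>. u \<phi> + v \<phi>) \<theta> k) \<le>
        (1 + norm k) ^ N * (norm (fourier_loc u \<theta> k) + norm (fourier_loc v \<theta> k))"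
      unfolding fourier_loc_def by (intro mult_left_mono norm_triangle_ineq) simp
    also have "\<dots> \<le> M1 + M2" unfolding distrib_left by (intro add_mono bspec[OF M(1) k] bspec[OF M(2) k])
    finally show ?thesis .
  qed
  then show "bdd_above ((\<lambda>k. (1 + norm k) ^ N * norm (fourier_loc (\<lambda>\<phi>. u \<phi> + v \<phi>) \<theta> k)) ` V)"
    by (intro bdd_aboveI[of _ "M1 + M2"]) auto
qed

lemma rapid_decay_cmult:
  assumes "rapid_decay u \<theta> V"
  shows "rapid_decay (\<lambda>\<phi>. c * u \<phi>) \<theta> V"
  unfolding rapid_decay_def
proof
  fix N
  obtain M where M: "\<forall>k\<in>V. (1 + norm k) ^ N * norm (fourier_loc u \<theta> k) \<le> M"
    using assms unfolding rapid_decay_def bdd_above_def by (meson imageI)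
  have "(1 + norm k) ^ N * norm (fourier_loc (\<lambda>\<phi>. c * u \<phi>) \<theta> k) \<le> norm c * M" if k: "k \<in> V" for k
    using mult_left_mono[OF bspec[OF M k] norm_ge_zero[of c]] by (simp add: fourier_loc_def norm_mult mult_ac)
  then show "bdd_above ((\<lambda>k. (1 + norm k) ^ N * norm (fourier_loc (\<lambda>\<phi>. c * u \<phi>) \<theta> k)) ` V)"
    by (intro bdd_aboveI[of _ "norm c * M"]) auto
qed

context
  fixes \<Omega> :: "'a::euclidean_space set" and \<Gamma>
  assumes \<Omega>: "open \<Omega>" and \<Gamma>: "closed_cone \<Omega> \<Gamma>"
begin

lemma distributions_WF_add:
  "u \<in> distributions_WF \<Omega> \<Gamma> \<Longrightarrow> v \<in> distributions_WF \<Omega> \<Gamma> \<Longrightarrow> (\<lambda>\<phi>. u \<phi> + v \<phi>) \<in> distributions_WF \<Omega> \<Gamma>"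
  by (simp add: distributions_WF_iff[OF \<Omega> \<Gamma>] distributions_add rapid_decay_add)

lemma distributions_WF_cmult:
  "u \<in> distributions_WF \<Omega> \<Gamma> \<Longrightarrow> (\<lambda>\<phi>. c * u \<phi>) \<in> distributions_WF \<Omega> \<Gamma>"
  by (simp add: distributions_WF_iff[OF \<Omega> \<Gamma>] distributions_cmult rapid_decay_cmult)

lemma distributions_WF_zero: "(\<lambda>\<phi>. 0) \<in> distributions_WF \<Omega> \<Gamma>"
proof -
  have "rapid_decay (\<lambda>\<phi>. 0) \<theta> V" for \<theta> :: "'a \<Rightarrow> complex" and V
    unfolding rapid_decay_def by (auto simp: fourier_loc_def intro!: bdd_aboveI[of _ 0])
  then show ?thesis unfolding distributions_WF_iff[OF \<Omega> \<Gamma>] using distributions_zero by blast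
qed

end

section \<open>Linearity of the push-forward and closedness of the image cone\<close>

context push_family
begin

lemma E1_add: "u \<in> E1 \<Longrightarrow> v \<in> E1 \<Longrightarrow> (\<lambda>\<phi>. u \<phi> + v \<phi>) \<in> E1"
  and E1_cmult: "u \<in> E1 \<Longrightarrow> (\<lambda>\<phi>. c * u \<phi>) \<in> E1"
proof -
  have z: "\<forall>\<phi>\<in>test_fun \<Omega>1. supp \<phi> \<inter> C = {} \<longrightarrow> u \<phi> = 0" if "u \<in> E1" for u
    using dsupp_subset_iff[OF open1 C E1D(2)[OF that]] E1D(3)[OF that] by blast
  show "(\<lambda>\<phi>. u \<phi> + v \<phi>) \<in> E1" if "u \<in> E1" "v \<in> E1"
  proof -
    have "(\<lambda>\<phi>. u \<phi> + v \<phi>) \<in> distributions \<Omega>1" by (rule distributions_add[OF E1D(2)[OF that(1)] E1D(2)[OF that(2)]])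
    from dsupp_subset_iff[OF open1 C this] have "dsupp \<Omega>1 (\<lambda>\<phi>. u \<phi> + v \<phi>) \<subseteq> C" using z[OF that(1)] z[OF that(2)] by simp
    then show ?thesis unfolding E1_def using distributions_WF_add[OF open1 \<Gamma> E1D(1)[OF that(1)] E1D(1)[OF that(2)]] by simp
  qed
  show "(\<lambda>\<phi>. c * u \<phi>) \<in> E1" if "u \<in> E1"
  proof -
    have "(\<lambda>\<phi>. c * u \<phi>) \<in> distributions \<Omega>1" by (rule distributions_cmult[OF E1D(2)[OF that]])
    from dsupp_subset_iff[OF open1 C this] have "dsupp \<Omega>1 (\<lambda>\<phi>. c * u \<phi>) \<subseteq> C" using z[OF that] by simp
    then show ?thesis unfolding E1_def using distributions_WF_cmult[OF open1 \<Gamma> E1D(1)[OF that]] by simp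
  qed
qed

lemma E1_diff: "u \<in> E1 \<Longrightarrow> v \<in> E1 \<Longrightarrow> (\<lambda>\<phi>. u \<phi> - v \<phi>) \<in> E1"
  using E1_add[of u "\<lambda>\<phi>. (-1) * v \<phi>"] E1_cmult[of v "-1"] by simp

text \<open>\<open>pairing\<close> refers to the support of u and is not linear by its form. A
  cutoff depending only on \<kappa> makes the push-forward of every u in \<open>E1\<close> its value
  at one fixed test function.\<close>

lemma
  assumes a: "a \<in> A" and u: "u \<in> E1"
  shows push_add: "v \<in> E1 \<Longrightarrow> push a (\<lambda>\<phi>. u \<phi> + v \<phi>) = (\<lambda>\<phi>. push a u \<phi> + push a v \<phi>)"
    and push_cmult: "push a (\<lambda>\<phi>. c * u \<phi>) = (\<lambda>\<phi>. c * push a u \<phi>)"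
proof -
  have eq: "\<exists>\<zeta>. \<forall>u\<in>E1. push a u \<kappa> = u (\<lambda>x. \<zeta> x * \<kappa> (f (x, a)))" if \<kappa>: "\<kappa> \<in> test_fun \<Omega>2" for \<kappa>
  proof -
    obtain \<zeta> where \<zeta>: "\<zeta> \<in> test_fun \<Omega>1"
      "\<And>u a \<kappa>'. u \<in> distributions \<Omega>1 \<Longrightarrow> dsupp \<Omega>1 u \<subseteq> C \<Longrightarrow> a \<in> A \<Longrightarrow> \<kappa>' \<in> test_fun \<Omega>2 \<Longrightarrow> supp \<kappa>' \<subseteq> supp \<kappa> \<Longrightarrow>
         push a u \<kappa>' = u (\<lambda>x. \<zeta> x * \<kappa>' (f (x, a)))"
      by (rule uniform_cutoff[OF test_funD(2,3)[OF \<kappa>]]) (rule that; assumption)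
    then show ?thesis using a \<kappa> E1D by (intro exI[of _ \<zeta>]) simp
  qed
  show "push a (\<lambda>\<phi>. u \<phi> + v \<phi>) = (\<lambda>\<phi>. push a u \<phi> + push a v \<phi>)" if v: "v \<in> E1"
  proof
    fix \<kappa> show "push a (\<lambda>\<phi>. u \<phi> + v \<phi>) \<kappa> = push a u \<kappa> + push a v \<kappa>"
    proof (cases "\<kappa> \<in> test_fun \<Omega>2")
      case True
      then obtain \<zeta> where "\<forall>u\<in>E1. push a u \<kappa> = u (\<lambda>x. \<zeta> x * \<kappa> (f (x, a)))" using eq by blast
      then show ?thesis using u v E1_add[OF u v] by simp
    qed (simp add: push_distr_def)
  qed
  show "push a (\<lambda>\<phi>. c * u \<phi>) = (\<lambda>\<phi>. c * push a u \<phi>)"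
  proof
    fix \<kappa> show "push a (\<lambda>\<phi>. c * u \<phi>) \<kappa> = c * push a u \<kappa>"
    proof (cases "\<kappa> \<in> test_fun \<Omega>2")
      case True
      then obtain \<zeta> where "\<forall>u\<in>E1. push a u \<kappa> = u (\<lambda>x. \<zeta> x * \<kappa> (f (x, a)))" using eq by blast
      then show ?thesis using u E1_cmult[OF u] by simp
    qed (simp add: push_distr_def)
  qed
qed

text \<open>The derivative of each slice is replaced by \<open>pullc\<close>, which is continuous in
  x, a and k jointly and so permits limits. As \<Gamma> lies over C, the base point may be taken in
  C.\<close>

lemma Xi_iff:
  "(y, k) \<in> \<Xi> \<longleftrightarrow> (y, k) \<in> dotT \<Omega>2 \<and> (\<exists>a\<in>A. \<exists>x\<in>C. y = f (x, a) \<and> (pullc f x a k = 0 \<or> (x, pullc f x a k) \<in> \<Gamma>))"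
proof -
  have eq: "pull_covector (\<lambda>x. f (x, a)) x k = pullc f x a k" if "x \<in> \<Omega>1" "a \<in> A" for x a
    by (rule pullc_eq_pull_covector[OF f]) (use that AU in auto)
  have \<Gamma>C': "x \<in> C" if "(x, l) \<in> \<Gamma>" for x l using \<Gamma>C that by force
  show ?thesis
  proof
    assume "(y, k) \<in> \<Xi>"
    then obtain a x where ax: "a \<in> A" "(y, k) \<in> dotT \<Omega>2" "x \<in> \<Omega>1" "y = f (x, a)" "(x, pull_covector (\<lambda>x. f (x, a)) x k) \<in> \<Gamma> \<union> C \<times> {0}"
      unfolding \<Xi> push_cone_def by auto
    then have "(x, pullc f x a k) \<in> \<Gamma> \<union> C \<times> {0}" using eq by simp
    then show "(y, k) \<in> dotT \<Omega>2 \<and> (\<exists>a\<in>A. \<exists>x\<in>C. y = f (x, a) \<and> (pullc f x a k = 0 \<or> (x, pullc f x a k) \<in> \<Gamma>))"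
      using ax \<Gamma>C' by auto
  next
    assume R: "(y, k) \<in> dotT \<Omega>2 \<and> (\<exists>a\<in>A. \<exists>x\<in>C. y = f (x, a) \<and> (pullc f x a k = 0 \<or> (x, pullc f x a k) \<in> \<Gamma>))"
    then obtain a x where ax: "a \<in> A" "x \<in> C" "y = f (x, a)" "pullc f x a k = 0 \<or> (x, pullc f x a k) \<in> \<Gamma>" by blast
    have x1: "x \<in> \<Omega>1" using ax C_subset by blast
    have "(x, pull_covector (\<lambda>x. f (x, a)) x k) \<in> \<Gamma> \<union> C \<times> {0}" using eq[OF x1 ax(1)] ax by auto
    then have "(y, k) \<in> push_cone \<Omega>1 \<Omega>2 C (\<lambda>x. f (x, a)) \<Gamma>" unfolding push_cone_def using R x1 ax(3) by blast
    then show "(y, k) \<in> \<Xi>" unfolding \<Xi> using ax(1) by blast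
  qed
qed

text \<open>For a sequence in \<Xi> with limit in \<open>dotT \<Omega>2\<close>, the points (x, a)
  over it stay in a compact preimage and subconverge. The pulled back covectors then converge to 0
  or to a covector of \<Gamma>, and both alternatives belong to \<Xi>.\<close>

lemma closed_cone_Xi: "closed_cone \<Omega>2 \<Xi>"
  unfolding closed_cone_def
proof (intro conjI allI impI)
  have sub: "\<Xi> \<subseteq> dotT \<Omega>2" using Xi_iff by auto
  have "dotT \<Omega>2 \<inter> closure \<Xi> \<subseteq> \<Xi>"
  proof
    fix z assume z: "z \<in> dotT \<Omega>2 \<inter> closure \<Xi>"
    obtain y k where yk: "z = (y, k)" by (cases z)
    have y2: "y \<in> \<Omega>2" using z by (simp add: yk dotT_def)
    obtain s where s: "\<And>n. s n \<in> \<Xi>" "s \<longlonglongrightarrow> z" using z closure_sequential by blast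
    have "\<forall>n. \<exists>xa. fst xa \<in> C \<and> snd xa \<in> A \<and> fst (s n) = f xa \<and>
        (pullc f (fst xa) (snd xa) (snd (s n)) = 0 \<or> (fst xa, pullc f (fst xa) (snd xa) (snd (s n))) \<in> \<Gamma>)"
    proof
      fix n
      have "(fst (s n), snd (s n)) \<in> \<Xi>" using s(1) by simp
      then obtain a x where "a \<in> A" "x \<in> C" "fst (s n) = f (x, a)"
         "pullc f x a (snd (s n)) = 0 \<or> (x, pullc f x a (snd (s n))) \<in> \<Gamma>" unfolding Xi_iff by blast
      then show "\<exists>xa. fst xa \<in> C \<and> snd xa \<in> A \<and> fst (s n) = f xa \<and>
        (pullc f (fst xa) (snd xa) (snd (s n)) = 0 \<or> (fst xa, pullc f (fst xa) (snd xa) (snd (s n))) \<in> \<Gamma>)"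
        by (intro exI[of _ "(x, a)"]) simp
    qed
    from choice[OF this] obtain w where w: "\<And>n. fst (w n) \<in> C" "\<And>n. snd (w n) \<in> A" "\<And>n. fst (s n) = f (w n)"
      "\<And>n. pullc f (fst (w n)) (snd (w n)) (snd (s n)) = 0 \<or> (fst (w n), pullc f (fst (w n)) (snd (w n)) (snd (s n))) \<in> \<Gamma>" by blast
    obtain e where e: "e > 0" "cball y e \<subseteq> \<Omega>2" using open_contains_cball_eq[OF open2] y2 by blast
    let ?KK = "{z \<in> C \<times> A. f z \<in> cball y e}"
    have cKK: "compact ?KK" by (rule compact_preimage[OF compact_cball e(2)])
    have fs: "(\<lambda>n. fst (s n)) \<longlonglongrightarrow> y" and ss: "(\<lambda>n. snd (s n)) \<longlonglongrightarrow> k"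
      using tendsto_fst[OF s(2)] tendsto_snd[OF s(2)] by (simp_all add: yk)
    have "eventually (\<lambda>n. dist (fst (s n)) y < e) sequentially" using tendstoD[OF fs e(1)] .
    \<comment> \<open>Only from n0 on are the base points in the ball whose preimage is compact;
      hence the shifted sequence below.\<close>
    then obtain n0 where n0: "\<And>n. n \<ge> n0 \<Longrightarrow> dist (fst (s n)) y < e" unfolding eventually_sequentially by blast
    have "w (n + n0) \<in> ?KK" for n
    proof -
      have "dist (fst (s (n + n0))) y < e" by (rule n0) simp
      then have "f (w (n + n0)) \<in> cball y e" by (simp add: w(3) dist_commute)
      then show ?thesis using w(1,2) by (simp add: mem_Times_iff)
    qed
    then have "\<forall>n. (\<lambda>n. w (n + n0)) n \<in> ?KK" by simp
    from seq_compactE[OF cKK[unfolded compact_eq_seq_compact_metric] this]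
    obtain l r where l: "l \<in> ?KK" "strict_mono r" "((\<lambda>n. w (n + n0)) \<circ> r) \<longlonglongrightarrow> l" by blast
    define m where "m n = r n + n0" for n
    have m: "filterlim m sequentially sequentially"
      unfolding m_def by (rule filterlim_compose[OF filterlim_add_const_nat_at_top filterlim_subseq[OF l(2)]])
    have wl: "(\<lambda>n. w (m n)) \<longlonglongrightarrow> l" using l(3) by (simp add: o_def m_def)
    have sm: "(\<lambda>n. snd (s (m n))) \<longlonglongrightarrow> k" "(\<lambda>n. fst (s (m n))) \<longlonglongrightarrow> y"
      using filterlim_compose[OF ss m] filterlim_compose[OF fs m] .
    obtain x a where xa: "l = (x, a)" by (cases l)
    have xC: "x \<in> C" and aA: "a \<in> A" using l(1) by (auto simp: xa)
    have x1: "x \<in> \<Omega>1" and aU: "a \<in> U" using xC aA C_subset AU by auto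
    have "isCont f l"
      using continuous_on_eq_continuous_at[OF open_Times[OF open1 openU]] smooth_on_continuous[OF f] x1 aU by (auto simp: xa)
    then have "(\<lambda>n. f (w (m n))) \<longlonglongrightarrow> f l" using wl by (rule isCont_tendsto_compose)
    moreover have "(\<lambda>n. f (w (m n))) \<longlonglongrightarrow> y" using sm(2) by (simp add: w(3))
    ultimately have y: "y = f (x, a)" using LIMSEQ_unique xa by blast
    define p where "p n = pullc f (fst (w (m n))) (snd (w (m n))) (snd (s (m n)))" for n
    have pl: "p \<longlonglongrightarrow> pullc f x a k"
    proof -
      have "isCont (\<lambda>(x, a, k). pullc f x a k) (x, a, k)"
        using continuous_on_eq_continuous_at[OF open_Times[OF open1 open_Times[OF openU open_UNIV]]] pullc_continuous[OF f] x1 aU by auto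
      moreover have "(\<lambda>n. (fst (w (m n)), snd (w (m n)), snd (s (m n)))) \<longlonglongrightarrow> (x, a, k)"
        using tendsto_Pair[OF tendsto_fst[OF wl] tendsto_Pair[OF tendsto_snd[OF wl] sm(1)]] by (simp add: xa)
      ultimately have "(\<lambda>n. (\<lambda>(x, a, k). pullc f x a k) (fst (w (m n)), snd (w (m n)), snd (s (m n)))) \<longlonglongrightarrow> (\<lambda>(x, a, k). pullc f x a k) (x, a, k)"
        by (rule isCont_tendsto_compose)
      then show ?thesis by (simp add: p_def[abs_def])
    qed
    have "pullc f x a k = 0 \<or> (x, pullc f x a k) \<in> \<Gamma>"
    proof (rule disjCI)
      assume nz: "(x, pullc f x a k) \<notin> \<Gamma>"
      show "pullc f x a k = 0"
      proof (rule ccontr)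
        assume n0: "pullc f x a k \<noteq> 0"
        \<comment> \<open>\<Gamma> is closed relative to \<open>dotT \<Omega>1\<close> only. Its
          limit points with nonzero covector over \<Omega>1 are recovered from a closed set
          \<open>T\<close>.\<close>
        obtain T where T: "closed T" "\<Gamma> = dotT \<Omega>1 \<inter> T"
          using \<Gamma> unfolding closed_cone_def by (metis closedin_closed)
        have "eventually (\<lambda>n. p n \<in> - {0}) sequentially"
          by (rule topological_tendstoD[OF pl]) (use n0 in auto)
        then have ev: "eventually (\<lambda>n. (fst (w (m n)), p n) \<in> T) sequentially"
        proof (rule eventually_mono)
          fix n assume "p n \<in> - {0}"
          then have "(fst (w (m n)), p n) \<in> \<Gamma>" using w(4)[of "m n"] by (simp add: p_def)
          then show "(fst (w (m n)), p n) \<in> T" using T by blast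
        qed
        have "(\<lambda>n. (fst (w (m n)), p n)) \<longlonglongrightarrow> (x, pullc f x a k)"
          using tendsto_Pair[OF tendsto_fst[OF wl] pl] by (simp add: xa)
        from Lim_in_closed_set[OF T(1) ev _ this] have "(x, pullc f x a k) \<in> T" by simp
        then show False using nz T(2) x1 n0 by (auto simp: dotT_def)
      qed
    qed
    then show "z \<in> \<Xi>" using z y aA xC unfolding yk Xi_iff by blast
  qed
  then have "\<Xi> = dotT \<Omega>2 \<inter> closure \<Xi>" using sub closure_subset by blast
  then show "closedin (top_of_set (dotT \<Omega>2)) \<Xi>" by (metis closedin_closed_Int closed_closure)
next
  fix y k and t :: real assume h: "(y, k) \<in> \<Xi> \<and> 0 < t"
  have cone: "\<And>x k t. (x, k) \<in> \<Gamma> \<Longrightarrow> t > 0 \<Longrightarrow> (x, t *\<^sub>R k) \<in> \<Gamma>"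
    using \<Gamma> unfolding closed_cone_def by auto
  obtain a x where ax: "(y, k) \<in> dotT \<Omega>2" "a \<in> A" "x \<in> C" "y = f (x, a)" "pullc f x a k = 0 \<or> (x, pullc f x a k) \<in> \<Gamma>"
    using h unfolding Xi_iff by blast
  have "(y, t *\<^sub>R k) \<in> dotT \<Omega>2" using ax(1) h by (auto simp: dotT_def)
  moreover have "pullc f x a (t *\<^sub>R k) = 0 \<or> (x, pullc f x a (t *\<^sub>R k)) \<in> \<Gamma>"
    using ax(5) cone h unfolding pullc_scale by auto
  ultimately show "(y, t *\<^sub>R k) \<in> \<Xi>" unfolding Xi_iff using ax by blast
qed

section \<open>Uniform continuity of the push-forwards\<close>

lemma push_in_WF:
  assumes u: "u \<in> E1" and a: "a \<in> A"
  shows "push a u \<in> distributions_WF \<Omega>2 \<Xi>"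
  unfolding distributions_WF_iff[OF open2 closed_cone_Xi]
proof (intro conjI allI impI)
  show "push a u \<in> distributions \<Omega>2" by (rule push_distribution[OF E1D(2,3)[OF u] a])
  fix \<theta> V assume \<theta>: "\<theta> \<in> test_fun \<Omega>2" "closed V" "conic_set V" "(supp \<theta> \<times> V) \<inter> \<Xi> = {}"
  show "rapid_decay (push a u) \<theta> V"
    unfolding rapid_decay_def
  proof
    fix N
    obtain q where "\<forall>u\<in>E1. \<forall>a\<in>A. \<forall>k\<in>V. (1 + norm k) ^ N * norm (fourier_loc (push a u) \<theta> k) \<le> q u"
      using push_conic[OF \<theta>, of N] by blast
    then show "bdd_above ((\<lambda>k. (1 + norm k) ^ N * norm (fourier_loc (push a u) \<theta> k)) ` V)"
      using u a by (intro bdd_aboveI[of _ "q u"]) auto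
  qed
qed

lemma push_normal_seminorm:
  assumes p: "p \<in> normal_seminorms \<Omega>2 \<Xi>"
  shows "\<exists>q. dominated q \<and> (\<forall>u\<in>E1. \<forall>a\<in>A. p (push a u) \<le> q u)"
proof -
  from p consider B where "p = bounded_seminorm B" "test_bounded \<Omega>2 B"
    | N V \<theta> where "p = conic_seminorm N V \<theta>" "\<theta> \<in> test_fun \<Omega>2" "closed V" "conic_set V" "(supp \<theta> \<times> V) \<inter> \<Xi> = {}"
    unfolding normal_seminorms_def by blast
  then show ?thesis
  proof cases
    case 1
    obtain B1 where B1: "test_bounded \<Omega>1 B1"
      "\<And>u a \<phi>. u \<in> distributions \<Omega>1 \<Longrightarrow> dsupp \<Omega>1 u \<subseteq> C \<Longrightarrow> a \<in> A \<Longrightarrow> \<phi> \<in> B \<Longrightarrow> norm (push a u \<phi>) \<le> bounded_seminorm B1 u"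
      by (rule push_bounded[OF 1(2)]) (rule that; assumption)
    have B1n: "bounded_seminorm B1 \<in> normal_seminorms \<Omega>1 \<Gamma>" unfolding normal_seminorms_def using B1(1) by blast
    have "p (push a u) \<le> bounded_seminorm B1 u" if u: "u \<in> E1" and a: "a \<in> A" for u a
      unfolding 1(1) bounded_seminorm_def[of B]
      by (rule sup0_least) (use B1(2)[OF E1D(2,3)[OF u] a] bounded_seminorm_nonneg[OF B1(1) E1D(2)[OF u]] in auto)
    then show ?thesis using dominatedI[OF B1n order_refl] by blast
  next
    case 2
    obtain q where q: "dominated q" "\<forall>u\<in>E1. \<forall>a\<in>A. \<forall>k\<in>V. (1 + norm k) ^ N * norm (fourier_loc (push a u) \<theta> k) \<le> q u"
      using push_conic[OF 2(2-5), of N] by blast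
    obtain q' where q': "dominated q'" "\<And>u. u \<in> E1 \<Longrightarrow> q u \<le> q' u" "\<And>u. u \<in> E1 \<Longrightarrow> 0 \<le> q' u"
      using dominated_nonneg_bound[OF q(1)] by blast
    have "p (push a u) \<le> q' u" if u: "u \<in> E1" and a: "a \<in> A" for u a
      unfolding 2(1) conic_seminorm_def
    proof (rule sup0_least)
      fix y assume "y \<in> (\<lambda>k. (1 + norm k) ^ N * norm (fourier_loc (push a u) \<theta> k)) ` V"
      then have "y \<le> q u" using q(2) u a by auto
      also have "\<dots> \<le> q' u" by (rule q'(2)[OF u])
      finally show "y \<le> q' u" .
    qed (rule q'(3)[OF u])
    then show ?thesis using q'(1) by blast
  qed
qed

text \<open>A continuous seminorm of the target is bounded by finitely many defining ones, each
  dominated uniformly in a. So the supremum over A is finite and dominated, and a dominated seminorm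
  is continuous.\<close>

lemma uniformly_continuous_push:
  "uniformly_continuous_family A
     (subtopology (normal_topology \<Omega>1 \<Gamma>) {u. dsupp \<Omega>1 u \<subseteq> C}) (normal_topology \<Omega>2 \<Xi>) push"
proof -
  let ?X = "subtopology (normal_topology \<Omega>1 \<Gamma>) {u. dsupp \<Omega>1 u \<subseteq> C}"
  have tX: "topspace ?X = E1" by (auto simp: topspace_normal_topology E1_def)
  have bound: "\<exists>q. dominated q \<and> (\<forall>u\<in>E1. \<forall>a\<in>A. p (push a u) \<le> q u)"
    if p: "seminorm_on (distributions_WF \<Omega>2 \<Xi>) p" "continuous_map (normal_topology \<Omega>2 \<Xi>) euclideanreal p" for p
  proof -
    obtain P0 c where P0: "finite P0" "P0 \<subseteq> normal_seminorms \<Omega>2 \<Xi>" "c \<ge> 0"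
      "\<And>v. v \<in> distributions_WF \<Omega>2 \<Xi> \<Longrightarrow> p v \<le> c * (\<Sum>q\<in>P0. q v)"
    proof (rule continuous_seminorm_bound[of "normal_seminorms \<Omega>2 \<Xi>" "distributions_WF \<Omega>2 \<Xi>" p])
      show "topspace (seminorm_topology (distributions_WF \<Omega>2 \<Xi>) (normal_seminorms \<Omega>2 \<Xi>)) = distributions_WF \<Omega>2 \<Xi>"
        using topspace_normal_topology[of \<Omega>2 \<Xi>] by (simp add: normal_topology_def)
      show "continuous_map (seminorm_topology (distributions_WF \<Omega>2 \<Xi>) (normal_seminorms \<Omega>2 \<Xi>)) euclideanreal p"
        using p(2) by (simp add: normal_topology_def)
    qed (use p normal_seminorm_on[OF open2] distributions_WF_zero[OF open2 closed_cone_Xi]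
           distributions_WF_cmult[OF open2 closed_cone_Xi] in auto)
    have "\<forall>s\<in>P0. \<exists>q. dominated q \<and> (\<forall>u\<in>E1. \<forall>a\<in>A. s (push a u) \<le> q u)" using push_normal_seminorm P0(2) by blast
    from bchoice[OF this] obtain q where q: "\<And>s. s \<in> P0 \<Longrightarrow> dominated (q s)"
      "\<And>s u a. s \<in> P0 \<Longrightarrow> u \<in> E1 \<Longrightarrow> a \<in> A \<Longrightarrow> s (push a u) \<le> q s u" by blast
    have "p (push a u) \<le> c * (\<Sum>s\<in>P0. q s u)" if "u \<in> E1" "a \<in> A" for u a
    proof -
      have "p (push a u) \<le> c * (\<Sum>s\<in>P0. s (push a u))" by (rule P0(4)[OF push_in_WF[OF that]])
      also have "\<dots> \<le> c * (\<Sum>s\<in>P0. q s u)" by (intro mult_left_mono sum_mono q(2) that P0(3))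
      finally show ?thesis .
    qed
    moreover have "dominated (\<lambda>u. c * (\<Sum>s\<in>P0. q s u))" by (rule dominated_cmult[OF dominated_sum[OF P0(1) q(1)] P0(3)])
    ultimately show ?thesis by blast
  qed
  show ?thesis
    unfolding uniformly_continuous_family_def tX topspace_normal_topology
  proof (intro conjI ballI allI impI)
    fix a u assume "a \<in> A" "u \<in> E1"
    then show "push a u \<in> distributions_WF \<Omega>2 \<Xi>" by (rule push_in_WF[rotated])
  next
    fix p assume p: "seminorm_on (distributions_WF \<Omega>2 \<Xi>) p \<and> continuous_map (normal_topology \<Omega>2 \<Xi>) euclideanreal p"
    obtain q0 where q0: "dominated q0" "\<forall>u\<in>E1. \<forall>a\<in>A. p (push a u) \<le> q0 u" using bound p by blast
    obtain q where q: "dominated q" "\<And>u. u \<in> E1 \<Longrightarrow> q0 u \<le> q u" "\<And>u. u \<in> E1 \<Longrightarrow> 0 \<le> q u"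
      using dominated_nonneg_bound[OF q0(1)] by blast
    have le: "p (push a u) \<le> q u" if "u \<in> E1" "a \<in> A" for u a
      using q0(2) q(2) that by (meson order_trans)
    show bdd: "bdd_above ((\<lambda>a. p (push a u)) ` A)" if "u \<in> E1" for u
      by (rule bdd_aboveI[of _ "q u"]) (use le[OF that] in auto)
    have sa: "seminorm_on E1 (\<lambda>u. p (push a u))" if a: "a \<in> A" for a
    proof -
      have ps: "\<forall>u\<in>distributions_WF \<Omega>2 \<Xi>. 0 \<le> p u"
        "\<forall>u\<in>distributions_WF \<Omega>2 \<Xi>. \<forall>v\<in>distributions_WF \<Omega>2 \<Xi>. p (\<lambda>x. u x + v x) \<le> p u + p v"
        "\<forall>u\<in>distributions_WF \<Omega>2 \<Xi>. \<forall>c. p (\<lambda>x. c * u x) = norm c * p u"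
        using p unfolding seminorm_on_def by auto
      show ?thesis
        unfolding seminorm_on_def
      proof (intro conjI ballI allI)
        fix u v assume "u \<in> E1" "v \<in> E1"
        then show "p (push a (\<lambda>x. u x + v x)) \<le> p (push a u) + p (push a v)"
          using ps(2) push_in_WF a by (simp add: push_add)
      next
        fix u and c :: complex assume "u \<in> E1"
        then show "p (push a (\<lambda>x. c * u x)) = norm c * p (push a u)"
          using ps(3) push_in_WF a by (simp add: push_cmult)
      qed (use ps(1) push_in_WF a in blast)
    qed
    show sn: "seminorm_on E1 (\<lambda>u. sup0 ((\<lambda>a. p (push a u)) ` A))"
      by (rule seminorm_on_sup0[OF sa bdd])
    obtain P0 c where P0: "finite P0" "P0 \<subseteq> normal_seminorms \<Omega>1 \<Gamma>" "c \<ge> 0" "\<forall>u\<in>E1. q u \<le> c * (\<Sum>p\<in>P0. p u)"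
      using q(1) unfolding dominated_def by blast
    show "continuous_map ?X euclideanreal (\<lambda>u. sup0 ((\<lambda>a. p (push a u)) ` A))"
      unfolding normal_topology_def
    proof (rule continuous_seminormI[OF _ _ E1_diff sn P0(1-3)])
      show "topspace (seminorm_topology (distributions_WF \<Omega>1 \<Gamma>) (normal_seminorms \<Omega>1 \<Gamma>)) = distributions_WF \<Omega>1 \<Gamma>"
        using topspace_normal_topology[of \<Omega>1 \<Gamma>] by (simp add: normal_topology_def)
      show "E1 = distributions_WF \<Omega>1 \<Gamma> \<inter> {u. dsupp \<Omega>1 u \<subseteq> C}" by (auto simp: E1_def)
      fix v assume v: "v \<in> E1"
      have "sup0 ((\<lambda>a. p (push a v)) ` A) \<le> q v" by (rule sup0_least) (use le[OF v] q(3)[OF v] in auto)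
      also have "\<dots> \<le> c * (\<Sum>p\<in>P0. p v)" using P0(4) v by blast
      finally show "sup0 ((\<lambda>a. p (push a v)) ` A) \<le> c * (\<Sum>p\<in>P0. p v)" .
    next
      fix s assume "s \<in> P0"
      then have "seminorm_on (distributions_WF \<Omega>1 \<Gamma>) s" using normal_seminorm_on[OF open1] P0(2) by blast
      then have "\<forall>u\<in>distributions_WF \<Omega>1 \<Gamma>. \<forall>c. s (\<lambda>x. c * u x) = norm c * s u" unfolding seminorm_on_def by simp
      from bspec[OF this distributions_WF_zero[OF open1 \<Gamma>], THEN spec, of 0] show "s (\<lambda>x. 0) = 0" by simp
    qed
  qed
qed

end

text \<open>The first conjunct confirms that the target is one of the spaces for which the normal
  topology is meant: the union of the image cones over A is again a closed cone.\<close>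

theorem theorem6p4:
  fixes \<Omega>1 :: "(real ^ 'd1) set" and \<Omega>2 :: "(real ^ 'd2) set"
    and A U :: "(real ^ 'n) set"
    and \<Gamma> :: "((real ^ 'd1) \<times> (real ^ 'd1)) set"
    and \<Xi> :: "((real ^ 'd2) \<times> (real ^ 'd2)) set"
    and f :: "(real ^ 'd1) \<times> (real ^ 'n) \<Rightarrow> real ^ 'd2"
    and C :: "(real ^ 'd1) set"
  assumes "open \<Omega>1" and "open \<Omega>2"
    and "A \<subseteq> U" and "compact A" and "open U"
    and "closed_cone \<Omega>1 \<Gamma>"
    and "smooth_on (\<Omega>1 \<times> U) f" and "f ` (\<Omega>1 \<times> U) \<subseteq> \<Omega>2"
    and "closedin (top_of_set \<Omega>1) C"
    and "proper_map (top_of_set (C \<times> A)) (top_of_set \<Omega>2) f"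
    and "fst ` \<Gamma> \<subseteq> C"
    and "\<Xi> = (\<Union>a\<in>A. push_cone \<Omega>1 \<Omega>2 C (\<lambda>x. f (x, a)) \<Gamma>)"
  shows "closed_cone \<Omega>2 \<Xi> \<and>
    uniformly_continuous_family A
      (subtopology (normal_topology \<Omega>1 \<Gamma>) {u. dsupp \<Omega>1 u \<subseteq> C})
      (normal_topology \<Omega>2 \<Xi>)
      (\<lambda>a. push_distr \<Omega>1 \<Omega>2 (\<lambda>x. f (x, a)))"
proof -
  interpret push_family \<Omega>1 \<Omega>2 A U \<Gamma> \<Xi> f C
    using assms by unfold_locales
  show ?thesis using closed_cone_Xi uniformly_continuous_push by blast
qed

end
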